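(* Fix $d\in\mathbb{N}$ and $n\ge d+1$. Let $X_1,\dots,X_n$ be independent standard Gaussian random vectors in $\mathbb{R}^d$ and let $\mathcal{P}_{n,d}=\mathrm{conv}(X_1,\dots,X_n)$. Then for every $j\in\{0,\dots,d-1\}$, $$\mathbb{E}\sum_{F\in\mathcal{F}_j(\mathcal{P}_{n,d})}\alpha\big(T_F(\mathcal{P}_{n,d})\big)=\sum_{s=0}^{\infty}(-1)^s\,\sigma\genfrac{[}{]}{0pt}{}{n}{d-s}\,\sigma\genfrac{\{}{\}}{0pt}{}{d-s}{j+1}.$$
   Context: $\mathbb{N}=\{1,2,\dots\}$. A polyhedral cone is the set of nonnegative linear combinations of finitely many vectors. The solid angle of a polyhedral cone $C$ is $\alpha(C)=\mathbb{P}[Z\in C]$ with $Z$ uniformly distributed on the unit sphere of the linear hull of $C$; $\alpha(C)=1$ if $C$ is a linear subspace (including $C=\{0\}$). For a polytope $P$, $\mathcal{F}_j(P)$ is the set of its $j$-dimensional faces ($P$ itself being a face). The tangent cone of $P\subset\mathbb{R}^d$ at a face $F$ is $T_F(P)=\{v\in\mathbb{R}^d: f_0+\varepsilon v\in P\text{ for some }\varepsilon>0\}$, where $f_0$ is any point of the relative interior of $F$. The normal cone is the polar cone $N_F(P)=\{w:\langle w,u\rangle\le 0\ \text{for all } u\in T_F(P)\}$. For a random polytope, angles are computed for each realization. Angle sums of the regular simplex: let $e_1,\dots,e_n$ be the standard basis of $\mathbb{R}^n$ and $\Delta_n=\mathrm{conv}(e_1,\dots,e_n)$, $\Delta_k=\mathrm{conv}(e_1,\dots,e_k)\subset\mathbb{R}^n$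 for $k\le n$. For $n\in\mathbb{N}$ and $k\in\{1,\dots,n\}$ put $$\sigma\genfrac{\{}{\}}{0pt}{}{n}{k}=\binom nk\,\alpha(T_{\Delta_k}(\Delta_n)),\qquad \sigma\genfrac{[}{]}{0pt}{}{n}{k}=\binom nk\,\alpha(N_{\Delta_k}(\Delta_n)),$$ and put both equal to $0$ if $k\notin\{1,\dots,n\}$. A product $\sigma\genfrac{[}{]}{0pt}{}{n}{m}\sigma\genfrac{\{}{\}}{0pt}{}{m}{i}$ with $m\le 0$ is $0$, so the sum is finite. *)

theory Defs
  imports "HOL-Analysis.Analysis" "HOL-Probability.Probability"
begin

section \<open>Standard Gaussian vectors\<close>

definition std_gaussian_density :: "'a::euclidean_space \<Rightarrow> real" where
  "std_gaussian_density x = (\<Prod>b\<in>Basis. std_normal_density (x \<bullet> b))"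

definition std_gaussian :: "'a::euclidean_space measure" where
  "std_gaussian = density lborel (\<lambda>x. ennreal (std_gaussian_density x))"

lemma std_gaussian_density_norm:
  "std_gaussian_density (x::'a::euclidean_space) =
     (1 / sqrt (2 * pi)) ^ DIM('a) * exp (- (norm x)\<^sup>2 / 2)"
proof -
  have "(norm x)\<^sup>2 = (\<Sum>b\<in>Basis. (x \<bullet> b)\<^sup>2)"
    by (simp add: norm_eq_sqrt_inner euclidean_inner[of x x] power2_eq_square sum_nonneg)
  then have "- (norm x)\<^sup>2 / 2 = (\<Sum>b\<in>Basis. - (x \<bullet> b)\<^sup>2 / 2)"
    by (simp add: sum_negf sum_divide_distrib)
  then show ?thesis
    by (simp add: std_gaussian_density_def std_normal_density_def exp_sum prod_dividef power_one_over)
qed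

lemma std_gaussian_density_nonneg: "0 \<le> std_gaussian_density x"
  by (simp add: std_gaussian_density_def prod_nonneg)

lemma measurable_std_gaussian_density [measurable]:
  "std_gaussian_density \<in> borel_measurable borel"
  unfolding std_gaussian_density_def by measurable

lemma sets_std_gaussian [simp, measurable_cong]: "sets std_gaussian = sets borel"
  by (simp add: std_gaussian_def)

lemma space_std_gaussian [simp]: "space std_gaussian = UNIV"
  by (simp add: std_gaussian_def)

lemma emeasure_std_gaussian_prod:
  fixes A :: "'a::euclidean_space \<Rightarrow> real set"
  assumes A[measurable]: "\<And>b. b \<in> Basis \<Longrightarrow> A b \<in> sets borel"
  shows "emeasure std_gaussian {x::'a. \<forall>b\<in>Basis. x \<bullet> b \<in> A b} =
    (\<Prod>b\<in>Basis. emeasure (density lborel (\<lambda>t. ennreal (std_normal_density t))) (A b))"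
proof -
  let ?f = "\<lambda>b t. ennreal (std_normal_density t) * indicator (A b) t"
  have [measurable]: "{x::'a. \<forall>b\<in>Basis. x \<bullet> b \<in> A b} \<in> sets borel"
    by measurable
  have "emeasure std_gaussian {x::'a. \<forall>b\<in>Basis. x \<bullet> b \<in> A b} =
      (\<integral>\<^sup>+x. ennreal (std_gaussian_density x) * indicator {x::'a. \<forall>b\<in>Basis. x \<bullet> b \<in> A b} x \<partial>lborel)"
    by (simp add: std_gaussian_def emeasure_density)
  also have "\<dots> = (\<integral>\<^sup>+x. (\<Prod>b\<in>Basis. ?f b (x \<bullet> b)) \<partial>(lborel :: 'a measure))"
  proof (rule nn_integral_cong)
    fix x :: 'a
    have "indicator {x::'a. \<forall>b\<in>Basis. x \<bullet> b \<in> A b} x = (\<Prod>b\<in>Basis. indicator (A b) (x \<bullet> b) :: ennreal)"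
      by (auto simp: indicator_def intro!: prod_zero[symmetric])
    moreover have "ennreal (std_gaussian_density x) = (\<Prod>b\<in>Basis. ennreal (std_normal_density (x \<bullet> b)))"
      by (simp add: std_gaussian_density_def prod_ennreal)
    ultimately show "ennreal (std_gaussian_density x) * indicator {x::'a. \<forall>b\<in>Basis. x \<bullet> b \<in> A b} x =
        (\<Prod>b\<in>Basis. ?f b (x \<bullet> b))"
      by (simp add: prod.distrib)
  qed
  also have "\<dots> = (\<Prod>b\<in>Basis. \<integral>\<^sup>+t. ?f b t \<partial>lborel)"
    by (rule nn_integral_lborel_prod) auto
  also have "\<dots> = (\<Prod>b\<in>Basis. emeasure (density lborel (\<lambda>t. ennreal (std_normal_density t))) (A b))"
    by (intro prod.cong refl) (simp add: emeasure_density)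
  finally show ?thesis .
qed

lemma prob_space_std_normal: "prob_space (density lborel (\<lambda>t. ennreal (std_normal_density t)))"
  by (rule prob_space_normal_density) simp

lemma prob_space_std_gaussian: "prob_space (std_gaussian :: 'a::euclidean_space measure)"
proof
  interpret N: prob_space "density lborel (\<lambda>t. ennreal (std_normal_density t))"
    by (rule prob_space_std_normal)
  have "emeasure (density lborel (\<lambda>t. ennreal (std_normal_density t))) UNIV = 1"
    using N.emeasure_space_1 by simp
  then show "emeasure std_gaussian (space (std_gaussian :: 'a measure)) = 1"
    using emeasure_std_gaussian_prod[of "\<lambda>_ :: 'a. UNIV"] by simp
qed

section \<open>Solid angles\<close>

text \<open>
  The uniform distribution on the unit sphere of a linear subspace \<open>L\<close> is realised as the law of
  the normalised orthogonal projection to \<open>L\<close> of a standard Gaussian vector. It is a probability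
  measure carried by the unit sphere of \<open>L\<close> and invariant under the orthogonal transformations
  that preserve \<open>L\<close> (both shown below), and the uniform distribution is the only such measure.
  For \<open>L = {0}\<close> it is the point mass at \<open>0\<close>, so that the angle of \<open>{0}\<close> is \<open>1\<close>.
\<close>

definition uniform_sphere :: "'a::euclidean_space set \<Rightarrow> 'a measure" where
  "uniform_sphere L = distr std_gaussian borel (\<lambda>x. sgn (closest_point L x))"

definition solid_angle :: "'a::euclidean_space set \<Rightarrow> real" where
  "solid_angle C = measure (uniform_sphere (span C)) C"

lemma closest_point_subspace_eq:
  fixes L :: "'a::euclidean_space set"
  assumes "subspace L" "p \<in> L" and orth: "\<And>y. y \<in> L \<Longrightarrow> (x - p) \<bullet> y = 0"
  shows "closest_point L x = p"
proof -
  have "dist x p \<le> dist x z" if "z \<in> L" for z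
  proof -
    have "(x - p) \<bullet> (p - z) = 0"
      using assms that by (simp add: subspace_diff)
    then have "(norm (x - z))\<^sup>2 = (norm (x - p))\<^sup>2 + (norm (p - z))\<^sup>2"
      using norm_add_Pythagorean[of "x - p" "p - z"] by (simp add: orthogonal_def)
    then have "(norm (x - p))\<^sup>2 \<le> (norm (x - z))\<^sup>2"
      by simp
    then show ?thesis
      unfolding dist_norm by (rule power2_le_imp_le) simp
  qed
  then show ?thesis
    using closest_point_unique[of L p x] assms
    by (simp add: subspace_imp_convex closed_subspace)
qed

lemma closest_point_subspace:
  fixes L :: "'a::euclidean_space set"
  assumes "subspace L"
  shows "closest_point L x \<in> L" and "y \<in> L \<Longrightarrow> (x - closest_point L x) \<bullet> y = 0"
proof -
  obtain p z where "p \<in> span L" "\<And>w. w \<in> span L \<Longrightarrow> orthogonal z w" "x = p + z"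
    using orthogonal_subspace_decomp_exists[of L x] by metis
  moreover have "span L = L"
    using assms by (simp add: span_eq_iff)
  ultimately have p: "p \<in> L" "\<And>y. y \<in> L \<Longrightarrow> (x - p) \<bullet> y = 0"
    by (auto simp: orthogonal_def)
  then have "closest_point L x = p"
    by (intro closest_point_subspace_eq assms) auto
  then show "closest_point L x \<in> L" and "y \<in> L \<Longrightarrow> (x - closest_point L x) \<bullet> y = 0"
    using p by auto
qed

lemma measurable_closest_point_subspace [measurable]:
  fixes L :: "'a::euclidean_space set"
  assumes "subspace L"
  shows "closest_point L \<in> borel_measurable borel"
  using assms subspace_0[OF assms]
  by (intro borel_measurable_continuous_onI continuous_on_closest_point)
     (auto simp: subspace_imp_convex closed_subspace)

lemma measurable_sgn_euclidean [measurable]: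
  "(sgn :: 'a::euclidean_space \<Rightarrow> 'a) \<in> borel_measurable borel"
  unfolding sgn_div_norm[abs_def] by measurable

lemma measurable_uniform_sphere_map:
  fixes L :: "'a::euclidean_space set"
  assumes "subspace L"
  shows "(\<lambda>x. sgn (closest_point L x)) \<in> borel_measurable borel"
  using measurable_compose[OF measurable_closest_point_subspace[OF assms] measurable_sgn_euclidean] .

lemma prob_space_uniform_sphere:
  assumes "subspace L"
  shows "prob_space (uniform_sphere L)"
  unfolding uniform_sphere_def using measurable_uniform_sphere_map[OF assms]
  by (intro prob_space.prob_space_distr[OF prob_space_std_gaussian]) simp

lemma AE_uniform_sphere:
  fixes L :: "'a::euclidean_space set"
  assumes L: "subspace L" and "L \<noteq> {0}"
  shows "AE z in uniform_sphere L. z \<in> L \<and> norm z = 1"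
proof -
  from assms obtain v where v: "v \<in> L" "v \<noteq> 0"
    using subspace_0 by blast
  have "negligible {x. v \<bullet> x = 0}"
    by (rule negligible_hyperplane) (use v in auto)
  then have "AE x in lebesgue. v \<bullet> x \<noteq> 0"
    by (simp add: negligible_iff_null_sets AE_iff_null_sets)
  then have "AE x in (lborel :: 'a measure). v \<bullet> x \<noteq> 0"
    by (simp add: AE_completion_iff)
  then have *: "AE x in (std_gaussian :: 'a measure). v \<bullet> x \<noteq> 0"
    unfolding std_gaussian_def by (subst AE_density) (auto elim!: eventually_mono)
  have "sgn (closest_point L x) \<in> L \<and> norm (sgn (closest_point L x)) = 1" if "v \<bullet> x \<noteq> 0" for x
  proof -
    have "closest_point L x \<noteq> 0"
      using closest_point_subspace(2)[OF L v(1), of x] that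
      by (auto simp: inner_commute)
    then show ?thesis
      using closest_point_subspace(1)[OF L, of x] L
      by (simp add: sgn_div_norm subspace_scale)
  qed
  then have "AE x in std_gaussian. sgn (closest_point L x) \<in> L \<and> norm (sgn (closest_point L x)) = 1"
    using * by (auto elim!: eventually_mono)
  moreover have "{z \<in> space borel. z \<in> L \<and> norm z = 1} \<in> sets borel"
  proof -
    have "closed (L \<inter> sphere 0 1)"
      using closed_subspace[OF L] by (intro closed_Int) auto
    moreover have "{z \<in> space borel. z \<in> L \<and> norm z = 1} = L \<inter> sphere 0 1"
      by auto
    ultimately show ?thesis by simp
  qed
  ultimately show ?thesis
    unfolding uniform_sphere_def using measurable_uniform_sphere_map[OF L]
    by (subst AE_distr_iff) auto
qed

lemma distr_std_gaussian_orthogonal: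
  fixes f :: "real^'n::{finite,wellorder} \<Rightarrow> real^'n::_"
  assumes f: "orthogonal_transformation f"
  shows "distr std_gaussian borel f = std_gaussian"
proof -
  define g where "g = inv f"
  have g: "orthogonal_transformation g"
    unfolding g_def using orthogonal_transformation_inv[OF f] .
  have bij: "bij f"
    using orthogonal_transformation_bij[OF f] .
  have [measurable]: "f \<in> borel_measurable borel"
    using f by (intro borel_measurable_continuous_onI linear_continuous_on)
      (simp add: linear_linear orthogonal_transformation_linear)
  have lb: "distr lborel borel f = lborel"
  proof (rule lborel_eqI[symmetric])
    fix l u :: "real^'n::_"
    assume lu: "\<And>b. b \<in> Basis \<Longrightarrow> l \<bullet> b \<le> u \<bullet> b"
    have pre: "f -` box l u = g ` box l u"
      unfolding g_def using bij by (rule bij_vimage_eq_inv_image)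
    have m: "g ` box l u \<in> lmeasurable"
      using measurable_orthogonal_image[OF g] by blast
    have [measurable]: "f -` box l u \<in> sets borel"
      using measurable_sets[of f borel borel "box l u"] by simp
    have "emeasure (distr lborel borel f) (box l u) = emeasure lborel (f -` box l u)"
      by (subst emeasure_distr) auto
    also have "\<dots> = emeasure lebesgue (g ` box l u)"
      using \<open>f -` box l u \<in> sets borel\<close> by (simp add: pre)
    also have "\<dots> = ennreal (measure lebesgue (g ` box l u))"
      using m by (simp add: emeasure_eq_measure2)
    also have "\<dots> = ennreal (measure lebesgue (box l u))"
      using measure_orthogonal_image[OF g, of "box l u"] by simp
    finally show "emeasure (distr lborel borel f) (box l u) = ennreal (\<Prod>b\<in>Basis. (u - l) \<bullet> b)"
      using lu by (simp add: measure_lborel_box_eq)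
  qed simp
  have "distr std_gaussian borel f =
      distr (density lborel (\<lambda>x. ennreal (std_gaussian_density (f x)))) borel f"
    using f by (simp add: std_gaussian_def std_gaussian_density_norm orthogonal_transformation_norm)
  also have "\<dots> = density (distr lborel borel f) (\<lambda>x. ennreal (std_gaussian_density x))"
    by (subst density_distr) auto
  finally show ?thesis
    by (simp add: lb std_gaussian_def)
qed

lemma uniform_sphere_orthogonal_invariant:
  fixes f :: "real^'n::{finite,wellorder} \<Rightarrow> real^'n::_"
  assumes L: "subspace L" and f: "orthogonal_transformation f" and fL: "f ` L = L"
  shows "distr (uniform_sphere L) borel f = uniform_sphere L"
proof -
  have lin: "linear f"
    using f by (rule orthogonal_transformation_linear)
  have [measurable]: "f \<in> borel_measurable borel"
    using lin by (intro borel_measurable_continuous_onI linear_continuous_on)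
      (simp add: linear_linear)
  note [measurable] = measurable_uniform_sphere_map[OF L]
  have cp: "closest_point L (f x) = f (closest_point L x)" for x
  proof (rule closest_point_subspace_eq[OF L])
    show "f (closest_point L x) \<in> L"
      using closest_point_subspace(1)[OF L, of x] fL by blast
    fix y assume "y \<in> L"
    then obtain z where "y = f z" "z \<in> L"
      using fL by blast
    then show "(f x - f (closest_point L x)) \<bullet> y = 0"
      using closest_point_subspace(2)[OF L, of z x] f lin
      by (simp add: linear_diff[symmetric] orthogonal_transformation_def)
  qed
  have "f (sgn x) = sgn (f x)" for x
    using lin f by (simp add: sgn_div_norm linear_scale orthogonal_transformation_norm)
  then have eq: "f (sgn (closest_point L x)) = sgn (closest_point L (f x))" for x
    by (simp add: cp)
  have "distr (uniform_sphere L) borel f =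
      distr std_gaussian borel (\<lambda>x. f (sgn (closest_point L x)))"
    unfolding uniform_sphere_def by (subst distr_distr) (auto simp: comp_def)
  also have "\<dots> = distr (distr std_gaussian borel f) borel (\<lambda>x. sgn (closest_point L x))"
    by (subst distr_distr) (auto simp: comp_def eq)
  finally show ?thesis
    by (simp add: distr_std_gaussian_orthogonal[OF f] uniform_sphere_def)
qed

lemma solid_angle_subspace:
  fixes L :: "'a::euclidean_space set"
  assumes L: "subspace L"
  shows "solid_angle L = 1"
proof -
  interpret prob_space "uniform_sphere L"
    using L by (rule prob_space_uniform_sphere)
  have [measurable]: "(\<lambda>x. sgn (closest_point L x)) \<in> borel_measurable borel" "L \<in> sets borel"
    using measurable_uniform_sphere_map[OF L] closed_subspace[OF L] by auto
  have "sgn (closest_point L x) \<in> L" for x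
    using closest_point_subspace(1)[OF L, of x] L by (simp add: sgn_div_norm subspace_scale)
  then have "AE z in uniform_sphere L. z \<in> L"
    unfolding uniform_sphere_def by (subst AE_distr_iff) auto
  then have "prob L = 1"
    by (intro prob_eq_1[THEN iffD2]) (auto simp: uniform_sphere_def)
  moreover have "span L = L"
    using L by (simp only: span_eq_iff)
  ultimately show ?thesis
    unfolding solid_angle_def by (simp only:)
qed

section \<open>Faces, tangent cones and normal cones\<close>

text \<open>
  \<open>face_of\<close> also admits the empty set, which has \<open>aff_dim\<close> equal to \<open>-1\<close> and is excluded here.
\<close>

definition faces_of_dim :: "nat \<Rightarrow> 'a::euclidean_space set \<Rightarrow> 'a set set" where
  "faces_of_dim j P = {F. F face_of P \<and> aff_dim F = int j}"

text \<open>The cone does not depend on the point \<open>f\<^sub>0\<close> chosen in the relative interior of \<open>F\<close>.\<close>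

definition tangent_cone :: "'a::euclidean_space set \<Rightarrow> 'a set \<Rightarrow> 'a set" where
  "tangent_cone F P = {v. \<exists>f\<^sub>0\<in>rel_interior F. \<exists>\<epsilon>>0. f\<^sub>0 + \<epsilon> *\<^sub>R v \<in> P}"

definition normal_cone :: "'a::euclidean_space set \<Rightarrow> 'a set \<Rightarrow> 'a set" where
  "normal_cone F P = {w. \<forall>u\<in>tangent_cone F P. w \<bullet> u \<le> 0}"

section \<open>Angle sums of the regular simplex\<close>

text \<open>
  The indices of \<open>real^'n\<close> are taken in their order, so that \<open>std_basis 1, \<dots>, std_basis CARD('n)\<close>
  is the standard basis.
\<close>

definition std_basis :: "nat \<Rightarrow> real^'n::{finite,wellorder}" where
  "std_basis i = axis (sorted_list_of_set (UNIV :: 'n set) ! (i - 1)) 1"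

definition std_simplex :: "nat \<Rightarrow> (real^'n::{finite,wellorder}) set" where
  "std_simplex k = convex hull (std_basis ` {1..k})"

text \<open>
  \<open>normal_angle_sum TYPE('n) k\<close> is \<open>\<sigma>[n, k]\<close> for \<open>n = CARD('n)\<close>, the normal cone being taken in
  \<open>real^'n\<close>.

  \<open>tangent_angle_sum TYPE('n) m k\<close> is \<open>\<sigma>{m, k}\<close> for \<open>m \<le> CARD('n)\<close>, the simplices being placed
  in \<open>real^'n\<close> as \<open>conv(e\<^sub>1, \<dots>, e\<^sub>k)\<close> and \<open>conv(e\<^sub>1, \<dots>, e\<^sub>m)\<close>. The value does not depend on the
  dimension of the surrounding space (\<open>tangent_angle_sum_ambient\<close> below); in particular it is the
  one obtained in dimension \<open>m\<close>.

  Both vanish at index \<open>0\<close>, so a truncated difference \<open>d - s\<close> with \<open>s \<ge> d\<close> contributes \<open>0\<close>.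
\<close>

definition normal_angle_sum :: "'n::{finite,wellorder} itself \<Rightarrow> nat \<Rightarrow> real" where
  "normal_angle_sum (_ :: 'n itself) k =
    (if k \<in> {1..CARD('n)}
     then real (CARD('n) choose k) *
       solid_angle (normal_cone (std_simplex k) (std_simplex CARD('n) :: (real^'n::_) set))
     else 0)"

definition tangent_angle_sum :: "'n::{finite,wellorder} itself \<Rightarrow> nat \<Rightarrow> nat \<Rightarrow> real" where
  "tangent_angle_sum (_ :: 'n itself) m k =
    (if k \<in> {1..m}
     then real (m choose k) *
       solid_angle (tangent_cone (std_simplex k) (std_simplex m :: (real^'n::_) set))
     else 0)"

lemma bij_betw_std_basis:
  "bij_betw std_basis {1..CARD('n)} (Basis :: (real^'n::{finite,wellorder}) set)"
proof -
  let ?xs = "sorted_list_of_set (UNIV :: 'n set)"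
  have "bij_betw (\<lambda>i. i - 1) {1..CARD('n)} {..<CARD('n)}"
    by (rule bij_betwI[where g = Suc]) auto
  moreover have "bij_betw ((!) ?xs) {..<CARD('n)} UNIV"
    using bij_betw_nth[of ?xs "{..<CARD('n)}" UNIV] by simp
  moreover have "bij_betw (\<lambda>k. axis k 1) (UNIV :: 'n set) (Basis :: (real^'n::_) set)"
    by (auto simp: bij_betw_def inj_on_def axis_eq_axis Basis_vec_def)
  ultimately have "bij_betw ((\<lambda>k. axis k 1) \<circ> ((!) ?xs) \<circ> (\<lambda>i. i - 1)) {1..CARD('n)}
      (Basis :: (real^'n::_) set)"
    by (blast intro: bij_betw_trans)
  then show ?thesis
    by (simp add: std_basis_def[abs_def] comp_def)
qed

lemma solid_angle_isometric_image:
  fixes f :: "'a::euclidean_space \<Rightarrow> 'b::euclidean_space"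
  assumes f: "linear f" "\<And>x y. f x \<bullet> f y = x \<bullet> y"
    and Basis: "f ` Basis \<subseteq> Basis"
  shows "solid_angle (f ` C) = solid_angle C"
proof -
  define g where "g = adjoint f"
  have g: "x \<bullet> g y = f x \<bullet> y" for x y
    unfolding g_def by (rule adjoint_works[OF f(1)])
  have lin_g: "linear g"
    unfolding g_def by (rule adjoint_linear[OF f(1)])
  have gf: "g (f x) = x" for x
    by (rule vector_eq_rdot[THEN iffD1]) (simp add: g f inner_commute)
  have inj: "inj f"
    by (rule inj_on_inverseI[of _ g]) (simp add: gf)
  have bm[measurable]: "g \<in> borel_measurable borel"
    using lin_g by (intro borel_measurable_continuous_onI linear_continuous_on)
      (simp add: linear_linear)
  have bmf[measurable]: "f \<in> borel_measurable borel"
    using f by (intro borel_measurable_continuous_onI linear_continuous_on)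
      (simp add: linear_linear)
  have norm_f: "norm (f x) = norm x" for x
    by (simp add: norm_eq_sqrt_inner f)
  have "distr std_gaussian borel g = (std_gaussian :: 'a measure)"
  proof (rule measure_eqI_generator_eq[where E = "range (\<lambda>(l, u). box l u)" and \<Omega> = UNIV
        and A = "\<lambda>n::nat. box (- (real n *\<^sub>R One)) (real n *\<^sub>R One)"])
    show "Int_stable (range (\<lambda>(l, u). box l (u::'a)))"
    proof (rule Int_stableI)
      fix A B assume "A \<in> range (\<lambda>(l, u). box l (u::'a))" "B \<in> range (\<lambda>(l, u). box l (u::'a))"
      then obtain a b c d where "A = box a b" "B = box c d" by auto
      then have "A \<inter> B = (\<lambda>(l, u). box l u)
          (\<Sum>i\<in>Basis. max (a \<bullet> i) (c \<bullet> i) *\<^sub>R i, \<Sum>i\<in>Basis. min (b \<bullet> i) (d \<bullet> i) *\<^sub>R i)"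
        by (auto simp: mem_box)
      then show "A \<inter> B \<in> range (\<lambda>(l, u). box l (u::'a))"
        by blast
    qed
    show "sets (distr std_gaussian borel g) = sigma_sets UNIV (range (\<lambda>(l, u). box l (u::'a)))"
      "sets std_gaussian = sigma_sets UNIV (range (\<lambda>(l, u). box l (u::'a)))"
      by (simp_all add: borel_eq_box)
    show "(\<Union>n::nat. box (- (real n *\<^sub>R One)) (real n *\<^sub>R One)) = (UNIV :: 'a set)"
      by (rule UN_box_eq_UNIV)
    interpret G: prob_space "distr std_gaussian borel g"
      by (rule prob_space.prob_space_distr[OF prob_space_std_gaussian]) simp
    show "emeasure (distr std_gaussian borel g) (box (- (real n *\<^sub>R One)) (real n *\<^sub>R One)) \<noteq> \<infinity>" for n
      by simp
    fix S :: "'a set" assume "S \<in> range (\<lambda>(l, u). box l u)"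
    then obtain l u where S: "S = box l u" by auto
    let ?N = "density lborel (\<lambda>t. ennreal (std_normal_density t))"
    let ?I = "\<lambda>b. {l \<bullet> b <..< u \<bullet> b}"
    let ?A = "\<lambda>b. if b \<in> f ` Basis then ?I (g b) else UNIV"
    interpret N: prob_space ?N by (rule prob_space_std_normal)
    have N1: "emeasure ?N UNIV = 1"
      using N.emeasure_space_1 by simp
    have gb: "g y \<bullet> b = y \<bullet> f b" for y b
      using g[of b y] by (simp only: inner_commute)
    have "g -` S = {y. \<forall>b\<in>Basis. y \<bullet> f b \<in> ?I b}"
      by (auto simp: S mem_box gb)
    also have "\<dots> = {y. \<forall>b\<in>f ` Basis. y \<bullet> b \<in> ?I (g b)}"
      by (simp add: gf)
    also have "\<dots> = {y. \<forall>b\<in>Basis. y \<bullet> b \<in> ?A b}"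
      using Basis by (intro Collect_cong) (auto split: if_splits)
    finally have "g -` S = {y. \<forall>b\<in>Basis. y \<bullet> b \<in> ?A b}" .
    moreover have "emeasure (distr std_gaussian borel g) S = emeasure std_gaussian (g -` S)"
      by (subst emeasure_distr) (auto simp: S)
    ultimately have "emeasure (distr std_gaussian borel g) S = (\<Prod>b\<in>Basis. emeasure ?N (?A b))"
      by (simp only:) (rule emeasure_std_gaussian_prod, auto)
    also have "\<dots> = (\<Prod>b\<in>f ` Basis. emeasure ?N (?A b))"
      by (rule prod.mono_neutral_right) (use Basis N1 in auto)
    also have "\<dots> = (\<Prod>b\<in>Basis. emeasure ?N (?I b))"
      using inj by (subst prod.reindex) (auto simp: gf intro: inj_on_subset)
    also have "\<dots> = emeasure std_gaussian {x::'a. \<forall>b\<in>Basis. x \<bullet> b \<in> ?I b}"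
      by (rule emeasure_std_gaussian_prod[symmetric]) auto
    also have "{x::'a. \<forall>b\<in>Basis. x \<bullet> b \<in> ?I b} = S"
      by (auto simp: S mem_box)
    finally show "emeasure (distr std_gaussian borel g) S = emeasure std_gaussian S" .
  qed auto
  note distr_g = this
  have sub: "subspace (span C)" "subspace (span (f ` C))"
    by auto
  have span_f: "span (f ` C) = f ` span C"
    using f(1) by (rule span_linear_image)
  have cp: "closest_point (span (f ` C)) y = f (closest_point (span C) (g y))" for y
  proof (rule closest_point_subspace_eq[OF sub(2)])
    show "f (closest_point (span C) (g y)) \<in> span (f ` C)"
      using closest_point_subspace(1)[OF sub(1)] by (simp add: span_f)
    fix z assume "z \<in> span (f ` C)"
    then obtain x where x: "z = f x" "x \<in> span C"
      by (auto simp: span_f)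
    have "(y - f (closest_point (span C) (g y))) \<bullet> z = (g y - closest_point (span C) (g y)) \<bullet> x"
      using g[of x y] f(2)
      by (simp add: x inner_diff_left) (simp add: inner_commute)
    then show "(y - f (closest_point (span C) (g y))) \<bullet> z = 0"
      using closest_point_subspace(2)[OF sub(1) x(2)] by simp
  qed
  have sgn_f: "sgn (f x) = f (sgn x)" for x
    using f(1) by (simp add: sgn_div_norm linear_scale norm_f)
  have mem: "f x \<in> f ` C \<longleftrightarrow> x \<in> C" for x
    using inj by (auto simp: inj_def)
  have borel_iff: "f ` C \<in> sets borel \<longleftrightarrow> C \<in> sets borel"
  proof
    assume "f ` C \<in> sets borel"
    then have "f -` (f ` C) \<in> sets borel"
      using measurable_sets[OF bmf, of "f ` C"] by simp
    then show "C \<in> sets borel"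
      using inj by (simp add: inj_vimage_image_eq)
  next
    assume C: "C \<in> sets borel"
    have "closed (range f)"
      by (intro closed_subspace linear_subspace_image f(1)) simp
    moreover have "f ` C = range f \<inter> g -` C"
      by (auto simp: gf image_iff)
    ultimately show "f ` C \<in> sets borel"
      using measurable_sets[OF bm C] by auto
  qed
  show ?thesis
  proof (cases "C \<in> sets borel")
    case False
    then show ?thesis
      using borel_iff by (simp add: solid_angle_def uniform_sphere_def measure_notin_sets)
  next
    case True
    note C = True
    note C' = borel_iff[THEN iffD2, OF True]
    note [measurable] = C C' measurable_uniform_sphere_map[OF sub(1)] measurable_uniform_sphere_map[OF sub(2)]
    have "solid_angle (f ` C) = measure std_gaussian {y. sgn (closest_point (span (f ` C)) y) \<in> f ` C}"
      unfolding solid_angle_def uniform_sphere_def by (subst measure_distr) (auto simp: vimage_def)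
    also have "\<dots> = measure std_gaussian (g -` {x. sgn (closest_point (span C) x) \<in> C})"
      by (simp add: cp sgn_f mem vimage_def)
    also have "\<dots> = measure (distr std_gaussian borel g) {x. sgn (closest_point (span C) x) \<in> C}"
      by (subst measure_distr) auto
    also have "\<dots> = solid_angle C"
      unfolding distr_g solid_angle_def uniform_sphere_def
      by (subst measure_distr) (auto simp: vimage_def)
    finally show ?thesis .
  qed
qed

lemma tangent_cone_linear_image:
  fixes f :: "'a::euclidean_space \<Rightarrow> 'b::euclidean_space"
  assumes f: "linear f" "inj f"
  shows "tangent_cone (f ` F) (f ` P) = f ` tangent_cone F P"
proof -
  have ri: "rel_interior (f ` F) = f ` rel_interior F"
    using f by (intro rel_interior_injective_linear_image) (simp_all add: linear_linear)
  have "v \<in> f ` tangent_cone F P" if "p \<in> rel_interior F" "e > 0" "f p + e *\<^sub>R v \<in> f ` P" for p e v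
  proof -
    from that obtain q where q: "q \<in> P" "f p + e *\<^sub>R v = f q" by auto
    then have "e *\<^sub>R v = f (q - p)"
      using f(1) by (simp add: linear_diff algebra_simps)
    then have "(1 / e) *\<^sub>R (e *\<^sub>R v) = f ((1 / e) *\<^sub>R (q - p))"
      using f(1) by (simp add: linear_scale)
    then have "v = f ((1 / e) *\<^sub>R (q - p))"
      using that by simp
    moreover have "(1 / e) *\<^sub>R (q - p) \<in> tangent_cone F P"
      using that q unfolding tangent_cone_def by (auto intro!: bexI[of _ p] exI[of _ e])
    ultimately show ?thesis by blast
  qed
  then have "tangent_cone (f ` F) (f ` P) \<subseteq> f ` tangent_cone F P"
    by (auto simp: tangent_cone_def[of "f ` F"] ri)
  moreover have "f v \<in> tangent_cone (f ` F) (f ` P)"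
    if "p \<in> rel_interior F" "e > 0" "p + e *\<^sub>R v \<in> P" for p e v
  proof -
    have "f p + e *\<^sub>R f v = f (p + e *\<^sub>R v)"
      using f(1) by (simp add: linear_add linear_scale)
    then have "f p + e *\<^sub>R f v \<in> f ` P"
      using that by blast
    then show ?thesis
      using that unfolding tangent_cone_def ri by blast
  qed
  then have "f ` tangent_cone F P \<subseteq> tangent_cone (f ` F) (f ` P)"
    by (auto simp: tangent_cone_def[of F])
  ultimately show ?thesis
    by blast
qed

lemma tangent_angle_sum_ambient_le:
  assumes mn: "CARD('m) \<le> CARD('n)" and m: "m \<le> CARD('m)"
  shows "tangent_angle_sum TYPE('m::{finite,wellorder}) m k =
    tangent_angle_sum TYPE('n::{finite,wellorder}) m k"
proof -
  define f :: "real^'m::_ \<Rightarrow> real^'n::_"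
    where "f = (\<lambda>x. \<Sum>i\<in>{1..CARD('m)}. (x \<bullet> std_basis i) *\<^sub>R std_basis i)"
  have inj_m: "inj_on (std_basis :: nat \<Rightarrow> real^'m::_) {1..CARD('m)}"
    and img_m: "std_basis ` {1..CARD('m)} = (Basis :: (real^'m::_) set)"
    using bij_betw_std_basis[where 'n='m] by (auto simp: bij_betw_def)
  have inj_n: "inj_on (std_basis :: nat \<Rightarrow> real^'n::_) {1..CARD('n)}"
    and img_n: "std_basis ` {1..CARD('n)} = (Basis :: (real^'n::_) set)"
    using bij_betw_std_basis[where 'n='n] by (auto simp: bij_betw_def)
  have ip_m: "(std_basis i :: real^'m::_) \<bullet> std_basis j = (if i = j then 1 else 0)"
    if "i \<in> {1..CARD('m)}" "j \<in> {1..CARD('m)}" for i j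
  proof -
    have "(std_basis i :: real^'m::_) \<in> Basis" "(std_basis j :: real^'m::_) \<in> Basis"
      unfolding img_m[symmetric] using that by blast+
    then show ?thesis
      using that by (simp add: inner_Basis inj_on_eq_iff[OF inj_m])
  qed
  have ip_n: "(std_basis i :: real^'n::_) \<bullet> std_basis j = (if i = j then 1 else 0)"
    if "i \<in> {1..CARD('m)}" "j \<in> {1..CARD('m)}" for i j
  proof -
    have ij: "i \<in> {1..CARD('n)}" "j \<in> {1..CARD('n)}"
      using that mn by auto
    then have "(std_basis i :: real^'n::_) \<in> Basis" "(std_basis j :: real^'n::_) \<in> Basis"
      unfolding img_n[symmetric] by blast+
    then show ?thesis
      using ij by (simp add: inner_Basis inj_on_eq_iff[OF inj_n])
  qed
  have lin: "linear f"
    unfolding f_def by (intro linearI)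
      (simp_all add: inner_add_left scaleR_add_left sum.distrib scaleR_sum_right)
  have fb: "f (std_basis i) = std_basis i" if "i \<in> {1..CARD('m)}" for i
  proof -
    have "f (std_basis i) = (\<Sum>j\<in>{1..CARD('m)}. if i = j then std_basis j else 0)"
      unfolding f_def using that by (intro sum.cong refl) (auto simp: ip_m)
    then show ?thesis
      using that by simp
  qed
  have ip: "f x \<bullet> f y = x \<bullet> y" for x y
  proof -
    have "f x \<bullet> f y = (\<Sum>i\<in>{1..CARD('m)}. \<Sum>j\<in>{1..CARD('m)}.
        (if i = j then (x \<bullet> std_basis i) * (y \<bullet> std_basis j) else 0))"
      unfolding f_def inner_sum_left inner_sum_right
      by (subst sum.swap) (intro sum.cong refl, auto simp: ip_n)
    also have "\<dots> = (\<Sum>i\<in>{1..CARD('m)}. (x \<bullet> std_basis i) * (y \<bullet> std_basis i))"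
      by simp
    also have "\<dots> = (\<Sum>b\<in>std_basis ` {1..CARD('m)}. (x \<bullet> b) * (y \<bullet> b))"
      by (subst sum.reindex[OF inj_m]) simp
    also have "\<dots> = x \<bullet> y"
      unfolding img_m by (rule euclidean_inner[symmetric])
    finally show ?thesis .
  qed
  have "f ` Basis \<subseteq> Basis"
  proof -
    have "f ` Basis = (std_basis :: nat \<Rightarrow> real^'n::_) ` {1..CARD('m)}"
      unfolding img_m[symmetric] image_image by (rule image_cong) (auto simp: fb)
    also have "\<dots> \<subseteq> std_basis ` {1..CARD('n)}"
      using mn by (intro image_mono) auto
    finally show ?thesis
      by (simp only: img_n)
  qed
  note angle = solid_angle_isometric_image[OF lin ip this]
  have inj: "inj f"
  proof (rule injI)
    fix x y assume "f x = f y"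
    then have "f (x - y) = 0"
      using lin by (simp add: linear_diff)
    then have "(x - y) \<bullet> (x - y) = 0"
      using ip[of "x - y" "x - y"] by simp
    then show "x = y" by simp
  qed
  have simplex: "f ` std_simplex l = std_simplex l" if "l \<le> CARD('m)" for l
  proof -
    have "f ` std_basis ` {1..l} = std_basis ` {1..l}"
      unfolding image_image using that by (intro image_cong refl) (auto simp: fb)
    then show ?thesis
      using convex_hull_linear_image[OF lin] by (simp add: std_simplex_def)
  qed
  have "solid_angle (tangent_cone (std_simplex k) (std_simplex m :: (real^'n::_) set)) =
      solid_angle (tangent_cone (std_simplex k) (std_simplex m :: (real^'m::_) set))"
    if "k \<in> {1..m}"
  proof -
    have "tangent_cone (std_simplex k) (std_simplex m :: (real^'n::_) set) =
        f ` tangent_cone (std_simplex k) (std_simplex m)"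
      using tangent_cone_linear_image[OF lin inj, of "std_simplex k" "std_simplex m"]
        simplex[of k] simplex[of m] that m by simp
    then show ?thesis
      by (simp add: angle)
  qed
  then show ?thesis
    by (simp add: tangent_angle_sum_def)
qed

lemma tangent_angle_sum_ambient:
  assumes "m \<le> CARD('m)" "m \<le> CARD('n)"
  shows "tangent_angle_sum TYPE('m::{finite,wellorder}) m k =
    tangent_angle_sum TYPE('n::{finite,wellorder}) m k"
  using tangent_angle_sum_ambient_le[where 'm='m and 'n='n]
    tangent_angle_sum_ambient_le[where 'm='n and 'n='m] assms
  by (metis nat_le_linear)

end

theory Submission
  imports Defs
begin

text \<open>
  Write \<open>k = j + 1\<close>. Almost surely the points are in general position, so that every
  \<open>j\<close>-face is spanned by exactly \<open>k\<close> of them, and the expected angle sum is the sum over all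
  \<open>k\<close>-subsets \<open>F\<close> of the expectation of the angle at \<open>F\<close>, counted when \<open>F\<close> spans a face. Let \<open>p\<^sub>r\<close>
  be the probability that \<open>F\<close> still spans a face after the points have been projected orthogonally to
  an \<open>r\<close>-dimensional subspace (\<open>face_prob\<close>). The projected points are Gaussian again. Two
  comparisons of these probabilities prove the theorem.

  \<^item> Projecting along a line. If \<open>F\<close> spans a face with tangent cone \<open>T\<close> and \<open>z\<close> is a Gaussian
    direction, then almost surely exactly one of three things happens: \<open>z \<in> T\<close>, or \<open>-z \<in> T\<close>, or \<open>F\<close>
    still spans a face after projecting along \<open>z\<close> (\<open>point_tangent_trichotomy\<close>). The first two have
    the same probability, hence twice the expected angle at \<open>F\<close> is \<open>p\<^sub>d - p\<^sub>d\<^sub>-\<^sub>1\<close>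
    (\<open>measure_exposes_tangent\<close>).

  \<^item> Projecting along a plane. If \<open>F\<close> spans a face in dimension \<open>r\<close> but not in dimension \<open>r - 2\<close>,
    then the hyperplanes supporting the polytope along \<open>F\<close>, seen through their two coordinates on the
    plane, form a pointed planar cone. It has exactly two sides, and each of them is given by a facet
    containing \<open>F\<close>; if \<open>F\<close> spans no face, or still spans one in dimension \<open>r - 2\<close>, there is no such
    facet (\<open>card_pivots\<close>). Therefore \<open>2 (p\<^sub>r - p\<^sub>r\<^sub>-\<^sub>2)\<close> is the sum over the \<open>r\<close>-subsets
    \<open>J\<close> containing \<open>F\<close> of the probability that \<open>J\<close> is such a facet. That \<open>J\<close> is a facet at all has
    probability twice the angle of the normal cone of the regular simplex at its face on \<open>J\<close>
    (\<open>measure_exposes_facet\<close>). Whether it is one of the two sides depends on the signs of the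
    coefficients of the affine dependence among the points of \<open>J\<close>, projected to dimension
    \<open>r - 2\<close>. Its direction is independent of the first event and uniformly distributed on the sphere of
    vectors with coordinate sum zero (\<open>kernel_direction_uniform\<close>), which brings in twice the angle of
    the tangent cone of the simplex on \<open>J\<close> at its face on \<open>F\<close> (\<open>measure_exposes_cancels\<close>).
    Altogether \<open>p\<^sub>r - p\<^sub>r\<^sub>-\<^sub>2\<close> is twice the sum over \<open>J\<close> of products of a normal and a
    tangent angle (\<open>face_prob_diff\<close>).

  The differences \<open>p\<^sub>r - p\<^sub>r\<^sub>-\<^sub>1\<close> and \<open>p\<^sub>r\<^sub>-\<^sub>1 - p\<^sub>r\<^sub>-\<^sub>2\<close> add up to
  \<open>p\<^sub>r - p\<^sub>r\<^sub>-\<^sub>2\<close>, so solving for the former recursively produces the alternating sum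
  (\<open>face_prob_diff_alternating\<close>). Summation over \<open>F\<close> and the symmetry of the simplex turn the
  products of angles into products of angle sums (\<open>sum_conic_volume\<close>).

  The angle sum has to be shown measurable on all configurations of points, including the degenerate
  ones. The sets involved are Boolean combinations of projections of closed sets of a Euclidean space,
  and such projections are Borel sets (\<open>borel_Ex_closed\<close>).
\<close>

section \<open>General position and the pivots of a pencil of supporting hyperplanes\<close>

text \<open>
  The vectors \<open>y i\<close> are to be thought of as homogeneous coordinates \<open>(1, x i)\<close> of points, and \<open>A\<close> as a
  linear family of affine functionals: some hyperplane of the family supports the points, touching
  them exactly along \<open>F\<close>. Restricting the family to the functionals that are constant in certain
  directions amounts to projecting the points along these directions. The trivial functional exposes
  the index set of all points.
\<close>

definition exposes :: "'a::euclidean_space set \<Rightarrow> ('n::finite \<Rightarrow> 'a) \<Rightarrow> 'n set \<Rightarrow> bool" where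
  "exposes A y F \<longleftrightarrow> (\<exists>\<phi>\<in>A. (\<forall>i\<in>F. \<phi> \<bullet> y i = 0) \<and> (\<forall>i\<in>-F. \<phi> \<bullet> y i > 0))"

text \<open>
  On \<open>A\<close>, any \<open>dim A\<close> of the evaluations at the \<open>y i\<close> are linearly independent. Coefficient vectors
  indexed by the points make sense of this for families with repetitions.
\<close>

definition in_general_position :: "'a::euclidean_space set \<Rightarrow> ('n::finite \<Rightarrow> 'a) \<Rightarrow> bool" where
  "in_general_position A y \<longleftrightarrow> (\<forall>v::real^'n. card {i. v$i \<noteq> 0} \<le> dim A \<longrightarrow>
     (\<forall>\<phi>\<in>A. (\<Sum>i\<in>UNIV. v$i * (\<phi> \<bullet> y i)) = 0) \<longrightarrow> v = 0)"

lemma in_general_positionD: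
  fixes v :: "real^'n::finite"
  assumes "in_general_position A y" "{i. v$i \<noteq> 0} \<subseteq> I" "card I \<le> dim A"
    "\<And>\<phi>. \<phi> \<in> A \<Longrightarrow> (\<Sum>i\<in>UNIV. v$i * (\<phi> \<bullet> y i)) = 0"
  shows "v = 0"
proof -
  have "card {i. v$i \<noteq> 0} \<le> dim A"
    using card_mono[OF _ assms(2)] assms(3) by (meson finite order_trans)
  then show ?thesis using assms(1,4) unfolding in_general_position_def by blast
qed

text \<open>
  A pattern orthogonal to all attained patterns would be a relation forbidden by general position.
\<close>

lemma general_position_values:
  fixes y :: "'n::finite \<Rightarrow> 'a::euclidean_space"
  assumes A: "subspace A" and gp: "in_general_position A y" and I: "card I \<le> dim A"
  shows "\<exists>\<phi>\<in>A. \<forall>i\<in>I. \<phi> \<bullet> y i = t i"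
proof -
  define T :: "'a \<Rightarrow> real^'n" where "T \<phi> = (\<chi> i. if i \<in> I then \<phi> \<bullet> y i else 0)" for \<phi>
  define t' :: "real^'n" where "t' = (\<chi> i. if i \<in> I then t i else 0)"
  have linT: "linear T"
    by (rule linearI) (auto simp: T_def vec_eq_iff inner_add_left)
  have sub: "subspace (T ` A)"
    using linT A by (rule linear_subspace_image)
  then have spn: "span (T ` A) = T ` A" by (simp add: span_eq_iff)
  obtain p z where pz: "p \<in> span (T ` A)" "\<And>w. w \<in> span (T ` A) \<Longrightarrow> orthogonal z w" "t' = p + z"
    using orthogonal_subspace_decomp_exists[of "T ` A" t'] by metis
  obtain \<phi> where \<phi>: "\<phi> \<in> A" "p = T \<phi>" using pz(1) spn by auto
  have zI: "z $ i = 0" if "i \<notin> I" for i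
  proof -
    have "z = t' - p" using pz by simp
    then show ?thesis using that by (simp add: t'_def \<phi> T_def)
  qed
  have "z = 0"
  proof (rule in_general_positionD[OF gp _ I])
    show "{i. z $ i \<noteq> 0} \<subseteq> I" using zI by auto
    fix \<psi> assume "\<psi> \<in> A"
    then have "z \<bullet> T \<psi> = 0" using pz(2) spn by (auto simp: orthogonal_def)
    moreover have "z \<bullet> T \<psi> = (\<Sum>i\<in>UNIV. z$i * (\<psi> \<bullet> y i))"
      unfolding inner_vec_def T_def by (intro sum.cong) (auto simp: zI)
    ultimately show "(\<Sum>i\<in>UNIV. z$i * (\<psi> \<bullet> y i)) = 0" by simp
  qed
  then have "t' = T \<phi>" using pz \<phi> by simp
  then have "\<forall>i\<in>I. \<phi> \<bullet> y i = t i"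
    by (auto simp: t'_def T_def vec_eq_iff split: if_splits)
  then show ?thesis using \<phi> by blast
qed

text \<open>
  Otherwise all patterns on \<open>dim A\<close> of the zeros would be attained on \<open>A\<close>, hence on the orthogonal
  complement of \<open>\<phi>\<close> in \<open>A\<close>, whose dimension is too small.
\<close>

lemma general_position_card_zeros:
  fixes y :: "'n::finite \<Rightarrow> 'a::euclidean_space"
  assumes A: "subspace A" and gp: "in_general_position A y" and \<phi>: "\<phi> \<in> A" "\<phi> \<noteq> 0"
  shows "card {i. \<phi> \<bullet> y i = 0} < dim A"
proof (rule ccontr)
  assume "\<not> ?thesis"
  then obtain I where I: "I \<subseteq> {i. \<phi> \<bullet> y i = 0}" "card I = dim A"
    by (meson not_less obtain_subset_with_card_n)
  \<comment> \<open>All values on \<open>I\<close> are attained on \<open>A\<close>, hence already on the smaller space \<open>A'\<close>.\<close>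
  define A' where "A' = A \<inter> {\<psi>. \<phi> \<bullet> \<psi> = 0}"
  define T :: "'a \<Rightarrow> real^'n" where "T \<psi> = (\<chi> i. if i \<in> I then \<psi> \<bullet> y i else 0)" for \<psi>
  have linT: "linear T"
    by (rule linearI) (auto simp: T_def vec_eq_iff inner_add_left)
  have subA': "subspace A'"
    unfolding A'_def by (rule subspace_inter[OF A subspace_hyperplane])
  have "\<phi> \<notin> A'"
    using \<phi> by (simp add: A'_def)
  moreover have "A' \<subseteq> A" by (auto simp: A'_def)
  ultimately have "A' \<subset> A" using \<phi> by blast
  then have lt: "dim A' < dim A"
    using subA' A by (metis dim_psubset span_eq_iff)
  have "(\<lambda>i. axis i 1) ` I \<subseteq> T ` A'"
  proof safe
    fix i assume "i \<in> I"
    obtain \<psi> where \<psi>: "\<psi> \<in> A" "\<forall>j\<in>I. \<psi> \<bullet> y j = (if j = i then 1 else 0)"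
      using general_position_values[OF A gp, of I "\<lambda>j. if j = i then 1 else 0"] I by auto
    define \<psi>' where "\<psi>' = \<psi> - ((\<psi> \<bullet> \<phi>) / (\<phi> \<bullet> \<phi>)) *\<^sub>R \<phi>"
    have "\<psi>' \<in> A'"
      using \<psi> \<phi> A by (auto simp: A'_def \<psi>'_def inner_diff_right inner_commute subspace_diff subspace_scale)
    moreover have "T \<psi>' = axis i 1"
      using \<psi> I \<open>i \<in> I\<close> by (auto simp: T_def \<psi>'_def vec_eq_iff axis_def inner_diff_left subset_iff)
    ultimately show "axis i 1 \<in> T ` A'" by (metis imageI)
  qed
  then have "dim ((\<lambda>i. axis i 1 :: real^'n) ` I) \<le> dim (T ` A')"
    by (rule dim_subset)
  moreover have "dim (T ` A') \<le> dim A'" by (rule dim_image_le[OF linT])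
  moreover have "dim ((\<lambda>i. axis i 1 :: real^'n) ` I) = card I"
  proof -
    have "independent ((\<lambda>i. axis i 1 :: real^'n) ` I)"
      by (rule independent_mono[OF independent_Basis]) (auto simp: Basis_vec_def)
    moreover have "inj_on (\<lambda>i. axis i 1 :: real^'n) I"
      by (auto simp: inj_on_def axis_eq_axis)
    ultimately show ?thesis by (simp add: dim_eq_card_independent card_image)
  qed
  ultimately show False using lt I by simp
qed

text \<open>
  A small perturbation by a functional that vanishes on \<open>F\<close> and equals \<open>1\<close> at the remaining zeros
  of \<open>\<phi>\<close> makes the inequalities strict.
\<close>

lemma exposes_of_nonneg:
  fixes y :: "'n::finite \<Rightarrow> 'a::euclidean_space"
  assumes A: "subspace A" and gp: "in_general_position A y" and \<phi>: "\<phi> \<in> A" "\<phi> \<noteq> 0"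
    and F: "\<And>i. i \<in> F \<Longrightarrow> \<phi> \<bullet> y i = 0" and nF: "\<And>i. i \<notin> F \<Longrightarrow> \<phi> \<bullet> y i \<ge> 0"
  shows "exposes A y F"
proof -
  define Z where "Z = {i. \<phi> \<bullet> y i = 0}"
  have "card Z \<le> dim A"
    using general_position_card_zeros[OF A gp \<phi>] by (simp add: Z_def)
  then obtain \<psi> where \<psi>: "\<psi> \<in> A" "\<forall>i\<in>Z. \<psi> \<bullet> y i = (if i \<in> F then 0 else 1)"
    using general_position_values[OF A gp, of Z "\<lambda>i. if i \<in> F then 0 else 1"] by blast
  have "\<forall>i\<in>-F. eventually (\<lambda>e. 0 < (\<phi> + e *\<^sub>R \<psi>) \<bullet> y i) (at_right 0)"
  proof
    fix i assume i: "i \<in> -F"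
    show "eventually (\<lambda>e. 0 < (\<phi> + e *\<^sub>R \<psi>) \<bullet> y i) (at_right 0)"
    proof (cases "i \<in> Z")
      case True
      then have "\<phi> \<bullet> y i = 0" "\<psi> \<bullet> y i = 1" using \<psi> i by (auto simp: Z_def)
      then show ?thesis
        by (auto simp: inner_add_left eventually_at_right_less)
    next
      case False
      then have "\<phi> \<bullet> y i > 0" using nF[of i] i by (auto simp: Z_def)
      moreover have "((\<lambda>e. (\<phi> + e *\<^sub>R \<psi>) \<bullet> y i) \<longlongrightarrow> (\<phi> + 0 *\<^sub>R \<psi>) \<bullet> y i) (at_right 0)"
        by (intro tendsto_intros)
      ultimately show ?thesis by (intro order_tendstoD) auto
    qed
  qed
  then have "eventually (\<lambda>e. \<forall>i\<in>-F. 0 < (\<phi> + e *\<^sub>R \<psi>) \<bullet> y i) (at_right 0)"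
    by (intro eventually_ball_finite) auto
  then obtain e where e: "\<forall>i\<in>-F. 0 < (\<phi> + e *\<^sub>R \<psi>) \<bullet> y i"
    by (auto dest: eventually_happens)
  moreover have "\<forall>i\<in>F. (\<phi> + e *\<^sub>R \<psi>) \<bullet> y i = 0"
    using F \<psi> by (auto simp: inner_add_left Z_def)
  moreover have "\<phi> + e *\<^sub>R \<psi> \<in> A"
    using \<phi> \<psi> A by (simp add: subspace_add subspace_scale)
  ultimately show ?thesis unfolding exposes_def by blast
qed

text \<open>
  The finitely generated cone spanned by the \<open>y i\<close>, the \<open>- y i\<close> with \<open>i \<in> F\<close> and the orthogonal
  complement of \<open>A\<close> is closed, so that a vector outside of it can be separated from it. Having the
  complement among the generators forces the separating functional into \<open>A\<close>.
\<close>

lemma Farkas: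
  fixes y :: "'n::finite \<Rightarrow> 'a::euclidean_space"
  assumes A: "subspace A"
    and *: "\<And>\<phi>. \<phi> \<in> A \<Longrightarrow> (\<forall>i\<in>F. \<phi> \<bullet> y i = 0) \<Longrightarrow> (\<forall>i\<in>-F. \<phi> \<bullet> y i \<ge> 0) \<Longrightarrow> \<phi> \<bullet> w \<ge> 0"
  shows "\<exists>v::real^'n. (\<forall>i\<in>-F. v$i \<ge> 0) \<and> (\<forall>\<phi>\<in>A. (\<Sum>i\<in>UNIV. v$i * (\<phi> \<bullet> y i)) = \<phi> \<bullet> w)"
proof -
  obtain B where B: "B \<subseteq> orthogonal_comp A" "orthogonal_comp A \<subseteq> span B" "finite B"
    by (metis basis_exists independent_imp_finite)
  define S where "S = range y \<union> uminus ` y ` F \<union> B \<union> uminus ` B"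
  have fin: "finite S" using B by (simp add: S_def)
  \<comment> \<open>The cone \<open>K\<close> of all vectors of the required form contains the generators \<open>S\<close>.\<close>
  define K where "K = {x. \<exists>v::real^'n. \<exists>m\<in>orthogonal_comp A. (\<forall>i\<in>-F. v$i \<ge> 0) \<and> x = (\<Sum>i\<in>UNIV. v$i *\<^sub>R y i) + m}"
  have "convex_cone K"
    unfolding convex_cone_iff
  proof (intro conjI ballI allI impI)
    show "0 \<in> K"
      unfolding K_def using subspace_0[OF subspace_orthogonal_comp]
      by (auto intro!: exI[of _ 0] bexI[of _ 0])
  next
    fix u x assume "u \<in> K" "x \<in> K"
    then obtain v m v' m' where 1: "m \<in> orthogonal_comp A" "m' \<in> orthogonal_comp A"
      "\<forall>i\<in>-F. v$i \<ge> (0::real)" "\<forall>i\<in>-F. v'$i \<ge> (0::real)"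
      "u = (\<Sum>i\<in>UNIV. v$i *\<^sub>R y i) + m" "x = (\<Sum>i\<in>UNIV. v'$i *\<^sub>R y i) + m'"
      unfolding K_def by blast
    have "u + x = (\<Sum>i\<in>UNIV. (v+v')$i *\<^sub>R y i) + (m + m')"
      by (simp add: 1 scaleR_add_left sum.distrib)
    moreover have "m + m' \<in> orthogonal_comp A" "\<forall>i\<in>-F. (v+v')$i \<ge> 0"
      using 1 by (auto intro: subspace_add subspace_orthogonal_comp)
    ultimately show "u + x \<in> K" unfolding K_def by blast
  next
    fix x and c :: real assume c: "0 \<le> c" and "x \<in> K"
    then obtain v m where 1: "m \<in> orthogonal_comp A"
      "\<forall>i\<in>-F. v$i \<ge> (0::real)" "x = (\<Sum>i\<in>UNIV. v$i *\<^sub>R y i) + m"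
      unfolding K_def by blast
    have "c *\<^sub>R x = (\<Sum>i\<in>UNIV. (c *\<^sub>R v)$i *\<^sub>R y i) + c *\<^sub>R m"
      by (simp add: 1 scaleR_add_right scaleR_sum_right)
    moreover have "c *\<^sub>R m \<in> orthogonal_comp A" "\<forall>i\<in>-F. (c *\<^sub>R v)$i \<ge> 0"
      using 1 c by (auto intro: subspace_scale subspace_orthogonal_comp)
    ultimately show "c *\<^sub>R x \<in> K" unfolding K_def by blast
  qed
  moreover have "S \<subseteq> K"
  proof
    fix x assume "x \<in> S"
    moreover have "- z \<in> orthogonal_comp A" "z \<in> orthogonal_comp A" if "z \<in> B" for z
      using B(1) that subspace_neg[OF subspace_orthogonal_comp[of A]] by auto
    ultimately consider (y) i where "x = y i" | (m) i where "i \<in> F" "x = - y i" | (B) "x \<in> orthogonal_comp A"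
      unfolding S_def by (elim UnE imageE) metis+
    then show "x \<in> K"
    proof cases
      case y
      have "x = (\<Sum>j\<in>UNIV. (axis i 1 :: real^'n)$j *\<^sub>R y j) + 0"
        by (simp add: y axis_def if_distrib[of "\<lambda>c. c *\<^sub>R _"] cong: if_cong)
      moreover have "\<forall>j\<in>-F. (axis i 1 :: real^'n)$j \<ge> 0" by (simp add: axis_def)
      ultimately show ?thesis unfolding K_def using subspace_0[OF subspace_orthogonal_comp] by blast
    next
      case m
      have "x = (\<Sum>j\<in>UNIV. (axis i (-1) :: real^'n)$j *\<^sub>R y j) + 0"
        by (simp add: m axis_def if_distrib[of "\<lambda>c. c *\<^sub>R _"] cong: if_cong)
      moreover have "\<forall>j\<in>-F. (axis i (-1) :: real^'n)$j \<ge> 0" using m by (auto simp: axis_def)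
      ultimately show ?thesis unfolding K_def using subspace_0[OF subspace_orthogonal_comp] by blast
    next
      case B
      have "x = (\<Sum>j\<in>UNIV. (0 :: real^'n)$j *\<^sub>R y j) + x" by simp
      moreover have "\<forall>j\<in>-F. (0 :: real^'n)$j \<ge> 0" by simp
      ultimately show ?thesis unfolding K_def using B by blast
    qed
  qed
  ultimately have hull: "convex_cone hull S \<subseteq> K" by (rule hull_minimal[rotated])
  have "w \<in> convex_cone hull S"
  proof (rule ccontr)
    assume "w \<notin> convex_cone hull S"
    then obtain a b where ab: "a \<bullet> w < b" "\<forall>x\<in>convex_cone hull S. a \<bullet> x > b"
      using separating_hyperplane_closed_point[OF _ closed_convex_cone_hull[OF fin], of w]
      by (auto simp: convex_convex_cone_hull)
    have "b < 0" using ab(2) convex_cone_hull_contains_0[of S] by force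
    have pos: "a \<bullet> x \<ge> 0" if "x \<in> S" for x
    proof (rule ccontr)
      assume neg: "\<not> ?thesis"
      have "(b / (a \<bullet> x)) *\<^sub>R x \<in> convex_cone hull S"
        using that \<open>b < 0\<close> neg by (intro convex_cone_hull_mul hull_inc) (auto simp: divide_nonpos_nonpos)
      then show False using ab(2) neg by force
    qed
    have "a \<bullet> x = 0" if "x \<in> B" for x
      using pos[of x] pos[of "-x"] that by (auto simp: S_def)
    then have "B \<subseteq> {x. a \<bullet> x = 0}" by auto
    then have "span B \<subseteq> {x. a \<bullet> x = 0}" by (rule span_minimal) (rule subspace_hyperplane)
    then have "a \<in> orthogonal_comp (orthogonal_comp A)"
      using B(2) by (auto simp: orthogonal_comp_def orthogonal_def inner_commute)
    then have "a \<in> A" using orthogonal_comp_self[OF A] by simp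
    moreover have "\<forall>i\<in>F. a \<bullet> y i = 0"
    proof
      fix i assume "i \<in> F"
      then show "a \<bullet> y i = 0" using pos[of "y i"] pos[of "- y i"] by (auto simp: S_def)
    qed
    moreover have "\<forall>i\<in>-F. a \<bullet> y i \<ge> 0" using pos by (auto simp: S_def)
    ultimately have "a \<bullet> w \<ge> 0" by (rule *)
    with ab \<open>b < 0\<close> show False by simp
  qed
  then obtain v m where vm: "m \<in> orthogonal_comp A" "\<forall>i\<in>-F. v$i \<ge> (0::real)"
      "w = (\<Sum>i\<in>UNIV. v$i *\<^sub>R y i) + m"
    using hull unfolding K_def by blast
  have "(\<Sum>i\<in>UNIV. v$i * (\<phi> \<bullet> y i)) = \<phi> \<bullet> w" if "\<phi> \<in> A" for \<phi>
    using vm(1) that by (simp add: vm(3) inner_add_right inner_sum_right orthogonal_comp_def orthogonal_def)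
  then show ?thesis using vm(2) by blast
qed

text \<open>
  The signed area of the parallelogram spanned by the images of \<open>\<phi>\<close> and \<open>\<psi>\<close> in the plane with
  coordinates \<open>(\<bullet>) a\<close> and \<open>(\<bullet>) b\<close>. If the image of a cone is pointed, then \<open>\<phi>\<close> is mapped to its
  clockwise boundary ray exactly if this area is nonnegative for all \<open>\<psi>\<close> in the cone.
\<close>

definition tilt :: "'a::euclidean_space \<Rightarrow> 'a \<Rightarrow> 'a \<Rightarrow> 'a \<Rightarrow> real" where
  "tilt a b \<phi> \<psi> = (a \<bullet> \<phi>) * (b \<bullet> \<psi>) - (b \<bullet> \<phi>) * (a \<bullet> \<psi>)"

text \<open>
  The functionals in \<open>A\<close> that are nonnegative on the points and zero on \<open>F\<close> form a cone, which \<open>a\<close> and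
  \<open>b\<close> map to the plane. A pivot is a facet whose functional \<open>\<phi>\<close> is mapped to the clockwise boundary ray
  of the image. The coefficients \<open>v\<close> certify this, being a representation of the tilt by point
  evaluations as in Farkas' lemma. Exchanging \<open>a\<close> and \<open>b\<close> reverses the orientation and yields the
  pivot on the other side.
\<close>

definition pivot :: "'a::euclidean_space set \<Rightarrow> 'a \<Rightarrow> 'a \<Rightarrow> ('n::finite \<Rightarrow> 'a) \<Rightarrow> 'n set \<Rightarrow> 'n set \<Rightarrow> bool" where
  "pivot A a b y F J \<longleftrightarrow> F \<subseteq> J \<and> card J = dim A - 1 \<and>
    (\<exists>\<phi>\<in>A. (\<forall>i\<in>J. \<phi> \<bullet> y i = 0) \<and> (\<forall>i\<in>-J. \<phi> \<bullet> y i > 0) \<and>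
      (\<exists>v::real^'n. (\<forall>i\<in>-J. v$i = 0) \<and> (\<forall>i\<in>J-F. v$i > 0) \<and>
        (\<forall>\<psi>\<in>A. (\<Sum>i\<in>UNIV. v$i * (\<psi> \<bullet> y i)) = tilt a b \<phi> \<psi>)))"

text \<open>
  Each of the two functionals lies on the nonnegative side of the other. The tilt is antisymmetric, so
  it vanishes, and complementary slackness in the certificate compares the facets.
\<close>

lemma pivot_subset:
  fixes y :: "'n::finite \<Rightarrow> 'a::euclidean_space"
  assumes "pivot A a b y F J" "pivot A a b y F J'"
  shows "J \<subseteq> J'"
proof -
  have key: "tilt a b \<phi> \<phi>' \<ge> 0 \<and> (tilt a b \<phi> \<phi>' = 0 \<longrightarrow> J \<subseteq> J')"
    if "F \<subseteq> J" "F \<subseteq> J'" "\<forall>i\<in>-J. v$i = 0" "\<forall>i\<in>J-F. v$i > 0"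
      "(\<Sum>i\<in>UNIV. v$i * (\<phi>' \<bullet> y i)) = tilt a b \<phi> \<phi>'"
      "\<forall>i\<in>J'. \<phi>' \<bullet> y i = 0" "\<forall>i\<in>-J'. \<phi>' \<bullet> y i > 0" for J J' \<phi> \<phi>' and v :: "real^'n"
  proof -
    have nn: "v$i * (\<phi>' \<bullet> y i) \<ge> 0" for i
    proof -
      consider "i \<in> J'" | "i \<in> J - F" "i \<notin> J'" | "i \<notin> J" using \<open>F \<subseteq> J'\<close> by blast
      then show ?thesis
      proof cases
        case 2
        then have "v$i > 0" "\<phi>' \<bullet> y i > 0" using that by auto
        then show ?thesis by simp
      qed (use that in auto)
    qed
    have "tilt a b \<phi> \<phi>' \<ge> 0"
      unfolding that(5)[symmetric] by (intro sum_nonneg nn)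
    moreover have "J \<subseteq> J'" if 0: "tilt a b \<phi> \<phi>' = 0"
    proof
      fix i assume i: "i \<in> J"
      have "v$i * (\<phi>' \<bullet> y i) = 0"
        using sum_nonneg_eq_0_iff[of UNIV "\<lambda>i. v$i * (\<phi>' \<bullet> y i)"] nn
          \<open>(\<Sum>i\<in>UNIV. v$i * (\<phi>' \<bullet> y i)) = tilt a b \<phi> \<phi>'\<close> 0 by simp
      then have "v$i = 0 \<or> \<phi>' \<bullet> y i = 0" by simp
      then show "i \<in> J'" using i \<open>\<forall>i\<in>J-F. v$i > 0\<close> \<open>F \<subseteq> J'\<close> \<open>\<forall>i\<in>-J'. \<phi>' \<bullet> y i > 0\<close>
        by (metis ComplI DiffI less_irrefl subsetD)
    qed
    ultimately show ?thesis by blast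
  qed
  obtain \<phi> v where 1: "\<phi> \<in> A" "\<forall>i\<in>J. \<phi> \<bullet> y i = 0" "\<forall>i\<in>-J. \<phi> \<bullet> y i > 0" "\<forall>i\<in>-J. v$i = 0"
    "\<forall>i\<in>J-F. v$i > 0" "\<And>\<psi>. \<psi> \<in> A \<Longrightarrow> (\<Sum>i\<in>UNIV. v$i * (\<psi> \<bullet> y i)) = tilt a b \<phi> \<psi>"
    using assms(1) unfolding pivot_def by blast
  obtain \<phi>' v' where 2: "\<phi>' \<in> A" "\<forall>i\<in>J'. \<phi>' \<bullet> y i = 0" "\<forall>i\<in>-J'. \<phi>' \<bullet> y i > 0" "\<forall>i\<in>-J'. v'$i = 0"
    "\<forall>i\<in>J'-F. v'$i > 0" "\<And>\<psi>. \<psi> \<in> A \<Longrightarrow> (\<Sum>i\<in>UNIV. v'$i * (\<psi> \<bullet> y i)) = tilt a b \<phi>' \<psi>"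
    using assms(2) unfolding pivot_def by blast
  have F: "F \<subseteq> J" "F \<subseteq> J'" using assms by (auto simp: pivot_def)
  have "tilt a b \<phi> \<phi>' \<ge> 0 \<and> (tilt a b \<phi> \<phi>' = 0 \<longrightarrow> J \<subseteq> J')"
    by (rule key[OF F 1(4,5) 1(6)[OF 2(1)] 2(2,3)])
  moreover have "tilt a b \<phi>' \<phi> \<ge> 0"
    using key[OF F(2,1) 2(4,5) 2(6)[OF 1(1)] 1(2,3)] by simp
  moreover have "tilt a b \<phi>' \<phi> = - tilt a b \<phi> \<phi>'" by (simp add: tilt_def)
  ultimately show ?thesis by simp
qed

lemma pivot_unique:
  "pivot A a b y F J \<Longrightarrow> pivot A a b y F J' \<Longrightarrow> J = J'"
  using pivot_subset by blast

text \<open>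
  The functional of the pivot is perturbed to one that exposes \<open>F\<close>. A functional exposing \<open>F\<close> that
  is orthogonal to \<open>a\<close> and \<open>b\<close> would have tilt zero against the certificate, which is a positive
  combination of its values.
\<close>

lemma pivot_imp_exposes:
  fixes y :: "'n::finite \<Rightarrow> 'a::euclidean_space"
  assumes A: "subspace A" and gp: "in_general_position A y" and n: "dim A \<le> CARD('n)"
    and F: "card F < dim A - 1" and J: "pivot A a b y F J"
  shows "exposes A y F" and "\<not> exposes (A \<inter> {\<psi>. a \<bullet> \<psi> = 0 \<and> b \<bullet> \<psi> = 0}) y F"
proof -
  obtain \<phi> v where 1: "\<phi> \<in> A" "\<forall>i\<in>J. \<phi> \<bullet> y i = 0" "\<forall>i\<in>-J. \<phi> \<bullet> y i > 0" "\<forall>i\<in>-J. v$i = 0"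
    "\<forall>i\<in>J-F. v$i > 0" "\<And>\<psi>. \<psi> \<in> A \<Longrightarrow> (\<Sum>i\<in>UNIV. v$i * (\<psi> \<bullet> y i)) = tilt a b \<phi> \<psi>"
    using J unfolding pivot_def by blast
  have FJ: "F \<subseteq> J" "card J = dim A - 1" using J by (auto simp: pivot_def)
  have "J \<noteq> UNIV" using FJ n F by auto
  then obtain i where i: "i \<notin> J" by auto
  then have "\<phi> \<bullet> y i > 0" using 1(3) by simp
  then have "\<phi> \<noteq> 0" by auto
  show "exposes A y F"
  proof (rule exposes_of_nonneg[OF A gp \<open>\<phi> \<in> A\<close> \<open>\<phi> \<noteq> 0\<close>])
    show "\<phi> \<bullet> y i = 0" if "i \<in> F" for i using that 1(2) FJ by blast
    show "\<phi> \<bullet> y i \<ge> 0" for i using 1(2,3) by (cases "i \<in> J") (auto intro: less_imp_le)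
  qed
  show "\<not> exposes (A \<inter> {\<psi>. a \<bullet> \<psi> = 0 \<and> b \<bullet> \<psi> = 0}) y F"
  proof
    assume "exposes (A \<inter> {\<psi>. a \<bullet> \<psi> = 0 \<and> b \<bullet> \<psi> = 0}) y F"
    then obtain \<psi> where \<psi>: "\<psi> \<in> A" "a \<bullet> \<psi> = 0" "b \<bullet> \<psi> = 0" "\<forall>i\<in>F. \<psi> \<bullet> y i = 0" "\<forall>i\<in>-F. \<psi> \<bullet> y i > 0"
      unfolding exposes_def by blast
    have eq: "(\<Sum>i\<in>UNIV. v$i * (\<psi> \<bullet> y i)) = 0"
      using 1(6)[OF \<psi>(1)] \<psi> by (simp add: tilt_def)
    have "J - F \<noteq> {}" using FJ F by (metis Diff_eq_empty_iff card_mono finite not_less)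
    then obtain j where j: "j \<in> J - F" by blast
    have nn: "v$i * (\<psi> \<bullet> y i) \<ge> 0" for i
    proof -
      consider "i \<in> F" | "i \<in> J - F" | "i \<notin> J" by blast
      then show ?thesis
      proof cases
        case 2
        then have "v$i > 0" "\<psi> \<bullet> y i > 0" using 1(5) \<psi> by auto
        then show ?thesis by simp
      qed (use 1(4) \<psi> in auto)
    qed
    then have "v$j * (\<psi> \<bullet> y j) = 0"
      using eq sum_nonneg_eq_0_iff[of UNIV "\<lambda>i. v$i * (\<psi> \<bullet> y i)"] by simp
    moreover have "v$j > 0" "\<psi> \<bullet> y j > 0" using 1(5) \<psi> j by auto
    ultimately show False by simp
  qed
qed

text \<open>
  As no functional in \<open>A''\<close> exposes \<open>F\<close>, the planar image of the cone of functionals supporting the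
  points along \<open>F\<close> avoids the origin and has a boundary ray. It is attained by some \<open>\<phi>0\<close> on a compact
  base of the cone, and Farkas' lemma represents the tilt against \<open>\<phi>0\<close>. The support of this certificate
  consists of zeros of \<open>\<phi>0\<close>, of which there are at most \<open>dim A - 1\<close>; being a relation on \<open>A''\<close>, it has at
  least \<open>dim A'' + 1\<close> elements. These bounds agree, so \<open>\<phi>0\<close> exposes a facet.
\<close>

lemma ex_pivot:
  fixes y :: "'n::finite \<Rightarrow> 'a::euclidean_space"
  assumes A: "subspace A" and gp: "in_general_position A y" and n: "dim A \<le> CARD('n)"
    and ab: "a \<in> A" "b \<in> A" "a \<bullet> a = 1" "b \<bullet> b = 1" "a \<bullet> b = 0"
    and A'': "A'' = A \<inter> {\<psi>. a \<bullet> \<psi> = 0 \<and> b \<bullet> \<psi> = 0}" "dim A = dim A'' + 2"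
    and gp'': "in_general_position A'' y"
    and F: "F \<noteq> UNIV" and ex: "exposes A y F" and nex: "\<not> exposes A'' y F"
  shows "\<exists>J. pivot A a b y F J"
proof -
  have subA'': "subspace A''"
    using A unfolding A''(1) by (auto simp: subspace_def inner_add_right)
  define N where "N = A \<inter> (\<Inter>i\<in>F. {\<phi>. \<phi> \<bullet> y i = 0}) \<inter> (\<Inter>i\<in>-F. {\<phi>. 0 \<le> \<phi> \<bullet> y i})"
  have NI: "\<phi> \<in> N \<longleftrightarrow> \<phi> \<in> A \<and> (\<forall>i\<in>F. \<phi> \<bullet> y i = 0) \<and> (\<forall>i\<in>-F. 0 \<le> \<phi> \<bullet> y i)" for \<phi>
    by (auto simp: N_def)
  have nonneg: "\<phi> \<bullet> y i \<ge> 0" if "\<phi> \<in> N" for \<phi> i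
    using that by (cases "i \<in> F") (auto simp: NI)
  have Nsc: "c *\<^sub>R \<phi> \<in> N" if "\<phi> \<in> N" "c \<ge> 0" for c \<phi>
    using that A by (auto simp: NI subspace_scale)
  have closedN: "closed N"
    unfolding N_def
    by (intro closed_Int closed_INT closed_subspace[OF A] ballI closed_Collect_eq closed_Collect_le)
       (auto intro!: continuous_intros)
  \<comment> \<open>The slice \<open>D\<close> of the cone \<open>N\<close> by the hyperplane of functionals with value \<open>1\<close> at \<open>s\<close> is a compact base.\<close>
  define s where "s = (\<Sum>i\<in>UNIV. y i)"
  have pos: "\<phi> \<bullet> s > 0" if "\<phi> \<in> N" "\<phi> \<noteq> 0" for \<phi>
  proof (rule ccontr)
    assume "\<not> ?thesis"
    moreover have "\<phi> \<bullet> s = (\<Sum>i\<in>UNIV. \<phi> \<bullet> y i)" by (simp add: s_def inner_sum_right)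
    ultimately have "(\<Sum>i\<in>UNIV. \<phi> \<bullet> y i) = 0"
      using sum_nonneg[of UNIV "\<lambda>i. \<phi> \<bullet> y i"] nonneg[OF that(1)] by simp
    then have "{i. \<phi> \<bullet> y i = 0} = UNIV"
      using sum_nonneg_eq_0_iff[of UNIV "\<lambda>i. \<phi> \<bullet> y i"] nonneg[OF that(1)] by auto
    then show False
      using general_position_card_zeros[OF A gp, of \<phi>] that n by (simp add: NI)
  qed
  obtain \<psi> where \<psi>: "\<psi> \<in> A" "\<forall>i\<in>F. \<psi> \<bullet> y i = 0" "\<forall>i\<in>-F. \<psi> \<bullet> y i > 0"
    using ex unfolding exposes_def by blast
  then have \<psi>N: "\<psi> \<in> N" by (auto simp: NI less_imp_le)
  have "\<psi> \<noteq> 0" using \<psi> F by auto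
  define D where "D = N \<inter> {\<phi>. \<phi> \<bullet> s = 1}"
  have normD: "(1 / (\<phi> \<bullet> s)) *\<^sub>R \<phi> \<in> D" if "\<phi> \<in> N" "\<phi> \<noteq> 0" for \<phi>
    using Nsc[OF that(1), of "1 / (\<phi> \<bullet> s)"] pos[OF that] by (simp add: D_def)
  have "D \<noteq> {}" using normD[OF \<psi>N \<open>\<psi> \<noteq> 0\<close>] by blast
  have "closed D"
    unfolding D_def by (intro closed_Int closedN closed_Collect_eq) (auto intro!: continuous_intros)
  moreover have "bounded D"
  proof -
    have "compact (N \<inter> sphere 0 1)"
      using closedN by (simp add: closed_Int_compact)
    moreover have "(1 / norm \<psi>) *\<^sub>R \<psi> \<in> N \<inter> sphere 0 1"
      using Nsc[OF \<psi>N] \<open>\<psi> \<noteq> 0\<close> by simp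
    ultimately obtain \<phi>0 where \<phi>0: "\<phi>0 \<in> N \<inter> sphere 0 1" "\<forall>\<phi>\<in>N \<inter> sphere 0 1. \<phi>0 \<bullet> s \<le> \<phi> \<bullet> s"
      using continuous_attains_inf[of "N \<inter> sphere 0 1" "\<lambda>\<phi>. \<phi> \<bullet> s",
          OF _ _ continuous_on_inner[OF continuous_on_id continuous_on_const]] by blast
    have m: "\<phi>0 \<bullet> s > 0" using \<phi>0 by (intro pos) auto
    have "norm \<phi> \<le> 1 / (\<phi>0 \<bullet> s)" if "\<phi> \<in> D" for \<phi>
    proof -
      have "\<phi> \<noteq> 0" "\<phi> \<in> N" "\<phi> \<bullet> s = 1" using that by (auto simp: D_def)
      then have "(1 / norm \<phi>) *\<^sub>R \<phi> \<in> N \<inter> sphere 0 1" using Nsc[of \<phi> "1 / norm \<phi>"] by simp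
      then have "\<phi>0 \<bullet> s \<le> ((1 / norm \<phi>) *\<^sub>R \<phi>) \<bullet> s" using \<phi>0 by blast
      then show ?thesis using m \<open>\<phi> \<noteq> 0\<close> \<open>\<phi> \<bullet> s = 1\<close> by (simp add: field_simps)
    qed
    then show ?thesis by (auto simp: bounded_iff)
  qed
  ultimately have cD: "compact D" by (simp add: compact_eq_bounded_closed)
  have "convex N"
    unfolding N_def
  proof (intro convex_Int convex_INT subspace_imp_convex[OF A])
    show "convex {\<phi>. \<phi> \<bullet> y i = 0}" for i using convex_hyperplane[of "y i" 0] by (simp add: inner_commute)
    show "convex {\<phi>. 0 \<le> \<phi> \<bullet> y i}" for i using convex_halfspace_ge[of 0 "y i"] by (simp add: inner_commute)
  qed
  then have "convex D"
    unfolding D_def using convex_hyperplane[of s 1] by (auto intro: convex_Int simp: inner_commute)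
  define \<pi> where "\<pi> \<phi> = (a \<bullet> \<phi>, b \<bullet> \<phi>)" for \<phi>
  have lin\<pi>: "linear \<pi>"
    by (rule linearI) (auto simp: \<pi>_def inner_add_right)
  have nz: "\<pi> \<phi> \<noteq> 0" if "\<phi> \<in> D" for \<phi>
  proof
    assume "\<pi> \<phi> = 0"
    then have "\<phi> \<in> A''" using that by (auto simp: \<pi>_def A''(1) D_def NI zero_prod_def)
    moreover have "\<phi> \<noteq> 0" using that by (auto simp: D_def)
    ultimately have "exposes A'' y F"
      using that by (intro exposes_of_nonneg[OF subA'' gp'']) (auto simp: D_def NI)
    with nex show False by blast
  qed
  have "convex (\<pi> ` D)" "compact (\<pi> ` D)"
    using convex_linear_image[OF lin\<pi> \<open>convex D\<close>] 
      compact_continuous_image[OF linear_continuous_on cD] lin\<pi> by (auto simp: linear_linear)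
  then obtain \<tau> c where \<tau>: "c > 0" "\<forall>x\<in>\<pi> ` D. \<tau> \<bullet> x > c"
    using separating_hyperplane_closed_0[of "\<pi> ` D"] nz by (metis compact_imp_closed imageE)
  obtain t1 t2 where t: "\<tau> = (t1, t2)" by (cases \<tau>)
  have den: "t1 * (a \<bullet> \<phi>) + t2 * (b \<bullet> \<phi>) > 0" if "\<phi> \<in> D" for \<phi>
    using \<tau> that by (auto simp: t \<pi>_def intro: less_trans)
  \<comment> \<open>In the coordinates along \<open>\<tau>\<close> and its rotation by a right angle the slope on \<open>\<pi> ` D\<close> is continuous. A point of minimal slope lies on the boundary ray.\<close>
  have "\<exists>\<phi>0\<in>D. \<forall>\<phi>\<in>D. (t1 * (b \<bullet> \<phi>0) - t2 * (a \<bullet> \<phi>0)) / (t1 * (a \<bullet> \<phi>0) + t2 * (b \<bullet> \<phi>0))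
      \<le> (t1 * (b \<bullet> \<phi>) - t2 * (a \<bullet> \<phi>)) / (t1 * (a \<bullet> \<phi>) + t2 * (b \<bullet> \<phi>))"
    using den by (intro continuous_attains_inf[OF cD \<open>D \<noteq> {}\<close>] continuous_intros) force
  then obtain \<phi>0 where \<phi>0: "\<phi>0 \<in> D" and min: "\<And>\<phi>. \<phi> \<in> D \<Longrightarrow>
      (t1 * (b \<bullet> \<phi>0) - t2 * (a \<bullet> \<phi>0)) / (t1 * (a \<bullet> \<phi>0) + t2 * (b \<bullet> \<phi>0))
      \<le> (t1 * (b \<bullet> \<phi>) - t2 * (a \<bullet> \<phi>)) / (t1 * (a \<bullet> \<phi>) + t2 * (b \<bullet> \<phi>))" by blast
  have tiltD: "tilt a b \<phi>0 \<phi> \<ge> 0" if "\<phi> \<in> D" for \<phi>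
  proof -
    have "0 \<le> (t1 * (b \<bullet> \<phi>) - t2 * (a \<bullet> \<phi>)) * (t1 * (a \<bullet> \<phi>0) + t2 * (b \<bullet> \<phi>0))
        - (t1 * (b \<bullet> \<phi>0) - t2 * (a \<bullet> \<phi>0)) * (t1 * (a \<bullet> \<phi>) + t2 * (b \<bullet> \<phi>))"
      using min[OF that] den[OF that] den[OF \<phi>0] by (simp add: divide_simps mult.commute)
    also have "\<dots> = (t1\<^sup>2 + t2\<^sup>2) * tilt a b \<phi>0 \<phi>"
      by (simp add: tilt_def algebra_simps power2_eq_square)
    finally have "0 \<le> (t1\<^sup>2 + t2\<^sup>2) * tilt a b \<phi>0 \<phi>" .
    moreover have "t1\<^sup>2 + t2\<^sup>2 > 0"
      using den[OF that] by (metis add.right_neutral mult_zero_left less_irrefl sum_power2_gt_zero_iff)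
    ultimately show ?thesis by (simp add: zero_le_mult_iff)
  qed
  have tiltN: "tilt a b \<phi>0 \<phi> \<ge> 0" if "\<phi> \<in> N" for \<phi>
  proof (cases "\<phi> = 0")
    case False
    have "tilt a b \<phi>0 ((1 / (\<phi> \<bullet> s)) *\<^sub>R \<phi>) = (1 / (\<phi> \<bullet> s)) * tilt a b \<phi>0 \<phi>"
      by (simp add: tilt_def algebra_simps diff_divide_distrib)
    then show ?thesis using tiltD[OF normD[OF that False]] pos[OF that False]
      by (simp add: zero_le_divide_iff)
  qed (simp add: tilt_def)
  define w where "w = (a \<bullet> \<phi>0) *\<^sub>R b - (b \<bullet> \<phi>0) *\<^sub>R a"
  have w: "\<phi> \<bullet> w = tilt a b \<phi>0 \<phi>" for \<phi>
    by (simp add: w_def tilt_def inner_diff_right inner_commute)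
  have "\<exists>v::real^'n. (\<forall>i\<in>-F. v$i \<ge> 0) \<and> (\<forall>\<phi>\<in>A. (\<Sum>i\<in>UNIV. v$i * (\<phi> \<bullet> y i)) = \<phi> \<bullet> w)"
    by (rule Farkas[OF A]) (use tiltN in \<open>auto simp: w NI\<close>)
  then obtain v :: "real^'n" where v: "\<forall>i\<in>-F. v$i \<ge> 0"
    "\<And>\<phi>. \<phi> \<in> A \<Longrightarrow> (\<Sum>i\<in>UNIV. v$i * (\<phi> \<bullet> y i)) = tilt a b \<phi>0 \<phi>" by (auto simp: w)
  have \<phi>0': "\<phi>0 \<in> N" "\<phi>0 \<in> A" "\<phi>0 \<noteq> 0" using \<phi>0 by (auto simp: D_def NI)
  define J where "J = {i. \<phi>0 \<bullet> y i = 0}"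
  have FJ: "F \<subseteq> J" using \<phi>0' by (auto simp: J_def NI)
  have cardJ: "card J < dim A"
    unfolding J_def by (rule general_position_card_zeros[OF A gp \<phi>0'(2,3)])
  have "(\<Sum>i\<in>UNIV. v$i * (\<phi>0 \<bullet> y i)) = 0"
    using v(2)[OF \<phi>0'(2)] by (simp add: tilt_def)
  moreover have nn: "v$i * (\<phi>0 \<bullet> y i) \<ge> 0" for i
    using v(1) nonneg[OF \<phi>0'(1), of i] FJ by (cases "i \<in> F") (auto simp: J_def)
  ultimately have vz: "v$i * (\<phi>0 \<bullet> y i) = 0" for i
    using sum_nonneg_eq_0_iff[of UNIV "\<lambda>i. v$i * (\<phi>0 \<bullet> y i)"] by simp
  then have supp: "{i. v$i \<noteq> 0} \<subseteq> J" by (auto simp: J_def)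
  \<comment> \<open>The support of \<open>v\<close> lies in \<open>J\<close>, which has fewer than \<open>dim A\<close> elements. General position with respect to \<open>A''\<close> bounds it from below, so that it is all of \<open>J\<close>.\<close>
  have "dim A'' < card {i. v$i \<noteq> 0}"
  proof (rule ccontr)
    assume "\<not> ?thesis"
    then have "v = 0"
      by (intro in_general_positionD[OF gp'' order_refl]) (auto simp: v(2) A''(1) tilt_def)
    then have "\<phi> \<bullet> w = 0" if "\<phi> \<in> A" for \<phi> using v(2)[OF that] by (simp add: w)
    moreover have "w \<in> A" unfolding w_def using ab A by (simp add: subspace_diff subspace_scale)
    ultimately have "w \<bullet> w = 0" by blast
    then have w0: "w = 0" by simp
    have "a \<bullet> w = - (b \<bullet> \<phi>0)" "b \<bullet> w = a \<bullet> \<phi>0"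
      using ab by (simp_all add: w_def inner_diff_right inner_commute)
    then have "\<pi> \<phi>0 = 0" using w0 by (simp add: \<pi>_def zero_prod_def)
    then show False using nz[OF \<phi>0] by blast
  qed
  then have "{i. v$i \<noteq> 0} = J" "card J = dim A - 1"
    using cardJ A''(2) supp card_mono[OF _ supp] card_subset_eq[OF _ supp] by auto
  moreover have "\<forall>i\<in>-J. \<phi>0 \<bullet> y i > 0"
    using nonneg[OF \<phi>0'(1)] by (simp add: J_def less_le)
  moreover have "\<forall>i\<in>J-F. v$i > 0"
    using v(1) \<open>{i. v$i \<noteq> 0} = J\<close> by (force simp: less_le)
  ultimately have "pivot A a b y F J"
    unfolding pivot_def using FJ \<phi>0' v(2)
    by (intro conjI bexI[of _ \<phi>0] exI[of _ v]) (auto simp: J_def)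
  then show ?thesis ..
qed

text \<open>
  A relation on \<open>A''\<close> is on \<open>A\<close> a combination of \<open>(\<bullet>) a\<close> and \<open>(\<bullet>) b\<close>. If it is supported on \<open>J\<close>, it
  annihilates the functional \<open>\<phi>\<close> of the facet and is therefore a multiple of the tilt against \<open>\<phi>\<close>. The
  sign of the nonzero factor decides on which side the pivot lies. The left-hand side does not
  refer to \<open>a\<close> and \<open>b\<close>, and its two conditions turn out to be independent for Gaussian points.
\<close>

lemma pivot_iff:
  fixes y :: "'n::finite \<Rightarrow> 'a::euclidean_space"
  assumes A: "subspace A" and gp: "in_general_position A y" and n: "dim A \<le> CARD('n)"
    and ab: "a \<in> A" "b \<in> A" "a \<bullet> a = 1" "b \<bullet> b = 1" "a \<bullet> b = 0"
    and A'': "A'' = A \<inter> {\<psi>. a \<bullet> \<psi> = 0 \<and> b \<bullet> \<psi> = 0}" "dim A = dim A'' + 2"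
    and gp'': "in_general_position A'' y"
    and F: "card F < dim A - 1" and J: "F \<subseteq> J" "card J = dim A - 1"
  shows "exposes A y J \<and> (\<exists>v::real^'n. (\<forall>i\<in>-J. v$i = 0) \<and> (\<forall>i\<in>J-F. v$i > 0) \<and>
      (\<forall>\<psi>\<in>A''. (\<Sum>i\<in>UNIV. v$i * (\<psi> \<bullet> y i)) = 0))
    \<longleftrightarrow> pivot A a b y F J \<or> pivot A b a y F J" (is "?l \<longleftrightarrow> ?r")
proof
  assume ?r
  then show ?l
  proof
    assume "pivot A a b y F J"
    then obtain \<phi> v where \<phi>: "\<phi> \<in> A" "\<forall>i\<in>J. \<phi> \<bullet> y i = 0" "\<forall>i\<in>-J. \<phi> \<bullet> y i > 0" "\<forall>i\<in>-J. v$i = 0"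
      "\<forall>i\<in>J-F. v$i > 0" "\<forall>\<psi>\<in>A. (\<Sum>i\<in>UNIV. v$i * (\<psi> \<bullet> y i)) = tilt a b \<phi> \<psi>"
      unfolding pivot_def by blast
    moreover have "\<forall>\<psi>\<in>A''. (\<Sum>i\<in>UNIV. v$i * (\<psi> \<bullet> y i)) = 0"
      using \<phi>(6) by (simp add: A''(1) tilt_def)
    ultimately show ?l unfolding exposes_def by blast
  next
    assume "pivot A b a y F J"
    then obtain \<phi> v where \<phi>: "\<phi> \<in> A" "\<forall>i\<in>J. \<phi> \<bullet> y i = 0" "\<forall>i\<in>-J. \<phi> \<bullet> y i > 0" "\<forall>i\<in>-J. v$i = 0"
      "\<forall>i\<in>J-F. v$i > 0" "\<forall>\<psi>\<in>A. (\<Sum>i\<in>UNIV. v$i * (\<psi> \<bullet> y i)) = tilt b a \<phi> \<psi>"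
      unfolding pivot_def by blast
    moreover have "\<forall>\<psi>\<in>A''. (\<Sum>i\<in>UNIV. v$i * (\<psi> \<bullet> y i)) = 0"
      using \<phi>(6) by (simp add: A''(1) tilt_def)
    ultimately show ?l unfolding exposes_def by blast
  qed
next
  assume ?l
  then obtain \<phi> and v :: "real^'n" where \<phi>: "\<phi> \<in> A" "\<forall>i\<in>J. \<phi> \<bullet> y i = 0" "\<forall>i\<in>-J. \<phi> \<bullet> y i > 0"
    and v: "\<forall>i\<in>-J. v$i = 0" "\<forall>i\<in>J-F. v$i > 0" "\<And>\<psi>. \<psi> \<in> A'' \<Longrightarrow> (\<Sum>i\<in>UNIV. v$i * (\<psi> \<bullet> y i)) = 0"
    unfolding exposes_def by blast
  have subA'': "subspace A''"
    using A unfolding A''(1) by (auto simp: subspace_def inner_add_right)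
  have "J - F \<noteq> {}" using J F by (metis Diff_eq_empty_iff card_mono finite not_less)
  then have "v \<noteq> 0" using v(2) by force
  have "J \<noteq> UNIV" using J n F by auto
  then obtain i where "i \<notin> J" by auto
  then have "\<phi> \<bullet> y i > 0" using \<phi>(3) by simp
  then have "\<phi> \<noteq> 0" by auto
  define u where "u = (\<Sum>i\<in>UNIV. v$i *\<^sub>R y i)"
  have u: "(\<Sum>i\<in>UNIV. v$i * (\<psi> \<bullet> y i)) = \<psi> \<bullet> u" for \<psi>
    by (simp add: u_def inner_sum_right)
  define \<alpha> \<beta> where "\<alpha> = a \<bullet> u" and "\<beta> = b \<bullet> u"
  define p q where "p = a \<bullet> \<phi>" and "q = b \<bullet> \<phi>"
  have eq: "\<psi> \<bullet> u = \<alpha> * (a \<bullet> \<psi>) + \<beta> * (b \<bullet> \<psi>)" if "\<psi> \<in> A" for \<psi>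
  proof -
    have "\<psi> - (a \<bullet> \<psi>) *\<^sub>R a - (b \<bullet> \<psi>) *\<^sub>R b \<in> A''"
      using A that ab by (auto simp: A''(1) inner_diff_right inner_commute intro!: subspace_diff subspace_scale)
    then have "(\<psi> - (a \<bullet> \<psi>) *\<^sub>R a - (b \<bullet> \<psi>) *\<^sub>R b) \<bullet> u = 0"
      using v(3) u by metis
    then show ?thesis by (simp add: inner_diff_left \<alpha>_def \<beta>_def mult.commute)
  qed
  have "\<phi> \<bullet> u = 0"
    unfolding u[symmetric] using \<phi>(2) v(1) by (intro sum.neutral) auto
  then have 0: "\<alpha> * p + \<beta> * q = 0" using eq[OF \<phi>(1)] by (simp add: p_def q_def)
  have pq: "p\<^sup>2 + q\<^sup>2 > 0"
  proof (rule ccontr)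
    assume "\<not> ?thesis"
    then have "p = 0" "q = 0" by (auto simp: sum_power2_gt_zero_iff)
    then have "\<phi> \<in> A''" using \<phi>(1) by (simp add: A''(1) p_def q_def)
    then have "card {i. \<phi> \<bullet> y i = 0} < dim A''"
      by (rule general_position_card_zeros[OF subA'' gp'' _ \<open>\<phi> \<noteq> 0\<close>])
    moreover have "card J \<le> card {i. \<phi> \<bullet> y i = 0}" using \<phi>(2) by (intro card_mono) auto
    ultimately show False using J A''(2) by simp
  qed
  have pq0: "p\<^sup>2 + q\<^sup>2 \<noteq> 0" using pq by (rule less_imp_neq[symmetric])
  \<comment> \<open>The vectors \<open>(\<alpha>, \<beta>)\<close> and \<open>(p, q)\<close> of the plane are orthogonal, so that the former is a multiple of the latter turned by a right angle.\<close>
  define \<kappa> where "\<kappa> = (p * \<beta> - q * \<alpha>) / (p\<^sup>2 + q\<^sup>2)"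
  have \<alpha>: "\<alpha> = - \<kappa> * q"
  proof -
    have "\<alpha> * (p\<^sup>2 + q\<^sup>2) = p * (\<alpha> * p + \<beta> * q) - q * (p * \<beta> - q * \<alpha>)" by (simp add: algebra_simps power2_eq_square)
    also have "\<dots> = - (p * \<beta> - q * \<alpha>) * q" using 0 by (simp add: algebra_simps)
    finally have "\<alpha> = - (p * \<beta> - q * \<alpha>) * q / (p\<^sup>2 + q\<^sup>2)" by (rule nonzero_eq_divide_eq[OF pq0, THEN iffD2])
    then show ?thesis unfolding \<kappa>_def by (simp only: minus_divide_left times_divide_eq_left)
  qed
  have \<beta>: "\<beta> = \<kappa> * p"
  proof -
    have "\<beta> * (p\<^sup>2 + q\<^sup>2) = q * (\<alpha> * p + \<beta> * q) + p * (p * \<beta> - q * \<alpha>)" by (simp add: algebra_simps power2_eq_square)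
    also have "\<dots> = (p * \<beta> - q * \<alpha>) * p" using 0 by simp
    finally have "\<beta> = (p * \<beta> - q * \<alpha>) * p / (p\<^sup>2 + q\<^sup>2)" by (rule nonzero_eq_divide_eq[OF pq0, THEN iffD2])
    then show ?thesis unfolding \<kappa>_def by (simp only: times_divide_eq_left)
  qed
  have eq': "(\<Sum>i\<in>UNIV. v$i * (\<psi> \<bullet> y i)) = \<kappa> * tilt a b \<phi> \<psi>" if "\<psi> \<in> A" for \<psi>
    using eq[OF that] by (simp add: u \<alpha> \<beta> tilt_def p_def q_def algebra_simps)
  have "\<kappa> \<noteq> 0"
  proof
    assume "\<kappa> = 0"
    have "v = 0"
    proof (rule in_general_positionD[OF gp])
      show "{i. v$i \<noteq> 0} \<subseteq> J" using v(1) by auto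
    qed (use J eq' \<open>\<kappa> = 0\<close> in auto)
    then show False using \<open>v \<noteq> 0\<close> by blast
  qed
  then consider "\<kappa> > 0" | "\<kappa> < 0" by linarith
  then show ?r
  proof cases
    case 1
    have "pivot A a b y F J"
      unfolding pivot_def
    proof (intro conjI J bexI[OF _ \<phi>(1)] \<phi>(2,3) exI[of _ "(1/\<kappa>) *\<^sub>R v"] ballI)
      show "((1/\<kappa>) *\<^sub>R v)$i = 0" if "i \<in> -J" for i using that v by simp
      show "((1/\<kappa>) *\<^sub>R v)$i > 0" if "i \<in> J - F" for i using that v 1 by simp
      show "(\<Sum>i\<in>UNIV. ((1/\<kappa>) *\<^sub>R v)$i * (\<psi> \<bullet> y i)) = tilt a b \<phi> \<psi>" if "\<psi> \<in> A" for \<psi>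
        using eq'[OF that] 1 by (simp add: sum_divide_distrib[symmetric] field_simps)
    qed
    then show ?thesis ..
  next
    case 2
    have "pivot A b a y F J"
      unfolding pivot_def
    proof (intro conjI J bexI[OF _ \<phi>(1)] \<phi>(2,3) exI[of _ "(-1/\<kappa>) *\<^sub>R v"] ballI)
      show "((-1/\<kappa>) *\<^sub>R v)$i = 0" if "i \<in> -J" for i using that v by simp
      show "((-1/\<kappa>) *\<^sub>R v)$i > 0" if "i \<in> J - F" for i
      proof -
        have "-1/\<kappa> > 0" "v$i > 0" using that v 2 by (auto simp: divide_neg_neg)
        then have "(-1/\<kappa>) * v$i > 0" by (rule mult_pos_pos)
        then show ?thesis by simp
      qed
      show "(\<Sum>i\<in>UNIV. ((-1/\<kappa>) *\<^sub>R v)$i * (\<psi> \<bullet> y i)) = tilt b a \<phi> \<psi>" if "\<psi> \<in> A" for \<psi>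
      proof -
        have "(\<Sum>i\<in>UNIV. ((-1/\<kappa>) *\<^sub>R v)$i * (\<psi> \<bullet> y i)) = (-1/\<kappa>) * (\<Sum>i\<in>UNIV. v$i * (\<psi> \<bullet> y i))"
          by (simp add: sum_distrib_left sum_negf)
        also have "\<dots> = - tilt a b \<phi> \<psi>" using eq'[OF that] 2 by simp
        finally show ?thesis by (simp add: tilt_def)
      qed
    qed
    then show ?thesis ..
  qed
qed

text \<open>
  The functional of the facet is unique up to a positive factor. A functional exposing \<open>F\<close> would have to
  lie strictly on both sides of it.
\<close>

lemma pivot_asym:
  fixes y :: "'n::finite \<Rightarrow> 'a::euclidean_space"
  assumes A: "subspace A" and gp: "in_general_position A y" and n: "dim A \<le> CARD('n)"
    and F: "card F < dim A - 1" and 1: "pivot A a b y F J" and 2: "pivot A b a y F J"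
  shows False
proof -
  obtain \<phi> v where \<phi>: "\<phi> \<in> A" "\<forall>i\<in>J. \<phi> \<bullet> y i = 0" "\<forall>i\<in>-J. \<phi> \<bullet> y i > 0" "\<forall>i\<in>-J. v$i = 0"
    "\<forall>i\<in>J-F. v$i > 0" "\<And>\<psi>. \<psi> \<in> A \<Longrightarrow> (\<Sum>i\<in>UNIV. v$i * (\<psi> \<bullet> y i)) = tilt a b \<phi> \<psi>"
    using 1 unfolding pivot_def by blast
  obtain \<phi>' v' where \<phi>': "\<phi>' \<in> A" "\<forall>i\<in>J. \<phi>' \<bullet> y i = 0" "\<forall>i\<in>-J. \<phi>' \<bullet> y i > 0" "\<forall>i\<in>-J. v'$i = 0"
    "\<forall>i\<in>J-F. v'$i > 0" "\<And>\<psi>. \<psi> \<in> A \<Longrightarrow> (\<Sum>i\<in>UNIV. v'$i * (\<psi> \<bullet> y i)) = tilt b a \<phi>' \<psi>"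
    using 2 unfolding pivot_def by blast
  have J: "F \<subseteq> J" "card J = dim A - 1" using 1 by (auto simp: pivot_def)
  have "J \<noteq> UNIV" using J n F by auto
  then obtain i where i: "i \<notin> J" by auto
  \<comment> \<open>Both functionals vanish on \<open>J\<close>, which determines them up to a factor.\<close>
  define \<xi> where "\<xi> = (\<phi>' \<bullet> y i) *\<^sub>R \<phi> - (\<phi> \<bullet> y i) *\<^sub>R \<phi>'"
  have pos: "\<phi> \<bullet> y i > 0" "\<phi>' \<bullet> y i > 0" using \<phi>(3) \<phi>'(3) i by auto
  have "\<xi> = 0"
  proof (rule ccontr)
    assume "\<xi> \<noteq> 0"
    moreover have "\<xi> \<in> A" using A \<phi> \<phi>' by (simp add: \<xi>_def subspace_diff subspace_scale)
    ultimately have "card {i. \<xi> \<bullet> y i = 0} < dim A"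
      by (intro general_position_card_zeros[OF A gp])
    moreover have "insert i J \<subseteq> {i. \<xi> \<bullet> y i = 0}"
      using \<phi>(2) \<phi>'(2) by (auto simp: \<xi>_def inner_diff_left)
    then have "card (insert i J) \<le> card {i. \<xi> \<bullet> y i = 0}" by (intro card_mono) auto
    ultimately show False using i J F by simp
  qed
  then have c: "(\<phi>' \<bullet> y i) *\<^sub>R \<phi> = (\<phi> \<bullet> y i) *\<^sub>R \<phi>'" by (simp add: \<xi>_def)
  obtain \<psi> where \<psi>: "\<psi> \<in> A" "\<forall>i\<in>F. \<psi> \<bullet> y i = 0" "\<forall>i\<in>-F. \<psi> \<bullet> y i > 0"
    using pivot_imp_exposes(1)[OF A gp n F 1] unfolding exposes_def by blast
  have "J - F \<noteq> {}" using J F by (metis Diff_eq_empty_iff card_mono finite not_less)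
  then obtain j where j: "j \<in> J - F" by blast
  have sp: "(\<Sum>i\<in>UNIV. v$i * (\<psi> \<bullet> y i)) > 0" if "\<forall>i\<in>-J. v$i = 0" "\<forall>i\<in>J-F. v$i > 0" for v :: "real^'n"
  proof -
    have nn: "v$i * (\<psi> \<bullet> y i) \<ge> 0" for i
    proof -
      consider "i \<in> F" | "i \<in> J - F" | "i \<notin> J" by blast
      then show ?thesis
      proof cases
        case 2
        then have "v$i > 0" "\<psi> \<bullet> y i > 0" using that \<psi> by auto
        then show ?thesis by simp
      qed (use that \<psi> in auto)
    qed
    moreover have "v$j * (\<psi> \<bullet> y j) > 0" using that \<psi> j by auto
    ultimately show ?thesis by (intro sum_pos2[of _ j]) auto
  qed
  have t1: "tilt a b \<phi> \<psi> > 0" using sp[OF \<phi>(4,5)] \<phi>(6)[OF \<psi>(1)] by simp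
  have t2: "tilt b a \<phi>' \<psi> > 0" using sp[OF \<phi>'(4,5)] \<phi>'(6)[OF \<psi>(1)] by simp
  have "(\<phi>' \<bullet> y i) * tilt a b \<phi> \<psi> = tilt a b ((\<phi>' \<bullet> y i) *\<^sub>R \<phi>) \<psi>" by (simp add: tilt_def algebra_simps)
  also have "\<dots> = - ((\<phi> \<bullet> y i) * tilt b a \<phi>' \<psi>)" unfolding c by (simp add: tilt_def algebra_simps)
  finally show False using t1 t2 pos mult_pos_pos[of "\<phi>' \<bullet> y i" "tilt a b \<phi> \<psi>"] mult_pos_pos[of "\<phi> \<bullet> y i" "tilt b a \<phi>' \<psi>"] by linarith
qed

text \<open>
  A pointed planar cone has two sides.
\<close>

lemma card_pivots:
  fixes y :: "'n::finite \<Rightarrow> 'a::euclidean_space"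
  assumes A: "subspace A" and gp: "in_general_position A y" and n: "dim A \<le> CARD('n)"
    and ab: "a \<in> A" "b \<in> A" "a \<bullet> a = 1" "b \<bullet> b = 1" "a \<bullet> b = 0"
    and A'': "A'' = A \<inter> {\<psi>. a \<bullet> \<psi> = 0 \<and> b \<bullet> \<psi> = 0}" "dim A = dim A'' + 2"
    and gp'': "in_general_position A'' y"
    and F: "card F < dim A - 1"
  shows "card {J. F \<subseteq> J \<and> card J = dim A - 1 \<and> exposes A y J \<and>
      (\<exists>v::real^'n. (\<forall>i\<in>-J. v$i = 0) \<and> (\<forall>i\<in>J-F. v$i > 0) \<and>
        (\<forall>\<psi>\<in>A''. (\<Sum>i\<in>UNIV. v$i * (\<psi> \<bullet> y i)) = 0))}
    = (if exposes A y F \<and> \<not> exposes A'' y F then 2 else 0)" (is "card ?S = _")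
proof -
  have "J \<in> ?S \<longleftrightarrow> pivot A a b y F J \<or> pivot A b a y F J" for J
  proof (cases "F \<subseteq> J \<and> card J = dim A - 1")
    case True
    then show ?thesis using pivot_iff[OF A gp n ab A'' gp'' F, of J] by simp
  next
    case False
    then have "\<not> pivot A a b y F J" "\<not> pivot A b a y F J" unfolding pivot_def by blast+
    then show ?thesis using False by blast
  qed
  then have S: "?S = {J. pivot A a b y F J \<or> pivot A b a y F J}" by blast
  show ?thesis
  proof (cases "exposes A y F \<and> \<not> exposes A'' y F")
    case True
    have "F \<noteq> UNIV" using F n by auto
    then obtain J where J: "pivot A a b y F J"
      using ex_pivot[OF A gp n ab A'' gp''] True by blast
    have A2: "A'' = A \<inter> {\<psi>. b \<bullet> \<psi> = 0 \<and> a \<bullet> \<psi> = 0}" using A''(1) by blast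
    have "b \<bullet> a = 0" using ab by (simp add: inner_commute)
    then obtain J' where J': "pivot A b a y F J'"
      using ex_pivot[OF A gp n ab(2,1,4,3) _ A2 A''(2) gp''] True \<open>F \<noteq> UNIV\<close> by blast
    have "?S = {J, J'}" unfolding S using J J' pivot_unique by blast
    moreover have "J \<noteq> J'" using pivot_asym[OF A gp n F] J J' by blast
    ultimately show ?thesis using True by simp
  next
    case False
    have A2: "A'' = A \<inter> {\<psi>. b \<bullet> \<psi> = 0 \<and> a \<bullet> \<psi> = 0}" using A''(1) by blast
    have "?S = {}" unfolding S
      using pivot_imp_exposes[OF A gp n F, of a b] pivot_imp_exposes[OF A gp n F, of b a] False
      by (auto simp: A''(1)[symmetric] A2[symmetric])
    then show ?thesis using False by (simp only: card.empty if_False)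
  qed
qed

section \<open>Gaussian vectors and matrices\<close>

abbreviation std_normal :: "real measure" where
  "std_normal \<equiv> density lborel (\<lambda>t. ennreal (std_normal_density t))"

lemma emeasure_std_gaussian_box:
  "emeasure std_gaussian (box l u) = (\<Prod>b\<in>Basis. emeasure std_normal {l \<bullet> b <..< u \<bullet> b})"
proof -
  have "box l u = {x. \<forall>b\<in>Basis. x \<bullet> b \<in> {l \<bullet> b <..< u \<bullet> b}}" by (auto simp: mem_box)
  then show ?thesis by (simp only:) (rule emeasure_std_gaussian_prod, auto)
qed

text \<open>
  Boxes are stable under intersection and generate the Borel sets.
\<close>

lemma std_gaussian_eqI:
  fixes M :: "'a::euclidean_space measure"
  assumes sets: "sets M = sets borel"
    and box: "\<And>l u. emeasure M (box l u) = (\<Prod>b\<in>Basis. emeasure std_normal {l \<bullet> b <..< u \<bullet> b})"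
  shows "M = std_gaussian"
proof (rule measure_eqI_generator_eq[where E = "range (\<lambda>(l, u). box l u)" and \<Omega> = UNIV
      and A = "\<lambda>n::nat. box (- (real n *\<^sub>R One)) (real n *\<^sub>R One)"])
  show "Int_stable (range (\<lambda>(l, u). box l (u::'a)))"
  proof (rule Int_stableI)
    fix A B assume "A \<in> range (\<lambda>(l, u). box l (u::'a))" "B \<in> range (\<lambda>(l, u). box l (u::'a))"
    then obtain a b c d where "A = box a b" "B = box c d" by auto
    then have "A \<inter> B = (\<lambda>(l, u). box l u)
        (\<Sum>i\<in>Basis. max (a \<bullet> i) (c \<bullet> i) *\<^sub>R i, \<Sum>i\<in>Basis. min (b \<bullet> i) (d \<bullet> i) *\<^sub>R i)"
      by (auto simp: mem_box)
    then show "A \<inter> B \<in> range (\<lambda>(l, u). box l (u::'a))"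
      by blast
  qed
  show "sets M = sigma_sets UNIV (range (\<lambda>(l, u). box l (u::'a)))"
    "sets std_gaussian = sigma_sets UNIV (range (\<lambda>(l, u). box l (u::'a)))"
    by (simp_all add: sets borel_eq_box)
  show "(\<Union>n::nat. box (- (real n *\<^sub>R One)) (real n *\<^sub>R One)) = (UNIV :: 'a set)"
    by (rule UN_box_eq_UNIV)
  show eq: "emeasure M S = emeasure std_gaussian S" if "S \<in> range (\<lambda>(l, u). box l u)" for S
    using that by (auto simp: box emeasure_std_gaussian_box)
  interpret G: prob_space "std_gaussian :: 'a measure" by (rule prob_space_std_gaussian)
  show "emeasure M (box (- (real n *\<^sub>R One)) (real n *\<^sub>R One)) \<noteq> \<infinity>" for n
    by (subst eq) auto
qed auto

lemma prod_Basis_vec: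
  fixes f :: "'a::euclidean_space^'n \<Rightarrow> 'b::comm_monoid_mult"
  shows "(\<Prod>b\<in>Basis. f b) = (\<Prod>i\<in>UNIV. \<Prod>u\<in>Basis. f (axis i u))"
proof -
  have "(Basis :: ('a^'n) set) = (\<lambda>(i,u). axis i u) ` (UNIV \<times> Basis)"
    by (auto simp: Basis_vec_def)
  moreover have "inj_on (\<lambda>(i,u). axis i u) (UNIV \<times> (Basis :: 'a set))"
    by (auto simp: inj_on_def axis_eq_axis)
  ultimately have "(\<Prod>b\<in>Basis. f b) = (\<Prod>x\<in>UNIV \<times> Basis. f (case x of (i,u) \<Rightarrow> axis i u))"
    using prod.reindex[of "\<lambda>(i,u). axis i u" "UNIV \<times> (Basis :: 'a set)" f] by (simp only: comp_def)
  also have "\<dots> = (\<Prod>i\<in>UNIV. \<Prod>u\<in>Basis. f (axis i u))"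
    by (simp add: prod.cartesian_product case_prod_unfold)
  finally show ?thesis .
qed

lemma mem_box_vec: "x \<in> box l u \<longleftrightarrow> (\<forall>i. x $ i \<in> box (l $ i) (u $ i))"
  for x :: "'a::euclidean_space^'n"
  by (auto simp: mem_box Basis_vec_def inner_axis)

lemma measurable_vec_nth [measurable]: "(\<lambda>x::'a::euclidean_space^'n. x $ i) \<in> borel_measurable borel"
  by (intro borel_measurable_continuous_onI continuous_intros)

lemma measurable_vec_lambda:
  fixes f :: "'b \<Rightarrow> 'n::finite \<Rightarrow> 'a::euclidean_space"
  assumes "\<And>i. (\<lambda>x. f x i) \<in> borel_measurable M"
  shows "(\<lambda>x. \<chi> i. f x i) \<in> borel_measurable M"
proof (subst borel_measurable_euclidean_space, rule ballI)
  fix b :: "'a^'n" assume "b \<in> Basis"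
  then obtain i u where b: "b = axis i u" by (auto simp: Basis_vec_def)
  have [measurable]: "(\<lambda>x. f x i) \<in> borel_measurable M" by (rule assms)
  have "(\<lambda>x. (\<chi> i. f x i) \<bullet> b) = (\<lambda>x. f x i \<bullet> u)" by (simp add: b inner_axis)
  then show "(\<lambda>x. (\<chi> i. f x i) \<bullet> b) \<in> borel_measurable M" by simp
qed

lemma sets_components:
  fixes A :: "'n::finite \<Rightarrow> 'a::euclidean_space set"
  assumes [measurable]: "\<And>i. A i \<in> sets borel"
  shows "{x. \<forall>i. x $ i \<in> A i} \<in> sets borel"
  by measurable

lemma std_gaussian_vec:
  "distr (\<Pi>\<^sub>M i\<in>UNIV. std_gaussian) borel vec_lambda = (std_gaussian :: ('a::euclidean_space^'n::finite) measure)"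
proof (rule std_gaussian_eqI)
  interpret product_prob_space "\<lambda>_::'n. std_gaussian :: 'a measure" UNIV
    by (rule product_prob_spaceI) (rule prob_space_std_gaussian)
  have [measurable]: "vec_lambda \<in> borel_measurable (\<Pi>\<^sub>M i\<in>(UNIV::'n set). (std_gaussian::'a measure))"
    using measurable_vec_lambda[of "\<lambda>x i. x i" "\<Pi>\<^sub>M i\<in>(UNIV::'n set). (std_gaussian::'a measure)"]
    by simp
  fix l u :: "'a^'n"
  have "emeasure (distr (\<Pi>\<^sub>M i\<in>UNIV. std_gaussian) borel vec_lambda) (box l u)
    = emeasure (\<Pi>\<^sub>M i\<in>(UNIV::'n set). (std_gaussian::'a measure)) (\<Pi>\<^sub>E i\<in>UNIV. box (l$i) (u$i))"
    by (subst emeasure_distr) (auto intro!: arg_cong2[where f=emeasure] simp: mem_box_vec space_PiM PiE_iff)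
  also have "\<dots> = (\<Prod>i\<in>UNIV. emeasure std_gaussian (box (l$i) (u$i)))"
    by (rule emeasure_PiM) auto
  also have "\<dots> = (\<Prod>b\<in>Basis. emeasure std_normal {l \<bullet> b <..< u \<bullet> b})"
    by (simp add: prod_Basis_vec emeasure_std_gaussian_box inner_axis)
  finally show "emeasure (distr (\<Pi>\<^sub>M i\<in>UNIV. std_gaussian) borel vec_lambda) (box l u) = \<dots>" .
qed simp

lemma emeasure_std_gaussian_components:
  fixes A :: "'n::finite \<Rightarrow> 'a::euclidean_space set"
  assumes A[measurable]: "\<And>i. A i \<in> sets borel"
  shows "emeasure std_gaussian {x. \<forall>i. x $ i \<in> A i} = (\<Prod>i\<in>UNIV. emeasure std_gaussian (A i))"
proof -
  interpret product_prob_space "\<lambda>_::'n. std_gaussian :: 'a measure" UNIV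
    by (rule product_prob_spaceI) (rule prob_space_std_gaussian)
  have [measurable]: "vec_lambda \<in> borel_measurable (\<Pi>\<^sub>M i\<in>(UNIV::'n set). (std_gaussian::'a measure))"
    using measurable_vec_lambda[of "\<lambda>x i. x i" "\<Pi>\<^sub>M i\<in>(UNIV::'n set). (std_gaussian::'a measure)"]
    by simp
  have [measurable]: "{x. \<forall>i. x $ i \<in> A i} \<in> sets borel"
    by measurable
  have "emeasure std_gaussian {x. \<forall>i. x $ i \<in> A i} =
     emeasure (\<Pi>\<^sub>M i\<in>(UNIV::'n set). (std_gaussian::'a measure)) (\<Pi>\<^sub>E i\<in>UNIV. A i)"
    unfolding std_gaussian_vec[symmetric]
    by (subst emeasure_distr) (auto intro!: arg_cong2[where f=emeasure] simp: space_PiM PiE_iff)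
  also have "\<dots> = (\<Prod>i\<in>UNIV. emeasure std_gaussian (A i))"
    by (rule emeasure_PiM) auto
  finally show ?thesis .
qed

lemma distr_std_gaussian_map_components:
  fixes f :: "'a::euclidean_space \<Rightarrow> 'b::euclidean_space"
  assumes [measurable]: "f \<in> borel_measurable borel" and f: "distr std_gaussian borel f = std_gaussian"
  shows "distr std_gaussian borel (\<lambda>x::'a^'n::finite. \<chi> i. f (x $ i)) = std_gaussian"
proof (rule std_gaussian_eqI)
  have [measurable]: "(\<lambda>x::'a^'n. \<chi> i. f (x $ i)) \<in> borel_measurable borel"
    by (intro measurable_vec_lambda) measurable
  fix l u :: "'b^'n"
  have "emeasure (distr std_gaussian borel (\<lambda>x::'a^'n. \<chi> i. f (x $ i))) (box l u)
    = emeasure std_gaussian {x::'a^'n. \<forall>i. x $ i \<in> f -` box (l$i) (u$i)}"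
    by (subst emeasure_distr) (auto intro!: arg_cong2[where f=emeasure] simp: mem_box_vec)
  also have "\<dots> = (\<Prod>i\<in>UNIV. emeasure std_gaussian (f -` box (l$i) (u$i)))"
  proof (rule emeasure_std_gaussian_components)
    show "f -` box (l$i) (u$i) \<in> sets borel" for i
      using measurable_sets[OF assms(1), of "box (l$i) (u$i)"] by simp
  qed
  also have "\<dots> = (\<Prod>i\<in>UNIV. emeasure (distr std_gaussian borel f) (box (l$i) (u$i)))"
    by (subst emeasure_distr) auto
  also have "\<dots> = (\<Prod>b\<in>Basis. emeasure std_normal {l \<bullet> b <..< u \<bullet> b})"
    by (simp add: f prod_Basis_vec emeasure_std_gaussian_box inner_axis)
  finally show "emeasure (distr std_gaussian borel (\<lambda>x::'a^'n. \<chi> i. f (x $ i))) (box l u) = \<dots>" .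
qed simp

lemma distr_std_gaussian_transpose:
  "distr std_gaussian borel (transpose :: real^'d^'n::finite \<Rightarrow> real^'n^'d::finite) = std_gaussian"
proof (rule std_gaussian_eqI)
  have [measurable]: "(transpose :: real^'d^'n \<Rightarrow> real^'n^'d) \<in> borel_measurable borel"
    unfolding transpose_def by (intro measurable_vec_lambda) measurable
  fix l u :: "real^'n^'d"
  have "emeasure (distr std_gaussian borel (transpose :: real^'d^'n \<Rightarrow> _)) (box l u)
    = emeasure std_gaussian (box (transpose l) (transpose u))"
    by (subst emeasure_distr) (auto intro!: arg_cong2[where f=emeasure] simp: mem_box_vec transpose_def)
  also have "\<dots> = (\<Prod>b\<in>Basis. emeasure std_normal {l \<bullet> b <..< u \<bullet> b})"
    unfolding emeasure_std_gaussian_box prod_Basis_vec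
    by (subst prod.swap) (simp add: inner_axis transpose_def)
  finally show "emeasure (distr std_gaussian borel (transpose :: real^'d^'n \<Rightarrow> _)) (box l u) = \<dots>" .
qed simp

text \<open>
  Resampling the points outside \<open>K\<close> while keeping those in \<open>K\<close> plays the role of conditioning on the
  latter.
\<close>

definition mix :: "'n set \<Rightarrow> 'a^'n \<Rightarrow> 'a^'n \<Rightarrow> 'a^'n::finite" where
  "mix K x x' = (\<chi> i. if i \<in> K then x $ i else x' $ i)"

lemma measurable_mix [measurable]:
  "(\<lambda>(x, x'). mix K x x') \<in> borel_measurable (borel \<Otimes>\<^sub>M (borel :: ('a::euclidean_space^'n::finite) measure))"
  unfolding mix_def case_prod_beta by (intro measurable_vec_lambda) measurable

lemma distr_std_gaussian_mix:
  "distr (std_gaussian \<Otimes>\<^sub>M std_gaussian) borel (\<lambda>(x, x'). mix K x x')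
    = (std_gaussian :: ('a::euclidean_space^'n::finite) measure)" (is "?M = _")
proof (rule std_gaussian_eqI)
  interpret G: prob_space "std_gaussian :: ('a^'n) measure" by (rule prob_space_std_gaussian)
  interpret G': prob_space "std_gaussian :: 'a measure" by (rule prob_space_std_gaussian)
  have [simp]: "emeasure (std_gaussian::'a measure) UNIV = 1" using G'.emeasure_space_1 by simp
  have s: "sets (std_gaussian \<Otimes>\<^sub>M std_gaussian) = sets (borel \<Otimes>\<^sub>M (borel :: ('a^'n) measure))"
    by (intro sets_pair_measure_cong) auto
  have m: "(\<lambda>(x, x'). mix K x x') \<in> borel_measurable (std_gaussian \<Otimes>\<^sub>M (std_gaussian :: ('a^'n) measure))"
    using measurable_mix[of K] by (simp cong: measurable_cong_sets add: s)
  fix l u :: "'a^'n"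
  let ?A = "{x::'a^'n. \<forall>i. x $ i \<in> (if i \<in> K then box (l$i) (u$i) else UNIV)}"
  let ?B = "{x::'a^'n. \<forall>i. x $ i \<in> (if i \<in> K then UNIV else box (l$i) (u$i))}"
  have 1: "(if i \<in> K then box (l$i) (u$i) else UNIV) \<in> sets borel"
    "(if i \<in> K then UNIV else box (l$i) (u$i)) \<in> sets borel" for i by auto
  have [measurable]: "?A \<in> sets borel" "?B \<in> sets borel"
    by (intro sets_components 1)+
  have "emeasure ?M (box l u) = emeasure (std_gaussian \<Otimes>\<^sub>M std_gaussian) (?A \<times> ?B)"
    by (subst emeasure_distr[OF m])
       (auto intro!: arg_cong2[where f=emeasure] simp: mem_box_vec mix_def space_pair_measure split: if_splits)
  also have "\<dots> = emeasure std_gaussian ?A * emeasure std_gaussian ?B"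
    by (rule G.emeasure_pair_measure_Times) auto
  also have "\<dots> = (\<Prod>i\<in>UNIV. emeasure std_gaussian (if i \<in> K then box (l$i) (u$i) else UNIV)) *
     (\<Prod>i\<in>UNIV. emeasure std_gaussian (if i \<in> K then UNIV else box (l$i) (u$i)))"
    by (subst (1 2) emeasure_std_gaussian_components) auto
  also have "\<dots> = (\<Prod>i\<in>UNIV. emeasure std_gaussian (box (l$i) (u$i)))"
    unfolding prod.distrib[symmetric] by (intro prod.cong) auto
  also have "\<dots> = (\<Prod>b\<in>Basis. emeasure std_normal {l \<bullet> b <..< u \<bullet> b})"
    by (simp add: prod_Basis_vec emeasure_std_gaussian_box inner_axis)
  finally show "emeasure ?M (box l u) = \<dots>" .
qed simp

lemma AE_std_gaussian_negligible:
  fixes S :: "'a::euclidean_space set"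
  assumes "negligible S"
  shows "AE x in std_gaussian. x \<notin> S"
proof -
  have "AE x in lebesgue. x \<notin> S"
    using assms by (simp add: negligible_iff_null_sets AE_iff_null_sets) (metis AE_not_in)
  then have "AE x in (lborel :: 'a measure). x \<notin> S"
    by (simp add: AE_completion_iff)
  then show ?thesis
    unfolding std_gaussian_def by (subst AE_density) (auto elim!: eventually_mono)
qed

lemma AE_std_gaussian_hyperplane:
  fixes h :: "'a::euclidean_space"
  assumes "h \<noteq> 0"
  shows "AE x in std_gaussian. h \<bullet> x \<noteq> c"
  using AE_std_gaussian_negligible[of "{x. h \<bullet> x = c}"] negligible_hyperplane[of h c] assms by simp

section \<open>Reflections and the uniqueness of the uniform distribution on a sphere\<close>

text \<open>
  Reflections suffice to express rotational invariance, as two vectors of the same norm are exchanged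
  by a reflection. The reflection in the zero vector is the identity, by division by zero.
\<close>

definition reflect :: "'a::real_inner \<Rightarrow> 'a \<Rightarrow> 'a" where
  "reflect h x = x - (2 * (h \<bullet> x) / (h \<bullet> h)) *\<^sub>R h"

lemma linear_reflect: "linear (reflect h)"
  by (rule linearI) (simp_all add: reflect_def inner_add_right algebra_simps add_divide_distrib)

lemma inner_reflect: "reflect h x \<bullet> reflect h y = x \<bullet> y"
proof (cases "h = 0")
  case False
  then have "h \<bullet> h \<noteq> 0" by simp
  then show ?thesis
    by (simp add: reflect_def inner_diff_left inner_diff_right inner_commute field_simps)
qed (simp add: reflect_def)

lemma reflect_reflect [simp]: "reflect h (reflect h x) = x"
proof (cases "h = 0")
  case False
  then have "h \<bullet> h \<noteq> 0" by simp
  then show ?thesis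
    by (simp add: reflect_def inner_diff_right scaleR_diff_right algebra_simps scaleR_left_diff_distrib[symmetric])
qed (simp add: reflect_def)

lemma inner_reflect_swap: "reflect h x \<bullet> y = x \<bullet> reflect h y"
  using inner_reflect[of h x "reflect h y"] by simp

lemma norm_reflect [simp]: "norm (reflect h x) = norm x"
  by (simp add: norm_eq_sqrt_inner inner_reflect)

lemma reflect_orthogonal: "h \<bullet> x = 0 \<Longrightarrow> reflect h x = x"
  by (simp add: reflect_def)

lemma orthogonal_transformation_reflect: "orthogonal_transformation (reflect h)"
  by (simp add: orthogonal_transformation_def linear_reflect inner_reflect)

lemma reflect_diff:
  assumes "norm u = norm v"
  shows "reflect (u - v) u = v"
proof (cases "u = v")
  case False
  have n: "u \<bullet> u = v \<bullet> v" using assms by (simp add: norm_eq_sqrt_inner)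
  have "(u - v) \<bullet> (u - v) = 2 * ((u - v) \<bullet> u)"
    by (simp add: inner_diff_left inner_diff_right n inner_commute)
  moreover have "(u - v) \<bullet> (u - v) \<noteq> 0" using False by simp
  ultimately show ?thesis by (simp add: reflect_def)
qed (simp add: reflect_def)

lemma measurable_reflect [measurable]: "reflect (h::'a::euclidean_space) \<in> borel_measurable borel"
  by (intro borel_measurable_continuous_onI linear_continuous_on) (simp add: linear_linear linear_reflect)

lemma reflect_in_subspace: "subspace V \<Longrightarrow> h \<in> V \<Longrightarrow> x \<in> V \<Longrightarrow> reflect h x \<in> V"
  by (simp add: reflect_def subspace_diff subspace_scale)

text \<open>
  The set is a countable union of projections along compact balls, and these are closed.
\<close>

lemma borel_Ex_closed:
  fixes P :: "'a::euclidean_space \<Rightarrow> 'b::euclidean_space \<Rightarrow> bool"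
  assumes "closed {p. P (snd p) (fst p)}"
  shows "{x. \<exists>c. P x c} \<in> sets borel"
proof -
  let ?P = "\<lambda>n::nat. {x. \<exists>c. c \<in> cball 0 (real n) \<and> (c, x) \<in> {p. P (snd p) (fst p)}}"
  have "{x. \<exists>c. P x c} = (\<Union>n. ?P n)"
  proof (intro set_eqI iffI)
    fix x assume "x \<in> {x. \<exists>c. P x c}"
    then obtain c where c: "P x c" by blast
    obtain n :: nat where "norm c \<le> real n" using real_arch_simple by blast
    then have "x \<in> ?P n" using c by (auto simp: dist_norm)
    then show "x \<in> (\<Union>n. ?P n)" by blast
  qed auto
  moreover have "closed (?P n)" for n
    by (rule closed_compact_projection[OF _ assms]) simp
  ultimately show ?thesis by (auto intro: borel_closed)
qed

text \<open>
  Reflection invariance makes all caps of radius \<open>\<delta>\<close> on the sphere of \<open>V\<close> equally heavy, for \<open>M\<close> as well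
  as for the uniform distribution. Counting the pairs at distance less than \<open>\<delta>\<close> whose second component
  lies in \<open>C\<close> in two ways then bounds the mass of \<open>C\<close> under the uniform distribution by the mass of
  its \<open>\<delta>\<close>-neighbourhood under \<open>M\<close>, suitably normalised, and \<open>\<delta>\<close> tends to zero.
\<close>

lemma invariant_measure_le_closed:
  fixes M :: "(real^'n::{finite,wellorder}) measure"
  assumes V: "subspace V" "V \<noteq> {0}" and sets: "sets M = sets borel" and fin: "finite_measure M"
    and on: "AE x in M. x \<in> V \<and> norm x = 1"
    and inv: "\<And>h. h \<in> V \<Longrightarrow> distr M borel (reflect h) = M"
    and C: "closed C"
  shows "measure (uniform_sphere V) C * measure M UNIV \<le> measure M C"
proof -
  interpret M: finite_measure M by (rule fin)
  let ?U = "uniform_sphere V"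
  interpret U: prob_space ?U using V(1) by (rule prob_space_uniform_sphere)
  have setsU[measurable_cong]: "sets ?U = sets borel" by (simp add: uniform_sphere_def)
  note [measurable_cong] = sets
  have spM: "space M = UNIV" and spU: "space ?U = UNIV"
    using sets_eq_imp_space_eq[OF sets] sets_eq_imp_space_eq[OF setsU] by auto
  have invU: "distr ?U borel (reflect h) = ?U" if "h \<in> V" for h
  proof (rule uniform_sphere_orthogonal_invariant[OF V(1) orthogonal_transformation_reflect])
    show "reflect h ` V = V"
    proof
      show "reflect h ` V \<subseteq> V" using reflect_in_subspace[OF V(1) that] by blast
      then show "V \<subseteq> reflect h ` V"
        by (metis image_mono imageI reflect_reflect subsetD subsetI)
    qed
  qed
  have onU: "AE x in ?U. x \<in> V \<and> norm x = 1" by (rule AE_uniform_sphere[OF V])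
  have caps: "measure N (ball u \<delta>) = measure N (ball w \<delta>)"
    if "sets N = sets borel" "\<And>h. h \<in> V \<Longrightarrow> distr N borel (reflect h) = N"
      "u \<in> V" "w \<in> V" "norm u = 1" "norm w = 1" for N :: "(real^'n::_) measure" and u w \<delta>
  proof -
    let ?h = "u - w"
    have h: "?h \<in> V" using that V by (simp add: subspace_diff)
    have [measurable]: "reflect ?h \<in> measurable N borel"
      using measurable_reflect[of ?h] that(1) by (simp cong: measurable_cong_sets)
    have spN: "space N = UNIV" using sets_eq_imp_space_eq[OF that(1)] by simp
    have "measure N (ball w \<delta>) = measure (distr N borel (reflect ?h)) (ball w \<delta>)" using that(2)[OF h] by simp
    also have "\<dots> = measure N (reflect ?h -` ball w \<delta>)" by (subst measure_distr) (auto simp: spN)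
    also have "reflect ?h -` ball w \<delta> = ball u \<delta>"
    proof -
      have "dist w (reflect ?h x) = dist u x" for x
      proof -
        have "w = reflect ?h u" using reflect_diff[of u w] that by simp
        then have "w - reflect ?h x = reflect ?h (u - x)" using linear_diff[OF linear_reflect[of ?h], of u x] by metis
        then show ?thesis unfolding dist_norm by (metis norm_reflect)
      qed
      then show ?thesis by auto
    qed
    finally show ?thesis by simp
  qed
  obtain e where e: "e \<in> V" "norm e = 1"
  proof -
    obtain v where "v \<in> V" "v \<noteq> 0" using V subspace_0 by blast
    then show ?thesis using that[of "sgn v"] V by (simp add: sgn_div_norm subspace_scale)
  qed
  have approx: "measure ?U C * measure M UNIV \<le> measure M {x. infdist x C \<le> \<delta>}" if "\<delta> > 0" "C \<noteq> {}" for \<delta>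
  proof -
    define c where "c = measure ?U (ball e \<delta>)"
    define c' where "c' = measure M (ball e \<delta>)"
    have cU: "measure ?U (ball u \<delta>) = c" if "u \<in> V" "norm u = 1" for u
      unfolding c_def by (rule caps[OF setsU invU]) (use that e in auto)
    have cM: "measure M (ball u \<delta>) = c'" if "u \<in> V" "norm u = 1" for u
      unfolding c'_def by (rule caps[OF sets inv]) (use that e in auto)
    have [measurable]: "C \<in> sets borel" "{x. infdist x C \<le> \<delta>} \<in> sets borel" "V \<in> sets borel"
      using C closed_subspace[OF V(1)] by (auto intro!: borel_closed closed_Collect_le continuous_intros)
    interpret P: pair_sigma_finite M ?U by unfold_locales
    interpret PF: finite_measure "M \<Otimes>\<^sub>M ?U"
      by (intro finite_measure_pair_measure fin U.finite_measure_axioms)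
    \<comment> \<open>If the caps had mass zero, then so would the sphere, which is covered by finitely many of them.\<close>
    have "c > 0"
    proof (rule ccontr)
      assume "\<not> c > 0"
      then have c0: "c = 0" using measure_nonneg[of ?U "ball e \<delta>"] by (simp add: c_def)
      have "compact (V \<inter> sphere 0 1)" using closed_subspace[OF V(1)] by (simp add: closed_Int_compact)
      then obtain T where T: "T \<subseteq> V \<inter> sphere 0 1" "finite T" "V \<inter> sphere 0 1 \<subseteq> (\<Union>x\<in>T. ball x \<delta>)"
        using compactE_image[of "V \<inter> sphere 0 1" "V \<inter> sphere 0 1" "\<lambda>x. ball x \<delta>"] \<open>\<delta> > 0\<close>
        by (metis (no_types, lifting) UN_I centre_in_ball open_ball subsetI)
      have "AE x in ?U. x \<in> (\<Union>x\<in>T. ball x \<delta>)"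
        using onU
      proof eventually_elim
        fix x assume "x \<in> V \<and> norm x = 1"
        then have "x \<in> V \<inter> sphere 0 1" by simp
        then show "x \<in> (\<Union>x\<in>T. ball x \<delta>)" using T(3) by blast
      qed
      then have "measure ?U (\<Union>x\<in>T. ball x \<delta>) = 1" by (intro U.prob_eq_1[THEN iffD2]) (auto simp: setsU intro!: borel_open)
      moreover have "measure ?U (\<Union>x\<in>T. ball x \<delta>) \<le> (\<Sum>x\<in>T. measure ?U (ball x \<delta>))"
        using T(2) by (intro U.finite_measure_subadditive_finite) auto
      moreover have "(\<Sum>x\<in>T. measure ?U (ball x \<delta>)) = 0"
      proof (intro sum.neutral ballI)
        fix x assume "x \<in> T"
        then have "x \<in> V" "norm x = 1" using T(1) by auto
        then show "measure ?U (ball x \<delta>) = 0" using cU c0 by simp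
      qed
      ultimately show False by simp
    qed
    \<comment> \<open>The mass of \<open>W \<inter> (UNIV \<times> C)\<close> is computed exactly by integrating over \<open>x\<close> first and estimated by integrating over \<open>z\<close> first. The same for \<open>W\<close> compares the masses \<open>c\<close> and \<open>c'\<close> of the caps.\<close>
    define W where "W = {(x::real^'n::_, z). dist x z < \<delta>}"
    have sP: "sets (M \<Otimes>\<^sub>M ?U) = sets (borel :: ((real^'n::_) \<times> (real^'n::_)) measure)"
      unfolding borel_prod[symmetric] by (intro sets_pair_measure_cong sets setsU)
    have W1: "W \<inter> (UNIV \<times> C) \<in> sets (M \<Otimes>\<^sub>M ?U)"
    proof -
      have "open W" unfolding W_def case_prod_beta by (intro open_Collect_less continuous_intros)
      moreover have "closed (UNIV \<times> C)" using C by (simp add: closed_Times)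
      ultimately show ?thesis unfolding sP by (intro sets.Int borel_open borel_closed)
    qed
    have W2: "W \<in> sets (M \<Otimes>\<^sub>M ?U)"
    proof -
      have "open W" unfolding W_def case_prod_beta by (intro open_Collect_less continuous_intros)
      then show ?thesis unfolding sP by (rule borel_open)
    qed
    have eM: "emeasure M (ball u \<delta>) = ennreal c'" if "u \<in> V" "norm u = 1" for u
      using cM[OF that] by (simp add: M.emeasure_eq_measure)
    have eU: "emeasure ?U (ball u \<delta>) = ennreal c" if "u \<in> V" "norm u = 1" for u
      using cU[OF that] by (simp add: U.emeasure_eq_measure)
    have "emeasure (M \<Otimes>\<^sub>M ?U) (W \<inter> (UNIV \<times> C)) = (\<integral>\<^sup>+z. emeasure M ((\<lambda>x. (x, z)) -` (W \<inter> (UNIV \<times> C))) \<partial>?U)"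
      by (rule P.emeasure_pair_measure_alt2[OF W1])
    also have "\<dots> = (\<integral>\<^sup>+z. ennreal c' * indicator C z \<partial>?U)"
      using onU
    proof (intro nn_integral_cong_AE, eventually_elim)
      fix z assume z: "z \<in> V \<and> norm z = 1"
      have "(\<lambda>x. (x, z)) -` (W \<inter> (UNIV \<times> C)) = (if z \<in> C then ball z \<delta> else {})"
        by (auto simp: W_def dist_commute)
      then show "emeasure M ((\<lambda>x. (x, z)) -` (W \<inter> (UNIV \<times> C))) = ennreal c' * indicator C z"
        using eM z by simp
    qed
    also have "\<dots> = ennreal c' * emeasure ?U C" by (simp add: nn_integral_cmult)
    finally have 1: "emeasure (M \<Otimes>\<^sub>M ?U) (W \<inter> (UNIV \<times> C)) = ennreal c' * emeasure ?U C" .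
    have "emeasure (M \<Otimes>\<^sub>M ?U) (W \<inter> (UNIV \<times> C)) = (\<integral>\<^sup>+x. emeasure ?U (Pair x -` (W \<inter> (UNIV \<times> C))) \<partial>M)"
      by (rule U.emeasure_pair_measure_alt[OF W1])
    also have "\<dots> \<le> (\<integral>\<^sup>+x. ennreal c * indicator {x. infdist x C \<le> \<delta>} x \<partial>M)"
      using on
    proof (intro nn_integral_mono_AE, eventually_elim)
      fix x assume x: "x \<in> V \<and> norm x = 1"
      show "emeasure ?U (Pair x -` (W \<inter> (UNIV \<times> C))) \<le> ennreal c * indicator {x. infdist x C \<le> \<delta>} x"
      proof (cases "infdist x C \<le> \<delta>")
        case True
        have "emeasure ?U (Pair x -` (W \<inter> (UNIV \<times> C))) \<le> emeasure ?U (ball x \<delta>)"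
          by (intro emeasure_mono) (auto simp: W_def)
        then show ?thesis using True eU x by simp
      next
        case False
        then have "Pair x -` (W \<inter> (UNIV \<times> C)) = {}"
          by (auto simp: W_def) (meson infdist_le less_imp_le order_trans)
        then show ?thesis by simp
      qed
    qed
    also have "\<dots> = ennreal c * emeasure M {x. infdist x C \<le> \<delta>}" by (simp add: nn_integral_cmult)
    finally have 2: "ennreal c' * emeasure ?U C \<le> ennreal c * emeasure M {x. infdist x C \<le> \<delta>}" by (simp add: 1)
    have "emeasure (M \<Otimes>\<^sub>M ?U) W = (\<integral>\<^sup>+z. emeasure M ((\<lambda>x. (x, z)) -` W) \<partial>?U)"
      by (rule P.emeasure_pair_measure_alt2[OF W2])
    also have "\<dots> = (\<integral>\<^sup>+z. ennreal c' \<partial>?U)"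
      using onU
    proof (intro nn_integral_cong_AE, eventually_elim)
      fix z assume z: "z \<in> V \<and> norm z = 1"
      have "(\<lambda>x. (x, z)) -` W = ball z \<delta>" by (auto simp: W_def dist_commute)
      then show "emeasure M ((\<lambda>x. (x, z)) -` W) = ennreal c'" using eM z by simp
    qed
    also have "\<dots> = ennreal c'" by (simp add: U.emeasure_space_1)
    finally have 3: "emeasure (M \<Otimes>\<^sub>M ?U) W = ennreal c'" .
    have "emeasure (M \<Otimes>\<^sub>M ?U) W = (\<integral>\<^sup>+x. emeasure ?U (Pair x -` W) \<partial>M)"
      by (rule U.emeasure_pair_measure_alt[OF W2])
    also have "\<dots> = (\<integral>\<^sup>+x. ennreal c \<partial>M)"
      using on
    proof (intro nn_integral_cong_AE, eventually_elim)
      fix x assume x: "x \<in> V \<and> norm x = 1"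
      have "Pair x -` W = ball x \<delta>" by (auto simp: W_def)
      then show "emeasure ?U (Pair x -` W) = ennreal c" using eU x by simp
    qed
    also have "\<dots> = ennreal c * emeasure M UNIV" by (simp add: spM)
    finally have "ennreal c' = ennreal c * emeasure M UNIV" using 3 by simp
    then have c': "c' = c * measure M UNIV"
      using \<open>c > 0\<close> by (simp add: M.emeasure_eq_measure ennreal_mult'[symmetric] c'_def)
    have "ennreal (c' * measure ?U C) \<le> ennreal (c * measure M {x. infdist x C \<le> \<delta>})"
      using 2 \<open>c > 0\<close> by (simp add: M.emeasure_eq_measure U.emeasure_eq_measure ennreal_mult' c'_def)
    then have "c' * measure ?U C \<le> c * measure M {x. infdist x C \<le> \<delta>}"
      using \<open>c > 0\<close> by (subst (asm) ennreal_le_iff) (auto intro!: mult_nonneg_nonneg)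
    then have "c * (measure ?U C * measure M UNIV) \<le> c * measure M {x. infdist x C \<le> \<delta>}"
      by (simp add: c' mult_ac)
    then show ?thesis using \<open>c > 0\<close> by simp
  qed
  show ?thesis
  proof (cases "C = {}")
    case False
    define D where "D n = {x. infdist x C \<le> 1 / real (Suc n)}" for n
    have DM: "D n \<in> sets M" for n
      unfolding D_def sets by (auto intro!: borel_closed closed_Collect_le continuous_intros)
    have "(\<lambda>n. measure M (D n)) \<longlonglongrightarrow> measure M (\<Inter>n. D n)"
    proof (rule M.finite_Lim_measure_decseq)
      show "range D \<subseteq> sets M" using DM by auto
      show "decseq D"
        unfolding D_def by (intro decseq_SucI) (auto intro: order_trans simp: frac_le)
    qed
    moreover have "(\<Inter>n. D n) = C"
    proof
      show "C \<subseteq> (\<Inter>n. D n)" by (auto simp: D_def infdist_zero)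
      show "(\<Inter>n. D n) \<subseteq> C"
      proof
        fix x assume x: "x \<in> (\<Inter>n. D n)"
        have "infdist x C \<le> 0"
        proof (rule field_le_epsilon)
          fix e :: real assume "e > 0"
          then obtain n where "inverse (real (Suc n)) < e" using reals_Archimedean by blast
          moreover have "infdist x C \<le> 1 / real (Suc n)" using x by (auto simp: D_def)
          ultimately show "infdist x C \<le> 0 + e" by (simp add: inverse_eq_divide)
        qed
        then have "infdist x C = 0" using infdist_nonneg[of x C] by linarith
        then show "x \<in> C" using in_closed_iff_infdist_zero[OF C False] by blast
      qed
    qed
    ultimately have lim: "(\<lambda>n. measure M (D n)) \<longlonglongrightarrow> measure M C" by simp
    show ?thesis
      by (rule LIMSEQ_le_const[OF lim]) (use approx False in \<open>auto simp: D_def\<close>)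
  qed simp
qed

text \<open>
  The complement of \<open>C\<close> is an increasing union of closed sets. The lower bound for these yields the upper
  bound for \<open>C\<close>.
\<close>

lemma invariant_measure_closed:
  fixes M :: "(real^'n::{finite,wellorder}) measure"
  assumes V: "subspace V" "V \<noteq> {0}" and sets: "sets M = sets borel" and fin: "finite_measure M"
    and on: "AE x in M. x \<in> V \<and> norm x = 1"
    and inv: "\<And>h. h \<in> V \<Longrightarrow> distr M borel (reflect h) = M"
    and C: "closed C"
  shows "measure M C = measure (uniform_sphere V) C * measure M UNIV"
proof (rule antisym)
  show "measure (uniform_sphere V) C * measure M UNIV \<le> measure M C"
    by (rule invariant_measure_le_closed[OF V sets fin on inv C])
  interpret M: finite_measure M by (rule fin)
  interpret U: prob_space "uniform_sphere V" using V(1) by (rule prob_space_uniform_sphere)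
  have setsU: "sets (uniform_sphere V) = sets borel" by (simp add: uniform_sphere_def)
  have sp: "space M = UNIV" "space (uniform_sphere V) = UNIV"
    using sets_eq_imp_space_eq[OF sets] sets_eq_imp_space_eq[OF setsU] by auto
  have Cb: "C \<in> sets M" "C \<in> sets (uniform_sphere V)" using C by (simp_all add: sets setsU)
  have "open (- C)" using C by (rule open_Compl)
  then obtain T where T: "\<And>n::nat. closed (T n)" "incseq T" "(\<Union>n. T n) = - C"
  proof -
    define T where "T n = {x. 1 / real (Suc n) \<le> infdist x C}" for n
    show thesis
    proof (cases "C = {}")
      case True
      then show ?thesis by (intro that[of "\<lambda>_. UNIV"]) (auto simp: incseq_def)
    next
      case False
      show ?thesis
      proof (rule that[of T])
        show "closed (T n)" for n
          unfolding T_def by (intro closed_Collect_le continuous_intros)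
        show "incseq T"
          unfolding T_def by (intro incseq_SucI) (auto intro: order_trans[rotated] simp: frac_le)
        show "(\<Union>n. T n) = - C"
        proof (intro set_eqI iffI)
          fix x assume "x \<in> (\<Union>n. T n)"
          then obtain n where "1 / real (Suc n) \<le> infdist x C" by (auto simp: T_def)
          then have "0 < infdist x C" by (rule less_le_trans[rotated]) simp
          then show "x \<in> - C" using infdist_zero[of x C] by force
        next
          fix x assume "x \<in> - C"
          then have "infdist x C \<noteq> 0" using in_closed_iff_infdist_zero[OF C False] by auto
          then have "infdist x C > 0" using infdist_nonneg[of x C] by linarith
          then obtain n where "inverse (real (Suc n)) < infdist x C" using reals_Archimedean by blast
          then show "x \<in> (\<Union>n. T n)" by (auto simp: T_def inverse_eq_divide intro: less_imp_le)
        qed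
      qed
    qed
  qed
  have "(\<lambda>n. measure M (T n)) \<longlonglongrightarrow> measure M (\<Union>n. T n)"
    using T by (intro M.finite_Lim_measure_incseq) (auto simp: sets)
  moreover have "(\<lambda>n. measure (uniform_sphere V) (T n)) \<longlonglongrightarrow> measure (uniform_sphere V) (\<Union>n. T n)"
    using T by (intro U.finite_Lim_measure_incseq) (auto simp: setsU)
  ultimately have "measure (uniform_sphere V) (\<Union>n. T n) * measure M UNIV \<le> measure M (\<Union>n. T n)"
    using invariant_measure_le_closed[OF V sets fin on inv T(1)]
    by (intro LIMSEQ_le[OF tendsto_mult_right]) auto
  moreover have "measure M (- C) = measure M UNIV - measure M C"
    using M.finite_measure_compl[OF Cb(1)] by (simp add: sp Compl_eq_Diff_UNIV)
  moreover have "measure (uniform_sphere V) (- C) = 1 - measure (uniform_sphere V) C"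
    using U.prob_compl[OF Cb(2)] by (simp add: sp Compl_eq_Diff_UNIV)
  ultimately show "measure M C \<le> measure (uniform_sphere V) C * measure M UNIV"
    by (simp add: T(3) algebra_simps)
qed

section \<open>Gaussian points in general position\<close>

text \<open>
  Homogeneous coordinates, on which the pairs \<open>(c, \<mu>)\<close> act as affine functionals.
\<close>

definition lift :: "real^'d^'n \<Rightarrow> 'n \<Rightarrow> real \<times> (real^'d)" where
  "lift x i = (1, x $ i)"

lemma inner_lift [simp]: "\<phi> \<bullet> lift x i = fst \<phi> + snd \<phi> \<bullet> x $ i"
  by (cases \<phi>) (simp add: lift_def)

lemma orthogonal_in_subspace:
  fixes S :: "'a::euclidean_space set"
  assumes A: "subspace A" and S: "finite S" "card S < dim A"
  obtains \<phi> where "\<phi> \<in> A" "\<phi> \<noteq> 0" "\<And>s. s \<in> S \<Longrightarrow> \<phi> \<bullet> s = 0"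
proof -
  let ?p = "closest_point A"
  have A': "span A = A" using A by (simp add: span_eq_iff)
  have "span (?p ` S) \<subseteq> A"
    using closest_point_subspace(1)[OF A] A by (intro span_minimal) auto
  moreover have "dim (?p ` S) < dim A"
    using S by (metis card_image_le dim_le_card' finite_imageI le_less_trans order_trans)
  then have "span (?p ` S) \<noteq> A" by (metis dim_span less_irrefl)
  ultimately have "span (?p ` S) \<subset> span A" unfolding A' by blast
  then obtain \<phi> where \<phi>: "\<phi> \<noteq> 0" "\<phi> \<in> span A" "\<And>y. y \<in> span (?p ` S) \<Longrightarrow> orthogonal \<phi> y"
    using orthogonal_to_subspace_exists_gen by metis
  show ?thesis
  proof (rule that)
    show "\<phi> \<in> A" "\<phi> \<noteq> 0" using \<phi> A' by auto
    fix s assume "s \<in> S"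
    then have "\<phi> \<bullet> ?p s = 0" using \<phi>(3)[of "?p s"] by (simp add: orthogonal_def span_base)
    moreover have "(s - ?p s) \<bullet> \<phi> = 0"
      using closest_point_subspace(2)[OF A] \<phi> A' by auto
    then have "s \<bullet> \<phi> = ?p s \<bullet> \<phi>" by (simp add: inner_diff_left)
    ultimately show "\<phi> \<bullet> s = 0" by (simp add: inner_commute)
  qed
qed

lemma emeasure_mix:
  fixes S :: "('a::euclidean_space^'n::finite) set"
  assumes [measurable]: "S \<in> sets borel"
  shows "emeasure std_gaussian S = (\<integral>\<^sup>+x. emeasure std_gaussian {x'. mix K x x' \<in> S} \<partial>std_gaussian)"
proof -
  interpret G: prob_space "std_gaussian :: ('a^'n) measure" by (rule prob_space_std_gaussian)
  have s: "sets (std_gaussian \<Otimes>\<^sub>M std_gaussian) = sets (borel \<Otimes>\<^sub>M (borel :: ('a^'n) measure))"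
    by (intro sets_pair_measure_cong) auto
  have m[measurable]: "(\<lambda>(x, x'). mix K x x') \<in> borel_measurable (std_gaussian \<Otimes>\<^sub>M (std_gaussian :: ('a^'n) measure))"
    using measurable_mix[of K] by (simp cong: measurable_cong_sets add: s)
  have "emeasure std_gaussian S = emeasure (distr (std_gaussian \<Otimes>\<^sub>M std_gaussian) borel (\<lambda>(x, x'). mix K x x')) S"
    by (simp add: distr_std_gaussian_mix)
  also have "\<dots> = emeasure (std_gaussian \<Otimes>\<^sub>M std_gaussian) ((\<lambda>(x, x'). mix K x x') -` S \<inter> space (std_gaussian \<Otimes>\<^sub>M std_gaussian))"
    by (rule emeasure_distr) auto
  also have "\<dots> = (\<integral>\<^sup>+x. emeasure std_gaussian (Pair x -` ((\<lambda>(x, x'). mix K x x') -` S \<inter> space (std_gaussian \<Otimes>\<^sub>M std_gaussian))) \<partial>std_gaussian)"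
    by (rule G.emeasure_pair_measure_alt) measurable
  also have "\<dots> = (\<integral>\<^sup>+x. emeasure std_gaussian {x'. mix K x x' \<in> S} \<partial>std_gaussian)"
    by (intro nn_integral_cong arg_cong2[where f=emeasure]) (auto simp: space_pair_measure)
  finally show ?thesis .
qed

lemma AE_mixI:
  fixes S :: "('a::euclidean_space^'n::finite) set"
  assumes S: "S \<in> sets borel" and *: "\<And>x. AE x' in std_gaussian. mix K x x' \<notin> S"
  shows "AE x in std_gaussian. x \<notin> S"
proof -
  have [measurable]: "(\<lambda>x'. mix K x x') \<in> borel_measurable borel" for x :: "'a^'n"
    unfolding mix_def by (intro measurable_vec_lambda) measurable
  have "emeasure std_gaussian {x'. mix K x x' \<in> S} = 0" for x
  proof -
    have "{x'. mix K x x' \<in> S} \<in> sets borel" using measurable_sets[of "mix K x" borel borel S] S by (simp add: vimage_def)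
    then show ?thesis using *[of x] by (subst (asm) AE_iff_measurable[OF _ refl]) auto
  qed
  then have "emeasure std_gaussian S = 0" by (subst emeasure_mix[OF S, of K]) simp
  then show ?thesis using S by (subst AE_iff_measurable[OF _ refl]) auto
qed

lemma ex_scale_ge_1:
  fixes f :: "'n::finite \<Rightarrow> real"
  assumes "\<forall>i\<in>S. f i > 0"
  shows "\<exists>c>0. \<forall>i\<in>S. 1 \<le> c * f i"
proof (cases "S = {}")
  case False
  define m where "m = Min (f ` S)"
  have "m \<in> f ` S" unfolding m_def using False by (intro Min_in) auto
  then have m: "m > 0" using assms by auto
  have "m \<le> f i" if "i \<in> S" for i unfolding m_def using that by (intro Min_le) auto
  then show ?thesis using m by (intro exI[of _ "1 / m"]) auto
qed (auto intro: exI[of _ 1])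

text \<open>
  Functionals may be rescaled, so that being positive can be replaced by being at least \<open>1\<close>, and the set
  becomes the projection of a closed set. The argument \<open>z\<close> allows for a family that depends on a random
  direction.
\<close>

lemma borel_exposes_family:
  fixes Q :: "((real \<times> (real^'d)) \<times> 'c::euclidean_space) set"
  assumes Q: "closed Q" and scale: "\<And>\<phi> z c. (\<phi>, z) \<in> Q \<Longrightarrow> c > 0 \<Longrightarrow> (c *\<^sub>R \<phi>, z) \<in> Q"
  shows "{(x :: real^'d^'n, z). exposes {\<phi>. (\<phi>, z) \<in> Q} (lift x) F} \<in> sets borel"
proof -
  have iff: "exposes {\<phi>. (\<phi>, z) \<in> Q} (lift x) F \<longleftrightarrow>
    (\<exists>\<phi>. (\<phi>, z) \<in> Q \<and> (\<forall>i\<in>F. \<phi> \<bullet> lift x i = 0) \<and> (\<forall>i\<in>-F. 1 \<le> \<phi> \<bullet> lift x i))" (is "?l \<longleftrightarrow> ?r")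
    for x :: "real^'d^'n" and z
  proof
    assume ?l
    then obtain \<phi> where \<phi>: "(\<phi>, z) \<in> Q" "\<forall>i\<in>F. \<phi> \<bullet> lift x i = 0" "\<forall>i\<in>-F. \<phi> \<bullet> lift x i > 0"
      unfolding exposes_def by blast
    \<comment> \<open>Rescaling turns the strict inequalities into closed conditions.\<close>
    obtain c where c: "c > 0" "\<forall>i\<in>-F. 1 \<le> c * (\<phi> \<bullet> lift x i)" using ex_scale_ge_1[OF \<phi>(3)] by blast
    have "\<forall>i\<in>F. (c *\<^sub>R \<phi>) \<bullet> lift x i = 0" "\<forall>i\<in>-F. 1 \<le> (c *\<^sub>R \<phi>) \<bullet> lift x i"
      using \<phi>(2) c(2) by (auto simp del: inner_lift)
    then show ?r using scale[OF \<phi>(1) c(1)] by blast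
  next
    assume ?r
    then obtain \<phi> where \<phi>: "(\<phi>, z) \<in> Q" "\<forall>i\<in>F. \<phi> \<bullet> lift x i = 0" "\<forall>i\<in>-F. 1 \<le> \<phi> \<bullet> lift x i" by blast
    have "\<forall>i\<in>-F. \<phi> \<bullet> lift x i > 0" using \<phi>(3) by (meson less_le_trans zero_less_one)
    then show ?l unfolding exposes_def using \<phi>(1,2) by blast
  qed
  have "{(x :: real^'d^'n, z). exposes {\<phi>. (\<phi>, z) \<in> Q} (lift x) F}
    = {p. \<exists>\<phi>. (\<phi>, snd p) \<in> Q \<and> (\<forall>i\<in>F. \<phi> \<bullet> lift (fst p) i = 0) \<and> (\<forall>i\<in>-F. 1 \<le> \<phi> \<bullet> lift (fst p) i)}"
    by (rule set_eqI) (simp only: iff case_prod_beta mem_Collect_eq)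
  also have "\<dots> \<in> sets borel"
  proof (rule borel_Ex_closed)
    have "{q :: (real \<times> (real^'d)) \<times> ((real^'d^'n) \<times> 'c). (fst q, snd (snd q)) \<in> Q \<and>
        (\<forall>i\<in>F. fst q \<bullet> lift (fst (snd q)) i = 0) \<and> (\<forall>i\<in>-F. 1 \<le> fst q \<bullet> lift (fst (snd q)) i)}
      = (\<lambda>q. (fst q, snd (snd q))) -` Q \<inter> (\<Inter>i\<in>F. {q. fst (fst q) + snd (fst q) \<bullet> fst (snd q) $ i = 0}) \<inter>
        (\<Inter>i\<in>-F. {q. 1 \<le> fst (fst q) + snd (fst q) \<bullet> fst (snd q) $ i})" by auto
    also have "closed \<dots>"
      by (intro closed_Int closed_INT ballI closed_Collect_eq closed_Collect_le closed_vimage[OF Q] continuous_intros)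
    finally show "closed {q :: (real \<times> (real^'d)) \<times> ((real^'d^'n) \<times> 'c). (fst q, snd (snd q)) \<in> Q \<and>
        (\<forall>i\<in>F. fst q \<bullet> lift (fst (snd q)) i = 0) \<and> (\<forall>i\<in>-F. 1 \<le> fst q \<bullet> lift (fst (snd q)) i)}" .
  qed
  finally show ?thesis .
qed

lemma borel_exposes:
  fixes A :: "(real \<times> (real^'d)) set"
  assumes A: "subspace A"
  shows "{x :: real^'d^'n. exposes A (lift x) F} \<in> sets borel"
proof -
  have "{(x :: real^'d^'n, z :: real). exposes {\<phi>. (\<phi>, z) \<in> A \<times> UNIV} (lift x) F} \<in> sets borel"
    by (rule borel_exposes_family)
      (auto simp: closed_Times closed_subspace[OF A] subspace_scale[OF A])
  then have "(\<lambda>x :: real^'d^'n. (x, 0 :: real)) -` {(x, z). exposes {\<phi>. (\<phi>, z) \<in> A \<times> UNIV} (lift x) F} \<inter> space borel \<in> sets borel"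
    by (rule measurable_sets[rotated]) (intro borel_measurable_continuous_onI continuous_intros)
  then show ?thesis by (simp add: vimage_def)
qed

text \<open>
  Consider a forbidden relation with coefficient \<open>1\<close> at \<open>i\<close>. A functional vanishing at the other points
  involved must vanish at \<open>x $ i\<close> as well, which therefore lies in a hyperplane determined by the
  others. Resampling the point \<open>x $ i\<close> alone avoids it.
\<close>

lemma AE_in_general_position:
  fixes A :: "(real \<times> (real^'d)) set"
  assumes A: "subspace A"
  shows "AE x::real^'d^'n in std_gaussian. in_general_position A (lift x)"
proof -
  define bad where "bad i I = {x::real^'d^'n. \<exists>v::real^'n. v$i = 1 \<and> (\<forall>l\<in>-I. v$l = 0) \<and>
    (\<forall>\<phi>\<in>A. (\<Sum>l\<in>UNIV. v$l * (\<phi> \<bullet> lift x l)) = 0)}" for i I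
  have borel: "bad i I \<in> sets borel" for i I
    unfolding bad_def
  proof (rule borel_Ex_closed)
    have "{p :: (real^'n) \<times> (real^'d^'n). fst p $ i = 1 \<and> (\<forall>l\<in>-I. fst p $ l = 0) \<and>
        (\<forall>\<phi>\<in>A. (\<Sum>l\<in>UNIV. fst p $ l * (\<phi> \<bullet> lift (snd p) l)) = 0)}
      = {p. fst p $ i = 1} \<inter> (\<Inter>l\<in>-I. {p. fst p $ l = 0}) \<inter>
        (\<Inter>\<phi>\<in>A. {p. (\<Sum>l\<in>UNIV. fst p $ l * (fst \<phi> + snd \<phi> \<bullet> snd p $ l)) = 0})"
      by auto
    also have "closed \<dots>"
      by (intro closed_Int closed_INT ballI closed_Collect_eq continuous_intros)
    finally show "closed {p :: (real^'n) \<times> (real^'d^'n). fst p $ i = 1 \<and> (\<forall>l\<in>-I. fst p $ l = 0) \<and>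
        (\<forall>\<phi>\<in>A. (\<Sum>l\<in>UNIV. fst p $ l * (\<phi> \<bullet> lift (snd p) l)) = 0)}" .
  qed
  have null: "AE x in std_gaussian. x \<notin> bad i I" if I: "i \<in> I" "card I \<le> dim A" for i I
  proof (rule AE_mixI[OF borel, where K = "-{i}"])
    fix x :: "real^'d^'n"
    \<comment> \<open>A functional vanishing at the remaining points of \<open>I\<close> would have to vanish at \<open>x $ i\<close> as well.\<close>
    let ?S = "lift x ` (I - {i})"
    have "card (I - {i}) < card I" using I(1) by (intro card_Diff1_less) auto
    then have "card ?S < dim A"
      using I card_image_le[of "I - {i}" "lift x"] by simp
    then obtain \<phi> where \<phi>: "\<phi> \<in> A" "\<phi> \<noteq> 0" "\<And>s. s \<in> ?S \<Longrightarrow> \<phi> \<bullet> s = 0"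
      using orthogonal_in_subspace[OF A, of ?S] by auto
    have "AE x' :: real^'d^'n in std_gaussian. fst \<phi> + snd \<phi> \<bullet> x' $ i \<noteq> 0"
    proof (cases "snd \<phi> = 0")
      case True
      then show ?thesis using \<phi>(2) by (simp add: prod_eq_iff)
    next
      case False
      then have "axis i (snd \<phi>) \<noteq> (0 :: real^'d^'n)" by (simp add: axis_eq_0_iff)
      then have "AE x' :: real^'d^'n in std_gaussian. axis i (snd \<phi>) \<bullet> x' \<noteq> - fst \<phi>"
        by (rule AE_std_gaussian_hyperplane)
      then show ?thesis
        by eventually_elim (simp add: inner_axis' eq_neg_iff_add_eq_0 add.commute)
    qed
    then show "AE x' in std_gaussian. mix (-{i}) x x' \<notin> bad i I"
    proof eventually_elim
      fix x' assume x': "fst \<phi> + snd \<phi> \<bullet> x' $ i \<noteq> 0"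
      show "mix (-{i}) x x' \<notin> bad i I"
      proof
        assume "mix (-{i}) x x' \<in> bad i I"
        then obtain v where v: "v$i = (1::real)" "\<forall>l\<in>-I. v$l = 0"
          "(\<Sum>l\<in>UNIV. v$l * (\<phi> \<bullet> lift (mix (-{i}) x x') l)) = 0"
          unfolding bad_def using \<phi>(1) by blast
        have 0: "v$l * (\<phi> \<bullet> lift (mix (-{i}) x x') l) = 0" if "l \<noteq> i" for l
        proof (cases "l \<in> I")
          case True
          then have "lift x l \<in> ?S" using that by blast
          then have "\<phi> \<bullet> lift x l = 0" by (rule \<phi>(3))
          then show ?thesis using that by (simp add: mix_def)
        qed (use v(2) in simp)
        have "(\<Sum>l\<in>UNIV. v$l * (\<phi> \<bullet> lift (mix (-{i}) x x') l))
          = v$i * (\<phi> \<bullet> lift (mix (-{i}) x x') i)"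
        proof -
          have "(\<Sum>l\<in>UNIV-{i}. v$l * (\<phi> \<bullet> lift (mix (-{i}) x x') l)) = 0"
            by (rule sum.neutral) (use 0 in blast)
          then show ?thesis
            using sum.remove[of UNIV i "\<lambda>l. v$l * (\<phi> \<bullet> lift (mix (-{i}) x x') l)"] by simp
        qed
        then show False using v(1,3) x' by (simp add: mix_def)
      qed
    qed
  qed
  have "AE x in std_gaussian. \<forall>i. \<forall>I. i \<in> I \<longrightarrow> card I \<le> dim A \<longrightarrow> x \<notin> bad i I"
  proof -
    have "AE x in std_gaussian. i \<in> I \<longrightarrow> card I \<le> dim A \<longrightarrow> x \<notin> bad i I" for i I
    proof (cases "i \<in> I \<and> card I \<le> dim A")
      case True
      then have "AE x in std_gaussian. x \<notin> bad i I" using null by blast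
      then show ?thesis by (rule AE_mp) (rule AE_I2, blast)
    next
      case False
      then show ?thesis by (intro AE_I2) blast
    qed
    then have "AE x in std_gaussian. \<forall>I. i \<in> I \<longrightarrow> card I \<le> dim A \<longrightarrow> x \<notin> bad i I" for i
      by (rule AE_all_countable[THEN iffD2, OF allI])
    then show ?thesis by (rule AE_all_countable[THEN iffD2, OF allI])
  qed
  then show ?thesis
  proof eventually_elim
    fix x assume x: "\<forall>i. \<forall>I. i \<in> I \<longrightarrow> card I \<le> dim A \<longrightarrow> x \<notin> bad i I"
    show "in_general_position A (lift x)"
      unfolding in_general_position_def
    proof (intro allI impI, rule ccontr)
      fix v :: "real^'n" assume v: "card {i. v$i \<noteq> 0} \<le> dim A" "\<forall>\<phi>\<in>A. (\<Sum>i\<in>UNIV. v$i * (\<phi> \<bullet> lift x i)) = 0" "v \<noteq> 0"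
      then obtain i where i: "v$i \<noteq> 0" by (auto simp: vec_eq_iff)
      let ?v = "(1 / v$i) *\<^sub>R v"
      have "(\<Sum>l\<in>UNIV. ?v$l * (\<phi> \<bullet> lift x l)) = 0" if "\<phi> \<in> A" for \<phi>
      proof -
        have "(\<Sum>l\<in>UNIV. ?v$l * (\<phi> \<bullet> lift x l)) = (1 / v$i) * (\<Sum>l\<in>UNIV. v$l * (\<phi> \<bullet> lift x l))"
          unfolding sum_distrib_left by (intro sum.cong) (simp_all del: inner_lift)
        moreover have "(\<Sum>l\<in>UNIV. v$l * (\<phi> \<bullet> lift x l)) = 0" using v(2) that by blast
        ultimately show ?thesis by (simp only: mult_zero_right)
      qed
      moreover have "?v $ i = 1" "\<forall>l\<in>-{i. v$i \<noteq> 0}. ?v $ l = 0" using i by auto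
      ultimately have "x \<in> bad i {i. v$i \<noteq> 0}"
        unfolding bad_def by (intro CollectI exI[of _ ?v] conjI ballI) simp_all
      moreover have "i \<in> {i. v$i \<noteq> 0}" using i by simp
      ultimately show False using x v(1) by metis
    qed
  qed
qed

section \<open>The probability of a facet\<close>

definition evals :: "real^'d^'n \<Rightarrow> real^'d \<Rightarrow> real^'n" where
  "evals x \<mu> = (\<chi> i. x $ i \<bullet> \<mu>)"

text \<open>
  The reflection acts on the \<open>d\<close> columns of the matrix with rows \<open>x $ i\<close>, that is, on the vectors
  of values of linear functionals at the points.
\<close>

definition reflect_rows :: "real^'n \<Rightarrow> real^'d^'n \<Rightarrow> real^'d^'n" where
  "reflect_rows h x = transpose (\<chi> j. reflect h (transpose x $ j))"

lemma measurable_transpose [measurable]: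
  "(transpose :: (real^'d)^'n::finite \<Rightarrow> (real^'n)^'d::finite) \<in> borel_measurable borel"
  unfolding transpose_def by (intro measurable_vec_lambda) measurable

lemma measurable_reflect_rows [measurable]:
  "(reflect_rows h :: real^'d^'n \<Rightarrow> _) \<in> borel_measurable borel"
proof -
  have [measurable]: "(\<lambda>x. \<chi> j. reflect h ((x :: real^'n^'d) $ j)) \<in> borel_measurable borel"
    by (intro measurable_vec_lambda) measurable
  have "(\<lambda>x::real^'d^'n. transpose ((\<lambda>x. \<chi> j. reflect h ((x :: real^'n^'d) $ j)) (transpose x))) \<in> borel_measurable borel"
    by measurable
  then show ?thesis unfolding reflect_rows_def[abs_def] .
qed

lemma distr_std_gaussian_reflect:
  fixes h :: "real^'n::{finite,wellorder}"
  shows "distr std_gaussian borel (reflect h) = std_gaussian"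
  by (rule distr_std_gaussian_orthogonal[OF orthogonal_transformation_reflect])

lemma distr_std_gaussian_uminus:
  "distr std_gaussian borel (\<lambda>x. - x) = (std_gaussian :: (real^'n::{finite,wellorder}) measure)"
  by (rule distr_std_gaussian_orthogonal)
     (simp add: orthogonal_transformation_def linear_uminus)

lemma distr_std_gaussian_reflect_rows:
  fixes h :: "real^'n::{finite,wellorder}"
  shows "distr std_gaussian borel (reflect_rows h) = (std_gaussian :: ((real^'d::finite)^'n::_) measure)"
proof -
  let ?f = "\<lambda>x::(real^'n::_)^'d::_. \<chi> j. reflect h (x $ j)"
  have [measurable]: "?f \<in> borel_measurable borel"
    by (intro measurable_vec_lambda) measurable
  have "distr std_gaussian borel (reflect_rows h :: (real^'d::_)^'n::_ \<Rightarrow> _)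
      = distr (distr (distr std_gaussian borel transpose) borel ?f) borel transpose"
    unfolding reflect_rows_def[abs_def] by (subst (1 2) distr_distr) (auto simp: comp_def)
  also have "\<dots> = std_gaussian"
    by (simp add: distr_std_gaussian_transpose distr_std_gaussian_map_components distr_std_gaussian_reflect)
  finally show ?thesis .
qed

lemma evals_reflect_rows:
  fixes x :: "real^'d^'n"
  shows "evals (reflect_rows h x) \<mu> = reflect h (evals x \<mu>)"
proof -
  have s: "evals x \<mu> = (\<Sum>j\<in>UNIV. (\<mu> $ j) *\<^sub>R (transpose x $ j))" for x :: "real^'d^'n"
    by (simp add: vec_eq_iff evals_def transpose_def inner_vec_def mult.commute)
  have "reflect h (evals x \<mu>) = (\<Sum>j\<in>UNIV. (\<mu> $ j) *\<^sub>R reflect h (transpose x $ j))"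
    unfolding s by (simp add: linear_sum[OF linear_reflect] linear_scale[OF linear_reflect])
  also have "\<dots> = evals (reflect_rows h x) \<mu>"
    unfolding s by (simp add: reflect_rows_def transpose_transpose)
  finally show ?thesis ..
qed

lemma distr_std_gaussian_inner:
  fixes u :: "real^'d::{finite,wellorder}"
  assumes "norm u = 1"
  shows "distr std_gaussian borel (\<lambda>z. z \<bullet> u) = std_gaussian"
proof (rule std_gaussian_eqI)
  fix a b :: real
  define e :: "real^'d::_" where "e = axis undefined 1"
  have e: "e \<in> Basis" by (simp add: e_def)
  then have "norm u = norm e" using assms by simp
  then have r: "reflect (u - e) u = e" by (rule reflect_diff)
  interpret N: prob_space std_normal by (rule prob_space_std_normal)
  have [simp]: "emeasure std_normal UNIV = 1" using N.emeasure_space_1 by simp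
  have "emeasure (distr std_gaussian borel (\<lambda>z. z \<bullet> u)) (box a b) = emeasure std_gaussian {z. z \<bullet> u \<in> box a b}"
    by (subst emeasure_distr) (auto intro!: arg_cong2[where f=emeasure])
  also have "\<dots> = emeasure (distr std_gaussian borel (reflect (u - e))) {z. z \<bullet> u \<in> box a b}"
    by (simp add: distr_std_gaussian_reflect)
  also have "\<dots> = emeasure std_gaussian {z. reflect (u - e) z \<bullet> u \<in> box a b}"
    by (subst emeasure_distr) (auto intro!: arg_cong2[where f=emeasure])
  also have "{z. reflect (u - e) z \<bullet> u \<in> box a b} = {z. \<forall>b'\<in>Basis. z \<bullet> b' \<in> (if b' = e then box a b else UNIV)}"
    using e by (auto simp: inner_reflect_swap r)
  also have "emeasure std_gaussian \<dots> = (\<Prod>b'\<in>Basis. emeasure std_normal (if b' = e then box a b else UNIV))"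
    by (rule emeasure_std_gaussian_prod) auto
  also have "\<dots> = (\<Prod>b'\<in>{e}. emeasure std_normal (if b' = e then box a b else UNIV))"
    by (rule prod.mono_neutral_right) (use e in auto)
  finally show "emeasure (distr std_gaussian borel (\<lambda>z. z \<bullet> u)) (box a b)
    = (\<Prod>b'\<in>Basis. emeasure std_normal {a \<bullet> b' <..< b \<bullet> b'})" by (simp add: box_real)
qed simp

lemma distr_std_gaussian_evals:
  fixes u :: "real^'d::{finite,wellorder}"
  assumes "norm u = 1"
  shows "distr std_gaussian borel (\<lambda>x::(real^'d::_)^'n::finite. evals x u) = std_gaussian"
  unfolding evals_def
  by (rule distr_std_gaussian_map_components[OF _ distr_std_gaussian_inner[OF assms]]) simp

lemma exposes_Times_iff:
  "exposes (UNIV \<times> L) (lift x) J \<longleftrightarrow>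
    (\<exists>c. \<exists>\<mu>\<in>L. (\<forall>i\<in>J. evals x \<mu> $ i = c) \<and> (\<forall>i\<in>-J. evals x \<mu> $ i > c))"
proof
  assume "exposes (UNIV \<times> L) (lift x) J"
  then obtain c \<mu> where "\<mu> \<in> L" "\<forall>i\<in>J. c + \<mu> \<bullet> x $ i = 0" "\<forall>i\<in>-J. c + \<mu> \<bullet> x $ i > 0"
    unfolding exposes_def by auto
  then show "\<exists>c. \<exists>\<mu>\<in>L. (\<forall>i\<in>J. evals x \<mu> $ i = c) \<and> (\<forall>i\<in>-J. evals x \<mu> $ i > c)"
    by (intro exI[of _ "-c"] bexI[of _ \<mu>]) (force simp: evals_def inner_commute)+
next
  assume "\<exists>c. \<exists>\<mu>\<in>L. (\<forall>i\<in>J. evals x \<mu> $ i = c) \<and> (\<forall>i\<in>-J. evals x \<mu> $ i > c)"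
  then obtain c \<mu> where "\<mu> \<in> L" "\<forall>i\<in>J. evals x \<mu> $ i = c" "\<forall>i\<in>-J. evals x \<mu> $ i > c" by blast
  then show "exposes (UNIV \<times> L) (lift x) J"
    unfolding exposes_def by (intro bexI[of _ "(-c, \<mu>)"]) (auto simp: evals_def inner_commute[of \<mu>])
qed

text \<open>
  The solid angle of the normal cone of the regular simplex at its face on \<open>J\<close>
  (\<open>solid_angle_normal_cone_simplex\<close>).
\<close>

definition normal_prob :: "'n::finite set \<Rightarrow> real" where
  "normal_prob J = measure (std_gaussian :: (real^'n) measure) {y. \<forall>i\<in>-J. y $ i < (\<Sum>l\<in>J. y $ l) / real (card J)}"

text \<open>
  A functional is constant on \<open>J\<close> if its vector of values is orthogonal to all vectors supported on \<open>J\<close>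
  with coordinate sum zero. Reflecting the normalised indicator of \<open>J\<close> to a unit vector \<open>e\<close> at \<open>i0\<close>
  turns this into the condition that the functional vanishes at all points of \<open>J\<close> but one, and these
  points determine it up to a factor. Its values at the remaining points are independent standard
  normal, because those points are independent of the functional. Reflecting back yields the event that
  defines the normal angle, once for each sign of the functional.
\<close>

lemma measure_exposes_facet:
  fixes J :: "'n::{finite,wellorder} set" and L :: "(real^'d::{finite,wellorder}) set"
  assumes L: "subspace L" "dim L = card J" and J: "J \<noteq> {}" "J \<noteq> UNIV"
  shows "measure std_gaussian {x :: (real^'d::_)^'n::_. exposes (UNIV \<times> L) (lift x) J} = 2 * normal_prob J"
proof -
  interpret G: prob_space "std_gaussian :: ((real^'d::_)^'n::_) measure" by (rule prob_space_std_gaussian)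
  interpret Gn: prob_space "std_gaussian :: (real^'n::_) measure" by (rule prob_space_std_gaussian)
  obtain i0 where i0: "i0 \<in> J" using J by blast
  define s where "s = sqrt (real (card J))"
  have s: "s > 0" "s * s = real (card J)" using i0 by (auto simp: s_def card_gt_0_iff)
  define u :: "real^'n::_" where "u = (\<chi> i. if i \<in> J then 1 / s else 0)"
  define e :: "real^'n::_" where "e = axis i0 1"
  have "u \<bullet> u = (\<Sum>i\<in>J. (1 / s) * (1 / s))"
    by (simp add: u_def inner_vec_def if_distrib[of "\<lambda>t. t * _"] sum.If_cases)
  also have "\<dots> = (s * s) / (s * s)" unfolding s(2) using s(2) by (simp add: field_simps)
  also have "\<dots> = 1" using s(1) by simp
  finally have "norm u = norm e" by (simp add: norm_eq_sqrt_inner e_def inner_axis_axis)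
  \<comment> \<open>The reflection exchanges the normalised indicator \<open>u\<close> of \<open>J\<close> with \<open>e\<close> and fixes the coordinates outside \<open>J\<close>.\<close>
  define h where "h = u - e"
  have hu: "reflect h u = e" unfolding h_def by (rule reflect_diff) fact
  then have he: "reflect h e = u" by (metis reflect_reflect)
  have h0: "h $ i = 0" if "i \<notin> J" for i using that i0 by (auto simp: h_def u_def e_def axis_def)
  have off: "reflect h y $ i = y $ i" if "i \<notin> J" for i y by (simp add: reflect_def h0[OF that])
  have rh: "reflect h (t *\<^sub>R w + z) = t *\<^sub>R reflect h w + z" if "\<forall>i\<in>J. z $ i = 0" for t w z
  proof -
    have "h \<bullet> z = 0" unfolding inner_vec_def using that h0 by (intro sum.neutral) auto
    then show ?thesis
      by (simp add: linear_add[OF linear_reflect] linear_scale[OF linear_reflect] reflect_orthogonal)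
  qed
  define E where "E = {x :: (real^'d::_)^'n::_. exposes (UNIV \<times> L) (lift x) J}"
  define E' where "E' = {x :: (real^'d::_)^'n::_. \<exists>\<mu>\<in>L. (\<forall>i\<in>J-{i0}. evals x \<mu> $ i = 0) \<and>
     (\<forall>i\<in>-J. evals x \<mu> $ i > evals x \<mu> $ i0 / s)}"
  have Eb: "E \<in> sets borel" unfolding E_def by (intro borel_exposes subspace_Times L subspace_UNIV)
  have pre: "reflect_rows h -` E = E'"
  proof (intro set_eqI iffI)
    fix x assume "x \<in> reflect_rows h -` E"
    then obtain c \<mu> where \<mu>: "\<mu> \<in> L" "\<forall>i\<in>J. reflect h (evals x \<mu>) $ i = c" "\<forall>i\<in>-J. reflect h (evals x \<mu>) $ i > c"
      unfolding E_def vimage_def mem_Collect_eq exposes_Times_iff evals_reflect_rows by blast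
    define z where "z = (\<chi> i. if i \<in> J then 0 else evals x \<mu> $ i)"
    have "reflect h (evals x \<mu>) = (c * s) *\<^sub>R u + z"
      using \<mu>(2) s by (auto simp: vec_eq_iff z_def u_def off)
    then have "evals x \<mu> = reflect h ((c * s) *\<^sub>R u + z)" by (metis reflect_reflect)
    also have "\<dots> = (c * s) *\<^sub>R e + z" by (subst rh) (auto simp: z_def hu)
    finally have ev: "evals x \<mu> = (c * s) *\<^sub>R e + z" .
    have "evals x \<mu> $ i0 = c * s" using i0 by (simp add: ev e_def z_def)
    moreover have "\<forall>i\<in>J-{i0}. evals x \<mu> $ i = 0" by (simp add: ev e_def z_def axis_def)
    moreover have "\<forall>i\<in>-J. evals x \<mu> $ i > c" using \<mu>(3) by (simp add: off)
    ultimately show "x \<in> E'" unfolding E'_def using \<mu>(1) s by (intro CollectI bexI[of _ \<mu>]) auto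
  next
    fix x assume "x \<in> E'"
    then obtain \<mu> where \<mu>: "\<mu> \<in> L" "\<forall>i\<in>J-{i0}. evals x \<mu> $ i = 0" "\<forall>i\<in>-J. evals x \<mu> $ i > evals x \<mu> $ i0 / s"
      unfolding E'_def by blast
    define z where "z = (\<chi> i. if i \<in> J then 0 else evals x \<mu> $ i)"
    define t where "t = evals x \<mu> $ i0"
    have "evals x \<mu> = t *\<^sub>R e + z" using \<mu>(2) i0 by (auto simp: vec_eq_iff t_def e_def z_def axis_def)
    moreover have "\<forall>i\<in>J. z $ i = 0" by (simp add: z_def)
    ultimately have ev: "reflect h (evals x \<mu>) = t *\<^sub>R u + z" by (simp only: rh he)
    have "\<forall>i\<in>J. reflect h (evals x \<mu>) $ i = t / s" by (simp add: ev u_def z_def)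
    moreover have "\<forall>i\<in>-J. reflect h (evals x \<mu>) $ i > t / s" using \<mu>(3) by (simp add: off t_def)
    ultimately show "x \<in> reflect_rows h -` E"
      unfolding E_def vimage_def mem_Collect_eq exposes_Times_iff evals_reflect_rows using \<mu>(1) by blast
  qed
  have E'b: "E' \<in> sets borel"
    unfolding pre[symmetric] using measurable_sets[OF measurable_reflect_rows Eb] by simp
  have "emeasure std_gaussian E = emeasure (distr std_gaussian borel (reflect_rows h)) E"
    by (simp add: distr_std_gaussian_reflect_rows)
  also have "\<dots> = emeasure std_gaussian E'"
    by (subst emeasure_distr) (use Eb pre in auto)
  also have "\<dots> = (\<integral>\<^sup>+x. emeasure std_gaussian {x'. mix (J-{i0}) x x' \<in> E'} \<partial>std_gaussian)"
    by (rule emeasure_mix[OF E'b])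
  also have "\<dots> = (\<integral>\<^sup>+x. 2 * ennreal (normal_prob J) \<partial>(std_gaussian :: ((real^'d::_)^'n::_) measure))"
  proof (rule nn_integral_cong_AE)
    have A: "subspace ({0::real} \<times> L)" by (intro subspace_Times L) simp
    have dimA: "dim ({0::real} \<times> L) = card J"
      using dim_Times[of "{0::real}" L] L by simp
    show "AE x::(real^'d::_)^'n::_ in std_gaussian. emeasure std_gaussian {x'. mix (J-{i0}) x x' \<in> E'} = 2 * ennreal (normal_prob J)"
      using AE_in_general_position[OF A]
    proof eventually_elim
      fix x :: "(real^'d::_)^'n::_" assume gp: "in_general_position ({0} \<times> L) (lift x)"
      have "card ((\<lambda>i. x $ i) ` (J - {i0})) \<le> card (J - {i0})" by (rule card_image_le) simp
      also have "\<dots> < card J" using i0 by (intro card_Diff1_less) auto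
      finally have "card ((\<lambda>i. x $ i) ` (J - {i0})) < dim L" using L by simp
      then obtain \<mu>1 where \<mu>1: "\<mu>1 \<in> L" "\<mu>1 \<noteq> 0" "\<And>v. v \<in> (\<lambda>i. x $ i) ` (J - {i0}) \<Longrightarrow> \<mu>1 \<bullet> v = 0"
        using orthogonal_in_subspace[OF L(1), of "(\<lambda>i. x $ i) ` (J - {i0})"] by auto
      define \<mu>0 where "\<mu>0 = sgn \<mu>1"
      have \<mu>0: "\<mu>0 \<in> L" "norm \<mu>0 = 1" "\<And>i. i \<in> J - {i0} \<Longrightarrow> \<mu>0 \<bullet> x $ i = 0"
        using \<mu>1 L by (auto simp: \<mu>0_def sgn_div_norm subspace_scale)
      have full: "\<mu> = 0" if "\<mu> \<in> L" "\<And>i. i \<in> J \<Longrightarrow> \<mu> \<bullet> x $ i = 0" for \<mu>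
      proof (rule ccontr)
        assume "\<mu> \<noteq> 0"
        then have "card {i. (0, \<mu>) \<bullet> lift x i = 0} < dim ({0::real} \<times> L)"
          using that by (intro general_position_card_zeros[OF A gp]) (auto simp: zero_prod_def)
        moreover have "card J \<le> card {i. (0, \<mu>) \<bullet> lift x i = 0}" using that by (intro card_mono) auto
        ultimately show False using dimA by simp
      qed
      have nz: "\<mu>0 \<bullet> x $ i0 \<noteq> 0" using full[OF \<mu>0(1)] \<mu>0 by fastforce
      have uniq: "\<exists>c. \<mu> = c *\<^sub>R \<mu>0" if "\<mu> \<in> L" "\<And>i. i \<in> J - {i0} \<Longrightarrow> \<mu> \<bullet> x $ i = 0" for \<mu>
      proof -
        define c where "c = (\<mu> \<bullet> x $ i0) / (\<mu>0 \<bullet> x $ i0)"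
        have "(\<mu> - c *\<^sub>R \<mu>0) \<bullet> x $ i = 0" if "i \<in> J" for i
          using that nz \<mu>0(3)[of i] \<open>\<And>i. i \<in> J - {i0} \<Longrightarrow> \<mu> \<bullet> x $ i = 0\<close>[of i]
          by (cases "i = i0") (auto simp: inner_diff_left c_def)
        then have "\<mu> - c *\<^sub>R \<mu>0 = 0"
          using L that \<mu>0 by (intro full) (auto simp: subspace_diff subspace_scale)
        then show ?thesis by auto
      qed
      \<comment> \<open>The points of \<open>J - {i0}\<close> determine the unit functional up to sign, and the two signs give the disjoint events \<open>?P\<close> and \<open>?N\<close> for the values at the resampled points.\<close>
      let ?P = "{y :: real^'n::_. \<forall>i\<in>-J. y $ i > y $ i0 / s}" and ?N = "{y :: real^'n::_. \<forall>i\<in>-J. y $ i < y $ i0 / s}"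
      have [measurable]: "?P \<in> sets borel" "?N \<in> sets borel" by measurable
      have evm: "evals (mix (J-{i0}) x x') \<mu> $ i = (if i \<in> J - {i0} then \<mu> \<bullet> x $ i else evals x' \<mu> $ i)" for x' \<mu> i
        by (simp add: evals_def mix_def inner_commute)
      have evs: "evals x' (c *\<^sub>R \<mu>) = c *\<^sub>R evals x' \<mu>" for c \<mu> and x' :: "(real^'d::_)^'n::_"
        by (simp add: evals_def vec_eq_iff)
      have eq: "{x'. mix (J-{i0}) x x' \<in> E'} = (\<lambda>x'. evals x' \<mu>0) -` (?P \<union> ?N)"
      proof (intro set_eqI iffI)
        fix x' assume "x' \<in> {x'. mix (J-{i0}) x x' \<in> E'}"
        then obtain \<mu> where \<mu>: "\<mu> \<in> L" "\<forall>i\<in>J-{i0}. \<mu> \<bullet> x $ i = 0"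
            "\<forall>i\<in>-J. evals x' \<mu> $ i > evals x' \<mu> $ i0 / s"
          using i0 unfolding E'_def by (auto simp: evm)
        obtain c where c: "\<mu> = c *\<^sub>R \<mu>0" using uniq \<mu> by blast
        have ineq: "c * (evals x' \<mu>0 $ i) > c * (evals x' \<mu>0 $ i0 / s)" if "i \<in> -J" for i
          using \<mu>(3) that by (simp add: c evs)
        obtain j where "j \<in> -J" using J by blast
        then have "c \<noteq> 0" using ineq by force
        then consider "c > 0" | "c < 0" by linarith
        then have "(\<forall>i\<in>-J. evals x' \<mu>0 $ i > evals x' \<mu>0 $ i0 / s) \<or> (\<forall>i\<in>-J. evals x' \<mu>0 $ i < evals x' \<mu>0 $ i0 / s)"
        proof cases
          case 1
          then show ?thesis using ineq by (simp only: mult_less_cancel_left_pos) blast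
        next
          case 2
          then show ?thesis using ineq by (simp only: mult_less_cancel_left_neg) blast
        qed
        then show "x' \<in> (\<lambda>x'. evals x' \<mu>0) -` (?P \<union> ?N)" by blast
      next
        fix x' assume "x' \<in> (\<lambda>x'. evals x' \<mu>0) -` (?P \<union> ?N)"
        then consider "\<forall>i\<in>-J. evals x' \<mu>0 $ i > evals x' \<mu>0 $ i0 / s" | "\<forall>i\<in>-J. evals x' \<mu>0 $ i < evals x' \<mu>0 $ i0 / s"
          by auto
        then show "x' \<in> {x'. mix (J-{i0}) x x' \<in> E'}"
        proof cases
          case 1
          then show ?thesis unfolding E'_def using \<mu>0 i0
            by (intro CollectI bexI[of _ \<mu>0]) (auto simp: evm)
        next
          case 2
          have "- \<mu>0 = (-1) *\<^sub>R \<mu>0" by simp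
          then have "evals x' (- \<mu>0) = - evals x' \<mu>0" by (simp only: evs) simp
          with 2 show ?thesis unfolding E'_def using \<mu>0 i0 L
            by (intro CollectI bexI[of _ "-\<mu>0"]) (auto simp: evm subspace_neg)
        qed
      qed
      have [measurable]: "(\<lambda>x'::(real^'d::_)^'n::_. evals x' \<mu>0) \<in> borel_measurable borel"
        unfolding evals_def by (intro measurable_vec_lambda) measurable
      have "emeasure std_gaussian {x'. mix (J-{i0}) x x' \<in> E'}
        = emeasure (distr std_gaussian borel (\<lambda>x'::(real^'d::_)^'n::_. evals x' \<mu>0)) (?P \<union> ?N)"
        unfolding eq by (subst emeasure_distr) auto
      also have "\<dots> = emeasure std_gaussian (?P \<union> ?N)"
        by (simp add: distr_std_gaussian_evals[OF \<mu>0(2)])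
      also have "\<dots> = emeasure std_gaussian ?P + emeasure std_gaussian ?N"
      proof (rule plus_emeasure[symmetric])
        obtain j where "j \<in> -J" using J by blast
        then show "?P \<inter> ?N = {}" by (blast dest: less_asym)
      qed auto
      also have "emeasure std_gaussian ?P = emeasure (distr std_gaussian borel (\<lambda>y. - y)) ?P"
        by (simp add: distr_std_gaussian_uminus)
      also have "\<dots> = emeasure std_gaussian ?N"
        by (subst emeasure_distr) (auto intro!: arg_cong2[where f=emeasure])
      also have "emeasure std_gaussian ?N = emeasure (distr std_gaussian borel (reflect h)) ?N"
        by (simp add: distr_std_gaussian_reflect)
      also have "\<dots> = emeasure std_gaussian {y :: real^'n::_. \<forall>i\<in>-J. y $ i < (\<Sum>l\<in>J. y $ l) / real (card J)}"
      proof -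
        have "reflect h y $ i0 / s = (\<Sum>l\<in>J. y $ l) / real (card J)" for y
        proof -
          have "reflect h y $ i0 = reflect h y \<bullet> e" by (simp add: e_def inner_axis)
          also have "\<dots> = y \<bullet> u" by (simp add: inner_reflect_swap he)
          also have "\<dots> = (\<Sum>l\<in>J. y $ l) / s"
            by (simp add: u_def inner_vec_def if_distrib[of "\<lambda>t. _ * t"] sum.If_cases sum_divide_distrib)
          finally show ?thesis using s by (simp add: divide_divide_eq_left)
        qed
        then have "reflect h -` ?N = {y :: real^'n::_. \<forall>i\<in>-J. y $ i < (\<Sum>l\<in>J. y $ l) / real (card J)}"
          by (auto simp: off)
        then show ?thesis by (subst emeasure_distr) auto
      qed
      also have "\<dots> = ennreal (normal_prob J)" by (simp add: normal_prob_def Gn.emeasure_eq_measure)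
      finally show "emeasure std_gaussian {x'. mix (J-{i0}) x x' \<in> E'} = 2 * ennreal (normal_prob J)"
        by (simp add: mult_2)
    qed
  qed
  also have "\<dots> = 2 * ennreal (normal_prob J)" using G.emeasure_space_1 by simp
  finally have "ennreal (measure std_gaussian E) = ennreal (2 * normal_prob J)"
    by (simp add: G.emeasure_eq_measure ennreal_mult' normal_prob_def)
  then show ?thesis by (simp add: E_def normal_prob_def)
qed

section \<open>The direction of the kernel of a Gaussian matrix\<close>

text \<open>
  What the Gram-Schmidt process leaves of \<open>y\<close>. The recursion shows that the result is measurable in
  all arguments and commutes with isometries; a vector of the list that depends on those after it is
  skipped, by division by zero.
\<close>

fun residual :: "'a::real_inner list \<Rightarrow> 'a \<Rightarrow> 'a" where
  "residual [] y = y"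
| "residual (b # bs) y = residual bs y -
    ((residual bs y \<bullet> residual bs b) / (residual bs b \<bullet> residual bs b)) *\<^sub>R residual bs b"

lemma residual_diff_in_span: "y - residual bs y \<in> span (set bs)"
proof (induction bs arbitrary: y)
  case (Cons b bs)
  have sub: "span (set bs) \<subseteq> span (set (b # bs))" by (rule span_mono) auto
  have "b \<in> span (set (b # bs))" by (rule span_base) simp
  then have "b - (b - residual bs b) \<in> span (set (b # bs))"
    using subsetD[OF sub Cons[of b]] by (rule span_diff)
  then have "residual bs b \<in> span (set (b # bs))" by simp
  moreover have "y - residual bs y \<in> span (set (b # bs))" using Cons[of y] sub by blast
  ultimately have "(y - residual bs y) + ((residual bs y \<bullet> residual bs b) / (residual bs b \<bullet> residual bs b)) *\<^sub>R residual bs b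
      \<in> span (set (b # bs))"
    by (intro span_add span_scale)
  then show ?case by (simp only: residual.simps diff_diff_eq2 diff_add_eq)
qed (simp add: span_zero)

lemma residual_orthogonal: "b \<in> set bs \<Longrightarrow> residual bs y \<bullet> b = 0"
proof (induction bs arbitrary: y b)
  case (Cons a bs)
  let ?z = "residual (a # bs) y"
  have orth: "?z \<bullet> c = 0" if "c \<in> set bs" for c
    using Cons.IH[OF that] by (simp add: inner_diff_left)
  then have "span (set bs) \<subseteq> {c. ?z \<bullet> c = 0}"
    by (intro span_minimal subspace_hyperplane) auto
  then have "?z \<bullet> (a - residual bs a) = 0" using residual_diff_in_span[of a bs] by blast
  moreover have "?z \<bullet> residual bs a = 0" by (simp add: inner_diff_left)
  ultimately have "?z \<bullet> a = 0" unfolding inner_diff_right by linarith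
  moreover have "b = a \<or> b \<in> set bs" using Cons.prems by simp
  ultimately show ?case using orth by blast
qed simp

lemma residual_in_subspace:
  assumes V: "subspace V"
  shows "set bs \<subseteq> V \<Longrightarrow> y \<in> V \<Longrightarrow> residual bs y \<in> V"
  by (induction bs arbitrary: y) (auto intro!: subspace_diff[OF V] subspace_scale[OF V])

lemma residual_map:
  assumes f: "linear f" "\<And>x y. f x \<bullet> f y = x \<bullet> y"
  shows "residual (map f bs) (f y) = f (residual bs y)"
  by (induction bs arbitrary: y) (simp_all add: f linear_diff linear_scale)

lemma measurable_residual:
  fixes gs :: "('b \<Rightarrow> 'a::euclidean_space) list"
  assumes "\<And>g. g \<in> set gs \<Longrightarrow> g \<in> borel_measurable M"
  shows "f \<in> borel_measurable M \<Longrightarrow> (\<lambda>x. residual (map (\<lambda>g. g x) gs) (f x)) \<in> borel_measurable M"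
  using assms
proof (induction gs arbitrary: f)
  case (Cons g gs)
  have [measurable]: "(\<lambda>x. residual (map (\<lambda>g. g x) gs) (f x)) \<in> borel_measurable M"
    "(\<lambda>x. residual (map (\<lambda>g. g x) gs) (g x)) \<in> borel_measurable M"
    using Cons by auto
  show ?case by simp
qed simp

lemma closest_point_subspace_isometry:
  fixes V :: "'a::euclidean_space set"
  assumes V: "subspace V" and f: "linear f" "\<And>x y. f x \<bullet> f y = x \<bullet> y" "f ` V = V"
  shows "closest_point V (f x) = f (closest_point V x)"
proof (rule closest_point_subspace_eq[OF V])
  show "f (closest_point V x) \<in> V" using closest_point_subspace(1)[OF V, of x] f(3) by blast
  fix y assume "y \<in> V"
  then obtain z where "y = f z" "z \<in> V" using f(3) by blast
  then show "(f x - f (closest_point V x)) \<bullet> y = 0"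
    using closest_point_subspace(2)[OF V, of z x] f(1,2) by (simp add: linear_diff[symmetric])
qed

lemma inner_closest_point_subspace:
  fixes V :: "'a::euclidean_space set"
  assumes V: "subspace V" and h: "h \<in> V"
  shows "h \<bullet> closest_point V x = h \<bullet> x"
  using closest_point_subspace(2)[OF V h, of x] by (simp add: inner_diff_right inner_commute)

lemma reflect_image_subspace:
  assumes "subspace V" "h \<in> V"
  shows "reflect h ` V = V"
proof
  show sub: "reflect h ` V \<subseteq> V" using reflect_in_subspace[OF assms] by blast
  show "V \<subseteq> reflect h ` V"
  proof
    fix x assume "x \<in> V"
    then have "reflect h x \<in> V" using sub by blast
    then have "reflect h (reflect h x) \<in> reflect h ` V" by (rule imageI)
    then show "x \<in> reflect h ` V" by simp
  qed
qed

text \<open>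
  The vector \<open>w x y\<close> is a solution in \<open>V\<close> of fewer than \<open>dim V\<close> random linear equations, chosen
  with the help of an independent Gaussian vector \<open>y\<close>. Reflections in \<open>V\<close> preserve the joint law
  of \<open>x\<close> and \<open>y\<close> and the event \<open>E\<close>, and they commute with the construction. Hence the direction of \<open>w\<close>,
  restricted to \<open>E\<close>, has a law that is reflection invariant and therefore a multiple of the uniform one.
\<close>

lemma kernel_direction_uniform:
  fixes V :: "(real^'n::{finite,wellorder}) set" and E :: "((real^'d::finite)^'n::_) set"
    and ms :: "(real^'d) list"
  defines "w \<equiv> \<lambda>x y. residual (map (\<lambda>m. closest_point V (evals x m)) ms) (closest_point V y)"
  assumes V: "subspace V" and ms: "length ms < dim V" and E: "E \<in> sets borel"
    and inv: "\<And>h. h \<in> V \<Longrightarrow> reflect_rows h -` E = E" and C: "closed C"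
  shows "AE (x, y) in std_gaussian \<Otimes>\<^sub>M std_gaussian. w x y \<noteq> 0"
    and "measure (std_gaussian \<Otimes>\<^sub>M std_gaussian) {(x, y). x \<in> E \<and> sgn (w x y) \<in> C}
      = measure std_gaussian E * measure (uniform_sphere V) C"
    and "{(x, y). x \<in> E \<and> sgn (w x y) \<in> C} \<in> sets (std_gaussian \<Otimes>\<^sub>M std_gaussian)"
proof -
  let ?G = "std_gaussian :: ((real^'d)^'n::_) measure" and ?H = "std_gaussian :: (real^'n::_) measure"
  let ?P = "?G \<Otimes>\<^sub>M ?H"
  interpret G: prob_space ?G by (rule prob_space_std_gaussian)
  interpret H: prob_space ?H by (rule prob_space_std_gaussian)
  interpret P: pair_prob_space ?G ?H ..
  have sP: "sets ?P = sets (borel \<Otimes>\<^sub>M borel)" by (intro sets_pair_measure_cong) auto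
  have spP: "space ?P = UNIV" by (simp add: space_pair_measure)
  have wm: "(\<lambda>p. w (fst p) (snd p)) \<in> borel_measurable ?P"
  proof -
    have [measurable]: "closest_point V \<in> borel_measurable borel" by (rule measurable_closest_point_subspace[OF V])
    have "(\<lambda>p. residual (map (\<lambda>g. g p) (map (\<lambda>m p. closest_point V (evals (fst p) m)) ms)) (closest_point V (snd p)))
      \<in> borel_measurable ?P"
    proof (rule measurable_residual)
      fix g assume "g \<in> set (map (\<lambda>m p. closest_point V (evals (fst (p :: ((real^'d)^'n::_) \<times> (real^'n::_))) m)) ms)"
      then obtain m where g: "g = (\<lambda>p. closest_point V (evals (fst p) m))" by auto
      have [measurable]: "(\<lambda>x::(real^'d)^'n::_. evals x m) \<in> borel_measurable borel"
        unfolding evals_def by (intro measurable_vec_lambda) measurable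
      show "g \<in> borel_measurable ?P" unfolding g by measurable
    qed measurable
    then show ?thesis by (simp add: w_def comp_def)
  qed
  have sw[measurable]: "(\<lambda>p. sgn (w (fst p) (snd p))) \<in> borel_measurable ?P"
    using measurable_compose[OF wm measurable_sgn_euclidean] .
  have "AE p in ?P. w (fst p) (snd p) \<noteq> 0"
  proof (rule P.AE_pair_measure)
    show "{p \<in> space ?P. w (fst p) (snd p) \<noteq> 0} \<in> sets ?P"
      using wm by measurable
    show "AE x in ?G. AE y in ?H. w (fst (x, y)) (snd (x, y)) \<noteq> 0"
    proof (rule AE_I2)
      fix x :: "(real^'d)^'n::_"
      let ?bs = "map (\<lambda>m. closest_point V (evals x m)) ms"
      have "card (set ?bs) < dim V" using ms card_length[of ?bs] by simp
      then obtain h where h: "h \<in> V" "h \<noteq> 0" "\<And>s. s \<in> set ?bs \<Longrightarrow> h \<bullet> s = 0"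
        using orthogonal_in_subspace[OF V, of "set ?bs"] by blast
      have "AE y in ?H. h \<bullet> y \<noteq> 0" by (rule AE_std_gaussian_hyperplane[OF h(2)])
      then show "AE y in ?H. w (fst (x, y)) (snd (x, y)) \<noteq> 0"
      proof eventually_elim
        fix y assume y: "h \<bullet> y \<noteq> 0"
        show "w (fst (x, y)) (snd (x, y)) \<noteq> 0"
        proof
          assume "w (fst (x, y)) (snd (x, y)) = 0"
          then have "closest_point V y \<in> span (set ?bs)"
            using residual_diff_in_span[of "closest_point V y" ?bs] by (simp add: w_def)
          moreover have "span (set ?bs) \<subseteq> {s. h \<bullet> s = 0}"
            using h(3) by (intro span_minimal subspace_hyperplane) auto
          ultimately have "h \<bullet> closest_point V y = 0" by blast
          then show False using y inner_closest_point_subspace[OF V h(1)] by simp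
        qed
      qed
    qed
  qed
  note wnz = this
  then show "AE (x, y) in std_gaussian \<Otimes>\<^sub>M std_gaussian. w x y \<noteq> 0" by (simp add: case_prod_beta)
  \<comment> \<open>The law \<open>M\<close> of the direction, restricted to \<open>E\<close>, is invariant under reflections in vectors of \<open>V\<close>.\<close>
  define EE where "EE = E \<times> (UNIV :: (real^'n::_) set)"
  have EEm: "EE \<in> sets ?P" unfolding EE_def using E by (intro pair_measureI) auto
  have "{(x, y). x \<in> E \<and> sgn (w x y) \<in> C} = EE \<inter> (\<lambda>p. sgn (w (fst p) (snd p))) -` C"
    by (auto simp: EE_def)
  then show "{(x, y). x \<in> E \<and> sgn (w x y) \<in> C} \<in> sets ?P"
    using EEm measurable_sets[OF sw borel_closed[OF C]] by (simp add: spP)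
  define M where "M = distr (density ?P (indicator EE)) borel (\<lambda>p. sgn (w (fst p) (snd p)))"
  have swd: "(\<lambda>p. sgn (w (fst p) (snd p))) \<in> borel_measurable (density ?P (indicator EE))"
    using sw by simp
  have eM: "emeasure M S = emeasure ?P {p. fst p \<in> E \<and> sgn (w (fst p) (snd p)) \<in> S}" if S: "S \<in> sets borel" for S
  proof -
    let ?Q = "(\<lambda>p. sgn (w (fst p) (snd p))) -` S"
    have Q: "?Q \<in> sets ?P" using measurable_sets[OF sw S] by (simp add: spP)
    have "emeasure M S = emeasure (density ?P (indicator EE)) ?Q"
      unfolding M_def by (subst emeasure_distr[OF swd S]) (simp add: spP)
    also have "\<dots> = (\<integral>\<^sup>+p. indicator EE p * indicator ?Q p \<partial>?P)"
      by (rule emeasure_density) (use EEm Q in auto)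
    also have "\<dots> = (\<integral>\<^sup>+p. indicator (EE \<inter> ?Q) p \<partial>?P)"
      by (simp add: indicator_inter_arith)
    also have "\<dots> = emeasure ?P (EE \<inter> ?Q)" using EEm Q by (intro nn_integral_indicator) auto
    also have "EE \<inter> ?Q = {p. fst p \<in> E \<and> sgn (w (fst p) (snd p)) \<in> S}" by (auto simp: EE_def)
    finally show ?thesis .
  qed
  have setsM: "sets M = sets borel" by (simp add: M_def)
  have eMU: "emeasure M UNIV = emeasure ?G E"
  proof -
    have "emeasure M UNIV = emeasure ?P EE" by (subst eM) (auto simp: EE_def intro!: arg_cong2[where f=emeasure])
    also have "\<dots> = emeasure ?G E * emeasure ?H UNIV"
      unfolding EE_def using E by (intro H.emeasure_pair_measure_Times) auto
    finally show ?thesis using H.emeasure_space_1 by simp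
  qed
  have spM: "space M = UNIV" by (simp add: M_def)
  have fin: "finite_measure M"
    by (rule finite_measureI) (simp add: spM eMU)
  have wV: "w x y \<in> V" for x y
    unfolding w_def using closest_point_subspace(1)[OF V] by (intro residual_in_subspace[OF V]) auto
  have "C \<in> sets borel" using C by simp
  have "AE x in M. x \<in> V \<and> norm x = 1"
  proof -
    have "AE p in density ?P (indicator EE). w (fst p) (snd p) \<noteq> 0"
      using wnz EEm by (subst AE_density) auto
    then have "AE p in density ?P (indicator EE). sgn (w (fst p) (snd p)) \<in> V \<and> norm (sgn (w (fst p) (snd p))) = 1"
      by eventually_elim (use wV V in \<open>auto simp: norm_sgn sgn_div_norm subspace_scale\<close>)
    moreover have "{x \<in> space borel. x \<in> V \<and> norm x = 1} \<in> sets borel"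
    proof -
      have "V \<inter> sphere 0 1 \<in> sets borel" using closed_subspace[OF V] by auto
      moreover have "V \<inter> sphere 0 1 = {x \<in> space borel. x \<in> V \<and> norm x = 1}" by auto
      ultimately show ?thesis by simp
    qed
    ultimately show ?thesis unfolding M_def by (subst AE_distr_iff[OF swd]) auto
  qed
  moreover have "distr M borel (reflect h) = M" if h: "h \<in> V" for h
  proof (rule measure_eqI)
    fix S assume "S \<in> sets (distr M borel (reflect h))"
    then have S: "S \<in> sets borel" by simp
    have S': "reflect h -` S \<in> sets borel" using measurable_sets[OF measurable_reflect S] by simp
    let ?T = "\<lambda>(x :: (real^'d)^'n::_, y). (reflect_rows h x, reflect h y)"
    have Tm: "?T \<in> measurable ?P ?P" by measurable
    have dT: "distr ?P ?P ?T = ?P"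
    proof -
      have "?P = distr ?G ?G (reflect_rows h) \<Otimes>\<^sub>M distr ?H ?H (reflect h)"
      proof -
        have "distr ?G ?G (reflect_rows h) = distr ?G borel (reflect_rows h)" by (rule distr_cong) auto
        moreover have "distr ?H ?H (reflect h) = distr ?H borel (reflect h)" by (rule distr_cong) auto
        ultimately show ?thesis
          by (simp only: distr_std_gaussian_reflect_rows distr_std_gaussian_reflect)
      qed
      also have "\<dots> = distr ?P (?G \<Otimes>\<^sub>M ?H) ?T"
        by (rule pair_measure_distr) (auto intro!: prob_space_imp_sigma_finite G.prob_space_distr H.prob_space_distr)
      finally show ?thesis by simp
    qed
    let ?B = "{p. fst p \<in> E \<and> sgn (w (fst p) (snd p)) \<in> S}"
    have B: "?B \<in> sets ?P"
    proof -
      have "?B = EE \<inter> (\<lambda>p. sgn (w (fst p) (snd p))) -` S" by (auto simp: EE_def)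
      then show ?thesis using EEm measurable_sets[OF sw S] by (simp add: spP)
    qed
    have eq: "w (reflect_rows h x) (reflect h y) = reflect h (w x y)" for x y
    proof -
      have cp: "closest_point V (reflect h y) = reflect h (closest_point V y)" for y
        by (rule closest_point_subspace_isometry[OF V linear_reflect inner_reflect reflect_image_subspace[OF V h]])
      have "map (\<lambda>m. closest_point V (evals (reflect_rows h x) m)) ms = map (reflect h) (map (\<lambda>m. closest_point V (evals x m)) ms)"
        by (simp add: evals_reflect_rows cp)
      then show ?thesis unfolding w_def cp by (simp only: residual_map[OF linear_reflect inner_reflect])
    qed
    have sg: "sgn (reflect h z) = reflect h (sgn z)" for z :: "real^'n::_"
      by (simp add: sgn_div_norm linear_scale[OF linear_reflect])
    have inE: "reflect_rows h x \<in> E \<longleftrightarrow> x \<in> E" for x using inv[OF h] by blast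
    have "emeasure (distr M borel (reflect h)) S = emeasure M (reflect h -` S)"
      by (subst emeasure_distr) (use S in \<open>auto simp: spM measurable_cong_sets[OF setsM refl]\<close>)
    also have "\<dots> = emeasure ?P {p. fst p \<in> E \<and> sgn (w (fst p) (snd p)) \<in> reflect h -` S}"
      by (rule eM[OF S'])
    also have "{p. fst p \<in> E \<and> sgn (w (fst p) (snd p)) \<in> reflect h -` S} = ?T -` ?B \<inter> space ?P"
      by (auto simp: spP inE eq sg)
    also have "emeasure ?P \<dots> = emeasure (distr ?P ?P ?T) ?B"
      by (rule emeasure_distr[OF Tm B, symmetric])
    also have "\<dots> = emeasure M S" by (simp only: dT eM[OF S])
    finally show "emeasure (distr M borel (reflect h)) S = emeasure M S" .
  qed (simp add: setsM)
  moreover have "V \<noteq> {0}" using ms by auto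
  ultimately have "measure M C = measure (uniform_sphere V) C * measure M UNIV"
    by (intro invariant_measure_closed[OF V _ setsM fin _ _ C])
  moreover have "measure M UNIV = measure ?G E" using eMU by (simp add: measure_def)
  moreover have "measure M C = measure ?P {(x, y). x \<in> E \<and> sgn (w x y) \<in> C}"
  proof -
    have "{(x, y). x \<in> E \<and> sgn (w x y) \<in> C} = {p. fst p \<in> E \<and> sgn (w (fst p) (snd p)) \<in> C}" by auto
    then show ?thesis using eM[OF \<open>C \<in> sets borel\<close>] by (simp add: measure_def)
  qed
  ultimately show "measure (std_gaussian \<Otimes>\<^sub>M std_gaussian) {(x, y). x \<in> E \<and> sgn (w x y) \<in> C}
      = measure std_gaussian E * measure (uniform_sphere V) C" by simp
qed

section \<open>The affine dependence of Gaussian points\<close>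

text \<open>
  The direction space of the regular simplex with vertices \<open>axis j 1\<close>, \<open>j \<in> J\<close>.
\<close>

definition zero_sum :: "'n set \<Rightarrow> (real^'n) set" where
  "zero_sum J = {v. (\<forall>i\<in>-J. v $ i = 0) \<and> (\<Sum>i\<in>UNIV. v $ i) = 0}"

text \<open>
  The tangent cone of the regular simplex on \<open>J\<close> at its face on \<open>F\<close> (\<open>tangent_cone_simplex\<close>).
\<close>

definition simplex_tangent :: "'n set \<Rightarrow> 'n set \<Rightarrow> (real^'n) set" where
  "simplex_tangent F J = {v \<in> zero_sum J. \<forall>i\<in>J-F. v $ i \<ge> 0}"

text \<open>
  The second condition in the characterisation of pivots: after projection to \<open>L\<close>, the points of \<open>J\<close> have
  an affine dependence that is positive off \<open>F\<close>.
\<close>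

definition cancels :: "(real^'d) set \<Rightarrow> 'n set \<Rightarrow> 'n set \<Rightarrow> real^'d^'n \<Rightarrow> bool" where
  "cancels L F J x \<longleftrightarrow> (\<exists>v::real^'n. (\<forall>i\<in>-J. v$i = 0) \<and> (\<forall>i\<in>J-F. v$i > 0) \<and>
     (\<forall>\<psi>\<in>UNIV \<times> L. (\<Sum>i\<in>UNIV. v$i * (\<psi> \<bullet> lift x i)) = 0))"

lemma subspace_zero_sum: "subspace (zero_sum J)"
  by (auto simp: subspace_def zero_sum_def sum.distrib sum_distrib_left[symmetric])

lemma closed_simplex_tangent: "closed (simplex_tangent F J)"
proof -
  have "simplex_tangent F J = zero_sum J \<inter> (\<Inter>i\<in>J-F. {v. 0 \<le> v $ i})"
    by (auto simp: simplex_tangent_def)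
  also have "closed \<dots>"
    by (intro closed_Int closed_INT ballI closed_subspace subspace_zero_sum closed_Collect_le continuous_intros)
  finally show ?thesis .
qed

lemma dim_zero_sum:
  fixes J :: "'n::finite set"
  assumes "J \<noteq> {}"
  shows "dim (zero_sum J) = card J - 1"
proof -
  define S where "S = {v::real^'n. \<forall>i\<in>-J. v $ i = 0}"
  define u :: "real^'n" where "u = (\<chi> i. if i \<in> J then 1 else 0)"
  have subS: "subspace S" by (auto simp: S_def subspace_def)
  have S': "S = {v. \<forall>b\<in>Basis. b \<notin> (\<lambda>i. axis i 1) ` J \<longrightarrow> v \<bullet> b = 0}"
  proof (intro set_eqI iffI)
    fix v assume "v \<in> S"
    then show "v \<in> {v. \<forall>b\<in>Basis. b \<notin> (\<lambda>i. axis i 1) ` J \<longrightarrow> v \<bullet> b = 0}"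
      by (auto simp: S_def Basis_vec_def inner_axis)
  next
    fix v :: "real^'n" assume v: "v \<in> {v. \<forall>b\<in>Basis. b \<notin> (\<lambda>i. axis i 1) ` J \<longrightarrow> v \<bullet> b = 0}"
    have "v $ i = 0" if "i \<notin> J" for i
    proof -
      have "axis i (1::real) \<notin> (\<lambda>i. axis i 1) ` J" using that by (auto simp: axis_eq_axis)
      then have "v \<bullet> axis i 1 = 0" using v by simp
      then show ?thesis by (simp add: inner_axis)
    qed
    then show "v \<in> S" by (simp add: S_def)
  qed
  have "dim S = card ((\<lambda>i. axis i (1::real) :: real^'n) ` J)"
    unfolding S' by (rule dim_substandard) (auto simp: Basis_vec_def)
  then have dimS: "dim S = card J" by (simp add: card_image inj_on_def axis_eq_axis)
  have uS: "u \<in> S" by (simp add: u_def S_def)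
  obtain j where "j \<in> J" using assms by blast
  then have "u $ j \<noteq> 0" by (simp add: u_def)
  then have "u \<noteq> 0" by auto
  have "span {u} \<subseteq> S" using uS subS by (simp add: span_minimal)
  then have "dim {v \<in> S. \<forall>w\<in>span {u}. orthogonal w v} + dim (span {u}) = dim S"
    by (intro dim_subspace_orthogonal_to_vectors subS) auto
  moreover have "{v \<in> S. \<forall>w\<in>span {u}. orthogonal w v} = zero_sum J"
  proof -
    have uv: "u \<bullet> v = (\<Sum>i\<in>UNIV. v $ i)" if "v \<in> S" for v
      using that unfolding inner_vec_def by (intro sum.cong) (auto simp: u_def S_def)
    have "(\<forall>w\<in>span {u}. orthogonal w v) \<longleftrightarrow> u \<bullet> v = 0" for v
      by (auto simp: span_singleton orthogonal_def)
    then show ?thesis by (auto simp: zero_sum_def uv S_def[symmetric]) (auto simp: S_def uv)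
  qed
  moreover have "dim (span {u}) = 1" using \<open>u \<noteq> 0\<close> by simp
  ultimately show ?thesis using dimS by simp
qed

lemma cancels_iff:
  fixes x :: "real^'d^'n"
  assumes L: "subspace L"
  shows "cancels L F J x \<longleftrightarrow> (\<exists>v\<in>zero_sum J. (\<forall>i\<in>J-F. v$i > 0) \<and> (\<forall>\<mu>\<in>L. v \<bullet> evals x \<mu> = 0))"
proof -
  have s: "(\<Sum>i\<in>UNIV. v$i * ((c, \<mu>) \<bullet> lift x i)) = c * (\<Sum>i\<in>UNIV. v $ i) + v \<bullet> evals x \<mu>" for v :: "real^'n" and c \<mu>
    by (simp add: inner_vec_def[of v] evals_def distrib_left sum.distrib sum_distrib_left mult.commute inner_commute[of \<mu>])
  have "(\<forall>\<psi>\<in>UNIV \<times> L. (\<Sum>i\<in>UNIV. v$i * (\<psi> \<bullet> lift x i)) = 0) \<longleftrightarrow>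
      (\<Sum>i\<in>UNIV. v $ i) = 0 \<and> (\<forall>\<mu>\<in>L. v \<bullet> evals x \<mu> = 0)" for v :: "real^'n"
  proof
    assume l: "\<forall>\<psi>\<in>UNIV \<times> L. (\<Sum>i\<in>UNIV. v$i * (\<psi> \<bullet> lift x i)) = 0"
    have "c * (\<Sum>i\<in>UNIV. v $ i) + v \<bullet> evals x \<mu> = 0" if "\<mu> \<in> L" for c \<mu>
      using l that s[of v c \<mu>] by simp
    from this[of 0 1] this[of _ 0] show "(\<Sum>i\<in>UNIV. v $ i) = 0 \<and> (\<forall>\<mu>\<in>L. v \<bullet> evals x \<mu> = 0)"
      using subspace_0[OF L] by (simp add: evals_def zero_vec_def[symmetric])
  next
    assume "(\<Sum>i\<in>UNIV. v $ i) = 0 \<and> (\<forall>\<mu>\<in>L. v \<bullet> evals x \<mu> = 0)"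
    then have "(\<Sum>i\<in>UNIV. v$i * ((c, \<mu>) \<bullet> lift x i)) = 0" if "\<mu> \<in> L" for c \<mu>
      unfolding s using that by simp
    then show "\<forall>\<psi>\<in>UNIV \<times> L. (\<Sum>i\<in>UNIV. v$i * (\<psi> \<bullet> lift x i)) = 0" by blast
  qed
  then show ?thesis unfolding cancels_def zero_sum_def by auto
qed

text \<open>
  As for exposed sets, rescaling turns positivity into a closed condition.
\<close>

lemma borel_cancels:
  fixes L :: "(real^'d) set"
  assumes L: "subspace L"
  shows "{x :: real^'d^'n. cancels L F J x} \<in> sets borel"
proof -
  have "{x :: real^'d^'n. cancels L F J x} =
    {x. \<exists>v. v \<in> zero_sum J \<and> (\<forall>i\<in>J-F. 1 \<le> v$i) \<and> (\<forall>\<mu>\<in>L. v \<bullet> evals x \<mu> = 0)}"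
  proof (intro Collect_cong iffI)
    fix x :: "real^'d^'n" assume "cancels L F J x"
    then obtain v where v: "v \<in> zero_sum J" "\<forall>i\<in>J-F. v$i > 0" "\<forall>\<mu>\<in>L. v \<bullet> evals x \<mu> = 0"
      unfolding cancels_iff[OF L] by blast
    show "\<exists>v. v \<in> zero_sum J \<and> (\<forall>i\<in>J-F. 1 \<le> v$i) \<and> (\<forall>\<mu>\<in>L. v \<bullet> evals x \<mu> = 0)"
    proof -
      obtain c where "c > 0" "\<forall>i\<in>J-F. 1 \<le> c * v$i" using ex_scale_ge_1[OF v(2)] by blast
      then show ?thesis using v
        by (intro exI[of _ "c *\<^sub>R v"] conjI ballI) (auto simp: subspace_scale[OF subspace_zero_sum])
    qed
  next
    fix x :: "real^'d^'n"
    assume "\<exists>v. v \<in> zero_sum J \<and> (\<forall>i\<in>J-F. 1 \<le> v$i) \<and> (\<forall>\<mu>\<in>L. v \<bullet> evals x \<mu> = 0)"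
    then show "cancels L F J x" unfolding cancels_iff[OF L] by (meson less_le_trans zero_less_one)
  qed
  also have "\<dots> \<in> sets borel"
  proof (rule borel_Ex_closed)
    have "{p :: (real^'n) \<times> (real^'d^'n). fst p \<in> zero_sum J \<and> (\<forall>i\<in>J-F. 1 \<le> fst p $ i) \<and> (\<forall>\<mu>\<in>L. fst p \<bullet> evals (snd p) \<mu> = 0)}
      = fst -` zero_sum J \<inter> (\<Inter>i\<in>J-F. {p. 1 \<le> fst p $ i}) \<inter> (\<Inter>\<mu>\<in>L. {p. (\<Sum>i\<in>UNIV. fst p $ i * (snd p $ i \<bullet> \<mu>)) = 0})"
      by (auto simp: inner_vec_def[where 'b='n] evals_def)
    also have "closed \<dots>"
      by (intro closed_Int closed_INT ballI closed_Collect_eq closed_Collect_le closed_vimage_fst closed_subspace subspace_zero_sum continuous_intros)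
    finally show "closed {p :: (real^'n) \<times> (real^'d^'n). fst p \<in> zero_sum J \<and> (\<forall>i\<in>J-F. 1 \<le> fst p $ i) \<and> (\<forall>\<mu>\<in>L. fst p \<bullet> evals (snd p) \<mu> = 0)}" .
  qed
  finally show ?thesis .
qed

lemma span_simplex_tangent:
  fixes F J :: "'n::finite set"
  assumes F: "F \<subseteq> J" "F \<noteq> {}"
  shows "span (simplex_tangent F J) = zero_sum J"
proof
  show "span (simplex_tangent F J) \<subseteq> zero_sum J"
    by (intro span_minimal subspace_zero_sum) (auto simp: simplex_tangent_def)
  obtain f where f: "f \<in> F" using F by blast
  show "zero_sum J \<subseteq> span (simplex_tangent F J)"
  proof
    fix v assume v: "v \<in> zero_sum J"
    define b :: "'n \<Rightarrow> real^'n" where "b i = axis i 1 - axis f 1" for i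
    have b: "b i \<in> simplex_tangent F J" if "i \<in> J" for i
      using that f F by (auto simp: b_def simplex_tangent_def zero_sum_def axis_def sum_subtractf)
    have "(\<Sum>i\<in>J. v $ i) = (\<Sum>i\<in>UNIV. v $ i)" using v by (intro sum.mono_neutral_left) (auto simp: zero_sum_def)
    then have s: "(\<Sum>i\<in>J. v $ i) = 0" using v by (simp add: zero_sum_def)
    have "(\<Sum>i\<in>J. v $ i *\<^sub>R b i) = (\<Sum>i\<in>J. v $ i *\<^sub>R axis i 1) - (\<Sum>i\<in>J. v $ i) *\<^sub>R axis f 1"
      by (simp add: b_def scaleR_diff_right sum_subtractf scaleR_sum_left)
    also have "\<dots> = (\<Sum>i\<in>UNIV. v $ i *\<^sub>R axis i 1)"
      using v s by (simp, intro sum.mono_neutral_left) (auto simp: zero_sum_def)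
    also have "\<dots> = v" using basis_expansion[of v] by (simp add: scalar_mult_eq_scaleR)
    finally have "v = (\<Sum>i\<in>J. v $ i *\<^sub>R b i)" ..
    also have "\<dots> \<in> span (simplex_tangent F J)"
      using b by (intro span_sum span_scale span_base)
    finally show "v \<in> span (simplex_tangent F J)" .
  qed
qed

text \<open>
  Both signs have to be admitted because the affine dependence is determined up to sign only.
\<close>

lemma uniform_sphere_double_tangent:
  fixes F J :: "'n::{finite,wellorder} set"
  assumes F: "F \<subset> J" "F \<noteq> {}"
  shows "measure (uniform_sphere (zero_sum J)) (simplex_tangent F J \<union> uminus ` simplex_tangent F J)
    = 2 * solid_angle (simplex_tangent F J)"
proof -
  let ?V = "zero_sum J" and ?T = "simplex_tangent F J"
  let ?U = "uniform_sphere ?V"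
  interpret U: prob_space ?U by (rule prob_space_uniform_sphere[OF subspace_zero_sum])
  have setsU: "sets ?U = sets borel" by (simp add: uniform_sphere_def)
  have spU: "space ?U = UNIV" using sets_eq_imp_space_eq[OF setsU] by simp
  have T: "?T \<in> sets borel" using closed_simplex_tangent[of F J] by (rule borel_closed)
  have eq: "uminus ` ?T = uminus -` ?T" by force
  have cl: "closed (uminus ` ?T)" using closed_simplex_tangent by (rule closed_negations)
  then have nT: "uminus ` ?T \<in> sets borel" by (rule borel_closed)
  have inv: "distr ?U borel uminus = ?U"
  proof (rule uniform_sphere_orthogonal_invariant[OF subspace_zero_sum])
    show "orthogonal_transformation (uminus :: real^'n::_ \<Rightarrow> real^'n::_)"
      by (simp add: orthogonal_transformation_def linear_uminus)
    show "uminus ` ?V = ?V"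
    proof
      show "uminus ` ?V \<subseteq> ?V" using subspace_neg[OF subspace_zero_sum] by blast
      show "?V \<subseteq> uminus ` ?V" using subspace_neg[OF subspace_zero_sum] by (metis image_eqI minus_minus subsetI)
    qed
  qed
  have "measure ?U (uminus ` ?T) = measure (distr ?U borel uminus) ?T"
    unfolding eq by (subst measure_distr) (use T in \<open>auto simp: spU measurable_cong_sets[OF setsU refl]\<close>)
  then have sym: "measure ?U (uminus ` ?T) = measure ?U ?T" by (simp only: inv)
  \<comment> \<open>The cone and its negative meet only where the coordinate \<open>i\<close> vanishes, and this is a null set.\<close>
  obtain i where i: "i \<in> J" "i \<notin> F" using F by blast
  obtain f where f: "f \<in> F" using F by blast
  have V: "axis i 1 - axis f 1 \<in> ?V" using i f F by (auto simp: zero_sum_def axis_def sum_subtractf)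
  define a where "a = closest_point ?V (axis i 1)"
  have aV: "a \<in> ?V" unfolding a_def by (rule closest_point_subspace(1)[OF subspace_zero_sum])
  have "(axis i 1 - axis f 1) \<bullet> a = (axis i 1 - axis f 1) \<bullet> axis i (1::real)"
    unfolding a_def by (rule inner_closest_point_subspace[OF subspace_zero_sum V])
  also have "\<dots> = 1" using i f by (auto simp: inner_diff_left inner_axis_axis)
  finally have "a \<noteq> 0" by auto
  have "AE y in std_gaussian. sgn (closest_point ?V y) \<notin> ?T \<inter> uminus ` ?T"
    using AE_std_gaussian_hyperplane[OF \<open>a \<noteq> 0\<close>, of 0]
  proof eventually_elim
    fix y assume y: "a \<bullet> y \<noteq> 0"
    have "a \<bullet> y = a \<bullet> closest_point ?V y" by (rule inner_closest_point_subspace[OF subspace_zero_sum aV, symmetric])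
    also have "\<dots> = closest_point ?V y \<bullet> closest_point ?V (axis i 1)" by (simp add: a_def inner_commute)
    also have "\<dots> = closest_point ?V y \<bullet> axis i 1"
      by (intro inner_closest_point_subspace[OF subspace_zero_sum] closest_point_subspace(1)[OF subspace_zero_sum])
    finally have ne: "closest_point ?V y $ i \<noteq> 0" using y by (simp add: inner_axis)
    then have "closest_point ?V y \<noteq> 0" by auto
    then have "sgn (closest_point ?V y) $ i \<noteq> 0" using ne by (simp add: sgn_div_norm)
    moreover have "z $ i = 0" if "z \<in> ?T \<inter> uminus -` ?T" for z
    proof -
      have "z $ i \<ge> 0" "(- z) $ i \<ge> 0" using that i by (auto simp: simplex_tangent_def)
      then show ?thesis by simp
    qed
    ultimately show "sgn (closest_point ?V y) \<notin> ?T \<inter> uminus ` ?T"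
      unfolding eq by blast
  qed
  then have "AE z in ?U. z \<notin> ?T \<inter> uminus ` ?T"
    unfolding uniform_sphere_def
  proof (subst AE_distr_iff)
    have "{z \<in> space borel. z \<notin> ?T \<inter> uminus ` ?T} = space borel - ?T \<inter> uminus ` ?T" by blast
    then show "{z \<in> space borel. z \<notin> ?T \<inter> uminus ` ?T} \<in> sets borel"
      using T nT by (simp only: sets.compl_sets sets.Int)
  qed (use measurable_uniform_sphere_map[OF subspace_zero_sum[of J]] in simp_all)
  then have "measure ?U (?T \<inter> uminus ` ?T) = 0"
    using T nT by (subst U.prob_eq_0) (auto simp: setsU)
  moreover have "measure ?U (?T \<union> uminus ` ?T) = measure ?U ?T + measure ?U (uminus ` ?T) - measure ?U (?T \<inter> uminus ` ?T)"
    using T nT measure_Un3[of ?T ?U "uminus ` ?T"] by (simp add: setsU U.fmeasurable_eq_sets)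
  ultimately have "measure ?U (?T \<union> uminus ` ?T) = 2 * measure ?U ?T" by (simp add: sym)
  also have "measure ?U ?T = solid_angle ?T"
    using F by (simp add: solid_angle_def span_simplex_tangent psubset_imp_subset)
  finally show ?thesis .
qed

text \<open>
  Almost surely, the \<open>card J\<close> points projected to dimension \<open>card J - 2\<close> have exactly one affine
  dependence up to a factor, and it spans the kernel of a matrix whose columns are values of
  functionals at the points. Its direction is uniformly distributed on the sphere of \<open>zero_sum J\<close> and
  independent of the event that \<open>J\<close> is a facet, as this event is invariant under reflections in
  \<open>zero_sum J\<close>. The probability therefore factors into twice the normal angle and twice the tangent
  angle.
\<close>

lemma measure_exposes_cancels:
  fixes F J :: "'n::{finite,wellorder} set" and L L'' :: "(real^'d::{finite,wellorder}) set"
  assumes L: "subspace L" "dim L = card J" and L'': "subspace L''" "dim L'' + 2 = card J"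
    and F: "F \<subset> J" "F \<noteq> {}" and J: "J \<noteq> UNIV"
  shows "measure std_gaussian {x :: (real^'d::_)^'n::_. exposes (UNIV \<times> L) (lift x) J \<and> cancels L'' F J x}
    = 4 * normal_prob J * solid_angle (simplex_tangent F J)"
proof -
  let ?G = "std_gaussian :: ((real^'d::_)^'n::_) measure" and ?H = "std_gaussian :: (real^'n::_) measure"
  let ?P = "?G \<Otimes>\<^sub>M ?H"
  let ?V = "zero_sum J" and ?T = "simplex_tangent F J"
  interpret G: prob_space ?G by (rule prob_space_std_gaussian)
  interpret H: prob_space ?H by (rule prob_space_std_gaussian)
  interpret P: pair_prob_space ?G ?H ..
  have spP: "space ?P = UNIV" by (simp add: space_pair_measure)
  have V: "subspace ?V" by (rule subspace_zero_sum)
  have Jne: "J \<noteq> {}" using F by blast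
  define E where "E = {x :: (real^'d::_)^'n::_. exposes (UNIV \<times> L) (lift x) J}"
  define B where "B = {x :: (real^'d::_)^'n::_. cancels L'' F J x}"
  have Eb: "E \<in> sets borel" unfolding E_def by (intro borel_exposes subspace_Times L subspace_UNIV)
  have Bb: "B \<in> sets borel" unfolding B_def by (rule borel_cancels[OF L''(1)])
  obtain D where D: "D \<subseteq> L''" "independent D" "L'' \<subseteq> span D" "card D = dim L''"
    using basis_exists by blast
  then obtain ms where ms: "set ms = D" "length ms = dim L''"
    by (metis distinct_card finite_distinct_list independent_imp_finite)
  have spanms: "span (set ms) = L''"
    using D L'' ms by (metis span_mono span_eq_iff subset_antisym)
  define w where "w x y = residual (map (\<lambda>m. closest_point ?V (evals x m)) ms) (closest_point ?V y)"
    for x :: "(real^'d::_)^'n::_" and y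
  have len: "length ms < dim ?V" using ms L'' dim_zero_sum[OF Jne] by simp
  \<comment> \<open>Values that are constant on \<open>J\<close> are orthogonal to \<open>zero_sum J\<close> and therefore fixed by the reflections.\<close>
  have inv: "reflect_rows h -` E = E" if h: "h \<in> ?V" for h
  proof -
    have sub: "E \<subseteq> reflect_rows h -` E"
    proof
      fix x assume "x \<in> E"
      then obtain c \<mu> where \<mu>: "\<mu> \<in> L" "\<forall>i\<in>J. evals x \<mu> $ i = c" "\<forall>i\<in>-J. evals x \<mu> $ i > c"
        unfolding E_def mem_Collect_eq exposes_Times_iff by blast
      have "h \<bullet> evals x \<mu> = (\<Sum>i\<in>UNIV. h $ i * c)"
        unfolding inner_vec_def
      proof (intro sum.cong refl)
        show "h $ i \<bullet> evals x \<mu> $ i = h $ i * c" for i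
          using h \<mu>(2) by (cases "i \<in> J") (auto simp: zero_sum_def)
      qed
      also have "\<dots> = 0" using h by (simp add: zero_sum_def sum_distrib_right[symmetric])
      finally have "evals (reflect_rows h x) \<mu> = evals x \<mu>" by (simp add: evals_reflect_rows reflect_orthogonal)
      then show "x \<in> reflect_rows h -` E"
        unfolding E_def vimage_def mem_Collect_eq exposes_Times_iff using \<mu> by (metis (no_types, lifting))
    qed
    moreover have "reflect_rows h (reflect_rows h x) = x" for x
      by (simp add: reflect_rows_def transpose_transpose vec_lambda_beta)
    ultimately have "reflect_rows h -` E \<subseteq> E" using sub by (metis subsetI subsetD vimageD vimageI2)
    then show ?thesis using sub by blast
  qed
  have clC: "closed (?T \<union> uminus ` ?T)"
    using closed_simplex_tangent by (intro closed_Un closed_negations)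
  let ?S = "{(x, y). x \<in> E \<and> sgn (w x y) \<in> ?T \<union> uminus ` ?T}"
  have K: "AE (x, y) in ?P. w x y \<noteq> 0"
    "measure ?P ?S = measure ?G E * measure (uniform_sphere ?V) (?T \<union> uminus ` ?T)"
    "?S \<in> sets ?P"
    unfolding w_def by (rule kernel_direction_uniform[OF V len Eb _ clC], erule inv)+
  have A: "subspace (UNIV \<times> L'' :: (real \<times> (real^'d::_)) set)" by (intro subspace_Times subspace_UNIV L'')
  have dimA: "dim (UNIV \<times> L'' :: (real \<times> (real^'d::_)) set) = card J - 1"
    using dim_Times[of "UNIV :: real set" L''] L'' by simp
  have main: "x \<in> B \<longleftrightarrow> sgn (w x y) \<in> ?T \<union> uminus ` ?T"
    if gp: "in_general_position (UNIV \<times> L'') (lift x)" and w0: "w x y \<noteq> 0" for x y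
  proof -
    have wV: "w x y \<in> ?V"
      unfolding w_def using closest_point_subspace(1)[OF V] by (intro residual_in_subspace[OF V]) auto
    have worth: "w x y \<bullet> evals x \<mu> = 0" if "\<mu> \<in> L''" for \<mu>
    proof -
      have "w x y \<bullet> evals x m = 0" if "m \<in> set ms" for m
      proof -
        have "w x y \<bullet> closest_point ?V (evals x m) = 0"
          unfolding w_def using that by (intro residual_orthogonal) auto
        then show ?thesis using inner_closest_point_subspace[OF V wV] by simp
      qed
      moreover have "subspace {m. w x y \<bullet> evals x m = 0}"
      proof -
        have "evals x (a + b) = evals x a + evals x b" "evals x (c *\<^sub>R a) = c *\<^sub>R evals x a" "evals x 0 = 0" for a b c
          by (simp_all add: evals_def vec_eq_iff inner_add_right)
        then show ?thesis by (auto simp: subspace_def inner_add_right)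
      qed
      ultimately have "span (set ms) \<subseteq> {m. w x y \<bullet> evals x m = 0}" by (intro span_minimal) auto
      then show ?thesis using that spanms by blast
    qed
    \<comment> \<open>A dependence among the points of \<open>J\<close> that vanishes at one of them has too small a support.\<close>
    have ann: "v = 0" if "v \<in> ?V" "\<forall>\<mu>\<in>L''. v \<bullet> evals x \<mu> = 0" "i \<in> J" "v $ i = 0" for v i
    proof (rule in_general_positionD[OF gp])
      show "{i. v $ i \<noteq> 0} \<subseteq> J - {i}" using that by (auto simp: zero_sum_def)
      show "card (J - {i}) \<le> dim (UNIV \<times> L'' :: (real \<times> (real^'d::_)) set)" using that dimA by simp
      fix \<phi> :: "real \<times> (real^'d::_)" assume "\<phi> \<in> UNIV \<times> L''"
      then have "snd \<phi> \<in> L''" by auto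
      then have "v \<bullet> evals x (snd \<phi>) = 0" using that by blast
      then have "(\<Sum>i\<in>UNIV. v $ i * (snd \<phi> \<bullet> x $ i)) = 0"
        by (simp add: inner_vec_def[of v] evals_def inner_commute)
      then show "(\<Sum>i\<in>UNIV. v $ i * (\<phi> \<bullet> lift x i)) = 0"
        using that(1) by (simp add: distrib_left sum.distrib sum_distrib_right[symmetric] zero_sum_def)
    qed
    have wnz: "w x y $ i \<noteq> 0" if "i \<in> J" for i using ann[OF wV _ that] worth w0 by blast
    have sT: "sgn (w x y) \<in> ?T \<longleftrightarrow> (\<forall>i\<in>J-F. w x y $ i > 0)"
    proof -
      have "sgn (w x y) \<in> ?V" using wV V by (simp add: sgn_div_norm subspace_scale)
      moreover have "0 \<le> sgn (w x y) $ i \<longleftrightarrow> w x y $ i > 0" if "i \<in> J" for i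
        using wnz[OF that] w0 by (auto simp: sgn_div_norm zero_le_mult_iff less_le)
      ultimately show ?thesis by (auto simp: simplex_tangent_def)
    qed
    have snT: "sgn (w x y) \<in> uminus ` ?T \<longleftrightarrow> (\<forall>i\<in>J-F. w x y $ i < 0)"
    proof -
      have "sgn (w x y) \<in> uminus ` ?T \<longleftrightarrow> - sgn (w x y) \<in> ?T" by force
      moreover have "- sgn (w x y) \<in> ?V" using wV V by (simp add: sgn_div_norm subspace_scale subspace_neg)
      moreover have "0 \<le> (- sgn (w x y)) $ i \<longleftrightarrow> w x y $ i < 0" if "i \<in> J" for i
        using wnz[OF that] w0 by (auto simp: sgn_div_norm mult_le_0_iff less_le)
      ultimately show ?thesis by (auto simp: simplex_tangent_def)
    qed
    show ?thesis
    proof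
      assume "x \<in> B"
      then obtain v where v: "v \<in> ?V" "\<forall>i\<in>J-F. v$i > 0" "\<forall>\<mu>\<in>L''. v \<bullet> evals x \<mu> = 0"
        unfolding B_def mem_Collect_eq cancels_iff[OF L''(1)] by blast
      obtain i where i: "i \<in> J" "i \<notin> F" using F by blast
      have "v $ i *\<^sub>R w x y - w x y $ i *\<^sub>R v = 0"
        by (rule ann[OF _ _ i(1)])
          (use v wV V worth in \<open>auto simp: subspace_diff subspace_scale inner_diff_left\<close>)
      then have eq: "v $ i * w x y $ l = w x y $ i * v $ l" for l by (simp add: vec_eq_iff)
      have vi: "v $ i > 0" using v i by blast
      consider "w x y $ i > 0" | "w x y $ i < 0" using wnz[OF i(1)] by linarith
      then show "sgn (w x y) \<in> ?T \<union> uminus ` ?T"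
      proof cases
        case 1
        have "w x y $ l > 0" if "l \<in> J - F" for l
        proof -
          have "v $ i * w x y $ l > 0" unfolding eq using 1 v that by simp
          then show ?thesis using vi by (simp add: zero_less_mult_iff)
        qed
        then show ?thesis using sT by blast
      next
        case 2
        have "w x y $ l < 0" if "l \<in> J - F" for l
        proof -
          have "v $ i * w x y $ l < 0" unfolding eq using 2 v that by (simp add: mult_neg_pos)
          then show ?thesis using vi by (simp add: mult_less_0_iff)
        qed
        then show ?thesis using snT by blast
      qed
    next
      assume "sgn (w x y) \<in> ?T \<union> uminus ` ?T"
      then consider "\<forall>i\<in>J-F. w x y $ i > 0" | "\<forall>i\<in>J-F. w x y $ i < 0" using sT snT by blast
      then show "x \<in> B"
      proof cases
        case 1
        then show ?thesis unfolding B_def mem_Collect_eq cancels_iff[OF L''(1)]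
          using wV worth by blast
      next
        case 2
        then show ?thesis unfolding B_def mem_Collect_eq cancels_iff[OF L''(1)]
          using wV worth V by (intro bexI[of _ "- w x y"]) (auto simp: subspace_neg)
      qed
    qed
  qed
  have "measure ?G (E \<inter> B) = measure (distr ?P ?G fst) (E \<inter> B)" by (simp only: H.distr_pair_fst)
  also have "\<dots> = measure ?P (fst -` (E \<inter> B))"
    using Eb Bb by (subst measure_distr) (auto simp: spP)
  also have "\<dots> = measure ?P ?S"
  proof (rule P.finite_measure_eq_AE)
    show "?S \<in> sets ?P" by (rule K(3))
    show "fst -` (E \<inter> B) \<in> sets ?P"
      using measurable_sets[OF measurable_fst[of ?G ?H], of "E \<inter> B"] Eb Bb by (simp add: spP)
    have "AE x in distr ?P ?G fst. in_general_position (UNIV \<times> L'') (lift x)"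
      using AE_in_general_position[OF A] by (simp only: H.distr_pair_fst)
    then have "AE p in ?P. in_general_position (UNIV \<times> L'') (lift (fst p))"
      by (rule AE_distrD[rotated]) simp
    then show "AE p in ?P. p \<in> fst -` (E \<inter> B) \<longleftrightarrow> p \<in> ?S"
      using K(1)
    proof eventually_elim
      fix p assume gp: "in_general_position (UNIV \<times> L'') (lift (fst p))" and w: "case p of (x, y) \<Rightarrow> w x y \<noteq> 0"
      then have "fst p \<in> B \<longleftrightarrow> sgn (w (fst p) (snd p)) \<in> ?T \<union> uminus ` ?T"
        by (intro main) (auto simp: case_prod_beta)
      then show "p \<in> fst -` (E \<inter> B) \<longleftrightarrow> p \<in> ?S" by (auto simp: case_prod_beta)
    qed
  qed
  also have "\<dots> = measure ?G E * (2 * solid_angle ?T)"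
    by (simp only: K(2) uniform_sphere_double_tangent[OF F])
  also have "measure ?G E = 2 * normal_prob J"
    unfolding E_def by (rule measure_exposes_facet[OF L Jne J])
  finally show ?thesis by (simp add: E_def B_def Collect_conj_eq[symmetric])
qed

section \<open>Projections along a plane\<close>

text \<open>
  Functionals in this subspace see the points through their first \<open>r\<close> coordinates only, which are
  \<open>r\<close>-dimensional Gaussian points. This keeps all dimensions within one type.
\<close>

definition coordinate_subspace :: "nat \<Rightarrow> (real^'d::{finite,wellorder}) set" where
  "coordinate_subspace r = {\<mu>. \<forall>b\<in>Basis. b \<notin> std_basis ` {1..r} \<longrightarrow> \<mu> \<bullet> b = 0}"

lemma subspace_coordinate_subspace: "subspace (coordinate_subspace r)"
  unfolding coordinate_subspace_def by (auto simp: subspace_def inner_add_left)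

lemma std_basis_in_Basis: "i \<in> {1..CARD('d)} \<Longrightarrow> (std_basis i :: real^'d::{finite,wellorder}) \<in> Basis"
  by (rule bij_betwE[OF bij_betw_std_basis, rule_format])

lemma std_basis_eq_iff:
  "i \<in> {1..CARD('d)} \<Longrightarrow> j \<in> {1..CARD('d)} \<Longrightarrow> (std_basis i :: real^'d::{finite,wellorder}) = std_basis j \<longleftrightarrow> i = j"
  by (rule inj_on_eq_iff[OF bij_betw_imp_inj_on[OF bij_betw_std_basis]])

lemma inner_std_basis:
  "i \<in> {1..CARD('d)} \<Longrightarrow> j \<in> {1..CARD('d)} \<Longrightarrow>
    (std_basis i :: real^'d::{finite,wellorder}) \<bullet> std_basis j = (if i = j then 1 else 0)"
  by (simp add: inner_Basis std_basis_in_Basis std_basis_eq_iff)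

lemma dim_coordinate_subspace:
  assumes "r \<le> CARD('d)"
  shows "dim (coordinate_subspace r :: (real^'d::{finite,wellorder}) set) = r"
proof -
  have "dim (coordinate_subspace r :: (real^'d::_) set) = card (std_basis ` {1..r} :: (real^'d::_) set)"
    unfolding coordinate_subspace_def
    by (rule dim_substandard) (use assms std_basis_in_Basis[where 'd='d] in auto)
  also have "\<dots> = card {1..r}"
    using assms by (intro card_image) (auto simp: inj_on_def std_basis_eq_iff)
  finally show ?thesis by simp
qed

lemma coordinate_subspace_iff:
  "\<mu> \<in> coordinate_subspace r \<longleftrightarrow> (\<forall>l\<in>{r<..CARD('d)}. (\<mu> :: real^'d::{finite,wellorder}) \<bullet> std_basis l = 0)"
proof -
  have B: "(Basis :: (real^'d::_) set) = std_basis ` {1..CARD('d)}"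
    using bij_betw_std_basis[where 'n='d] by (auto simp: bij_betw_def)
  show ?thesis
  proof
    assume \<mu>: "\<mu> \<in> coordinate_subspace r"
    show "\<forall>l\<in>{r<..CARD('d)}. \<mu> \<bullet> std_basis l = 0"
    proof
      fix l assume l: "l \<in> {r<..CARD('d)}"
      then have "l \<in> {1..CARD('d)}" by auto
      moreover have "(std_basis l :: real^'d::_) \<notin> std_basis ` {1..r}"
      proof
        assume "(std_basis l :: real^'d::_) \<in> std_basis ` {1..r}"
        then obtain i where i: "i \<in> {1..r}" "(std_basis l :: real^'d::_) = std_basis i" by auto
        then have "l = i" using l std_basis_eq_iff[where 'd='d, of l i] by auto
        then show False using i l by auto
      qed
      ultimately show "\<mu> \<bullet> std_basis l = 0" using \<mu> std_basis_in_Basis by (auto simp: coordinate_subspace_def)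
    qed
  next
    assume \<mu>: "\<forall>l\<in>{r<..CARD('d)}. \<mu> \<bullet> std_basis l = 0"
    show "\<mu> \<in> coordinate_subspace r"
      unfolding coordinate_subspace_def
    proof (intro CollectI ballI impI)
      fix b :: "real^'d::_" assume "b \<in> Basis" "b \<notin> std_basis ` {1..r}"
      then obtain l where "l \<in> {1..CARD('d)}" "b = std_basis l" "l \<notin> {1..r}" unfolding B by blast
      then show "\<mu> \<bullet> b = 0" using \<mu> by auto
    qed
  qed
qed

definition face_prob :: "(real^'d) set \<Rightarrow> 'n::finite set \<Rightarrow> real" where
  "face_prob L F = measure std_gaussian {x :: real^'d^'n. exposes (UNIV \<times> L) (lift x) F}"

text \<open>
  Summed over all \<open>F\<close> of a given size, this becomes a product of two angle sums of the simplex
  (\<open>sum_conic_volume\<close>).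
\<close>

definition conic_volume :: "nat \<Rightarrow> 'n::{finite,wellorder} set \<Rightarrow> real" where
  "conic_volume r F = (\<Sum>J | F \<subseteq> J \<and> card J = r. normal_prob J * solid_angle (simplex_tangent F J))"

text \<open>
  A nonzero functional cannot vanish at as many points as the dimension of its family.
\<close>

lemma face_prob_eq_0:
  fixes L :: "(real^'d) set" and F :: "'n::finite set"
  assumes L: "subspace L" "dim L + 1 = card F" and F: "F \<noteq> UNIV"
  shows "face_prob L F = 0"
proof -
  interpret G: prob_space "std_gaussian :: (real^'d^'n) measure" by (rule prob_space_std_gaussian)
  let ?A = "UNIV \<times> L :: (real \<times> (real^'d)) set"
  have A: "subspace ?A" by (intro subspace_Times subspace_UNIV L)
  have dimA: "dim ?A = card F" using dim_Times[of "UNIV :: real set" L] L by simp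
  have "AE x :: real^'d^'n in std_gaussian. x \<notin> {x. exposes ?A (lift x) F}"
    using AE_in_general_position[OF A]
  proof eventually_elim
    fix x :: "real^'d^'n" assume gp: "in_general_position ?A (lift x)"
    show "x \<notin> {x. exposes ?A (lift x) F}"
    proof
      assume "x \<in> {x. exposes ?A (lift x) F}"
      then obtain \<phi> where \<phi>: "\<phi> \<in> ?A" "\<forall>i\<in>F. \<phi> \<bullet> lift x i = 0" "\<forall>i\<in>-F. \<phi> \<bullet> lift x i > 0"
        unfolding exposes_def by blast
      obtain i where "i \<in> -F" using F by blast
      then have "\<phi> \<bullet> lift x i > 0" using \<phi> by blast
      then have "\<phi> \<noteq> 0" by (auto simp del: inner_lift)
      then have "card {i. \<phi> \<bullet> lift x i = 0} < dim ?A" by (rule general_position_card_zeros[OF A gp \<phi>(1)])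
      moreover have "card F \<le> card {i. \<phi> \<bullet> lift x i = 0}" using \<phi>(2) by (intro card_mono) auto
      ultimately show False using dimA by simp
    qed
  qed
  then show ?thesis
    unfolding face_prob_def by (subst G.prob_eq_0) (auto intro!: borel_exposes[OF A])
qed

text \<open>
  The plane that is projected out is spanned by the coordinate directions \<open>a\<close> and \<open>b\<close>. The expected
  number of pivots is twice the left-hand side, and each \<open>J\<close> contributes four times its product of angles
  to it.
\<close>

lemma face_prob_diff:
  fixes F :: "'n::{finite,wellorder} set"
  assumes F: "F \<noteq> {}" "card F < r" and r: "r \<le> CARD('d)" "r + 1 \<le> CARD('n)"
  shows "face_prob (coordinate_subspace r :: (real^'d::{finite,wellorder}) set) F
    - face_prob (coordinate_subspace (r - 2) :: (real^'d::_) set) F = 2 * conic_volume r F"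
proof -
  let ?L = "coordinate_subspace r :: (real^'d::_) set" and ?L'' = "coordinate_subspace (r - 2) :: (real^'d::_) set"
  let ?G = "std_gaussian :: ((real^'d::_)^'n::_) measure"
  interpret G: prob_space ?G by (rule prob_space_std_gaussian)
  have "card F \<ge> 1" using F(1) by (simp add: Suc_le_eq card_gt_0_iff)
  then have r2: "r \<ge> 2" using F by simp
  define A where "A = (UNIV \<times> ?L :: (real \<times> (real^'d::_)) set)"
  define A'' where "A'' = (UNIV \<times> ?L'' :: (real \<times> (real^'d::_)) set)"
  have sub: "subspace ?L" "subspace ?L''" by (rule subspace_coordinate_subspace)+
  have dimL: "dim ?L = r" "dim ?L'' = r - 2" using r by (auto intro!: dim_coordinate_subspace)
  have subA: "subspace A" "subspace A''" unfolding A_def A''_def by (intro subspace_Times subspace_UNIV sub)+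
  have dimA: "dim A = r + 1" "dim A'' = r - 1"
    unfolding A_def A''_def using dim_Times[of "UNIV :: real set" ?L] dim_Times[of "UNIV :: real set" ?L''] sub dimL r2 by auto
  define a where "a = (0 :: real, std_basis r :: real^'d::_)"
  define b where "b = (0 :: real, std_basis (r - 1) :: real^'d::_)"
  have rr: "r \<in> {1..CARD('d)}" "r - 1 \<in> {1..CARD('d)}" using r r2 by auto
  have ab: "a \<bullet> a = 1" "b \<bullet> b = 1" "a \<bullet> b = 0"
    using rr r2 by (auto simp: a_def b_def inner_std_basis)
  have abA: "a \<in> A" "b \<in> A"
    using rr r2 by (auto simp: a_def b_def A_def coordinate_subspace_iff inner_std_basis)
  have A'': "A'' = A \<inter> {\<psi>. a \<bullet> \<psi> = 0 \<and> b \<bullet> \<psi> = 0}"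
  proof -
    have I: "{r - 2<..CARD('d)} = insert r (insert (r - 1) {r<..CARD('d)})" using rr r2 by auto
    have "\<mu> \<in> ?L'' \<longleftrightarrow> \<mu> \<in> ?L \<and> \<mu> \<bullet> std_basis r = 0 \<and> \<mu> \<bullet> std_basis (r - 1) = 0" for \<mu>
      unfolding coordinate_subspace_iff I by blast
    moreover have "(c, \<mu>) \<in> A'' \<longleftrightarrow> \<mu> \<in> ?L''" "(c, \<mu>) \<in> A \<longleftrightarrow> \<mu> \<in> ?L"
      "a \<bullet> (c, \<mu>) = \<mu> \<bullet> std_basis r" "b \<bullet> (c, \<mu>) = \<mu> \<bullet> std_basis (r - 1)" for c \<mu>
      by (simp_all add: A_def A''_def a_def b_def inner_commute[of \<mu>])
    ultimately have eq: "(c, \<mu>) \<in> A'' \<longleftrightarrow> (c, \<mu>) \<in> A \<inter> {\<psi>. a \<bullet> \<psi> = 0 \<and> b \<bullet> \<psi> = 0}" for c \<mu>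
      by (simp only: Int_iff mem_Collect_eq)
    show ?thesis
    proof (rule set_eqI)
      fix \<phi>
      show "\<phi> \<in> A'' \<longleftrightarrow> \<phi> \<in> A \<inter> {\<psi>. a \<bullet> \<psi> = 0 \<and> b \<bullet> \<psi> = 0}"
        using eq[of "fst \<phi>" "snd \<phi>"] by (simp only: prod.collapse)
    qed
  qed
  have dims: "dim A = dim A'' + 2" "dim A \<le> CARD('n)" "card F < dim A - 1" using dimA r r2 F by auto
  have count: "card {J. F \<subseteq> J \<and> card J = dim A - 1 \<and> exposes A (lift x) J \<and> cancels ?L'' F J x}
    = (if exposes A (lift x) F \<and> \<not> exposes A'' (lift x) F then 2 else 0)"
    if "in_general_position A (lift x)" "in_general_position A'' (lift x)" for x :: "(real^'d::_)^'n::_"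
    unfolding cancels_def A''_def[symmetric]
    by (rule card_pivots[OF subA(1) that(1) dims(2) abA ab A'' dims(1) that(2) dims(3)])
  define E where "E J = {x :: (real^'d::_)^'n::_. exposes A (lift x) J \<and> cancels ?L'' F J x}" for J
  define EF where "EF = {x :: (real^'d::_)^'n::_. exposes A (lift x) F}"
  define EF'' where "EF'' = {x :: (real^'d::_)^'n::_. exposes A'' (lift x) F}"
  have meas: "E J \<in> sets borel" "EF \<in> sets borel" "EF'' \<in> sets borel" for J
  proof -
    have "E J = {x. exposes A (lift x) J} \<inter> {x. cancels ?L'' F J x}" by (auto simp: E_def)
    then show "E J \<in> sets borel"
      by (simp only: sets.Int[OF borel_exposes[OF subA(1)] borel_cancels[OF sub(2)]])
    show "EF \<in> sets borel" "EF'' \<in> sets borel" unfolding EF_def EF''_def by (intro borel_exposes subA)+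
  qed
  have mono: "EF'' \<subseteq> EF"
  proof -
    have "A'' \<subseteq> A" unfolding A'' by blast
    then show ?thesis unfolding EF_def EF''_def exposes_def by blast
  qed
  let ?Js = "{J. F \<subseteq> J \<and> card J = r}"
  have AE: "AE x in ?G. (\<Sum>J\<in>?Js. indicator (E J) x) = 2 * (indicator EF x - indicator EF'' x :: real)"
    using AE_in_general_position[OF subA(1)] AE_in_general_position[OF subA(2)]
  proof eventually_elim
    fix x :: "(real^'d::_)^'n::_"
    assume gp: "in_general_position A (lift x)" "in_general_position A'' (lift x)"
    have "(\<Sum>J\<in>?Js. indicator (E J) x) = real (card {J \<in> ?Js. x \<in> E J})"
      by (simp add: indicator_def sum.If_cases Int_def)
    also have "{J \<in> ?Js. x \<in> E J} = {J. F \<subseteq> J \<and> card J = dim A - 1 \<and> exposes A (lift x) J \<and> cancels ?L'' F J x}"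
      using dimA by (auto simp: E_def)
    also have "real (card \<dots>) = 2 * (indicator EF x - indicator EF'' x)"
      unfolding count[OF gp] using mono by (auto simp: EF_def EF''_def indicator_def)
    finally show "(\<Sum>J\<in>?Js. indicator (E J) x) = 2 * (indicator EF x - indicator EF'' x :: real)" .
  qed
  have int: "integrable ?G (indicator S :: _ \<Rightarrow> real)" if "S \<in> sets borel" for S
    using that by (simp add: G.emeasure_eq_measure less_top[symmetric])
  have "2 * (measure ?G EF - measure ?G EF'') = (\<integral>x. 2 * (indicator EF x - indicator EF'' x) \<partial>?G)"
    using meas int by simp
  also have "\<dots> = (\<integral>x. (\<Sum>J\<in>?Js. indicator (E J) x) \<partial>?G)"
    using AE meas by (intro integral_cong_AE) (auto simp: eq_commute)
  also have "\<dots> = (\<Sum>J\<in>?Js. measure ?G (E J))"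
    using meas int by (subst Bochner_Integration.integral_sum) auto
  also have "\<dots> = (\<Sum>J\<in>?Js. 4 * (normal_prob J * solid_angle (simplex_tangent F J)))"
  proof (intro sum.cong refl)
    fix J assume J: "J \<in> ?Js"
    have "J \<noteq> UNIV" using J r by auto
    moreover have "F \<subset> J" using J F by auto
    ultimately show "measure ?G (E J) = 4 * (normal_prob J * solid_angle (simplex_tangent F J))"
      unfolding E_def A_def using measure_exposes_cancels[OF sub(1) _ sub(2), of J F] J F dimL r2 by simp
  qed
  also have "\<dots> = 4 * conic_volume r F" by (simp add: conic_volume_def sum_distrib_left)
  finally show ?thesis by (simp add: face_prob_def EF_def EF''_def A_def A''_def)
qed

text \<open>
  Induction on \<open>r\<close>, removing one dimension at a time from the difference over two dimensions. It starts
  at \<open>r = card F\<close>, where \<open>F\<close> can only be a facet.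
\<close>

lemma face_prob_diff_alternating:
  fixes F :: "'n::{finite,wellorder} set"
  assumes F: "F \<noteq> {}" "card F \<le> r" and r: "r \<le> CARD('d)" "r + 1 \<le> CARD('n)"
  shows "face_prob (coordinate_subspace r :: (real^'d::{finite,wellorder}) set) F
    - face_prob (coordinate_subspace (r - 1) :: (real^'d::_) set) F
    = 2 * (\<Sum>s\<le>r - card F. (-1) ^ s * conic_volume (r - s) F)"
  using F(2) r
proof (induction r rule: dec_induct)
  case base
  let ?L = "coordinate_subspace (card F) :: (real^'d::_) set"
  have FU: "F \<noteq> UNIV" using base by auto
  have c: "card F \<ge> 1" using F(1) by (simp add: Suc_le_eq card_gt_0_iff)
  have "face_prob (coordinate_subspace (card F - 1) :: (real^'d::_) set) F = 0"
    using base c FU by (intro face_prob_eq_0 subspace_coordinate_subspace) (auto simp: dim_coordinate_subspace)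
  moreover have "face_prob ?L F = 2 * normal_prob F"
    unfolding face_prob_def using base FU F
    by (intro measure_exposes_facet subspace_coordinate_subspace dim_coordinate_subspace)
  moreover have "conic_volume (card F) F = normal_prob F"
  proof -
    have "{J. F \<subseteq> J \<and> card J = card F} = {F}" using card_subset_eq[of _ F] by (auto, metis finite subsetD)
    moreover have "simplex_tangent F F = zero_sum F" by (auto simp: simplex_tangent_def)
    ultimately show ?thesis by (simp add: conic_volume_def solid_angle_subspace subspace_zero_sum)
  qed
  ultimately show ?case by simp
next
  case (step r)
  have "face_prob (coordinate_subspace (Suc r) :: (real^'d::_) set) F
    - face_prob (coordinate_subspace (Suc r - 2) :: (real^'d::_) set) F = 2 * conic_volume (Suc r) F"
    using step F by (intro face_prob_diff) auto
  moreover have "Suc r - 2 = r - 1" by simp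
  ultimately have "face_prob (coordinate_subspace (Suc r) :: (real^'d::_) set) F
    - face_prob (coordinate_subspace r :: (real^'d::_) set) F
    = 2 * conic_volume (Suc r) F - 2 * (\<Sum>s\<le>r - card F. (-1) ^ s * conic_volume (r - s) F)"
    using step.IH step.prems by simp
  also have "\<dots> = 2 * (\<Sum>s\<le>Suc (r - card F). (-1) ^ s * conic_volume (Suc r - s) F)"
    unfolding sum.atMost_Suc_shift by (simp add: sum_negf)
  also have "Suc (r - card F) = Suc r - card F" using step by simp
  finally show ?case by simp
qed

section \<open>Projections along a line\<close>

text \<open>
  The tangent cone of the convex hull of the points at the face with vertices in \<open>F\<close>
  (\<open>tangent_cone_points\<close>).
\<close>

definition point_tangent :: "'n::finite set \<Rightarrow> real^'d^'n \<Rightarrow> (real^'d) set" where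
  "point_tangent F x = {z. \<exists>v::real^'n. (\<forall>i\<in>-F. v$i \<ge> 0) \<and> (\<Sum>i\<in>UNIV. v$i) = 0 \<and> z = (\<Sum>i\<in>UNIV. v$i *\<^sub>R x$i)}"

text \<open>
  Since \<open>F\<close> is exposed, the only tangent directions \<open>u\<close> with \<open>-u\<close> tangent are those parallel to the
  face, which excludes \<open>z\<close>. A supporting functional orthogonal to \<open>z\<close> likewise excludes \<open>z\<close> and
  \<open>-z\<close> from the cone. If neither of them is in the cone, then Farkas' lemma provides supporting
  functionals that are negative and positive on \<open>z\<close>; adding a functional exposing \<open>F\<close> and combining the
  results gives one that is orthogonal to \<open>z\<close> and exposes \<open>F\<close>.
\<close>

lemma point_tangent_trichotomy:
  fixes x :: "real^'d^'n"
  assumes E: "exposes UNIV (lift x) F"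
    and z: "\<And>v::real^'n. (\<forall>i\<in>-F. v$i = 0) \<Longrightarrow> (\<Sum>i\<in>UNIV. v$i) = 0 \<Longrightarrow> z \<noteq> (\<Sum>i\<in>UNIV. v$i *\<^sub>R x$i)"
  defines "E' \<equiv> exposes (UNIV \<times> {\<mu>. \<mu> \<bullet> z = 0}) (lift x) F"
  shows "\<not> (z \<in> point_tangent F x \<and> - z \<in> point_tangent F x)" (is ?A)
    and "z \<in> point_tangent F x \<Longrightarrow> \<not> E'"
    and "- z \<in> point_tangent F x \<Longrightarrow> \<not> E'"
    and "z \<in> point_tangent F x \<or> - z \<in> point_tangent F x \<or> E'"
proof -
  have pair: "(\<Sum>i\<in>UNIV. v$i * (\<phi> \<bullet> lift x i)) = fst \<phi> * (\<Sum>i\<in>UNIV. v$i) + snd \<phi> \<bullet> (\<Sum>i\<in>UNIV. v$i *\<^sub>R x$i)"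
    for v :: "real^'n" and \<phi>
    by (simp add: distrib_left sum.distrib inner_sum_right sum_distrib_left mult.commute)
  obtain \<phi>0 where \<phi>0: "\<forall>i\<in>F. \<phi>0 \<bullet> lift x i = 0" "\<forall>i\<in>-F. \<phi>0 \<bullet> lift x i > 0"
    using E unfolding exposes_def by blast
  have key: "\<forall>i\<in>-F. v$i = 0"
    if v: "\<forall>i\<in>-F. v$i \<ge> 0" and \<phi>: "\<forall>i\<in>F. \<phi> \<bullet> lift x i = 0" "\<forall>i\<in>-F. \<phi> \<bullet> lift x i > 0"
      and 0: "(\<Sum>i\<in>UNIV. v$i * (\<phi> \<bullet> lift x i)) = 0" for v :: "real^'n" and \<phi>
  proof
    fix i assume i: "i \<in> -F"
    have nn: "v$l * (\<phi> \<bullet> lift x l) \<ge> 0" for l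
    proof (cases "l \<in> F")
      case True
      then have "\<phi> \<bullet> lift x l = 0" using \<phi> by blast
      then show ?thesis by (simp only: mult_zero_right)
    next
      case False
      then have "\<phi> \<bullet> lift x l > 0" "v$l \<ge> 0" using \<phi> v by blast+
      then show ?thesis by (intro mult_nonneg_nonneg) auto
    qed
    have "\<forall>l\<in>UNIV. v$l * (\<phi> \<bullet> lift x l) = 0"
      by (rule sum_nonneg_eq_0_iff[THEN iffD1, OF _ nn 0]) simp
    then have "v$i * (\<phi> \<bullet> lift x i) = 0" by blast
    moreover have "\<phi> \<bullet> lift x i > 0" using \<phi> i by blast
    ultimately show "v$i = 0" by (simp del: inner_lift)
  qed
  show ?A
  proof
    assume "z \<in> point_tangent F x \<and> - z \<in> point_tangent F x"
    then obtain v v' :: "real^'n" where v: "\<forall>i\<in>-F. v$i \<ge> 0" "(\<Sum>i\<in>UNIV. v$i) = 0" "z = (\<Sum>i\<in>UNIV. v$i *\<^sub>R x$i)"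
      and v': "\<forall>i\<in>-F. v'$i \<ge> 0" "(\<Sum>i\<in>UNIV. v'$i) = 0" "-z = (\<Sum>i\<in>UNIV. v'$i *\<^sub>R x$i)"
      unfolding point_tangent_def by blast
    have "(\<Sum>i\<in>UNIV. v$i *\<^sub>R x$i) + (\<Sum>i\<in>UNIV. v'$i *\<^sub>R x$i) = 0"
      unfolding v(3)[symmetric] v'(3)[symmetric] by simp
    then have "(\<Sum>i\<in>UNIV. (v + v')$i * (\<phi>0 \<bullet> lift x i)) = 0"
      unfolding pair using v(2) v'(2) by (simp add: scaleR_add_left sum.distrib)
    then have "\<forall>i\<in>-F. (v + v')$i = 0" using v v' by (intro key[OF _ \<phi>0]) auto
    then have "\<forall>i\<in>-F. v$i = 0" using v(1) v'(1) by (metis add_nonneg_eq_0_iff vector_add_component)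
    then show False using z v by blast
  qed
  have notE': "\<not> E'" if zz: "w \<in> point_tangent F x" and w: "w = z \<or> w = - z" for w
  proof
    assume E'
    then obtain \<phi> where \<phi>: "snd \<phi> \<bullet> z = 0" "\<forall>i\<in>F. \<phi> \<bullet> lift x i = 0" "\<forall>i\<in>-F. \<phi> \<bullet> lift x i > 0"
      unfolding E'_def exposes_def by (auto simp del: inner_lift)
    obtain v :: "real^'n" where v: "\<forall>i\<in>-F. v$i \<ge> 0" "(\<Sum>i\<in>UNIV. v$i) = 0" "w = (\<Sum>i\<in>UNIV. v$i *\<^sub>R x$i)"
      using zz unfolding point_tangent_def by blast
    have "(\<Sum>i\<in>UNIV. v$i * (\<phi> \<bullet> lift x i)) = 0"
      unfolding pair v(3)[symmetric] using v(2) \<phi>(1) w by auto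
    then have v0: "\<forall>i\<in>-F. v$i = 0" by (rule key[OF v(1) \<phi>(2,3)])
    show False
    proof (cases "w = z")
      case True
      then show ?thesis using z[OF v0 v(2)] v(3) by blast
    next
      case False
      then have "z = (\<Sum>i\<in>UNIV. (- v)$i *\<^sub>R x$i)" using w v(3) by (simp add: sum_negf)
      then show ?thesis using z[of "- v"] v0 v(2) by (simp add: sum_negf)
    qed
  qed
  show "\<not> E'" if "z \<in> point_tangent F x" using notE'[OF that] by blast
  show "\<not> E'" if "- z \<in> point_tangent F x" using notE'[OF that] by blast
  have far: "\<exists>\<phi>. (\<forall>i\<in>F. \<phi> \<bullet> lift x i = 0) \<and> (\<forall>i\<in>-F. \<phi> \<bullet> lift x i \<ge> 0) \<and> snd \<phi> \<bullet> w < 0"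
    if w: "w \<notin> point_tangent F x" for w
  proof (rule ccontr)
    assume no: "\<not> ?thesis"
    have "\<exists>v::real^'n. (\<forall>i\<in>-F. v$i \<ge> 0) \<and> (\<forall>\<phi>\<in>UNIV. (\<Sum>i\<in>UNIV. v$i * (\<phi> \<bullet> lift x i)) = \<phi> \<bullet> (0, w))"
    proof (rule Farkas[OF subspace_UNIV])
      fix \<phi> assume "\<forall>i\<in>F. \<phi> \<bullet> lift x i = 0" "\<forall>i\<in>-F. 0 \<le> \<phi> \<bullet> lift x i"
      then have "\<not> snd \<phi> \<bullet> w < 0" using no by blast
      then show "0 \<le> \<phi> \<bullet> (0, w)" by (cases \<phi>) simp
    qed
    then obtain v :: "real^'n" where v: "\<forall>i\<in>-F. v$i \<ge> 0"
      "\<And>\<phi>. (\<Sum>i\<in>UNIV. v$i * (\<phi> \<bullet> lift x i)) = \<phi> \<bullet> (0, w)" by blast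
    have "(\<Sum>i\<in>UNIV. v$i) = 0" using v(2)[of "(1, 0)"] unfolding pair by simp
    moreover have "w = (\<Sum>i\<in>UNIV. v$i *\<^sub>R x$i)"
      using v(2)[of "(0, _)"] unfolding pair by (intro vector_eq_ldot[THEN iffD1]) simp
    ultimately show False using w v(1) unfolding point_tangent_def by blast
  qed
  show "z \<in> point_tangent F x \<or> - z \<in> point_tangent F x \<or> E'"
  proof (rule ccontr)
    assume no: "\<not> ?thesis"
    have comb: E' if \<phi>: "\<forall>i\<in>F. \<phi> \<bullet> lift x i = 0" "\<forall>i\<in>-F. \<phi> \<bullet> lift x i \<ge> 0"
      and t: "t \<ge> 0" "(snd \<phi>0 + t *\<^sub>R snd \<phi>) \<bullet> z = 0" for \<phi> t
    proof -
      have "(\<phi>0 + t *\<^sub>R \<phi>) \<bullet> lift x i = \<phi>0 \<bullet> lift x i + t * (\<phi> \<bullet> lift x i)" for i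
        by (simp only: inner_add_left inner_scaleR_left)
      moreover have "\<forall>i\<in>-F. \<phi>0 \<bullet> lift x i + t * (\<phi> \<bullet> lift x i) > 0"
        using \<phi>0(2) \<phi>(2) t(1) by (intro ballI add_pos_nonneg mult_nonneg_nonneg) blast+
      moreover have "\<forall>i\<in>F. \<phi>0 \<bullet> lift x i + t * (\<phi> \<bullet> lift x i) = 0"
        using \<phi>0(1) \<phi>(1) by (simp del: inner_lift)
      moreover have "\<phi>0 + t *\<^sub>R \<phi> \<in> UNIV \<times> {\<mu>. \<mu> \<bullet> z = 0}"
        using t(2) by (simp add: mem_Times_iff)
      ultimately show E' unfolding E'_def exposes_def
        by (intro bexI[of _ "\<phi>0 + t *\<^sub>R \<phi>"] conjI) (simp_all only: not_False_eq_True)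
    qed
    define \<alpha> where "\<alpha> = snd \<phi>0 \<bullet> z"
    obtain \<phi> where \<phi>: "\<forall>i\<in>F. \<phi> \<bullet> lift x i = 0" "\<forall>i\<in>-F. \<phi> \<bullet> lift x i \<ge> 0" "snd \<phi> \<bullet> z < 0"
      using far[of z] no by blast
    obtain \<psi> where \<psi>: "\<forall>i\<in>F. \<psi> \<bullet> lift x i = 0" "\<forall>i\<in>-F. \<psi> \<bullet> lift x i \<ge> 0" "snd \<psi> \<bullet> z > 0"
      using far[of "- z"] no by auto
    consider "\<alpha> \<ge> 0" | "\<alpha> < 0" by linarith
    then have E'
    proof cases
      case 1
      show ?thesis
        by (rule comb[OF \<phi>(1,2), of "- \<alpha> / (snd \<phi> \<bullet> z)"])
          (use 1 \<phi>(3) in \<open>auto simp: inner_add_left inner_diff_left \<alpha>_def divide_nonneg_neg divide_nonpos_neg\<close>)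
    next
      case 2
      show ?thesis
        by (rule comb[OF \<psi>(1,2), of "- \<alpha> / (snd \<psi> \<bullet> z)"])
          (use 2 \<psi>(3) in \<open>auto simp: inner_add_left inner_diff_left \<alpha>_def divide_nonpos_pos\<close>)
    qed
    with no show False by blast
  qed
qed

lemma borel_point_tangent:
  "{(x :: real^'d^'n, z). z \<in> point_tangent F x} \<in> sets borel"
proof -
  have "{p. \<exists>v::real^'n. (\<forall>i\<in>-F. v$i \<ge> 0) \<and> (\<Sum>i\<in>UNIV. v$i) = 0 \<and> snd p = (\<Sum>i\<in>UNIV. v$i *\<^sub>R fst (p :: (real^'d^'n) \<times> _) $ i)} \<in> sets borel"
  proof (rule borel_Ex_closed)
    have "{q :: (real^'n) \<times> ((real^'d^'n) \<times> (real^'d)). (\<forall>i\<in>-F. 0 \<le> fst q $ i) \<and> (\<Sum>i\<in>UNIV. fst q $ i) = 0 \<and>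
        snd (snd q) = (\<Sum>i\<in>UNIV. fst q $ i *\<^sub>R fst (snd q) $ i)}
      = (\<Inter>i\<in>-F. {q. 0 \<le> fst q $ i}) \<inter> {q. (\<Sum>i\<in>UNIV. fst q $ i) = 0} \<inter>
        {q. snd (snd q) = (\<Sum>i\<in>UNIV. fst q $ i *\<^sub>R fst (snd q) $ i)}" by auto
    also have "closed \<dots>"
      by (intro closed_Int closed_INT ballI closed_Collect_eq closed_Collect_le continuous_intros)
    finally show "closed {q :: (real^'n) \<times> ((real^'d^'n) \<times> (real^'d)). (\<forall>i\<in>-F. 0 \<le> fst q $ i) \<and> (\<Sum>i\<in>UNIV. fst q $ i) = 0 \<and>
        snd (snd q) = (\<Sum>i\<in>UNIV. fst q $ i *\<^sub>R fst (snd q) $ i)}" .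
  qed
  also have "{p. \<exists>v::real^'n. (\<forall>i\<in>-F. v$i \<ge> 0) \<and> (\<Sum>i\<in>UNIV. v$i) = 0 \<and> snd p = (\<Sum>i\<in>UNIV. v$i *\<^sub>R fst (p :: (real^'d^'n) \<times> _) $ i)}
    = {(x :: real^'d^'n, z). z \<in> point_tangent F x}" by (auto simp: point_tangent_def)
  finally show ?thesis .
qed

lemma borel_exposes_orthogonal:
  "{(x :: real^'d^'n, z). exposes (UNIV \<times> {\<mu>. \<mu> \<bullet> z = 0}) (lift x) F} \<in> sets borel"
proof -
  have "{(x :: real^'d^'n, z :: real^'d). exposes {\<phi>. (\<phi>, z) \<in> {q. snd (fst q) \<bullet> snd q = 0}} (lift x) F} \<in> sets borel"
    by (rule borel_exposes_family) (auto intro!: closed_Collect_eq continuous_intros)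
  moreover have "UNIV \<times> {\<mu>. \<mu> \<bullet> z = 0} = {\<phi> :: real \<times> (real^'d). (\<phi>, z) \<in> {q. snd (fst q) \<bullet> snd q = 0}}" for z
    by auto
  ultimately show ?thesis by simp
qed

text \<open>
  By rotational invariance all directions of projection are equivalent.
\<close>

lemma measure_exposes_orthogonal:
  fixes z :: "real^'d::{finite,wellorder}"
  assumes z: "z \<noteq> 0"
  shows "measure std_gaussian {x :: (real^'d::_)^'n::finite. exposes (UNIV \<times> {\<mu>. \<mu> \<bullet> z = 0}) (lift x) F}
    = face_prob (coordinate_subspace (CARD('d) - 1) :: (real^'d::_) set) F"
proof -
  define b where "b = (std_basis CARD('d) :: real^'d::_)"
  have "CARD('d) \<in> {1..CARD('d)}" by simp
  then have "norm b = 1" unfolding b_def by (intro norm_Basis std_basis_in_Basis)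
  define u where "u = sgn z"
  have "norm u = norm b" using z \<open>norm b = 1\<close> by (simp add: u_def norm_sgn)
  define h where "h = u - b"
  have hu: "reflect h u = b" unfolding h_def by (rule reflect_diff) fact
  define L where "L = (coordinate_subspace (CARD('d) - 1) :: (real^'d::_) set)"
  have coord: "\<mu> \<in> L \<longleftrightarrow> \<mu> \<bullet> b = 0" for \<mu> :: "real^'d::_"
  proof -
    have "{CARD('d) - 1<..CARD('d)} = {CARD('d)}" by auto
    then show ?thesis unfolding L_def coordinate_subspace_iff b_def by simp
  qed
  let ?f = "\<lambda>x :: (real^'d::_)^'n::finite. \<chi> i. reflect h (x $ i)"
  let ?S = "{x :: (real^'d::_)^'n. exposes (UNIV \<times> L) (lift x) F}"
  have S: "?S \<in> sets borel"
    unfolding L_def by (intro borel_exposes subspace_Times subspace_UNIV subspace_coordinate_subspace)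
  have fm: "?f \<in> borel_measurable borel" by (intro measurable_vec_lambda) measurable
  have sw: "\<mu> \<bullet> z = 0 \<longleftrightarrow> reflect h \<mu> \<bullet> b = 0" for \<mu>
  proof -
    have "reflect h \<mu> \<bullet> b = reflect h \<mu> \<bullet> reflect h u" by (simp add: hu)
    also have "\<dots> = (\<mu> \<bullet> z) / norm z" by (simp add: inner_reflect u_def sgn_div_norm divide_inverse mult.commute)
    finally show ?thesis using z by simp
  qed
  have "?f -` ?S = {x. exposes (UNIV \<times> {\<mu>. \<mu> \<bullet> z = 0}) (lift x) F}"
  proof (intro set_eqI iffI)
    fix x assume "x \<in> ?f -` ?S"
    then obtain c \<mu> where \<mu>: "\<mu> \<bullet> b = 0" "\<forall>i\<in>F. c + \<mu> \<bullet> reflect h (x $ i) = 0" "\<forall>i\<in>-F. c + \<mu> \<bullet> reflect h (x $ i) > 0"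
      unfolding exposes_def by (auto simp: coord)
    have "reflect h \<mu> \<bullet> z = 0" using \<mu>(1) by (simp add: sw)
    then show "x \<in> {x. exposes (UNIV \<times> {\<mu>. \<mu> \<bullet> z = 0}) (lift x) F}"
      unfolding exposes_def using \<mu>(2,3) by (intro CollectI bexI[of _ "(c, reflect h \<mu>)"]) (auto simp: inner_reflect_swap)
  next
    fix x assume "x \<in> {x. exposes (UNIV \<times> {\<mu>. \<mu> \<bullet> z = 0}) (lift x) F}"
    then obtain c \<mu> where \<mu>: "\<mu> \<bullet> z = 0" "\<forall>i\<in>F. c + \<mu> \<bullet> x $ i = 0" "\<forall>i\<in>-F. c + \<mu> \<bullet> x $ i > 0"
      unfolding exposes_def by auto
    then show "x \<in> ?f -` ?S"
      unfolding exposes_def vimage_def mem_Collect_eq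
      by (intro bexI[of _ "(c, reflect h \<mu>)"]) (auto simp: inner_reflect coord sw[symmetric])
  qed
  moreover have "measure std_gaussian ?S = measure (distr std_gaussian borel ?f) ?S"
    by (simp only: distr_std_gaussian_map_components[OF measurable_reflect distr_std_gaussian_reflect])
  moreover have "\<dots> = measure std_gaussian (?f -` ?S)" using fm S by (subst measure_distr) auto
  ultimately show ?thesis by (simp add: face_prob_def L_def)
qed

text \<open>
  The trichotomy is integrated over the points and an independent Gaussian direction \<open>z\<close>, which is
  almost surely not parallel to the at most \<open>d - 1\<close> dimensional affine hull of \<open>F\<close>. The laws of
  \<open>z\<close> and \<open>-z\<close> agree.
\<close>

lemma measure_exposes_tangent:
  fixes F :: "'n::finite set"
  assumes F: "F \<noteq> {}" "card F \<le> CARD('d::{finite,wellorder})"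
  shows "2 * measure (std_gaussian \<Otimes>\<^sub>M std_gaussian)
      {(x :: (real^'d::_)^'n, z). exposes UNIV (lift x) F \<and> z \<in> point_tangent F x}
    = face_prob (coordinate_subspace CARD('d) :: (real^'d::_) set) F
      - face_prob (coordinate_subspace (CARD('d) - 1) :: (real^'d::_) set) F"
proof -
  let ?G = "std_gaussian :: ((real^'d::_)^'n) measure" and ?H = "std_gaussian :: (real^'d::_) measure"
  let ?P = "?G \<Otimes>\<^sub>M ?H"
  interpret G: prob_space ?G by (rule prob_space_std_gaussian)
  interpret H: prob_space ?H by (rule prob_space_std_gaussian)
  interpret P: pair_prob_space ?G ?H ..
  have spP: "space ?P = UNIV" by (simp add: space_pair_measure)
  have sP: "sets ?P = sets borel"
    unfolding borel_prod[symmetric] by (intro sets_pair_measure_cong) auto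
  define E where "E = {(x :: (real^'d::_)^'n, z :: real^'d::_). exposes UNIV (lift x) F}"
  define T where "T = {(x :: (real^'d::_)^'n, z :: real^'d::_). z \<in> point_tangent F x}"
  define T' where "T' = {(x :: (real^'d::_)^'n, z :: real^'d::_). - z \<in> point_tangent F x}"
  define O' where "O' = {(x :: (real^'d::_)^'n, z :: real^'d::_). exposes (UNIV \<times> {\<mu>. \<mu> \<bullet> z = 0}) (lift x) F}"
  have Eb: "{x :: (real^'d::_)^'n. exposes UNIV (lift x) F} \<in> sets borel" by (intro borel_exposes subspace_UNIV)
  have Em: "E \<in> sets ?P"
  proof -
    have "E = {x :: (real^'d::_)^'n. exposes UNIV (lift x) F} \<times> UNIV" by (auto simp: E_def)
    then show ?thesis using Eb by auto
  qed
  have Tm: "T \<in> sets ?P" unfolding T_def sP by (rule borel_point_tangent)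
  have Om: "O' \<in> sets ?P" unfolding O'_def sP by (rule borel_exposes_orthogonal)
  let ?n = "\<lambda>p :: ((real^'d::_)^'n) \<times> (real^'d::_). (fst p, - snd p)"
  have nm: "?n \<in> measurable ?P ?P" by measurable
  have T'n: "T' = ?n -` T" by (auto simp: T_def T'_def)
  have T'm: "T' \<in> sets ?P" using measurable_sets[OF nm Tm] by (simp add: spP T'n)
  have dn: "distr ?P ?P ?n = ?P"
  proof -
    have "distr ?G ?G (\<lambda>x. x) = ?G" by (rule distr_id2) simp
    moreover have "distr ?H ?H uminus = ?H"
    proof -
      have "distr ?H ?H uminus = distr ?H borel uminus" by (rule distr_cong) auto
      then show ?thesis using distr_std_gaussian_uminus[where 'n='d] by simp
    qed
    ultimately have "?P = distr ?G ?G (\<lambda>x. x) \<Otimes>\<^sub>M distr ?H ?H uminus" by simp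
    also have "\<dots> = distr ?P (?G \<Otimes>\<^sub>M ?H) (\<lambda>(x, y). (x, - y))"
      by (rule pair_measure_distr) (auto intro!: prob_space_imp_sigma_finite H.prob_space_distr)
    also have "(\<lambda>(x, y). (x, - y)) = ?n" by auto
    finally show ?thesis ..
  qed
  have TT': "measure ?P (E \<inter> T') = measure ?P (E \<inter> T)"
  proof -
    have "measure ?P (E \<inter> T) = measure (distr ?P ?P ?n) (E \<inter> T)" by (simp only: dn)
    also have "\<dots> = measure ?P (?n -` (E \<inter> T))" using Em Tm nm by (subst measure_distr) (auto simp: spP)
    also have "?n -` (E \<inter> T) = E \<inter> T'" by (auto simp: E_def T_def T'_def)
    finally show ?thesis ..
  qed
  have OE: "O' \<subseteq> E" by (auto simp: O'_def E_def exposes_def simp del: inner_lift)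
  have null: "AE p in ?P. indicator E p = indicator (E \<inter> T) p + indicator (E \<inter> T') p + (indicator O' p :: real)"
  proof (rule P.AE_pair_measure)
    have [measurable]: "E \<in> sets ?P" "T \<in> sets ?P" "T' \<in> sets ?P" "O' \<in> sets ?P" by fact+
    show "{p \<in> space ?P. indicator E p = indicator (E \<inter> T) p + indicator (E \<inter> T') p + (indicator O' p :: real)} \<in> sets ?P"
      by measurable
    show "AE x in ?G. AE z in ?H. indicator E (x, z) = indicator (E \<inter> T) (x, z) + indicator (E \<inter> T') (x, z) + (indicator O' (x, z) :: real)"
    proof (rule AE_I2)
      fix x :: "(real^'d::_)^'n"
      obtain f where f: "f \<in> F" using F by blast
      \<comment> \<open>The affine hull of the points of \<open>F\<close> has dimension less than \<open>d\<close>, so that the direction \<open>z\<close> is almost surely not parallel to it.\<close>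
      let ?S = "(\<lambda>i. x $ i - x $ f) ` (F - {f})"
      have "card ?S \<le> card (F - {f})" by (rule card_image_le) simp
      also have "\<dots> < card F" using f by (intro card_Diff1_less) auto
      finally have lt: "card ?S < dim (UNIV :: (real^'d::_) set)" using F by simp
      have fin: "finite ?S" by simp
      have "\<exists>\<mu>. \<mu> \<noteq> 0 \<and> (\<forall>s\<in>?S. \<mu> \<bullet> s = 0)"
      proof (rule orthogonal_in_subspace[OF subspace_UNIV fin lt])
        fix \<mu> :: "real^'d::_" assume "\<mu> \<noteq> 0" "\<And>s. s \<in> ?S \<Longrightarrow> \<mu> \<bullet> s = 0"
        then show "\<exists>\<mu>. \<mu> \<noteq> 0 \<and> (\<forall>s\<in>?S. \<mu> \<bullet> s = 0)" by blast
      qed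
      then obtain \<mu> :: "real^'d::_" where \<mu>: "\<mu> \<noteq> 0" "\<forall>s\<in>?S. \<mu> \<bullet> s = 0" by blast
      have \<mu>F: "\<mu> \<bullet> x $ i = \<mu> \<bullet> x $ f" if "i \<in> F" for i
        using \<mu>(2) that by (cases "i = f") (auto simp: inner_diff_right)
      show "AE z in ?H. indicator E (x, z) = indicator (E \<inter> T) (x, z) + indicator (E \<inter> T') (x, z) + (indicator O' (x, z) :: real)"
        using AE_std_gaussian_hyperplane[OF \<mu>(1), of 0]
      proof eventually_elim
        fix z assume z: "\<mu> \<bullet> z \<noteq> 0"
        have nz: "z \<noteq> (\<Sum>i\<in>UNIV. v$i *\<^sub>R x$i)" if v: "\<forall>i\<in>-F. v$i = 0" "(\<Sum>i\<in>UNIV. v$i) = 0" for v :: "real^'n"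
        proof
          assume "z = (\<Sum>i\<in>UNIV. v$i *\<^sub>R x$i)"
          then have "\<mu> \<bullet> z = (\<Sum>i\<in>UNIV. v$i * (\<mu> \<bullet> x$i))" by (simp add: inner_sum_right)
          also have "\<dots> = (\<Sum>i\<in>UNIV. v$i * (\<mu> \<bullet> x$f))"
          proof (intro sum.cong refl)
            show "v$i * (\<mu> \<bullet> x$i) = v$i * (\<mu> \<bullet> x$f)" for i
              using v(1) \<mu>F[of i] by (cases "i \<in> F") auto
          qed
          also have "\<dots> = 0" using v(2) by (simp add: sum_distrib_right[symmetric])
          finally show False using z by simp
        qed
        show "indicator E (x, z) = indicator (E \<inter> T) (x, z) + indicator (E \<inter> T') (x, z) + (indicator O' (x, z) :: real)"
        proof (cases "exposes UNIV (lift x) F")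
          case True
          note tri = point_tangent_trichotomy[OF True nz]
          consider "z \<in> point_tangent F x" "- z \<notin> point_tangent F x" "(x, z) \<notin> O'"
            | "z \<notin> point_tangent F x" "- z \<in> point_tangent F x" "(x, z) \<notin> O'"
            | "z \<notin> point_tangent F x" "- z \<notin> point_tangent F x" "(x, z) \<in> O'"
            using tri unfolding O'_def by blast
          then show ?thesis using True by cases (auto simp: E_def T_def T'_def)
        next
          case False
          then have "(x, z) \<notin> E" "(x, z) \<notin> O'" using OE by (auto simp: E_def)
          then show ?thesis by simp
        qed
      qed
    qed
  qed
  have int: "integrable ?P (indicator S :: _ \<Rightarrow> real)" if "S \<in> sets ?P" for S
    using that by (simp add: P.emeasure_eq_measure less_top[symmetric])
  have "measure ?P E = (\<integral>p. indicator E p \<partial>?P)" using Em by simp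
  also have "\<dots> = (\<integral>p. indicator (E \<inter> T) p + indicator (E \<inter> T') p + indicator O' p \<partial>?P)"
    using null Em Tm T'm Om by (intro integral_cong_AE) auto
  also have "\<dots> = measure ?P (E \<inter> T) + measure ?P (E \<inter> T') + measure ?P O'"
    using int[of "E \<inter> T"] int[of "E \<inter> T'"] int[OF Om] Em Tm T'm Om by simp
  finally have sum: "measure ?P E = 2 * measure ?P (E \<inter> T) + measure ?P O'" by (simp add: TT')
  have "measure ?P E = measure ?G {x. exposes UNIV (lift x) F}"
  proof -
    have "measure ?G {x. exposes UNIV (lift x) F} = measure (distr ?P ?G fst) {x. exposes UNIV (lift x) F}"
      by (simp only: H.distr_pair_fst)
    also have "\<dots> = measure ?P (fst -` {x. exposes UNIV (lift x) F})"
      using Eb by (subst measure_distr) (auto simp: spP)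
    also have "fst -` {x. exposes UNIV (lift x) F} = E" by (auto simp: E_def)
    finally show ?thesis ..
  qed
  also have "\<dots> = face_prob (coordinate_subspace CARD('d) :: (real^'d::_) set) F"
  proof -
    have "(coordinate_subspace CARD('d) :: (real^'d::_) set) = UNIV" by (auto simp: coordinate_subspace_iff)
    then show ?thesis by (simp add: face_prob_def)
  qed
  finally have 1: "measure ?P E = face_prob (coordinate_subspace CARD('d) :: (real^'d::_) set) F" .
  have 2: "measure ?P O' = face_prob (coordinate_subspace (CARD('d) - 1) :: (real^'d::_) set) F" (is "_ = ?c")
  proof -
    have "emeasure ?P O' = (\<integral>\<^sup>+z. emeasure ?G ((\<lambda>x. (x, z)) -` O') \<partial>?H)"
      by (rule P.emeasure_pair_measure_alt2[OF Om])
    also have "\<dots> = (\<integral>\<^sup>+z. ennreal ?c \<partial>?H)"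
    proof (rule nn_integral_cong_AE)
      have "AE z in ?H. axis undefined 1 \<bullet> z \<noteq> 0"
        by (rule AE_std_gaussian_hyperplane) (simp add: axis_eq_0_iff)
      then show "AE z in ?H. emeasure ?G ((\<lambda>x. (x, z)) -` O') = ennreal ?c"
      proof eventually_elim
        fix z :: "real^'d::_" assume "axis undefined 1 \<bullet> z \<noteq> 0"
        then have "z \<noteq> 0" by auto
        moreover have "(\<lambda>x. (x, z)) -` O' = {x. exposes (UNIV \<times> {\<mu>. \<mu> \<bullet> z = 0}) (lift x) F}" by (auto simp: O'_def)
        ultimately show "emeasure ?G ((\<lambda>x. (x, z)) -` O') = ennreal ?c"
          using measure_exposes_orthogonal[of z F] by (simp add: G.emeasure_eq_measure)
      qed
    qed
    also have "\<dots> = ennreal ?c" using H.emeasure_space_1 by simp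
    finally have "ennreal (measure ?P O') = ennreal ?c" by (simp add: P.emeasure_eq_measure)
    then show ?thesis by (simp add: face_prob_def)
  qed
  have "E \<inter> T = {(x :: (real^'d::_)^'n, z). exposes UNIV (lift x) F \<and> z \<in> point_tangent F x}" by (auto simp: E_def T_def)
  then show ?thesis using sum 1 2 by simp
qed

section \<open>Faces and tangent cones of a convex hull\<close>

text \<open>
  The coefficients are indexed by the points and not by their positions, which covers families with
  repetitions.
\<close>

lemma convex_hull_indexed_image:
  fixes y :: "'n::finite \<Rightarrow> 'a::real_vector"
  shows "convex hull (y ` I) = {\<Sum>i\<in>UNIV. v$i *\<^sub>R y i | v::real^'n. (\<forall>i\<in>-I. v$i = 0) \<and> (\<forall>i\<in>I. v$i \<ge> 0) \<and> (\<Sum>i\<in>UNIV. v$i) = 1}"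
    (is "_ = ?C")
proof
  show "convex hull (y ` I) \<subseteq> ?C"
  proof (rule hull_minimal)
    show "y ` I \<subseteq> ?C"
    proof
      fix p assume "p \<in> y ` I"
      then obtain i where i: "i \<in> I" "p = y i" by blast
      have "p = (\<Sum>l\<in>UNIV. (axis i 1 :: real^'n)$l *\<^sub>R y l)"
        by (simp add: i axis_def if_distrib[of "\<lambda>c. c *\<^sub>R _"] cong: if_cong)
      moreover have "\<forall>l\<in>-I. (axis i 1 :: real^'n)$l = 0" "\<forall>l\<in>I. (axis i 1 :: real^'n)$l \<ge> 0"
        "(\<Sum>l\<in>UNIV. (axis i 1 :: real^'n)$l) = 1"
        using i by (auto simp: axis_def)
      ultimately show "p \<in> ?C" by blast
    qed
    show "convex ?C"
    proof (rule convexI)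
      fix p q and s t :: real assume "p \<in> ?C" "q \<in> ?C" and st: "0 \<le> s" "0 \<le> t" "s + t = 1"
      then obtain v w :: "real^'n" where v: "\<forall>i\<in>-I. v$i = 0" "\<forall>i\<in>I. v$i \<ge> 0" "(\<Sum>i\<in>UNIV. v$i) = 1" "p = (\<Sum>i\<in>UNIV. v$i *\<^sub>R y i)"
        and w: "\<forall>i\<in>-I. w$i = 0" "\<forall>i\<in>I. w$i \<ge> 0" "(\<Sum>i\<in>UNIV. w$i) = 1" "q = (\<Sum>i\<in>UNIV. w$i *\<^sub>R y i)"
        by blast
      let ?u = "s *\<^sub>R v + t *\<^sub>R w"
      have "s *\<^sub>R p + t *\<^sub>R q = (\<Sum>i\<in>UNIV. ?u$i *\<^sub>R y i)"
        by (simp add: v(4) w(4) scaleR_sum_right scaleR_add_left sum.distrib)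
      moreover have "(\<Sum>i\<in>UNIV. ?u$i) = 1"
        using v(3) w(3) st by (simp add: sum.distrib sum_distrib_left[symmetric])
      moreover have "\<forall>i\<in>-I. ?u$i = 0" "\<forall>i\<in>I. ?u$i \<ge> 0" using v w st by auto
      ultimately show "s *\<^sub>R p + t *\<^sub>R q \<in> ?C" by blast
    qed
  qed
  show "?C \<subseteq> convex hull (y ` I)"
  proof
    fix p assume "p \<in> ?C"
    then obtain v :: "real^'n" where v: "\<forall>i\<in>-I. v$i = 0" "\<forall>i\<in>I. v$i \<ge> 0" "(\<Sum>i\<in>UNIV. v$i) = 1" "p = (\<Sum>i\<in>UNIV. v$i *\<^sub>R y i)"
      by blast
    have "p = (\<Sum>i\<in>I. v$i *\<^sub>R y i)" unfolding v(4) using v(1) by (intro sum.mono_neutral_right) auto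
    moreover have "(\<Sum>i\<in>I. v$i) = 1" unfolding v(3)[symmetric] using v(1) by (intro sum.mono_neutral_left) auto
    ultimately show "p \<in> convex hull (y ` I)"
      using v(2) by (simp only:) (rule convex_sum[OF _ convex_convex_hull], auto intro: hull_inc)
  qed
qed

text \<open>
  For the inclusion from right to left, a point of the relative interior of the face is written with
  positive coefficients at all vertices of \<open>I\<close>, which leaves room for a small step in any direction of
  the right-hand side.
\<close>

lemma tangent_cone_convex_hull:
  fixes y :: "'n::finite \<Rightarrow> 'a::euclidean_space"
  assumes I: "I \<noteq> {}" "I \<subseteq> J"
  shows "tangent_cone (convex hull (y ` I)) (convex hull (y ` J)) =
    {\<Sum>i\<in>UNIV. v$i *\<^sub>R y i | v::real^'n. (\<forall>i\<in>-J. v$i = 0) \<and> (\<forall>i\<in>J-I. v$i \<ge> 0) \<and> (\<Sum>i\<in>UNIV. v$i) = 0}"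
    (is "_ = ?C")
proof
  show "tangent_cone (convex hull (y ` I)) (convex hull (y ` J)) \<subseteq> ?C"
  proof
    fix u assume "u \<in> tangent_cone (convex hull (y ` I)) (convex hull (y ` J))"
    then obtain f e where fe: "f \<in> rel_interior (convex hull (y ` I))" "e > 0" "f + e *\<^sub>R u \<in> convex hull (y ` J)"
      unfolding tangent_cone_def by blast
    have "f \<in> convex hull (y ` I)" using fe(1) rel_interior_subset by blast
    then obtain q :: "real^'n" where q: "\<forall>i\<in>-I. q$i = 0" "\<forall>i\<in>I. q$i \<ge> 0" "(\<Sum>i\<in>UNIV. q$i) = 1" "f = (\<Sum>i\<in>UNIV. q$i *\<^sub>R y i)"
      unfolding convex_hull_indexed_image by blast
    obtain p :: "real^'n" where p: "\<forall>i\<in>-J. p$i = 0" "\<forall>i\<in>J. p$i \<ge> 0" "(\<Sum>i\<in>UNIV. p$i) = 1" "f + e *\<^sub>R u = (\<Sum>i\<in>UNIV. p$i *\<^sub>R y i)"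
      using fe(3) unfolding convex_hull_indexed_image by blast
    let ?v = "(1 / e) *\<^sub>R (p - q)"
    have "(\<Sum>i\<in>UNIV. (p - q)$i *\<^sub>R y i) = e *\<^sub>R u"
      using p(4) q(4) by (simp add: scaleR_diff_left sum_subtractf) (metis add_diff_cancel_left')
    then have "(1 / e) *\<^sub>R (\<Sum>i\<in>UNIV. (p - q)$i *\<^sub>R y i) = u" using fe(2) by simp
    then have "u = (\<Sum>i\<in>UNIV. ?v$i *\<^sub>R y i)" by (simp add: scaleR_sum_right)
    moreover have "(\<Sum>i\<in>UNIV. ?v$i) = 0"
      using p(3) q(3) by (simp add: sum_divide_distrib[symmetric] sum_subtractf)
    moreover have "\<forall>i\<in>-J. ?v$i = 0" "\<forall>i\<in>J-I. ?v$i \<ge> 0" using p q I fe(2) by auto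
    ultimately show "u \<in> ?C" by blast
  qed
  show "?C \<subseteq> tangent_cone (convex hull (y ` I)) (convex hull (y ` J))"
  proof
    fix u assume "u \<in> ?C"
    then obtain v :: "real^'n" where v: "\<forall>i\<in>-J. v$i = 0" "\<forall>i\<in>J-I. v$i \<ge> 0" "(\<Sum>i\<in>UNIV. v$i) = 0" "u = (\<Sum>i\<in>UNIV. v$i *\<^sub>R y i)"
      by blast
    have cI: "card I > 0" using I by (simp add: card_gt_0_iff)
    have "rel_interior (convex hull (y ` I)) \<noteq> {}" using I by (simp add: rel_interior_eq_empty convex_convex_hull)
    then obtain f where f: "f \<in> rel_interior (convex hull (y ` I))" by blast
    define m where "m = (\<Sum>i\<in>UNIV. (if i \<in> I then 1 / card I else 0) *\<^sub>R y i)"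
    define b :: "real^'n" where "b = (\<chi> i. if i \<in> I then 1 / card I else 0)"
    have b: "\<forall>i\<in>-I. b$i = 0" "\<forall>i\<in>I. b$i > 0" "(\<Sum>i\<in>UNIV. b$i) = 1" "m = (\<Sum>i\<in>UNIV. b$i *\<^sub>R y i)"
      using cI by (auto simp: b_def m_def sum.If_cases)
    then have "m \<in> convex hull (y ` I)" unfolding convex_hull_indexed_image by (blast intro: less_imp_le)
    then obtain e where e: "e > 1" "(1 - e) *\<^sub>R m + e *\<^sub>R f \<in> convex hull (y ` I)"
      using convex_rel_interior_iff[of "convex hull (y ` I)" f] f I by (auto simp: convex_convex_hull)
    then obtain w :: "real^'n" where w: "\<forall>i\<in>-I. w$i = 0" "\<forall>i\<in>I. w$i \<ge> 0" "(\<Sum>i\<in>UNIV. w$i) = 1" "(1 - e) *\<^sub>R m + e *\<^sub>R f = (\<Sum>i\<in>UNIV. w$i *\<^sub>R y i)"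
      unfolding convex_hull_indexed_image by blast
    define q where "q = (1 / e) *\<^sub>R (w + (e - 1) *\<^sub>R b)"
    have "e *\<^sub>R f = (\<Sum>i\<in>UNIV. w$i *\<^sub>R y i) + (e - 1) *\<^sub>R m"
      unfolding w(4)[symmetric] by (simp add: algebra_simps)
    also have "\<dots> = (\<Sum>i\<in>UNIV. (w + (e - 1) *\<^sub>R b)$i *\<^sub>R y i)"
      by (simp add: b(4) scaleR_sum_right scaleR_add_left sum.distrib)
    finally have "(1 / e) *\<^sub>R (e *\<^sub>R f) = (1 / e) *\<^sub>R (\<Sum>i\<in>UNIV. (w + (e - 1) *\<^sub>R b)$i *\<^sub>R y i)" by simp
    then have fq: "f = (\<Sum>i\<in>UNIV. q$i *\<^sub>R y i)" using e(1) by (simp add: q_def scaleR_sum_right)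
    have q: "\<forall>i\<in>-I. q$i = 0" "(\<Sum>i\<in>UNIV. q$i) = 1"
      using w b e(1) by (simp_all add: q_def sum_divide_distrib[symmetric] sum.distrib sum_distrib_left[symmetric])
    have qpos: "q$i > 0" if "i \<in> I" for i
    proof -
      have "w$i + (e - 1) * b$i > 0" using w(2) b(2) e(1) that by (intro add_nonneg_pos mult_pos_pos) auto
      then show ?thesis using e(1) by (simp add: q_def)
    qed
    have "\<forall>i\<in>UNIV. eventually (\<lambda>t. (q + t *\<^sub>R v)$i \<ge> 0) (at_right 0)"
    proof
      fix i
      show "eventually (\<lambda>t. (q + t *\<^sub>R v)$i \<ge> 0) (at_right 0)"
      proof (cases "i \<in> I")
        case True
        have "((\<lambda>t. (q + t *\<^sub>R v)$i) \<longlongrightarrow> (q + 0 *\<^sub>R v)$i) (at_right 0)" by (intro tendsto_intros)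
        then have "eventually (\<lambda>t. (q + t *\<^sub>R v)$i > 0) (at_right 0)"
          using qpos[OF True] by (intro order_tendstoD) auto
        then show ?thesis by eventually_elim simp
      next
        case False
        then have "v$i \<ge> 0" "q$i = 0" using v q by (cases "i \<in> J", auto)
        have "eventually (\<lambda>t::real. t > 0) (at_right 0)" by (rule eventually_at_right_less)
        then show ?thesis by eventually_elim (use \<open>v$i \<ge> 0\<close> \<open>q$i = 0\<close> in simp)
      qed
    qed
    then have "eventually (\<lambda>t. \<forall>i\<in>UNIV. (q + t *\<^sub>R v)$i \<ge> 0) (at_right 0)"
      by (intro eventually_ball_finite) auto
    moreover have "eventually (\<lambda>t::real. t > 0) (at_right 0)" by (rule eventually_at_right_less)
    ultimately have "eventually (\<lambda>t. t > 0 \<and> (\<forall>i\<in>UNIV. (q + t *\<^sub>R v)$i \<ge> 0)) (at_right 0)"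
      by eventually_elim blast
    then obtain t :: real where t: "t > 0" "\<forall>i\<in>UNIV. (q + t *\<^sub>R v)$i \<ge> 0"
      using eventually_happens[of _ "at_right (0::real)"] by auto
    have "f + t *\<^sub>R u = (\<Sum>i\<in>UNIV. (q + t *\<^sub>R v)$i *\<^sub>R y i)"
      by (simp add: fq v(4) scaleR_sum_right scaleR_add_left sum.distrib)
    moreover have "(\<Sum>i\<in>UNIV. (q + t *\<^sub>R v)$i) = 1"
      using q(2) v(3) by (simp add: sum.distrib sum_distrib_left[symmetric])
    moreover have "\<forall>i\<in>-J. (q + t *\<^sub>R v)$i = 0" using q(1) v(1) I(2) by auto
    ultimately have "f + t *\<^sub>R u \<in> convex hull (y ` J)"
      unfolding convex_hull_indexed_image using t(2) by blast
    then show "u \<in> tangent_cone (convex hull (y ` I)) (convex hull (y ` J))"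
      unfolding tangent_cone_def using f t(1) by blast
  qed
qed

lemma tangent_cone_points:
  fixes x :: "real^'d^'n"
  assumes "I \<noteq> {}"
  shows "tangent_cone (convex hull (($) x ` I)) (convex hull (range (($) x))) = point_tangent I x"
proof -
  have "z \<in> point_tangent I x \<longleftrightarrow> z \<in> tangent_cone (convex hull (($) x ` I)) (convex hull (range (($) x)))" for z
    unfolding point_tangent_def tangent_cone_convex_hull[OF assms subset_UNIV]
    by (simp add: Compl_eq_Diff_UNIV conj_ac)
  then show ?thesis by blast
qed

lemma supporting_hyperplane_convex_hull:
  fixes y :: "'n::finite \<Rightarrow> 'a::euclidean_space"
  assumes I: "\<And>i. i \<in> I \<Longrightarrow> \<mu> \<bullet> y i = c" and nI: "\<And>i. i \<notin> I \<Longrightarrow> \<mu> \<bullet> y i < c"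
  shows "convex hull (range y) \<inter> {z. \<mu> \<bullet> z = c} = convex hull (y ` I)"
proof
  show "convex hull (y ` I) \<subseteq> convex hull (range y) \<inter> {z. \<mu> \<bullet> z = c}"
  proof -
    have "convex hull (y ` I) \<subseteq> {z. \<mu> \<bullet> z = c}"
      by (rule hull_minimal) (use I convex_hyperplane in auto)
    then show ?thesis using hull_mono[of "y ` I" "range y"] by blast
  qed
  show "convex hull (range y) \<inter> {z. \<mu> \<bullet> z = c} \<subseteq> convex hull (y ` I)"
  proof
    fix z assume z: "z \<in> convex hull (range y) \<inter> {z. \<mu> \<bullet> z = c}"
    then obtain v :: "real^'n" where v: "\<forall>i. v$i \<ge> 0" "(\<Sum>i\<in>UNIV. v$i) = 1" "z = (\<Sum>i\<in>UNIV. v$i *\<^sub>R y i)"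
      unfolding convex_hull_indexed_image by auto
    have "(\<Sum>i\<in>UNIV. v$i * (c - \<mu> \<bullet> y i)) = c * (\<Sum>i\<in>UNIV. v$i) - \<mu> \<bullet> z"
      by (simp add: v(3) inner_sum_right right_diff_distrib sum_subtractf sum_distrib_left mult.commute)
    also have "\<dots> = 0" using z v(2) by simp
    finally have 0: "(\<Sum>i\<in>UNIV. v$i * (c - \<mu> \<bullet> y i)) = 0" .
    have nn: "v$i * (c - \<mu> \<bullet> y i) \<ge> 0" for i
    proof (rule mult_nonneg_nonneg)
      show "v$i \<ge> 0" using v(1) by blast
      show "c - \<mu> \<bullet> y i \<ge> 0" using I[of i] nI[of i] by (cases "i \<in> I") auto
    qed
    have all: "\<forall>i\<in>UNIV. v$i * (c - \<mu> \<bullet> y i) = 0"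
      by (rule sum_nonneg_eq_0_iff[THEN iffD1, OF _ nn 0]) simp
    have "v$i = 0" if "i \<notin> I" for i
    proof -
      have "v$i * (c - \<mu> \<bullet> y i) = 0" using all by blast
      then show ?thesis using nI[OF that] by simp
    qed
    then show "z \<in> convex hull (y ` I)" unfolding convex_hull_indexed_image using v by blast
  qed
qed

text \<open>
  Faces of polytopes are exposed, and a face corresponds to the set of all indices of points lying
  in it. Repetitions and points in the relative interior of a face do no harm; the whole
  polytope is exposed by the zero functional.
\<close>

lemma bij_betw_faces:
  fixes x :: "real^'d^'n"
  shows "bij_betw (\<lambda>I. convex hull (($) x ` I)) {I. I \<noteq> {} \<and> exposes UNIV (lift x) I}
    {F. F face_of convex hull (range (($) x)) \<and> F \<noteq> {}}"
    (is "bij_betw ?h ?A ?B")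
proof -
  let ?P = "convex hull (range (($) x))"
  have exp: "\<exists>\<mu> c. (\<forall>i\<in>I. \<mu> \<bullet> x$i = c) \<and> (\<forall>i\<in>-I. \<mu> \<bullet> x$i < c)" if exI: "exposes UNIV (lift x) I" for I
  proof -
    obtain \<phi> where \<phi>: "\<forall>i\<in>I. fst \<phi> + snd \<phi> \<bullet> x$i = 0" "\<forall>i\<in>-I. fst \<phi> + snd \<phi> \<bullet> x$i > 0"
      using exI unfolding exposes_def inner_lift by blast
    have "\<forall>i\<in>I. (- snd \<phi>) \<bullet> x$i = fst \<phi>"
    proof
      fix i assume "i \<in> I"
      then have "fst \<phi> + snd \<phi> \<bullet> x$i = 0" using \<phi> by blast
      then show "(- snd \<phi>) \<bullet> x$i = fst \<phi>" unfolding inner_minus_left by linarith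
    qed
    moreover have "\<forall>i\<in>-I. (- snd \<phi>) \<bullet> x$i < fst \<phi>"
    proof
      fix i assume "i \<in> -I"
      then have "fst \<phi> + snd \<phi> \<bullet> x$i > 0" using \<phi> by blast
      then show "(- snd \<phi>) \<bullet> x$i < fst \<phi>" unfolding inner_minus_left by linarith
    qed
    ultimately show ?thesis by blast
  qed
  show ?thesis
  proof (rule bij_betwI')
    fix I J assume I: "I \<in> ?A" and J: "J \<in> ?A"
    have rec: "I = {i. x$i \<in> ?h I}" if "I \<in> ?A" for I
    proof -
      obtain \<mu> c where \<mu>: "\<forall>i\<in>I. \<mu> \<bullet> x$i = c" "\<forall>i\<in>-I. \<mu> \<bullet> x$i < c" using exp \<open>I \<in> ?A\<close> by blast
      then have "?P \<inter> {z. \<mu> \<bullet> z = c} = ?h I" by (intro supporting_hyperplane_convex_hull) auto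
      then have "?h I \<subseteq> {z. \<mu> \<bullet> z = c}" by blast
      then have "i \<in> I" if "x$i \<in> ?h I" for i using \<mu>(2) that by force
      moreover have "x$i \<in> ?h I" if "i \<in> I" for i using that by (intro hull_inc) auto
      ultimately show ?thesis by blast
    qed
    show "?h I = ?h J \<longleftrightarrow> I = J" using rec[OF I] rec[OF J] by metis
  next
    fix I assume I: "I \<in> ?A"
    then obtain \<mu> c where \<mu>: "\<forall>i\<in>I. \<mu> \<bullet> x$i = c" "\<forall>i\<in>-I. \<mu> \<bullet> x$i < c" using exp by blast
    then have eq: "?P \<inter> {z. \<mu> \<bullet> z = c} = ?h I" by (intro supporting_hyperplane_convex_hull) auto
    have "?P \<subseteq> {z. \<mu> \<bullet> z \<le> c}"
    proof (rule hull_minimal)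
      show "range (($) x) \<subseteq> {z. \<mu> \<bullet> z \<le> c}"
      proof
        fix z assume "z \<in> range (($) x)"
        then obtain i where "z = x$i" by blast
        then show "z \<in> {z. \<mu> \<bullet> z \<le> c}" using \<mu> by (cases "i \<in> I") (auto intro: less_imp_le)
      qed
    qed (rule convex_halfspace_le)
    then have "?P \<inter> {z. \<mu> \<bullet> z = c} face_of ?P"
      by (intro face_of_Int_supporting_hyperplane_le convex_convex_hull) blast
    then show "?h I \<in> ?B" using eq I by (simp add: image_is_empty)
  next
    fix F assume F: "F \<in> ?B"
    have "polyhedron ?P" by (intro polyhedron_convex_hull) simp
    then have "F exposed_face_of ?P" using F exposed_face_of_polyhedron by blast
    then obtain a b where ab: "?P \<subseteq> {z. a \<bullet> z \<le> b}" "F = ?P \<inter> {z. a \<bullet> z = b}"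
      unfolding exposed_face_of_def by blast
    define I where "I = {i. a \<bullet> x$i = b}"
    have le: "a \<bullet> x$i \<le> b" for i using ab(1) hull_inc[of "x$i" "range (($) x)" convex] by blast
    have FI: "F = ?h I"
      unfolding ab(2) by (rule supporting_hyperplane_convex_hull) (use le in \<open>auto simp: I_def less_le\<close>)
    then have "I \<noteq> {}" using F by auto
    moreover have "exposes UNIV (lift x) I"
      unfolding exposes_def
    proof (intro bexI[of _ "(b, - a)"] conjI ballI)
      show "(b, - a) \<bullet> lift x i = 0" if "i \<in> I" for i using that by (simp add: I_def)
      show "(b, - a) \<bullet> lift x i > 0" if "i \<in> -I" for i using that le[of i] by (simp add: I_def less_le)
    qed simp
    ultimately show "\<exists>I\<in>?A. F = ?h I" using FI by blast
  qed
qed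

lemma sum_faces_of_dim:
  fixes x :: "real^'d^'n" and g :: "(real^'d) set \<Rightarrow> real"
  shows "(\<Sum>F\<in>faces_of_dim j (convex hull (range (($) x))). g F) =
    (\<Sum>I | I \<noteq> {}. if exposes UNIV (lift x) I \<and> aff_dim (($) x ` I) = int j then g (convex hull (($) x ` I)) else 0)"
proof -
  let ?h = "\<lambda>I. convex hull (($) x ` I)"
  let ?A = "{I. I \<noteq> {} \<and> exposes UNIV (lift x) I}"
  let ?Aj = "{I. (I \<noteq> {} \<and> exposes UNIV (lift x) I) \<and> aff_dim (($) x ` I) = int j}"
  have "bij_betw ?h ?Aj (faces_of_dim j (convex hull (range (($) x))))"
  proof (rule bij_betw_subset[OF bij_betw_faces])
    show "?Aj \<subseteq> ?A" by blast
    have "faces_of_dim j (convex hull (range (($) x))) = {F \<in> {F. F face_of convex hull (range (($) x)) \<and> F \<noteq> {}}. aff_dim F = int j}"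
      by (auto simp: faces_of_dim_def)
    also have "\<dots> = {F \<in> ?h ` ?A. aff_dim F = int j}"
      using bij_betw_imp_surj_on[OF bij_betw_faces[of x]] by simp
    also have "\<dots> = ?h ` ?Aj" by (auto simp: aff_dim_convex_hull)
    finally show "?h ` ?Aj = faces_of_dim j (convex hull (range (($) x)))" ..
  qed
  then have "(\<Sum>F\<in>faces_of_dim j (convex hull (range (($) x))). g F) = (\<Sum>I\<in>?Aj. g (?h I))"
    by (rule sum.reindex_bij_betw[symmetric])
  also have "\<dots> = (\<Sum>I | I \<noteq> {}. if exposes UNIV (lift x) I \<and> aff_dim (($) x ` I) = int j then g (?h I) else 0)"
    by (subst sum.inter_filter[symmetric]) (auto intro!: sum.cong)
  finally show ?thesis .
qed

text \<open>
  The projection of \<open>z\<close> to the linear hull of the cone is the only point of the hull that differs from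
  \<open>z\<close> by a vector orthogonal to all differences of points. In this form the condition is visibly
  measurable in \<open>x\<close> and \<open>z\<close> together, although the linear hull jumps at degenerate configurations.
\<close>

lemma solid_angle_point_tangent:
  fixes x :: "real^'d^'n"
  assumes I: "I \<noteq> {}"
  shows "solid_angle (point_tangent I x) = measure std_gaussian
    {z. \<exists>v::real^'n. (\<forall>i\<in>-I. v$i \<ge> 0) \<and> (\<Sum>i\<in>UNIV. v$i) = 0 \<and> (\<forall>i l. (z - (\<Sum>i\<in>UNIV. v$i *\<^sub>R x$i)) \<bullet> (x$i - x$l) = 0)}"
proof -
  let ?C = "point_tangent I x"
  let ?L = "span ?C"
  have subL: "subspace ?L" by simp
  have diff: "x$i - x$l \<in> ?L" for i l
  proof -
    obtain f where f: "f \<in> I" using I by blast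
    have "x$i - x$f \<in> ?C" for i
    proof -
      let ?v = "axis i 1 - axis f 1 :: real^'n"
      have "x$i - x$f = (\<Sum>l\<in>UNIV. ?v$l *\<^sub>R x$l)"
        by (simp add: axis_def scaleR_diff_left sum_subtractf if_distrib[of "\<lambda>c. c *\<^sub>R _"] cong: if_cong)
      moreover have "\<forall>l\<in>-I. ?v$l \<ge> 0" "(\<Sum>l\<in>UNIV. ?v$l) = 0"
        using f by (auto simp: axis_def sum_subtractf)
      ultimately show ?thesis unfolding point_tangent_def by blast
    qed
    then have "(x$i - x$f) - (x$l - x$f) \<in> ?L" by (intro span_diff span_base)
    then show ?thesis by simp
  qed
  have orth: "w \<bullet> u = 0" if w: "\<forall>i l. w \<bullet> (x$i - x$l) = 0" and u: "u \<in> ?L" for w u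
  proof -
    obtain f where f: "f \<in> I" using I by blast
    have "w \<bullet> u = 0" if uC: "u \<in> ?C" for u
    proof -
      obtain v :: "real^'n" where v: "(\<Sum>i\<in>UNIV. v$i) = 0" "u = (\<Sum>i\<in>UNIV. v$i *\<^sub>R x$i)"
        using uC unfolding point_tangent_def by blast
      have "w \<bullet> u = (\<Sum>i\<in>UNIV. v$i * (w \<bullet> x$i))" by (simp add: v(2) inner_sum_right)
      also have "\<dots> = (\<Sum>i\<in>UNIV. v$i * (w \<bullet> x$f))"
      proof (intro sum.cong refl)
        fix i
        have "w \<bullet> (x$i - x$f) = 0" using w by blast
        then show "v$i * (w \<bullet> x$i) = v$i * (w \<bullet> x$f)" by (simp add: inner_diff_right)
      qed
      also have "\<dots> = 0" using v(1) by (simp add: sum_distrib_right[symmetric])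
      finally show ?thesis .
    qed
    then have "?L \<subseteq> {u. w \<bullet> u = 0}" by (intro span_minimal subspace_hyperplane) auto
    then show ?thesis using u by blast
  qed
  have cone: "c *\<^sub>R u \<in> ?C" if "u \<in> ?C" "c \<ge> 0" for c u
  proof -
    obtain v :: "real^'n" where v: "\<forall>i\<in>-I. v$i \<ge> 0" "(\<Sum>i\<in>UNIV. v$i) = 0" "u = (\<Sum>i\<in>UNIV. v$i *\<^sub>R x$i)"
      using \<open>u \<in> ?C\<close> unfolding point_tangent_def by blast
    have "c *\<^sub>R u = (\<Sum>i\<in>UNIV. (c *\<^sub>R v)$i *\<^sub>R x$i)" by (simp add: v(3) scaleR_sum_right)
    moreover have "\<forall>i\<in>-I. (c *\<^sub>R v)$i \<ge> 0" "(\<Sum>i\<in>UNIV. (c *\<^sub>R v)$i) = 0"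
      using v that(2) by (auto simp: sum_distrib_left[symmetric])
    ultimately show ?thesis unfolding point_tangent_def by blast
  qed
  have sgnC: "sgn u \<in> ?C \<longleftrightarrow> u \<in> ?C" for u
  proof
    assume "sgn u \<in> ?C"
    then have "norm u *\<^sub>R sgn u \<in> ?C" by (rule cone) simp
    moreover have "norm u *\<^sub>R sgn u = u" by (cases "u = 0") (simp_all add: sgn_div_norm)
    ultimately show "u \<in> ?C" by simp
  next
    assume "u \<in> ?C"
    then show "sgn u \<in> ?C" unfolding sgn_div_norm by (rule cone) simp
  qed
  have Cb: "?C \<in> sets borel"
  proof -
    have "(\<lambda>z. (x, z)) -` {(x :: real^'d^'n, z). z \<in> point_tangent I x} \<inter> space borel \<in> sets borel"
      by (rule measurable_sets[OF _ borel_point_tangent]) (intro borel_measurable_continuous_onI continuous_intros)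
    then show ?thesis by (simp add: vimage_def)
  qed
  have "solid_angle ?C = measure std_gaussian {z. sgn (closest_point ?L z) \<in> ?C}"
    unfolding solid_angle_def uniform_sphere_def
    using measurable_uniform_sphere_map[OF subL] Cb by (subst measure_distr) (auto simp: vimage_def)
  also have "{z. sgn (closest_point ?L z) \<in> ?C} = {z. \<exists>v::real^'n. (\<forall>i\<in>-I. v$i \<ge> 0) \<and> (\<Sum>i\<in>UNIV. v$i) = 0 \<and> (\<forall>i l. (z - (\<Sum>i\<in>UNIV. v$i *\<^sub>R x$i)) \<bullet> (x$i - x$l) = 0)}"
  proof (intro Collect_cong iffI)
    fix z assume "sgn (closest_point ?L z) \<in> ?C"
    then have "closest_point ?L z \<in> ?C" by (simp add: sgnC)
    then obtain v :: "real^'n" where v: "\<forall>i\<in>-I. v$i \<ge> 0" "(\<Sum>i\<in>UNIV. v$i) = 0" "closest_point ?L z = (\<Sum>i\<in>UNIV. v$i *\<^sub>R x$i)"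
      unfolding point_tangent_def by blast
    have "\<forall>i l. (z - (\<Sum>i\<in>UNIV. v$i *\<^sub>R x$i)) \<bullet> (x$i - x$l) = 0"
      unfolding v(3)[symmetric] using closest_point_subspace(2)[OF subL diff] by blast
    then show "\<exists>v::real^'n. (\<forall>i\<in>-I. v$i \<ge> 0) \<and> (\<Sum>i\<in>UNIV. v$i) = 0 \<and> (\<forall>i l. (z - (\<Sum>i\<in>UNIV. v$i *\<^sub>R x$i)) \<bullet> (x$i - x$l) = 0)"
      using v by blast
  next
    fix z assume "\<exists>v::real^'n. (\<forall>i\<in>-I. v$i \<ge> 0) \<and> (\<Sum>i\<in>UNIV. v$i) = 0 \<and> (\<forall>i l. (z - (\<Sum>i\<in>UNIV. v$i *\<^sub>R x$i)) \<bullet> (x$i - x$l) = 0)"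
    then obtain v :: "real^'n" where v: "\<forall>i\<in>-I. v$i \<ge> 0" "(\<Sum>i\<in>UNIV. v$i) = 0" "\<forall>i l. (z - (\<Sum>i\<in>UNIV. v$i *\<^sub>R x$i)) \<bullet> (x$i - x$l) = 0"
      by blast
    have inC: "(\<Sum>i\<in>UNIV. v$i *\<^sub>R x$i) \<in> ?C" unfolding point_tangent_def using v(1,2) by blast
    have "closest_point ?L z = (\<Sum>i\<in>UNIV. v$i *\<^sub>R x$i)"
      by (rule closest_point_subspace_eq[OF subL span_base[OF inC]]) (rule orth[OF v(3)])
    then show "sgn (closest_point ?L z) \<in> ?C" using inC by (simp add: sgnC)
  qed
  finally show ?thesis .
qed

section \<open>The angle sum as a random variable\<close>

definition angle_sum :: "nat \<Rightarrow> real^'d^'n \<Rightarrow> real" where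
  "angle_sum j x = (let P = convex hull (range (($) x)) in \<Sum>F\<in>faces_of_dim j P. solid_angle (tangent_cone F P))"

lemma affine_combination_in_hull:
  fixes y :: "'n::finite \<Rightarrow> 'a::real_vector" and w :: "real^'n"
  assumes w: "\<forall>l\<in>-J. w$l = 0" "(\<Sum>l\<in>UNIV. w$l) = 1"
  shows "(\<Sum>l\<in>UNIV. w$l *\<^sub>R y l) \<in> affine hull (y ` J)"
proof -
  define c where "c p = (\<Sum>l | l \<in> J \<and> y l = p. w$l)" for p
  have "(\<Sum>l\<in>UNIV. w$l *\<^sub>R y l) = (\<Sum>l\<in>J. w$l *\<^sub>R y l)" using w(1) by (intro sum.mono_neutral_right) auto
  also have "\<dots> = (\<Sum>p\<in>y ` J. \<Sum>l | l \<in> J \<and> y l = p. w$l *\<^sub>R y l)" by (rule sum.image_gen) simp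
  also have "\<dots> = (\<Sum>p\<in>y ` J. c p *\<^sub>R p)" by (simp add: c_def scaleR_sum_left)
  finally have 1: "(\<Sum>l\<in>UNIV. w$l *\<^sub>R y l) = (\<Sum>p\<in>y ` J. c p *\<^sub>R p)" .
  have "(\<Sum>p\<in>y ` J. c p) = (\<Sum>l\<in>J. w$l)" unfolding c_def by (rule sum.image_gen[symmetric]) simp
  also have "\<dots> = 1" unfolding w(2)[symmetric] using w(1) by (intro sum.mono_neutral_left) auto
  finally have "(\<Sum>p\<in>y ` J. c p) = 1" .
  then show ?thesis using 1 by (subst affine_hull_finite) auto
qed

lemma affine_hull_indexed_image:
  fixes y :: "'n::finite \<Rightarrow> 'a::real_vector"
  shows "affine hull (y ` J) = {\<Sum>l\<in>UNIV. w$l *\<^sub>R y l | w::real^'n. (\<forall>l\<in>-J. w$l = 0) \<and> (\<Sum>l\<in>UNIV. w$l) = 1}"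
    (is "_ = ?C")
proof
  show "?C \<subseteq> affine hull (y ` J)" using affine_combination_in_hull by blast
  show "affine hull (y ` J) \<subseteq> ?C"
  proof (rule hull_minimal)
    show "y ` J \<subseteq> ?C"
    proof
      fix p assume "p \<in> y ` J"
      then obtain i where i: "i \<in> J" "p = y i" by blast
      have "p = (\<Sum>l\<in>UNIV. (axis i 1 :: real^'n)$l *\<^sub>R y l)"
        by (simp add: i axis_def if_distrib[of "\<lambda>c. c *\<^sub>R _"] cong: if_cong)
      moreover have "\<forall>l\<in>-J. (axis i 1 :: real^'n)$l = 0" "(\<Sum>l\<in>UNIV. (axis i 1 :: real^'n)$l) = 1"
        using i by (auto simp: axis_def)
      ultimately show "p \<in> ?C" by blast
    qed
    show "affine ?C"
      unfolding affine_def
    proof (intro ballI allI impI)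
      fix p q and s t :: real assume "p \<in> ?C" "q \<in> ?C" and st: "s + t = 1"
      then obtain v w :: "real^'n" where v: "\<forall>i\<in>-J. v$i = 0" "(\<Sum>i\<in>UNIV. v$i) = 1" "p = (\<Sum>i\<in>UNIV. v$i *\<^sub>R y i)"
        and w: "\<forall>i\<in>-J. w$i = 0" "(\<Sum>i\<in>UNIV. w$i) = 1" "q = (\<Sum>i\<in>UNIV. w$i *\<^sub>R y i)"
        by blast
      let ?u = "s *\<^sub>R v + t *\<^sub>R w"
      have "s *\<^sub>R p + t *\<^sub>R q = (\<Sum>i\<in>UNIV. ?u$i *\<^sub>R y i)"
        by (simp add: v(3) w(3) scaleR_sum_right scaleR_add_left sum.distrib)
      moreover have "(\<Sum>i\<in>UNIV. ?u$i) = 1"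
        using v(2) w(2) st by (simp add: sum.distrib sum_distrib_left[symmetric])
      moreover have "\<forall>i\<in>-J. ?u$i = 0" using v w by auto
      ultimately show "s *\<^sub>R p + t *\<^sub>R q \<in> ?C" by blast
    qed
  qed
qed

text \<open>
  This turns the dimension into a finite combination of conditions of the form "a point lies in the
  affine hull of others", which are projections of closed sets.
\<close>

lemma aff_dim_image_less_iff:
  fixes x :: "real^'d^'n"
  shows "aff_dim (($) x ` I) < int k \<longleftrightarrow> (\<exists>J\<subseteq>I. card J \<le> k \<and> (\<forall>i\<in>I. x$i \<in> affine hull (($) x ` J)))"
proof
  assume less: "aff_dim (($) x ` I) < int k"
  obtain B where B: "\<not> affine_dependent B" "B \<subseteq> ($) x ` I" "affine hull B = affine hull (($) x ` I)"
    using affine_basis_exists by metis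
  obtain J where J: "J \<subseteq> I" "inj_on (($) x) J" "B = ($) x ` J" using B(2) subset_image_inj by metis
  have "int (card B) = aff_dim B + 1" using aff_dim_affine_independent[OF B(1)] by simp
  also have "aff_dim B = aff_dim (($) x ` I)" using B(3) by (metis aff_dim_affine_hull)
  finally have "card J \<le> k" using less J by (simp add: card_image)
  moreover have "x$i \<in> affine hull (($) x ` J)" if "i \<in> I" for i
    unfolding J(3)[symmetric] B(3) using that by (intro hull_inc) auto
  ultimately show "\<exists>J\<subseteq>I. card J \<le> k \<and> (\<forall>i\<in>I. x$i \<in> affine hull (($) x ` J))" using J(1) by blast
next
  assume "\<exists>J\<subseteq>I. card J \<le> k \<and> (\<forall>i\<in>I. x$i \<in> affine hull (($) x ` J))"
  then obtain J where J: "card J \<le> k" "\<forall>i\<in>I. x$i \<in> affine hull (($) x ` J)" by blast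
  have "($) x ` I \<subseteq> affine hull (($) x ` J)" using J(2) by blast
  then have "aff_dim (($) x ` I) \<le> aff_dim (affine hull (($) x ` J))" by (rule aff_dim_subset)
  also have "\<dots> = aff_dim (($) x ` J)" by (rule aff_dim_affine_hull)
  also have "\<dots> \<le> int (card (($) x ` J)) - 1" by (rule aff_dim_le_card) simp
  also have "\<dots> < int k" using J(1) card_image_le[of J "($) x"] by simp
  finally show "aff_dim (($) x ` I) < int k" .
qed

lemma borel_aff_dim: "{x :: real^'d^'n. aff_dim (($) x ` I) = int j} \<in> sets borel"
proof -
  have hull: "{x :: real^'d^'n. x$i \<in> affine hull (($) x ` J)} \<in> sets borel" for i J
  proof -
    have "{x :: real^'d^'n. \<exists>w::real^'n. (\<forall>l\<in>-J. w$l = 0) \<and> (\<Sum>l\<in>UNIV. w$l) = 1 \<and> x$i = (\<Sum>l\<in>UNIV. w$l *\<^sub>R x$l)} \<in> sets borel"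
    proof (rule borel_Ex_closed)
      have "{p :: (real^'n) \<times> (real^'d^'n). (\<forall>l\<in>-J. fst p$l = 0) \<and> (\<Sum>l\<in>UNIV. fst p$l) = 1 \<and> snd p$i = (\<Sum>l\<in>UNIV. fst p$l *\<^sub>R snd p$l)}
        = (\<Inter>l\<in>-J. {p. fst p$l = 0}) \<inter> {p. (\<Sum>l\<in>UNIV. fst p$l) = 1} \<inter> {p. snd p$i = (\<Sum>l\<in>UNIV. fst p$l *\<^sub>R snd p$l)}"
        by auto
      also have "closed \<dots>" by (intro closed_Int closed_INT ballI closed_Collect_eq continuous_intros)
      finally show "closed {p :: (real^'n) \<times> (real^'d^'n). (\<forall>l\<in>-J. fst p$l = 0) \<and> (\<Sum>l\<in>UNIV. fst p$l) = 1 \<and> snd p$i = (\<Sum>l\<in>UNIV. fst p$l *\<^sub>R snd p$l)}" .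
    qed
    also have "{x :: real^'d^'n. \<exists>w::real^'n. (\<forall>l\<in>-J. w$l = 0) \<and> (\<Sum>l\<in>UNIV. w$l) = 1 \<and> x$i = (\<Sum>l\<in>UNIV. w$l *\<^sub>R x$l)}
      = {x. x$i \<in> affine hull (($) x ` J)}" unfolding affine_hull_indexed_image by blast
    finally show ?thesis .
  qed
  have less: "{x :: real^'d^'n. aff_dim (($) x ` I) < int k} \<in> sets borel" for k
  proof -
    have "{x :: real^'d^'n. aff_dim (($) x ` I) < int k} = (\<Union>J\<in>{J. J \<subseteq> I \<and> card J \<le> k}. \<Inter>i\<in>I. {x. x$i \<in> affine hull (($) x ` J)})"
      unfolding aff_dim_image_less_iff by blast
    also have "\<dots> \<in> sets borel"
    proof (cases "I = {}")
      case False
      then show ?thesis using hull by (intro sets.finite_UN sets.finite_INT) auto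
    qed auto
    finally show ?thesis .
  qed
  have "{x :: real^'d^'n. aff_dim (($) x ` I) = int j} = {x. aff_dim (($) x ` I) < int (Suc j)} - {x. aff_dim (($) x ` I) < int j}"
    by auto
  then show ?thesis using less[of "Suc j"] less[of j] by (simp only: sets.Diff)
qed

text \<open>
  General position makes small sets of points distinct and affinely independent.
\<close>

lemma aff_dim_general_position:
  fixes x :: "real^'d^'n"
  assumes gp: "in_general_position UNIV (lift x)" and I: "card I \<le> CARD('d) + 1"
  shows "aff_dim (($) x ` I) = int (card I) - 1"
proof -
  have dimU: "dim (UNIV :: (real \<times> (real^'d)) set) = CARD('d) + 1" by simp
  have dep: "v = 0" if v: "\<forall>i\<in>-I. v$i = 0" "(\<Sum>i\<in>UNIV. v$i) = 0" "(\<Sum>i\<in>UNIV. v$i *\<^sub>R x$i) = 0" for v :: "real^'n"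
  proof (rule in_general_positionD[OF gp])
    show "{i. v$i \<noteq> 0} \<subseteq> I" using v(1) by auto
    show "card I \<le> dim (UNIV :: (real \<times> (real^'d)) set)" using I by simp
    fix \<phi> :: "real \<times> (real^'d)"
    have "(\<Sum>i\<in>UNIV. v$i * (\<phi> \<bullet> lift x i)) = fst \<phi> * (\<Sum>i\<in>UNIV. v$i) + snd \<phi> \<bullet> (\<Sum>i\<in>UNIV. v$i *\<^sub>R x$i)"
      by (simp add: distrib_left sum.distrib inner_sum_right sum_distrib_left mult.commute)
    then show "(\<Sum>i\<in>UNIV. v$i * (\<phi> \<bullet> lift x i)) = 0" using v by simp
  qed
  have inj: "inj_on (($) x) I"
  proof (rule inj_onI, rule ccontr)
    fix i l assume il: "i \<in> I" "l \<in> I" "x$i = x$l" "i \<noteq> l"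
    have "axis i 1 - axis l 1 = (0 :: real^'n)"
      using il by (intro dep) (auto simp: axis_def sum_subtractf scaleR_diff_left if_distrib[of "\<lambda>c. c *\<^sub>R _"] cong: if_cong)
    then have "(axis i 1 - axis l 1 :: real^'n) $ i = 0" by simp
    then show False using il(4) by (simp add: axis_def)
  qed
  have "\<not> affine_dependent (($) x ` I)"
  proof
    assume "affine_dependent (($) x ` I)"
    then obtain U where U: "(\<Sum>p\<in>($) x ` I. U p) = 0" "\<exists>p\<in>($) x ` I. U p \<noteq> 0" "(\<Sum>p\<in>($) x ` I. U p *\<^sub>R p) = 0"
      unfolding affine_dependent_explicit_finite[OF finite_imageI[OF finite]] by blast
    define v :: "real^'n" where "v = (\<chi> i. if i \<in> I then U (x$i) else 0)"
    have "(\<Sum>i\<in>UNIV. v$i) = (\<Sum>i\<in>I. U (x$i))" by (simp add: v_def sum.If_cases)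
    also have "\<dots> = 0" using U(1) inj by (simp add: sum.reindex)
    finally have 1: "(\<Sum>i\<in>UNIV. v$i) = 0" .
    have "(\<Sum>i\<in>UNIV. v$i *\<^sub>R x$i) = (\<Sum>i\<in>I. U (x$i) *\<^sub>R x$i)"
      by (simp add: v_def sum.If_cases if_distrib[of "\<lambda>c. c *\<^sub>R _"] cong: if_cong)
    also have "\<dots> = 0" using U(3) inj by (simp add: sum.reindex)
    finally have "v = 0" using 1 by (intro dep) (auto simp: v_def)
    then have "U (x$i) = 0" if "i \<in> I" for i using that by (auto simp: v_def vec_eq_iff split: if_splits)
    then show False using U(2) by blast
  qed
  then show ?thesis using inj aff_dim_affine_independent[of "($) x ` I"] by (simp add: card_image)
qed

text \<open>
  Pairs of a configuration \<open>x\<close> and a vector \<open>z\<close> whose projection to the linear hull of the tangent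
  cone at \<open>I\<close> lies in the cone.
\<close>

definition tangent_relation :: "'n::finite set \<Rightarrow> ((real^'d^'n) \<times> (real^'d)) set" where
  "tangent_relation I = {(x, z). \<exists>v::real^'n. (\<forall>i\<in>-I. v$i \<ge> 0) \<and> (\<Sum>i\<in>UNIV. v$i) = 0 \<and>
    (\<forall>i l. (z - (\<Sum>i\<in>UNIV. v$i *\<^sub>R x$i)) \<bullet> (x$i - x$l) = 0)}"

lemma borel_tangent_relation:
  "(tangent_relation I :: ((real^'d^'n) \<times> (real^'d)) set) \<in> sets borel"
proof -
  have "{p :: (real^'d^'n) \<times> (real^'d). \<exists>v::real^'n. (\<forall>i\<in>-I. v$i \<ge> 0) \<and> (\<Sum>i\<in>UNIV. v$i) = 0 \<and>
    (\<forall>i l. (snd p - (\<Sum>i\<in>UNIV. v$i *\<^sub>R fst p$i)) \<bullet> (fst p$i - fst p$l) = 0)} \<in> sets borel"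
  proof (rule borel_Ex_closed)
    have "{q :: (real^'n) \<times> ((real^'d^'n) \<times> (real^'d)). (\<forall>i\<in>-I. 0 \<le> fst q$i) \<and> (\<Sum>i\<in>UNIV. fst q$i) = 0 \<and>
        (\<forall>i l. (snd (snd q) - (\<Sum>i\<in>UNIV. fst q$i *\<^sub>R fst (snd q)$i)) \<bullet> (fst (snd q)$i - fst (snd q)$l) = 0)}
      = (\<Inter>i\<in>-I. {q. 0 \<le> fst q$i}) \<inter> {q. (\<Sum>i\<in>UNIV. fst q$i) = 0} \<inter>
        (\<Inter>i\<in>UNIV. \<Inter>l\<in>UNIV. {q. (snd (snd q) - (\<Sum>i\<in>UNIV. fst q$i *\<^sub>R fst (snd q)$i)) \<bullet> (fst (snd q)$i - fst (snd q)$l) = 0})"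
      by auto
    also have "closed \<dots>"
      by (intro closed_Int closed_INT ballI closed_Collect_eq closed_Collect_le continuous_intros)
    finally show "closed {q :: (real^'n) \<times> ((real^'d^'n) \<times> (real^'d)). (\<forall>i\<in>-I. 0 \<le> fst q$i) \<and> (\<Sum>i\<in>UNIV. fst q$i) = 0 \<and>
        (\<forall>i l. (snd (snd q) - (\<Sum>i\<in>UNIV. fst q$i *\<^sub>R fst (snd q)$i)) \<bullet> (fst (snd q)$i - fst (snd q)$l) = 0)}" .
  qed
  also have "{p :: (real^'d^'n) \<times> (real^'d). \<exists>v::real^'n. (\<forall>i\<in>-I. v$i \<ge> 0) \<and> (\<Sum>i\<in>UNIV. v$i) = 0 \<and>
    (\<forall>i l. (snd p - (\<Sum>i\<in>UNIV. v$i *\<^sub>R fst p$i)) \<bullet> (fst p$i - fst p$l) = 0)} = tangent_relation I"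
    unfolding tangent_relation_def by (rule set_eqI) (simp only: case_prod_beta mem_Collect_eq)
  finally show ?thesis .
qed

lemma angle_sum_eq:
  fixes x :: "real^'d^'n"
  shows "angle_sum j x = (\<Sum>I | I \<noteq> {}. if exposes UNIV (lift x) I \<and> aff_dim (($) x ` I) = int j
    then measure std_gaussian (Pair x -` tangent_relation I) else 0)"
  unfolding angle_sum_def Let_def sum_faces_of_dim
  by (intro sum.cong refl) (simp add: tangent_cone_points solid_angle_point_tangent tangent_relation_def vimage_def)

lemma measurable_tangent_measure:
  "(\<lambda>x::real^'d^'n. measure std_gaussian (Pair x -` tangent_relation I)) \<in> borel_measurable borel"
proof -
  interpret H: prob_space "std_gaussian :: (real^'d) measure" by (rule prob_space_std_gaussian)
  have "sets ((borel :: (real^'d^'n) measure) \<Otimes>\<^sub>M (std_gaussian :: (real^'d) measure)) = sets borel"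
    unfolding borel_prod[symmetric] by (intro sets_pair_measure_cong) auto
  then have "tangent_relation I \<in> sets ((borel :: (real^'d^'n) measure) \<Otimes>\<^sub>M (std_gaussian :: (real^'d) measure))"
    using borel_tangent_relation[of I] by blast
  then have "(\<lambda>x::real^'d^'n. emeasure std_gaussian (Pair x -` tangent_relation I)) \<in> borel_measurable borel"
    by (rule H.measurable_emeasure_Pair)
  then show ?thesis unfolding measure_def by measurable
qed

lemma measurable_angle_sum: "angle_sum j \<in> borel_measurable (borel :: (real^'d^'n) measure)"
proof -
  have S: "{x :: real^'d^'n. exposes UNIV (lift x) I \<and> aff_dim (($) x ` I) = int j} \<in> sets borel" for I
  proof -
    have "{x :: real^'d^'n. exposes UNIV (lift x) I \<and> aff_dim (($) x ` I) = int j}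
      = {x. exposes UNIV (lift x) I} \<inter> {x. aff_dim (($) x ` I) = int j}" by blast
    then show ?thesis by (simp only: sets.Int[OF borel_exposes[OF subspace_UNIV] borel_aff_dim])
  qed
  have "(\<lambda>x :: real^'d^'n. if exposes UNIV (lift x) I \<and> aff_dim (($) x ` I) = int j
    then measure std_gaussian (Pair x -` tangent_relation I) else 0) \<in> borel_measurable borel" for I
    by (rule measurable_If) (use measurable_tangent_measure S in auto)
  then have "(\<lambda>x :: real^'d^'n. \<Sum>I | I \<noteq> {}. if exposes UNIV (lift x) I \<and> aff_dim (($) x ` I) = int j
    then measure std_gaussian (Pair x -` tangent_relation I) else 0) \<in> borel_measurable borel"
    by (intro borel_measurable_sum)
  then show ?thesis by (simp only: angle_sum_eq[abs_def])
qed

lemma tangent_relation_general_position: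
  fixes x :: "real^'d^'n"
  assumes gp: "in_general_position UNIV (lift x)" and n: "CARD('d) + 1 \<le> CARD('n)"
  shows "Pair x -` tangent_relation I = point_tangent I x"
proof -
  have w0: "w = 0" if w: "\<forall>i l. w \<bullet> (x$i - x$l) = 0" for w
  proof (rule ccontr)
    assume "w \<noteq> 0"
    define l :: 'n where "l = undefined"
    let ?\<phi> = "(- (w \<bullet> x$l), w)"
    have "w \<bullet> x$i = w \<bullet> x$l" for i using w[rule_format, of i l] by (simp add: inner_diff_right)
    then have "{i. ?\<phi> \<bullet> lift x i = 0} = UNIV" by simp
    moreover have "card {i. ?\<phi> \<bullet> lift x i = 0} < dim (UNIV :: (real \<times> (real^'d)) set)"
      using \<open>w \<noteq> 0\<close> by (intro general_position_card_zeros[OF subspace_UNIV gp]) (auto simp: zero_prod_def)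
    ultimately show False using n by simp
  qed
  show ?thesis
  proof (intro set_eqI iffI)
    fix z assume "z \<in> Pair x -` tangent_relation I"
    then obtain v :: "real^'n" where v: "\<forall>i\<in>-I. v$i \<ge> 0" "(\<Sum>i\<in>UNIV. v$i) = 0"
      "\<forall>i l. (z - (\<Sum>i\<in>UNIV. v$i *\<^sub>R x$i)) \<bullet> (x$i - x$l) = 0"
      unfolding tangent_relation_def by blast
    have "z = (\<Sum>i\<in>UNIV. v$i *\<^sub>R x$i)" using w0[OF v(3)] by simp
    then show "z \<in> point_tangent I x" unfolding point_tangent_def using v by blast
  next
    fix z assume "z \<in> point_tangent I x"
    then obtain v :: "real^'n" where v: "\<forall>i\<in>-I. v$i \<ge> 0" "(\<Sum>i\<in>UNIV. v$i) = 0" "z = (\<Sum>i\<in>UNIV. v$i *\<^sub>R x$i)"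
      unfolding point_tangent_def by blast
    have "\<forall>i l. (z - (\<Sum>i\<in>UNIV. v$i *\<^sub>R x$i)) \<bullet> (x$i - x$l) = 0" unfolding v(3)[symmetric] by simp
    then show "z \<in> Pair x -` tangent_relation I" unfolding tangent_relation_def using v(1,2) by blast
  qed
qed

text \<open>
  In general position at most \<open>d\<close> points lie on a common hyperplane, so that proper faces are simplices
  with affinely independent vertices. The exposed set of all points has dimension \<open>d\<close>, which is
  greater than \<open>j\<close>.
\<close>

lemma exposed_aff_dim_iff:
  fixes x :: "real^'d^'n"
  assumes gp: "in_general_position UNIV (lift x)" and n: "CARD('d) + 1 \<le> CARD('n)" and j: "j < CARD('d)"
    and I: "exposes UNIV (lift x) I"
  shows "I \<noteq> {} \<and> aff_dim (($) x ` I) = int j \<longleftrightarrow> card I = j + 1"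
proof (cases "I = UNIV")
  case True
  obtain J :: "'n set" where J: "card J = CARD('d) + 1" using n obtain_subset_with_card_n[of "CARD('d) + 1" "UNIV :: 'n set"] by auto
  have "int (CARD('d)) = aff_dim (($) x ` J)" using aff_dim_general_position[OF gp, of J] J by simp
  also have "\<dots> \<le> aff_dim (($) x ` I)" unfolding True by (intro aff_dim_subset) auto
  finally show ?thesis using j n True by simp
next
  case False
  obtain \<phi> where \<phi>: "\<forall>i\<in>I. \<phi> \<bullet> lift x i = 0" "\<forall>i\<in>-I. \<phi> \<bullet> lift x i > 0" using I unfolding exposes_def by blast
  obtain i where "i \<in> -I" using False by blast
  then have "\<phi> \<bullet> lift x i > 0" using \<phi> by blast
  then have "\<phi> \<noteq> 0" by (auto simp del: inner_lift)
  then have "card {i. \<phi> \<bullet> lift x i = 0} < dim (UNIV :: (real \<times> (real^'d)) set)"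
    by (intro general_position_card_zeros[OF subspace_UNIV gp]) auto
  moreover have "card I \<le> card {i. \<phi> \<bullet> lift x i = 0}" using \<phi>(1) by (intro card_mono) auto
  ultimately have "card I \<le> CARD('d) + 1" by simp
  then have "aff_dim (($) x ` I) = int (card I) - 1" by (rule aff_dim_general_position[OF gp])
  then show ?thesis by (auto simp: card_gt_0_iff)
qed

text \<open>
  For points in general position the polytope has full dimension, the linear hull of each tangent cone is
  the whole space, and its angle is the probability that a Gaussian vector lies in it.
\<close>

lemma integral_angle_sum:
  assumes n: "CARD('d) + 1 \<le> CARD('n)" and j: "j < CARD('d)"
  shows "has_bochner_integral (std_gaussian :: (real^'d^'n) measure) (angle_sum j)
    (\<Sum>F | card F = j + 1. measure (std_gaussian \<Otimes>\<^sub>M std_gaussian)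
      {(x :: real^'d^'n, z). exposes UNIV (lift x) F \<and> z \<in> point_tangent F x})"
proof -
  let ?G = "std_gaussian :: (real^'d^'n) measure" and ?H = "std_gaussian :: (real^'d) measure"
  let ?P = "?G \<Otimes>\<^sub>M ?H"
  interpret G: prob_space ?G by (rule prob_space_std_gaussian)
  interpret H: prob_space ?H by (rule prob_space_std_gaussian)
  interpret P: pair_prob_space ?G ?H ..
  have sP: "sets ?P = sets borel"
    unfolding borel_prod[symmetric] by (intro sets_pair_measure_cong) auto
  define S where "S F = {(x :: real^'d^'n, z). exposes UNIV (lift x) F \<and> z \<in> point_tangent F x}" for F
  have Sm: "S F \<in> sets ?P" for F
  proof -
    have "S F = ({x. exposes UNIV (lift x) F} \<times> UNIV) \<inter> {(x, z). z \<in> point_tangent F x}" by (auto simp: S_def)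
    moreover have "({x :: real^'d^'n. exposes UNIV (lift x) F} \<times> UNIV) \<in> sets ?P"
      using borel_exposes[OF subspace_UNIV, of F] by auto
    moreover have "{(x :: real^'d^'n, z). z \<in> point_tangent F x} \<in> sets ?P" unfolding sP by (rule borel_point_tangent)
    ultimately show ?thesis by (simp only: sets.Int)
  qed
  have SP: "has_bochner_integral ?G (\<lambda>x. measure ?H (Pair x -` S F)) (measure ?P (S F))" for F
  proof (rule has_bochner_integral_nn_integral)
    have "(\<lambda>x. emeasure ?H (Pair x -` S F)) \<in> borel_measurable ?G" by (rule H.measurable_emeasure_Pair[OF Sm])
    then show "(\<lambda>x. measure ?H (Pair x -` S F)) \<in> borel_measurable ?G" unfolding measure_def by measurable
    have "(\<integral>\<^sup>+x. ennreal (measure ?H (Pair x -` S F)) \<partial>?G) = emeasure ?P (S F)"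
      by (subst H.emeasure_pair_measure_alt[OF Sm]) (simp add: H.emeasure_eq_measure)
    then show "(\<integral>\<^sup>+x. ennreal (measure ?H (Pair x -` S F)) \<partial>?G) = ennreal (measure ?P (S F))"
      by (simp add: P.emeasure_eq_measure)
  qed simp_all
  have "AE x in ?G. (\<Sum>F | card F = j + 1. measure ?H (Pair x -` S F)) = angle_sum j x"
    using AE_in_general_position[OF subspace_UNIV]
  proof eventually_elim
    fix x :: "real^'d^'n" assume gp: "in_general_position UNIV (lift x)"
    have "angle_sum j x = (\<Sum>I | I \<noteq> {}. if exposes UNIV (lift x) I \<and> aff_dim (($) x ` I) = int j
      then measure ?H (point_tangent I x) else 0)"
      unfolding angle_sum_eq tangent_relation_general_position[OF gp n] ..
    also have "\<dots> = (\<Sum>I\<in>UNIV. if exposes UNIV (lift x) I \<and> card I = j + 1 then measure ?H (point_tangent I x) else 0)"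
    proof (rule sum.mono_neutral_cong_left)
      show "\<forall>I\<in>UNIV - {I. I \<noteq> {}}. (if exposes UNIV (lift x) I \<and> card I = j + 1 then measure ?H (point_tangent I x) else 0) = 0"
        by simp
      fix I assume "I \<in> {I :: 'n set. I \<noteq> {}}"
      then show "(if exposes UNIV (lift x) I \<and> aff_dim (($) x ` I) = int j then measure ?H (point_tangent I x) else 0)
        = (if exposes UNIV (lift x) I \<and> card I = j + 1 then measure ?H (point_tangent I x) else 0)"
        using exposed_aff_dim_iff[OF gp n j, of I] by (cases "exposes UNIV (lift x) I") simp_all
    qed simp_all
    also have "\<dots> = (\<Sum>I | card I = j + 1. if exposes UNIV (lift x) I then measure ?H (point_tangent I x) else 0)"
      by (rule sum.mono_neutral_cong_right) auto
    also have "\<dots> = (\<Sum>F | card F = j + 1. measure ?H (Pair x -` S F))"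
      by (intro sum.cong refl) (simp add: S_def vimage_def)
    finally show "(\<Sum>F | card F = j + 1. measure ?H (Pair x -` S F)) = angle_sum j x" ..
  qed
  note AE = this
  have int: "has_bochner_integral ?G (\<lambda>x. \<Sum>F | card F = j + 1. measure ?H (Pair x -` S F)) (\<Sum>F | card F = j + 1. measure ?P (S F))"
    by (intro has_bochner_integral_sum SP)
  have "angle_sum j \<in> borel_measurable ?G" by (subst measurable_cong_sets[OF sets_std_gaussian refl]) (rule measurable_angle_sum)
  then have "has_bochner_integral ?G (angle_sum j) (\<Sum>F | card F = j + 1. measure ?P (S F))"
    by (rule has_bochner_integral_cong_AE[OF borel_measurable_has_bochner_integral[OF int] _ AE, THEN iffD1, OF _ int])
  then show ?thesis by (simp only: S_def)
qed

section \<open>Angle sums of the regular simplex\<close>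

text \<open>
  The \<open>i\<close>-th element of the index type, which carries the numbering of the standard basis.
\<close>

definition basis_index :: "nat \<Rightarrow> 'n::{finite,wellorder}" where
  "basis_index i = sorted_list_of_set (UNIV :: 'n set) ! (i - 1)"

lemma std_basis_eq_axis: "(std_basis i :: real^'n::{finite,wellorder}) = axis (basis_index i) 1"
  by (simp add: std_basis_def basis_index_def)

lemma bij_betw_basis_index: "bij_betw basis_index {1..CARD('n)} (UNIV :: 'n::{finite,wellorder} set)"
proof -
  let ?xs = "sorted_list_of_set (UNIV :: 'n set)"
  have "bij_betw (\<lambda>i. i - 1) {1..CARD('n)} {..<CARD('n)}"
    by (rule bij_betwI[where g = Suc]) auto
  moreover have "bij_betw ((!) ?xs) {..<CARD('n)} UNIV"
    using bij_betw_nth[of ?xs "{..<CARD('n)}" UNIV] by simp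
  ultimately have "bij_betw ((!) ?xs \<circ> (\<lambda>i. i - 1)) {1..CARD('n)} UNIV" by (rule bij_betw_trans)
  then show ?thesis by (simp add: basis_index_def[abs_def] comp_def)
qed

lemma card_basis_index_image:
  "k \<le> CARD('n) \<Longrightarrow> card (basis_index ` {1..k} :: 'n::{finite,wellorder} set) = k"
  using card_image[OF inj_on_subset[OF bij_betw_imp_inj_on[OF bij_betw_basis_index[where 'n='n]], of "{1..k}"]]
  by simp

lemma std_simplex_eq:
  "(std_simplex k :: (real^'n::{finite,wellorder}) set) = convex hull ((\<lambda>i. axis i 1) ` basis_index ` {1..k})"
  by (simp add: std_simplex_def image_image std_basis_eq_axis)

lemma axis_expansion: "(\<Sum>i\<in>UNIV. v$i *\<^sub>R (axis i 1 :: real^'n)) = v"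
  using basis_expansion[of v] by (simp add: scalar_mult_eq_scaleR)

lemma tangent_cone_simplex:
  assumes "F \<noteq> {}" "F \<subseteq> J"
  shows "tangent_cone (convex hull ((\<lambda>i. axis i 1 :: real^'n) ` F)) (convex hull ((\<lambda>i. axis i 1) ` J)) = simplex_tangent F J"
  unfolding tangent_cone_convex_hull[OF assms, of "\<lambda>i. axis i 1 :: real^'n"] axis_expansion
  by (auto simp: simplex_tangent_def zero_sum_def)

lemma tangent_cone_std_simplex:
  assumes "k \<in> {1..m}" "m \<le> CARD('n)"
  shows "tangent_cone (std_simplex k) (std_simplex m :: (real^'n::{finite,wellorder}) set)
    = simplex_tangent (basis_index ` {1..k}) (basis_index ` {1..m})"
  unfolding std_simplex_eq by (rule tangent_cone_simplex) (use assms in auto)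

text \<open>
  The simplex has all permutations of its vertices as symmetries, and these act transitively on the
  flags of given sizes.
\<close>

lemma ex_permutation:
  fixes F0 J0 F J :: "'n::finite set"
  assumes "F0 \<subseteq> J0" "F \<subseteq> J" "card F0 = card F" "card J0 = card J"
  shows "\<exists>p. bij p \<and> p ` F0 = F \<and> p ` J0 = J"
proof -
  have "card (J0 - F0) = card (J - F)"
    using assms card_Diff_subset[of F0 J0] card_Diff_subset[of F J] by simp
  moreover have "card (- J0) = card (- J)"
    using assms card_Diff_subset[of J0 UNIV] card_Diff_subset[of J UNIV] by (simp add: Compl_eq_Diff_UNIV)
  ultimately obtain f g h where f: "bij_betw f F0 F" and g: "bij_betw g (J0 - F0) (J - F)" and h: "bij_betw h (-J0) (-J)"
    using assms(3) finite_same_card_bij[OF finite finite] by metis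
  define p where "p i = (if i \<in> F0 then f i else if i \<in> J0 then g i else h i)" for i
  have 1: "bij_betw p F0 F" using f by (rule bij_betw_cong[THEN iffD1, rotated]) (simp add: p_def)
  have 2: "bij_betw p (J0 - F0) (J - F)" using g by (rule bij_betw_cong[THEN iffD1, rotated]) (simp add: p_def)
  have 3: "bij_betw p (-J0) (-J)" using h by (rule bij_betw_cong[THEN iffD1, rotated]) (use assms(1) in \<open>auto simp: p_def\<close>)
  have 4: "bij_betw p J0 J"
    using bij_betw_combine[OF 1 2] assms by (simp add: Un_absorb1 Int_Diff)
  have "bij p" using bij_betw_combine[OF 4 3] by simp
  then show ?thesis using bij_betw_imp_surj_on[OF 1] bij_betw_imp_surj_on[OF 4] by blast
qed

definition permute_coords :: "('n \<Rightarrow> 'n) \<Rightarrow> real^'n \<Rightarrow> real^'n" where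
  "permute_coords p v = (\<chi> i. v $ inv p i)"

lemma linear_permute_coords: "linear (permute_coords p)"
  by (rule linearI) (simp_all add: permute_coords_def vec_eq_iff)

lemma inner_permute_coords:
  assumes "bij p"
  shows "permute_coords p v \<bullet> permute_coords p w = v \<bullet> w"
  unfolding permute_coords_def inner_vec_def
  using sum.reindex_bij_betw[OF bij_imp_bij_inv[OF assms], of "\<lambda>i. v$i \<bullet> w$i"] by simp

lemma permute_coords_axis:
  assumes "bij p"
  shows "permute_coords p (axis i c) = axis (p i) c"
proof -
  have "inv p l = i \<longleftrightarrow> l = p i" for l using assms by (metis bij_inv_eq_iff)
  then show ?thesis by (simp add: permute_coords_def axis_def vec_eq_iff)
qed

lemma permute_coords_simplex_tangent:
  fixes p :: "'n::finite \<Rightarrow> 'n"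
  assumes p: "bij p"
  shows "permute_coords p ` simplex_tangent F J = simplex_tangent (p ` F) (p ` J)"
proof -
  have sub: "permute_coords q v \<in> simplex_tangent (q ` A) (q ` B)"
    if v: "v \<in> simplex_tangent A B" and q: "bij q" for q :: "'n \<Rightarrow> 'n" and A B v
  proof -
    have "(\<Sum>i\<in>UNIV. v $ inv q i) = (\<Sum>i\<in>UNIV. v $ i)"
      by (rule sum.reindex_bij_betw[OF bij_imp_bij_inv[OF q]])
    also have "\<dots> = 0" using v by (simp add: simplex_tangent_def zero_sum_def)
    finally have sum: "(\<Sum>i\<in>UNIV. v $ inv q i) = 0" .
    have mem: "i \<in> q ` S" if "inv q i \<in> S" for i S
    proof -
      have "i = q (inv q i)" using q by (simp add: bij_is_surj surj_f_inv_f)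
      then show ?thesis using that by blast
    qed
    have nth: "permute_coords q v $ i = v $ inv q i" for i by (simp add: permute_coords_def)
    have inj: "inv q i \<in> S" if "i \<in> q ` S" for i S
      using that q by (auto simp: bij_is_inj)
    show ?thesis
      unfolding simplex_tangent_def zero_sum_def mem_Collect_eq nth
    proof (intro conjI ballI sum)
      show "v $ inv q i = 0" if "i \<in> - q ` B" for i
      proof -
        have "inv q i \<in> -B" using that mem by blast
        then show ?thesis using v by (simp add: simplex_tangent_def zero_sum_def)
      qed
      show "0 \<le> v $ inv q i" if "i \<in> q ` B - q ` A" for i
      proof -
        have "inv q i \<in> B - A" using that mem inj by blast
        then show ?thesis using v by (simp add: simplex_tangent_def)
      qed
    qed
  qed
  show ?thesis
  proof
    show "permute_coords p ` simplex_tangent F J \<subseteq> simplex_tangent (p ` F) (p ` J)"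
    proof
      fix w assume "w \<in> permute_coords p ` simplex_tangent F J"
      then obtain v where "v \<in> simplex_tangent F J" "w = permute_coords p v" by blast
      then show "w \<in> simplex_tangent (p ` F) (p ` J)" using sub[OF _ p] by simp
    qed
    show "simplex_tangent (p ` F) (p ` J) \<subseteq> permute_coords p ` simplex_tangent F J"
    proof
      fix v assume v: "v \<in> simplex_tangent (p ` F) (p ` J)"
      have "permute_coords (inv p) v \<in> simplex_tangent (inv p ` p ` F) (inv p ` p ` J)"
        by (rule sub[OF v bij_imp_bij_inv[OF p]])
      moreover have "inv p ` p ` A = A" for A using p by (simp add: image_comp bij_is_inj)
      moreover have "permute_coords p (permute_coords (inv p) v) = v"
        using p by (simp add: permute_coords_def vec_eq_iff inv_inv_eq bij_is_surj surj_f_inv_f)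
      ultimately show "v \<in> permute_coords p ` simplex_tangent F J" by (metis imageI)
    qed
  qed
qed

lemma solid_angle_simplex_tangent_cong:
  fixes F0 J0 F J :: "'n::finite set"
  assumes "F0 \<subseteq> J0" "F \<subseteq> J" "card F0 = card F" "card J0 = card J"
  shows "solid_angle (simplex_tangent F J) = solid_angle (simplex_tangent F0 J0)"
proof -
  obtain p where p: "bij p" "p ` F0 = F" "p ` J0 = J" using ex_permutation[OF assms] by blast
  have "solid_angle (permute_coords p ` simplex_tangent F0 J0) = solid_angle (simplex_tangent F0 J0)"
  proof (rule solid_angle_isometric_image[OF linear_permute_coords inner_permute_coords[OF p(1)]])
    show "permute_coords p ` Basis \<subseteq> Basis"
      by (auto simp: Basis_vec_def permute_coords_axis[OF p(1)])
  qed
  then show ?thesis by (simp add: permute_coords_simplex_tangent[OF p(1)] p)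
qed

lemma normal_prob_cong:
  fixes J0 J :: "'n::{finite,wellorder} set"
  assumes "card J0 = card J"
  shows "normal_prob J = normal_prob J0"
proof -
  obtain p where p: "bij p" "p ` J0 = J"
    using ex_permutation[of J0 J0 J J] assms by auto
  have orth: "orthogonal_transformation (permute_coords p)"
    by (simp add: orthogonal_transformation_def linear_permute_coords inner_permute_coords[OF p(1)])
  have [measurable]: "permute_coords p \<in> borel_measurable borel"
    by (intro borel_measurable_continuous_onI linear_continuous_on) (simp add: linear_linear linear_permute_coords)
  let ?S = "\<lambda>J. {y :: real^'n::_. \<forall>i\<in>-J. y $ i < (\<Sum>l\<in>J. y $ l) / real (card J)}"
  have Sm: "?S J \<in> sets borel" by measurable
  have "permute_coords p -` ?S J = ?S J0"
  proof -
    have "(\<Sum>l\<in>J. y $ inv p l) = (\<Sum>l\<in>J0. y $ l)" for y :: "real^'n::_"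
      unfolding p(2)[symmetric] using p(1) by (subst sum.reindex) (auto simp: bij_def inj_on_def inv_f_f)
    moreover have "(\<forall>i\<in>-J. y $ inv p i < c) \<longleftrightarrow> (\<forall>i\<in>-J0. y $ i < c)" for y :: "real^'n::_" and c
    proof -
      have "-J = p ` (-J0)" using p by (simp add: bij_image_Compl_eq)
      then show ?thesis using p(1) by (simp add: bij_is_inj)
    qed
    ultimately show ?thesis using assms by (auto simp: permute_coords_def)
  qed
  moreover have "normal_prob J = measure (distr std_gaussian borel (permute_coords p)) (?S J)"
    by (simp only: distr_std_gaussian_orthogonal[OF orth] normal_prob_def)
  moreover have "\<dots> = measure std_gaussian (permute_coords p -` ?S J)"
    using Sm by (subst measure_distr) auto
  ultimately show ?thesis by (simp add: normal_prob_def)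
qed

text \<open>
  The tangent directions that matter are \<open>axis i 1 - axis l 1\<close> with \<open>l\<close> in \<open>F\<close>.
\<close>

lemma normal_cone_simplex:
  assumes F: "F \<noteq> {}"
  shows "normal_cone (convex hull ((\<lambda>i. axis i 1 :: real^'n) ` F)) (convex hull (range (\<lambda>i. axis i 1)))
    = {w. \<forall>l\<in>F. \<forall>i. w$i \<le> w$l}"
proof -
  have T: "tangent_cone (convex hull ((\<lambda>i. axis i 1 :: real^'n) ` F)) (convex hull (range (\<lambda>i. axis i 1))) = simplex_tangent F UNIV"
    by (rule tangent_cone_simplex[OF F subset_UNIV])
  show ?thesis
  proof (intro set_eqI iffI)
    fix w assume "w \<in> normal_cone (convex hull ((\<lambda>i. axis i 1 :: real^'n) ` F)) (convex hull (range (\<lambda>i. axis i 1)))"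
    then have w: "\<And>u. u \<in> simplex_tangent F UNIV \<Longrightarrow> w \<bullet> u \<le> 0" unfolding normal_cone_def T by blast
    have "w$i \<le> w$l" if "l \<in> F" for i l
    proof -
      have "axis i 1 - axis l 1 \<in> simplex_tangent F UNIV"
        using that by (auto simp: simplex_tangent_def zero_sum_def sum_subtractf axis_def)
      then have "w \<bullet> (axis i 1 - axis l 1) \<le> 0" by (rule w)
      then show ?thesis by (simp add: inner_diff_right inner_axis)
    qed
    then show "w \<in> {w. \<forall>l\<in>F. \<forall>i. w$i \<le> w$l}" by blast
  next
    fix w :: "real^'n" assume w: "w \<in> {w. \<forall>l\<in>F. \<forall>i. w$i \<le> w$l}"
    obtain f where f: "f \<in> F" using F by blast
    have "w \<bullet> u \<le> 0" if u: "u \<in> simplex_tangent F UNIV" for u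
    proof -
      have "w \<bullet> u = (\<Sum>i\<in>UNIV. (w$i - w$f) * u$i) + w$f * (\<Sum>i\<in>UNIV. u$i)"
        by (simp add: inner_vec_def left_diff_distrib sum_subtractf sum_distrib_left)
      also have "\<dots> = (\<Sum>i\<in>UNIV. (w$i - w$f) * u$i)" using u by (simp add: simplex_tangent_def zero_sum_def)
      also have "\<dots> \<le> 0"
      proof (rule sum_nonpos)
        fix i
        show "(w$i - w$f) * u$i \<le> 0"
        proof (cases "i \<in> F")
          case True
          then have "w$i = w$f" using w f by (intro antisym) auto
          then show ?thesis by simp
        next
          case False
          then have "u$i \<ge> 0" using u by (simp add: simplex_tangent_def)
          moreover have "w$i - w$f \<le> 0" using w f by auto
          ultimately show ?thesis by (rule mult_nonpos_nonneg[rotated])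
        qed
      qed
      finally show ?thesis .
    qed
    then show "w \<in> normal_cone (convex hull ((\<lambda>i. axis i 1 :: real^'n) ` F)) (convex hull (range (\<lambda>i. axis i 1)))"
      unfolding normal_cone_def T by blast
  qed
qed

text \<open>
  The linear hull of the cone consists of the vectors that are constant on \<open>F\<close>, and projecting to it
  replaces the coordinates in \<open>F\<close> by their mean. Replacing the weak inequalities by strict ones changes
  the set by a null set.
\<close>

lemma solid_angle_normal_cone_simplex:
  fixes F :: "'n::{finite,wellorder} set"
  assumes F: "F \<noteq> {}"
  shows "solid_angle {w :: real^'n::_. \<forall>l\<in>F. \<forall>i. w$i \<le> w$l} = normal_prob F"
proof -
  let ?C = "{w :: real^'n::_. \<forall>l\<in>F. \<forall>i. w$i \<le> w$l}"
  define L where "L = {w :: real^'n::_. \<forall>i\<in>F. \<forall>l\<in>F. w$i = w$l}"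
  interpret H: prob_space "std_gaussian :: (real^'n::_) measure" by (rule prob_space_std_gaussian)
  obtain f where f: "f \<in> F" using F by blast
  have cF: "real (card F) > 0" using F by (simp add: card_gt_0_iff)
  have subL: "subspace L"
  proof (rule subspaceI)
    show "0 \<in> L" by (simp add: L_def)
    fix v w assume "v \<in> L" "w \<in> L"
    then have "v$i = v$l" "w$i = w$l" if "i \<in> F" "l \<in> F" for i l using that unfolding L_def by blast+
    then show "v + w \<in> L" unfolding L_def mem_Collect_eq vector_add_component by metis
  next
    fix c :: real and v assume "v \<in> L"
    then have "v$i = v$l" if "i \<in> F" "l \<in> F" for i l using that unfolding L_def by blast
    then show "c *\<^sub>R v \<in> L" unfolding L_def mem_Collect_eq vector_scaleR_component by metis
  qed
  have CL: "?C \<subseteq> L" by (auto simp: L_def intro: antisym)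
  have span: "span ?C = L"
  proof
    show "span ?C \<subseteq> L" by (intro span_minimal CL subL)
    show "L \<subseteq> span ?C"
    proof
      fix w assume w: "w \<in> L"
      define u :: "real^'n::_" where "u = (\<chi> i. if i \<in> F then 1 else 0)"
      define M where "M = Max (range (\<lambda>i. \<bar>w$i - w$f\<bar>))"
      have M: "\<bar>w$i - w$f\<bar> \<le> M" for i unfolding M_def by (rule Max_ge) auto
      have "M \<ge> 0" using M[of f] by simp
      \<comment> \<open>Adding a large multiple of the indicator of \<open>F\<close> moves any vector of \<open>L\<close> into the cone.\<close>
      have "u \<in> ?C" by (simp add: u_def)
      moreover have "w + M *\<^sub>R u \<in> ?C"
      proof (intro CollectI ballI allI)
        fix l i assume l: "l \<in> F"
        have "w$l = w$f" using w f l unfolding L_def by blast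
        moreover have "w$i \<le> w$f + M" using M[of i] by linarith
        moreover have "w$i = w$f" if "i \<in> F" using w f that unfolding L_def by blast
        ultimately show "(w + M *\<^sub>R u)$i \<le> (w + M *\<^sub>R u)$l" using l by (simp add: u_def)
      qed
      ultimately have "(w + M *\<^sub>R u) - M *\<^sub>R u \<in> span ?C" by (intro span_diff span_scale span_base)
      then show "w \<in> span ?C" by simp
    qed
  qed
  have cp: "closest_point L y = (\<chi> i. if i \<in> F then (\<Sum>l\<in>F. y$l) / card F else y$i)" (is "_ = ?m y") for y
  proof (rule closest_point_subspace_eq[OF subL])
    show "?m y \<in> L" by (simp add: L_def)
    fix w assume w: "w \<in> L"
    have "(y - ?m y) \<bullet> w = (\<Sum>i\<in>UNIV. if i \<in> F then (y$i - (\<Sum>l\<in>F. y$l) / card F) * w$f else 0)"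
      unfolding inner_vec_def
    proof (intro sum.cong refl)
      fix i
      have "w$i = w$f" if "i \<in> F" using w f that unfolding L_def by blast
      then show "(y - ?m y)$i \<bullet> w$i = (if i \<in> F then (y$i - (\<Sum>l\<in>F. y$l) / card F) * w$f else 0)" by simp
    qed
    also have "\<dots> = (\<Sum>i\<in>F. (y$i - (\<Sum>l\<in>F. y$l) / card F) * w$f)" by (simp add: sum.If_cases)
    also have "\<dots> = ((\<Sum>i\<in>F. y$i) - card F * ((\<Sum>l\<in>F. y$l) / card F)) * w$f"
      by (simp add: sum_distrib_right[symmetric] sum_subtractf)
    also have "\<dots> = 0" using cF by simp
    finally show "(y - ?m y) \<bullet> w = 0" .
  qed
  have Cb: "?C \<in> sets borel"
  proof -
    have "?C = (\<Inter>l\<in>F. \<Inter>i\<in>UNIV. {w. w$i \<le> w$l})" by auto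
    also have "closed \<dots>" by (intro closed_INT ballI closed_Collect_le continuous_intros)
    finally show ?thesis by (rule borel_closed)
  qed
  have sg: "sgn v \<in> ?C \<longleftrightarrow> v \<in> ?C" for v :: "real^'n::_"
  proof (cases "v = 0")
    case False
    then show ?thesis by (simp add: sgn_div_norm)
  qed simp
  have "solid_angle ?C = measure std_gaussian {y. sgn (closest_point L y) \<in> ?C}"
    unfolding solid_angle_def uniform_sphere_def span
    using measurable_uniform_sphere_map[OF subL] Cb by (subst measure_distr) (auto simp: vimage_def)
  also have "{y. sgn (closest_point L y) \<in> ?C} = {y. \<forall>i\<in>-F. y$i \<le> (\<Sum>l\<in>F. y$l) / card F}"
    unfolding sg cp using f by auto
  also have "measure std_gaussian \<dots> = measure std_gaussian {y :: real^'n::_. \<forall>i\<in>-F. y$i < (\<Sum>l\<in>F. y$l) / card F}"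
  proof (rule H.finite_measure_eq_AE)
    show "{y :: real^'n::_. \<forall>i\<in>-F. y$i \<le> (\<Sum>l\<in>F. y$l) / card F} \<in> sets std_gaussian"
      "{y :: real^'n::_. \<forall>i\<in>-F. y$i < (\<Sum>l\<in>F. y$l) / card F} \<in> sets std_gaussian" by simp_all
    have "AE y in (std_gaussian :: (real^'n::_) measure). y$i \<noteq> (\<Sum>l\<in>F. y$l) / card F" if "i \<notin> F" for i
    proof -
      define h :: "real^'n::_" where "h = axis i 1 - (1 / card F) *\<^sub>R (\<Sum>l\<in>F. axis l 1)"
      have "h \<bullet> axis i 1 = 1"
        using that by (auto simp: h_def inner_diff_left inner_sum_left inner_axis_axis intro!: sum.neutral)
      then have "h \<noteq> 0" by auto
      have "h \<bullet> y = y$i - (\<Sum>l\<in>F. y$l) / card F" for y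
        by (simp add: h_def inner_diff_left inner_sum_left inner_axis')
      then show ?thesis using AE_std_gaussian_hyperplane[OF \<open>h \<noteq> 0\<close>, of 0] by simp
    qed
    then have "AE y in (std_gaussian :: (real^'n::_) measure). \<forall>i\<in>-F. y$i \<noteq> (\<Sum>l\<in>F. y$l) / card F"
      by (intro AE_finite_allI) auto
    then show "AE y in (std_gaussian :: (real^'n::_) measure). y \<in> {y. \<forall>i\<in>-F. y$i \<le> (\<Sum>l\<in>F. y$l) / card F}
        \<longleftrightarrow> y \<in> {y. \<forall>i\<in>-F. y$i < (\<Sum>l\<in>F. y$l) / card F}"
      by eventually_elim (auto simp: less_le)
  qed
  finally show ?thesis by (simp add: normal_prob_def)
qed

lemma normal_angle_sum_eq:
  assumes J: "card (J :: 'n set) = r" and r: "r \<in> {1..CARD('n::{finite,wellorder})}"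
  shows "normal_angle_sum TYPE('n) r = real (CARD('n) choose r) * normal_prob J"
proof -
  have "basis_index ` {1..CARD('n)} = (UNIV :: 'n set)" by (rule bij_betw_imp_surj_on[OF bij_betw_basis_index])
  then have "(std_simplex CARD('n) :: (real^'n::_) set) = convex hull (range (\<lambda>i. axis i 1))" by (simp add: std_simplex_eq)
  then have full: "(std_simplex CARD('n) :: (real^'n::_) set) = convex hull (range (\<lambda>i. axis i 1))" .
  have ne: "(basis_index ` {1..r} :: 'n set) \<noteq> {}" using r by auto
  have "solid_angle (normal_cone (std_simplex r) (std_simplex CARD('n) :: (real^'n::_) set)) = normal_prob (basis_index ` {1..r} :: 'n set)"
    unfolding full std_simplex_eq[of r] normal_cone_simplex[OF ne] by (rule solid_angle_normal_cone_simplex[OF ne])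
  also have "\<dots> = normal_prob J" by (rule normal_prob_cong) (use J r card_basis_index_image[where 'n='n, of r] in simp)
  finally show ?thesis using r by (simp add: normal_angle_sum_def)
qed

lemma tangent_angle_sum_eq:
  fixes F J :: "'n::{finite,wellorder} set"
  assumes FJ: "F \<subseteq> J" "card F = k" "card J = r" and k: "k \<in> {1..r}"
  shows "tangent_angle_sum TYPE('n) r k = real (r choose k) * solid_angle (simplex_tangent F J)"
proof -
  have r: "r \<le> CARD('n)" using FJ(3) card_mono[of UNIV J] by simp
  have "solid_angle (simplex_tangent F J) = solid_angle (simplex_tangent (basis_index ` {1..k}) (basis_index ` {1..r} :: 'n set))"
    using FJ k r card_basis_index_image[where 'n='n, of k] card_basis_index_image[where 'n='n, of r]
    by (intro solid_angle_simplex_tangent_cong image_mono) auto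
  then show ?thesis using k tangent_cone_std_simplex[OF k r] by (simp add: tangent_angle_sum_def)
qed

text \<open>
  All terms of the double sum over \<open>F \<subseteq> J\<close> are equal by symmetry; there are \<open>n choose r\<close> sets
  \<open>J\<close>, and each contains \<open>r choose k\<close> sets \<open>F\<close>.
\<close>

lemma sum_conic_volume:
  assumes k: "k \<in> {1..r}" and r: "r \<le> CARD('n::{finite,wellorder})"
  shows "(\<Sum>F | card F = k. conic_volume r (F :: 'n set)) = normal_angle_sum TYPE('n) r * tangent_angle_sum TYPE('n) r k"
proof -
  have N: "card {J :: 'n set. card J = r} = CARD('n) choose r"
    using n_subsets[of "UNIV :: 'n set" r] by simp
  have K: "card {F. F \<subseteq> J \<and> card F = k} = r choose k" if "card J = r" for J :: "'n set"
    using n_subsets[of J k] that by simp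
  have "(\<Sum>F | card F = k. conic_volume r (F :: 'n set)) =
    (\<Sum>F | card F = k. \<Sum>J | card J = r. if F \<subseteq> J then normal_prob J * solid_angle (simplex_tangent F (J :: 'n set)) else 0)"
    unfolding conic_volume_def by (intro sum.cong refl sum.mono_neutral_cong_left) auto
  also have "\<dots> = (\<Sum>J | card J = r. \<Sum>F | card F = k. if F \<subseteq> J then normal_prob J * solid_angle (simplex_tangent F (J :: 'n set)) else 0)"
    by (rule sum.swap)
  also have "\<dots> = (\<Sum>J :: 'n set | card J = r. normal_prob J * tangent_angle_sum TYPE('n) r k)"
  proof (intro sum.cong refl)
    fix J :: "'n set" assume "J \<in> {J. card J = r}"
    then have J: "card J = r" by simp
    have "(\<Sum>F | card F = k. if F \<subseteq> J then normal_prob J * solid_angle (simplex_tangent F J) else 0)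
      = (\<Sum>F | F \<subseteq> J \<and> card F = k. normal_prob J * solid_angle (simplex_tangent F J))"
      by (intro sum.mono_neutral_cong_right) auto
    also have "\<dots> = (\<Sum>F | F \<subseteq> J \<and> card F = k. normal_prob J * (tangent_angle_sum TYPE('n) r k / real (r choose k)))"
    proof (intro sum.cong refl)
      fix F assume "F \<in> {F. F \<subseteq> J \<and> card F = k}"
      then have "tangent_angle_sum TYPE('n) r k = real (r choose k) * solid_angle (simplex_tangent F J)"
        using tangent_angle_sum_eq[of F J k r] J k by auto
      moreover have "r choose k > 0" using k by simp
      ultimately show "normal_prob J * solid_angle (simplex_tangent F J) = normal_prob J * (tangent_angle_sum TYPE('n) r k / real (r choose k))"
        by simp
    qed
    also have "\<dots> = normal_prob J * tangent_angle_sum TYPE('n) r k" using K[OF J] k by simp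
    finally show "(\<Sum>F | card F = k. if F \<subseteq> J then normal_prob J * solid_angle (simplex_tangent F J) else 0)
      = normal_prob J * tangent_angle_sum TYPE('n) r k" .
  qed
  also have "\<dots> = (\<Sum>J :: 'n set | card J = r. normal_angle_sum TYPE('n) r / real (CARD('n) choose r) * tangent_angle_sum TYPE('n) r k)"
  proof (intro sum.cong refl)
    fix J :: "'n set" assume "J \<in> {J. card J = r}"
    then have "normal_angle_sum TYPE('n) r = real (CARD('n) choose r) * normal_prob J"
      using k r by (intro normal_angle_sum_eq) auto
    moreover have "CARD('n) choose r > 0" using r by simp
    ultimately show "normal_prob J * tangent_angle_sum TYPE('n) r k =
      normal_angle_sum TYPE('n) r / real (CARD('n) choose r) * tangent_angle_sum TYPE('n) r k" by simp
  qed
  also have "\<dots> = normal_angle_sum TYPE('n) r * tangent_angle_sum TYPE('n) r k"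
    using N r by simp
  finally show ?thesis .
qed

text \<open>
  The alternating sum for \<open>F\<close> ends at \<open>d - s = k\<close>. The further terms of the series vanish because the
  tangent angle sum is zero there; for \<open>s \<ge> d\<close> the truncated difference is \<open>0\<close>, where it is zero too.
\<close>

lemma expected_angle_sum:
  assumes n: "CARD('d::{finite,wellorder}) + 1 \<le> CARD('n::{finite,wellorder})" and j: "j < CARD('d)"
  shows "has_bochner_integral (std_gaussian :: ((real^'d::_)^'n::_) measure) (angle_sum j)
    (\<Sum>s. (-1) ^ s * normal_angle_sum TYPE('n) (CARD('d) - s) * tangent_angle_sum TYPE('n) (CARD('d) - s) (j + 1))"
proof -
  let ?d = "CARD('d)" and ?k = "j + 1"
  let ?t = "\<lambda>s. (-1) ^ s * normal_angle_sum TYPE('n) (?d - s) * tangent_angle_sum TYPE('n) (?d - s) ?k"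
  have "(\<Sum>F | card F = ?k. measure (std_gaussian \<Otimes>\<^sub>M std_gaussian)
      {(x :: (real^'d::_)^'n::_, z). exposes UNIV (lift x) F \<and> z \<in> point_tangent F x})
    = (\<Sum>F :: 'n set | card F = ?k. \<Sum>s\<le>?d - ?k. (-1) ^ s * conic_volume (?d - s) F)"
  proof (intro sum.cong refl)
    fix F :: "'n set" assume "F \<in> {F. card F = ?k}"
    then have F: "card F = ?k" "F \<noteq> {}" by auto
    have "2 * measure (std_gaussian \<Otimes>\<^sub>M std_gaussian)
        {(x :: (real^'d::_)^'n::_, z). exposes UNIV (lift x) F \<and> z \<in> point_tangent F x}
      = 2 * (\<Sum>s\<le>?d - card F. (-1) ^ s * conic_volume (?d - s) F)"
      using measure_exposes_tangent[of F, where 'd='d] face_prob_diff_alternating[of F ?d, where 'd='d] F j n by simp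
    then show "measure (std_gaussian \<Otimes>\<^sub>M std_gaussian)
        {(x :: (real^'d::_)^'n::_, z). exposes UNIV (lift x) F \<and> z \<in> point_tangent F x}
      = (\<Sum>s\<le>?d - ?k. (-1) ^ s * conic_volume (?d - s) F)" using F by simp
  qed
  also have "\<dots> = (\<Sum>s\<le>?d - ?k. (-1) ^ s * (\<Sum>F :: 'n set | card F = ?k. conic_volume (?d - s) F))"
    by (subst sum.swap) (simp add: sum_distrib_left)
  also have "\<dots> = (\<Sum>s\<le>?d - ?k. ?t s)"
  proof (intro sum.cong refl)
    fix s assume "s \<in> {..?d - ?k}"
    then have "?k \<in> {1..?d - s}" "?d - s \<le> CARD('n)" using j n by auto
    then show "(-1) ^ s * (\<Sum>F :: 'n set | card F = ?k. conic_volume (?d - s) F) = ?t s"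
      by (simp add: sum_conic_volume)
  qed
  also have "\<dots> = (\<Sum>s. ?t s)"
  proof (rule suminf_finite[symmetric])
    fix s assume "s \<notin> {..?d - ?k}"
    then have "?d - s < ?k" by auto
    then show "?t s = 0" by (simp add: tangent_angle_sum_def)
  qed simp
  finally show ?thesis using integral_angle_sum[OF n j] by simp
qed

section \<open>Independent Gaussian points\<close>

text \<open>
  A family of independent points is a Gaussian matrix once its index set is identified with the finite
  index type of the rows.
\<close>

lemma distr_indep_gaussian_vec:
  fixes X :: "'i \<Rightarrow> 'w \<Rightarrow> 'a::euclidean_space" and t :: "'n::finite \<Rightarrow> 'i"
  assumes M: "prob_space M" and indep: "prob_space.indep_vars M (\<lambda>_. borel) X I"
    and X: "\<And>i. i \<in> I \<Longrightarrow> distr M borel (X i) = std_gaussian" and t: "bij_betw t UNIV I"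
  shows "(\<lambda>\<omega>. \<chi> i. X (t i) \<omega>) \<in> borel_measurable M"
    and "distr M borel (\<lambda>\<omega>. \<chi> i. X (t i) \<omega>) = std_gaussian"
proof -
  interpret prob_space M by (rule M)
  have tI: "t i \<in> I" for i using t by (auto simp: bij_betw_def)
  have rv [measurable]: "X (t i) \<in> borel_measurable M" for i
    using indep tI by (auto simp: indep_vars_def)
  show m: "(\<lambda>\<omega>. \<chi> i. X (t i) \<omega>) \<in> borel_measurable M" by (intro measurable_vec_lambda rv)
  show "distr M borel (\<lambda>\<omega>. \<chi> i. X (t i) \<omega>) = std_gaussian"
  proof (rule std_gaussian_eqI)
    fix l u :: "'a^'n"
    interpret G: prob_space "std_gaussian :: 'a measure" by (rule prob_space_std_gaussian)
    define A where "A k = box (l $ inv t k) (u $ inv t k)" for k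
    have At: "A (t i) = box (l$i) (u$i)" for i using t by (simp add: A_def bij_betw_def)
    have fin: "I \<noteq> {}" "finite I" using t by (auto simp: bij_betw_def)
    have "emeasure (distr M borel (\<lambda>\<omega>. \<chi> i. X (t i) \<omega>)) (box l u)
      = emeasure M ((\<lambda>\<omega>. \<chi> i. X (t i) \<omega>) -` box l u \<inter> space M)"
      using m by (subst emeasure_distr) auto
    also have "(\<lambda>\<omega>. \<chi> i. X (t i) \<omega>) -` box l u \<inter> space M = (\<Inter>i\<in>UNIV. X (t i) -` A (t i) \<inter> space M)"
      unfolding At by (auto simp: mem_box_vec)
    also have "\<dots> = (\<Inter>k\<in>I. X k -` A k \<inter> space M)"
      unfolding bij_betw_imp_surj_on[OF t, symmetric] by simp
    also have "emeasure M \<dots> = ennreal (\<Prod>k\<in>I. prob (X k -` A k \<inter> space M))"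
      using indep_varsD[OF indep _ _ order_refl, of A] fin by (simp add: emeasure_eq_measure A_def)
    also have "(\<Prod>k\<in>I. prob (X k -` A k \<inter> space M)) = (\<Prod>i\<in>UNIV. prob (X (t i) -` A (t i) \<inter> space M))"
      by (rule prod.reindex_bij_betw[OF t, symmetric])
    also have "ennreal \<dots> = (\<Prod>i\<in>UNIV. emeasure M (X (t i) -` box (l$i) (u$i) \<inter> space M))"
      by (simp add: emeasure_eq_measure prod_ennreal At)
    also have "\<dots> = (\<Prod>i\<in>UNIV. emeasure (distr M borel (X (t i))) (box (l$i) (u$i)))"
      by (subst emeasure_distr) auto
    also have "\<dots> = (\<Prod>b\<in>Basis. emeasure std_normal {l \<bullet> b <..< u \<bullet> b})"
      by (simp add: X[OF tI] prod_Basis_vec emeasure_std_gaussian_box inner_axis)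
    finally show "emeasure (distr M borel (\<lambda>\<omega>. \<chi> i. X (t i) \<omega>)) (box l u) = \<dots>" .
  qed simp
qed

theorem corollary4p2:
  fixes M :: "'w measure"
    and X :: "nat \<Rightarrow> 'w \<Rightarrow> real^'d::{finite,wellorder}"
    and d n j :: nat
  assumes "prob_space M"
    and "CARD('d) = d"
    and "CARD('n::{finite,wellorder}) = n"
    and "n \<ge> d + 1"
    and "prob_space.indep_vars M (\<lambda>_. borel) X {1..n}"
    and "\<And>i. i \<in> {1..n} \<Longrightarrow> distr M borel (X i) = std_gaussian"
    and "j < d"
  shows "has_bochner_integral M
    (\<lambda>\<omega>. let P = convex hull ((\<lambda>i. X i \<omega>) ` {1..n})
          in \<Sum>F\<in>faces_of_dim j P. solid_angle (tangent_cone F P))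
    (\<Sum>s. (-1) ^ s * normal_angle_sum TYPE('n) (d - s) * tangent_angle_sum TYPE('n) (d - s) (j + 1))"
proof -
  interpret prob_space M by (rule assms(1))
  define t :: "'n \<Rightarrow> nat" where "t = inv_into {1..n} basis_index"
  have "bij_betw basis_index {1..n} (UNIV :: 'n set)"
    using bij_betw_basis_index[where 'n='n] assms(3) by simp
  then have t: "bij_betw t UNIV {1..n}" unfolding t_def by (rule bij_betw_inv_into)
  then have range_t: "range t = {1..n}" by (rule bij_betw_imp_surj_on)
  let ?Y = "\<lambda>\<omega>. \<chi> i. X (t i) \<omega> :: (real^'d::_)^'n::_"
  have Y: "?Y \<in> borel_measurable M" "distr M borel ?Y = std_gaussian"
    by (rule distr_indep_gaussian_vec[OF assms(1,5) _ t], erule assms(6))+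
  have "range (($) (?Y \<omega>)) = (\<lambda>i. X i \<omega>) ` {1..n}" for \<omega>
    unfolding range_t[symmetric] by auto
  then have "angle_sum j (?Y \<omega>) = (let P = convex hull ((\<lambda>i. X i \<omega>) ` {1..n})
      in \<Sum>F\<in>faces_of_dim j P. solid_angle (tangent_cone F P))" for \<omega>
    by (simp only: angle_sum_def)
  moreover have "has_bochner_integral (distr M borel ?Y) (angle_sum j)
    (\<Sum>s. (-1) ^ s * normal_angle_sum TYPE('n) (d - s) * tangent_angle_sum TYPE('n) (d - s) (j + 1))"
    unfolding Y(2) using expected_angle_sum[where 'd='d and 'n='n, of j] assms by simp
  ultimately show ?thesis
    using integrable_distr_eq[OF Y(1) measurable_angle_sum[of j]] integral_distr[OF Y(1) measurable_angle_sum[of j]]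
    by (simp add: has_bochner_integral_iff)
qed

end
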